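(* Let $A=C^*_r(\mathbb F_2)+K(\ell^2(\mathbb F_2))\subset B(\ell^2(\mathbb F_2))$ and let $C\subset A$ be the abelian C*-algebra generated by $\{e_g:g\in\mathbb F_2\}\cup\{1\}$, where $e_g$ is the projection onto the one-dimensional subspace $\mathbb C\xi_g$ spanned by the canonical basis vector $\xi_g$ of $\ell^2(\mathbb F_2)$. Let $\|\cdot\|_\alpha$ be the C*-norm on $A\odot A$ given by $\|x\|_\alpha=\max\{\|x\|_{min},\|\pi_r(x)\|\}$, where $\pi_r$ is the representation of $A\odot A$ on $\ell^2(\mathbb F_2)$ defined in the context. Then $C$ is maximal abelian in $A$, but $C\otimes C$ (the closure of $C\odot C$ in $A\otimes_\beta A$) is not maximal abelian in $A\otimes_\beta A$ for any C*-norm $\|\cdot\|_\beta$ on $A\odot A$ satisfying $\|x\|_\beta\ge\|x\|_\alpha$ for all $x\in A\odot A$; in particular this holds for $\|\cdot\|_\beta=\|\cdot\|_{max}$.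
   Context: $\mathbb F_2$ is the free group on two generators, $\{\xi_g:g\in\mathbb F_2\}$ is the canonical orthonormal basis of $\ell^2(\mathbb F_2)$, and $K(\ell^2(\mathbb F_2))$ is the algebra of compact operators. $C^*_r(\mathbb F_2)\subset B(\ell^2(\mathbb F_2))$ is the reduced group C*-algebra, generated by the left-translation unitaries $\lambda_g\xi_h=\xi_{gh}$. $A$ is a C*-algebra, $K(\ell^2(\mathbb F_2))$ is an ideal of $A$, and $A/K(\ell^2(\mathbb F_2))\cong C^*_r(\mathbb F_2)$; $q:A\to C^*_r(\mathbb F_2)$ is the canonical quotient map, $q(a+k)=a$ for $a\in C^*_r(\mathbb F_2)$ and $k$ compact. $\lambda$ and $\rho$ are the representations of $C^*_r(\mathbb F_2)$ on $\ell^2(\mathbb F_2)$ corresponding to the left- and right-regular representations of $\mathbb F_2$: $\lambda$ is the identity representation, and $\rho(\lambda_g)\xi_h=\xi_{hg^{-1}}$. The representations $\lambda\circ q$ and $\rho\circ q$ of $A$ have commuting ranges, and $\pi_r$ is the representation of $A\odot A$ given by $\pi_r(\sum a_i\otimes b_i)=\sum\lambda(q(a_i))\rho(q(b_i))$. $\|\cdot\|_{min}$ and $\|\cdot\|_{max}$ are the minimal and maximal C*-norms on $A\odot A$, and $A\otimes_\beta A$ is the completion of $A\odot A$ in $\|\cdot\|_\beta$. "Maximal abelian" means maximal among abelian self-adjoint C*-subalgebras. *)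

theory Defs
  imports
    "HOL-Analysis.Analysis"
    "HOL-Library.Poly_Mapping"
    "HOL-Algebra.Module"
begin

section \<open>The free group on two generators\<close>

text \<open>A letter \<open>(x, s)\<close> is the generator \<open>x\<close> if \<open>s\<close> holds, and its inverse otherwise.\<close>

type_synonym letter = "bool \<times> bool"

inductive cancels :: "letter list \<Rightarrow> letter list \<Rightarrow> bool" where
  "cancels (u @ [(x, s), (x, \<not> s)] @ v) (u @ v)"

quotient_type free2 = "letter list" / "equivclp cancels"
  by simp

lemma cancels_append: "cancels u v \<Longrightarrow> cancels (a @ u @ b) (a @ v @ b)"
proof (induction rule: cancels.induct)
  case (1 u x s v)
  show ?case using cancels.intros[of "a @ u" x s "v @ b"] by simp
qed

lemma equivclp_cancels_append:
  assumes "equivclp cancels u v" shows "equivclp cancels (a @ u @ b) (a @ v @ b)"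
  using assms
proof (induction rule: equivclp_induct)
  case base
  show ?case by simp
next
  case (step y z)
  then have "equivclp cancels (a @ y @ b) (a @ z @ b)"
    by (metis cancels_append equivclp_sym r_into_equivclp)
  with step.IH show ?case by (rule equivclp_trans)
qed

definition inv_word :: "letter list \<Rightarrow> letter list" where
  "inv_word w = rev (map (\<lambda>(x, s). (x, \<not> s)) w)"

lemma cancels_inv_word: "cancels u v \<Longrightarrow> cancels (inv_word u) (inv_word v)"
proof (induction rule: cancels.induct)
  case (1 u x s v)
  show ?case using cancels.intros[of "inv_word v" x s "inv_word u"] by (simp add: inv_word_def)
qed

lemma equivclp_inv_word:
  assumes "equivclp cancels u v" shows "equivclp cancels (inv_word u) (inv_word v)"
  using assms
proof (induction rule: equivclp_induct)
  case base
  show ?case by simp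
next
  case (step y z)
  then have "equivclp cancels (inv_word y) (inv_word z)"
    by (metis cancels_inv_word equivclp_sym r_into_equivclp)
  with step.IH show ?case by (rule equivclp_trans)
qed

instantiation free2 :: "{monoid_mult, inverse}"
begin

lift_definition one_free2 :: free2 is "[]" .

lift_definition times_free2 :: "free2 \<Rightarrow> free2 \<Rightarrow> free2" is "(@)"
proof -
  fix u u' v v' :: "letter list"
  assume "equivclp cancels u u'" "equivclp cancels v v'"
  then have "equivclp cancels (u @ v) (u' @ v)" "equivclp cancels (u' @ v) (u' @ v')"
    using equivclp_cancels_append[of u u' "[]" v] equivclp_cancels_append[of v v' u' "[]"] by simp_all
  then show "equivclp cancels (u @ v) (u' @ v')" by (rule equivclp_trans)
qed

lift_definition inverse_free2 :: "free2 \<Rightarrow> free2" is inv_word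
  by (rule equivclp_inv_word)

definition divide_free2 :: "free2 \<Rightarrow> free2 \<Rightarrow> free2" where
  "divide_free2 g h = g * inverse h"

instance by standard (transfer; simp)+

end

lemma free2_left_inverse: "inverse g * g = 1" for g :: free2
proof transfer
  fix w show "equivclp cancels (inv_word w @ w) []"
  proof (induction w)
    case Nil
    show ?case by (simp add: inv_word_def)
  next
    case (Cons a w)
    obtain x s where a: "a = (x, s)" by fastforce
    have "cancels (inv_word w @ [(x, \<not> s), (x, \<not> \<not> s)] @ w) (inv_word w @ w)"
      by (rule cancels.intros)
    then have "cancels (inv_word (a # w) @ a # w) (inv_word w @ w)"
      by (simp add: inv_word_def a)
    with Cons.IH show ?case by (blast intro: equivclp_trans r_into_equivclp)
  qed
qed


section \<open>The Hilbert space of square-summable families\<close>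

lemma l2_upper:
  fixes f :: "'i \<Rightarrow> complex"
  assumes "(\<lambda>i. (cmod (f i))\<^sup>2) summable_on UNIV" "finite F"
  shows "L2_set (\<lambda>i. cmod (f i)) F \<le> sqrt (\<Sum>\<^sub>\<infinity>i. (cmod (f i))\<^sup>2)"
  unfolding L2_set_def using assms by (intro real_sqrt_le_mono finite_sum_le_infsum) auto

lemma l2_least:
  fixes f :: "'i \<Rightarrow> complex"
  assumes "\<And>F. finite F \<Longrightarrow> L2_set (\<lambda>i. cmod (f i)) F \<le> B"
  shows "(\<lambda>i. (cmod (f i))\<^sup>2) summable_on UNIV" "sqrt (\<Sum>\<^sub>\<infinity>i. (cmod (f i))\<^sup>2) \<le> B"
proof -
  have B: "0 \<le> B" using assms[of "{}"] by simp
  have le: "(\<Sum>i\<in>F. (cmod (f i))\<^sup>2) \<le> B\<^sup>2" if "finite F" for F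
    using assms[OF that] B unfolding L2_set_def by (simp add: real_le_lsqrt real_sqrt_le_iff sqrt_le_D)
  show s: "(\<lambda>i. (cmod (f i))\<^sup>2) summable_on UNIV"
    by (rule nonneg_bdd_above_summable_on) (auto intro!: bdd_aboveI[of _ "B\<^sup>2"] le)
  have "(\<Sum>\<^sub>\<infinity>i. (cmod (f i))\<^sup>2) \<le> B\<^sup>2"
    by (rule infsum_le_finite_sums[OF s]) (use le in auto)
  then show "sqrt (\<Sum>\<^sub>\<infinity>i. (cmod (f i))\<^sup>2) \<le> B"
    using B by (simp add: real_le_lsqrt)
qed

lemma l2_add:
  fixes f g :: "'i \<Rightarrow> complex"
  assumes "(\<lambda>i. (cmod (f i))\<^sup>2) summable_on UNIV" "(\<lambda>i. (cmod (g i))\<^sup>2) summable_on UNIV"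
  shows "(\<lambda>i. (cmod (f i + g i))\<^sup>2) summable_on UNIV"
    "sqrt (\<Sum>\<^sub>\<infinity>i. (cmod (f i + g i))\<^sup>2)
      \<le> sqrt (\<Sum>\<^sub>\<infinity>i. (cmod (f i))\<^sup>2) + sqrt (\<Sum>\<^sub>\<infinity>i. (cmod (g i))\<^sup>2)"
proof -
  have le: "L2_set (\<lambda>i. cmod (f i + g i)) F
      \<le> sqrt (\<Sum>\<^sub>\<infinity>i. (cmod (f i))\<^sup>2) + sqrt (\<Sum>\<^sub>\<infinity>i. (cmod (g i))\<^sup>2)"
    if "finite F" for F
  proof -
    have "L2_set (\<lambda>i. cmod (f i + g i)) F \<le> L2_set (\<lambda>i. cmod (f i) + cmod (g i)) F"
      by (intro L2_set_mono norm_triangle_ineq) auto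
    also have "\<dots> \<le> L2_set (\<lambda>i. cmod (f i)) F + L2_set (\<lambda>i. cmod (g i)) F"
      by (rule L2_set_triangle_ineq)
    finally show ?thesis using l2_upper[OF assms(1) that] l2_upper[OF assms(2) that] by linarith
  qed
  show "(\<lambda>i. (cmod (f i + g i))\<^sup>2) summable_on UNIV"
    "sqrt (\<Sum>\<^sub>\<infinity>i. (cmod (f i + g i))\<^sup>2)
      \<le> sqrt (\<Sum>\<^sub>\<infinity>i. (cmod (f i))\<^sup>2) + sqrt (\<Sum>\<^sub>\<infinity>i. (cmod (g i))\<^sup>2)"
    using l2_least[OF le] by auto
qed

typedef 'i ell2 = "{f :: 'i \<Rightarrow> complex. (\<lambda>i. (cmod (f i))\<^sup>2) summable_on UNIV}"
  by (rule exI[of _ "\<lambda>_. 0"]) simp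

setup_lifting type_definition_ell2

lift_definition scaleC :: "complex \<Rightarrow> 'i ell2 \<Rightarrow> 'i ell2" is "\<lambda>c f i. c * f i"
  by (simp add: norm_mult power_mult_distrib summable_on_cmult_right)

definition cinner :: "'i ell2 \<Rightarrow> 'i ell2 \<Rightarrow> complex" where
  "cinner x y = (\<Sum>\<^sub>\<infinity>i. cnj (Rep_ell2 x i) * Rep_ell2 y i)"

instantiation ell2 :: (type) real_normed_vector
begin

lift_definition zero_ell2 :: "'a ell2" is "\<lambda>_. 0" by simp

lift_definition plus_ell2 :: "'a ell2 \<Rightarrow> 'a ell2 \<Rightarrow> 'a ell2" is "\<lambda>f g i. f i + g i"
  by (rule l2_add)

lift_definition uminus_ell2 :: "'a ell2 \<Rightarrow> 'a ell2" is "\<lambda>f i. - f i" by simp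

definition minus_ell2 :: "'a ell2 \<Rightarrow> 'a ell2 \<Rightarrow> 'a ell2" where "minus_ell2 x y = x + - y"

definition scaleR_ell2 :: "real \<Rightarrow> 'a ell2 \<Rightarrow> 'a ell2" where "scaleR_ell2 r = scaleC (of_real r)"

lift_definition norm_ell2 :: "'a ell2 \<Rightarrow> real" is "\<lambda>f. sqrt (\<Sum>\<^sub>\<infinity>i. (cmod (f i))\<^sup>2)" .

definition dist_ell2 :: "'a ell2 \<Rightarrow> 'a ell2 \<Rightarrow> real" where "dist_ell2 x y = norm (x - y)"

definition sgn_ell2 :: "'a ell2 \<Rightarrow> 'a ell2" where "sgn_ell2 x = scaleR (inverse (norm x)) x"

definition uniformity_ell2 :: "('a ell2 \<times> 'a ell2) filter" where
  "uniformity_ell2 = (INF e\<in>{0<..}. principal {(x, y). dist x y < e})"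

definition open_ell2 :: "'a ell2 set \<Rightarrow> bool" where
  "open_ell2 U = (\<forall>x\<in>U. eventually (\<lambda>(x', y). x' = x \<longrightarrow> y \<in> U) uniformity)"

instance
proof
  fix x y z :: "'a ell2" and a b :: real
  show "x + y + z = x + (y + z)" by transfer (simp add: add.assoc)
  show "x + y = y + x" by transfer (simp add: add.commute)
  show "0 + x = x" by transfer simp
  show "- x + x = 0" by transfer simp
  show "x - y = x + - y" by (fact minus_ell2_def)
  show "a *\<^sub>R (x + y) = a *\<^sub>R x + a *\<^sub>R y"
    unfolding scaleR_ell2_def by transfer (simp add: algebra_simps)
  show "(a + b) *\<^sub>R x = a *\<^sub>R x + b *\<^sub>R x"
    unfolding scaleR_ell2_def by transfer (simp add: algebra_simps)
  show "a *\<^sub>R b *\<^sub>R x = (a * b) *\<^sub>R x"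
    unfolding scaleR_ell2_def by transfer (simp add: algebra_simps)
  show "1 *\<^sub>R x = x" unfolding scaleR_ell2_def by transfer simp
  show "dist x y = norm (x - y)" by (fact dist_ell2_def)
  show "sgn x = inverse (norm x) *\<^sub>R x" by (fact sgn_ell2_def)
  show "(uniformity :: ('a ell2 \<times> 'a ell2) filter)
      = (INF e\<in>{0<..}. principal {(x, y). dist x y < e})"
    by (fact uniformity_ell2_def)
  show "open U = (\<forall>x\<in>U. \<forall>\<^sub>F (x', y) in uniformity. x' = x \<longrightarrow> y \<in> U)"
    for U :: "'a ell2 set" by (fact open_ell2_def)
  show "(norm x = 0) = (x = 0)"
  proof transfer
    fix f :: "'a \<Rightarrow> complex" assume s: "(\<lambda>i. (cmod (f i))\<^sup>2) summable_on UNIV"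
    show "(sqrt (\<Sum>\<^sub>\<infinity>i. (cmod (f i))\<^sup>2) = 0) = (f = (\<lambda>_. 0))"
    proof
      assume "sqrt (\<Sum>\<^sub>\<infinity>i. (cmod (f i))\<^sup>2) = 0"
      then have "cmod (f i) \<le> 0" for i using l2_upper[OF s, of "{i}"] by simp
      then show "f = (\<lambda>_. 0)" by auto
    qed simp
  qed
  show "norm (x + y) \<le> norm x + norm y" by transfer (rule l2_add)
  show "norm (a *\<^sub>R x) = \<bar>a\<bar> * norm x"
    unfolding scaleR_ell2_def
    by transfer (simp add: norm_mult power_mult_distrib infsum_cmult_right' real_sqrt_mult)
qed

end

lemma scaleC_add_right: "scaleC c (x + y) = scaleC c x + scaleC c y"
  by transfer (simp add: algebra_simps)

lemma scaleC_scaleR: "scaleC c (r *\<^sub>R x) = r *\<^sub>R scaleC c x"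
  unfolding scaleR_ell2_def by transfer (simp add: algebra_simps)

lemma norm_scaleC: "norm (scaleC c x) = cmod c * norm x"
  by transfer (simp add: norm_mult power_mult_distrib infsum_cmult_right' real_sqrt_mult)

lift_definition ket :: "'i \<Rightarrow> 'i ell2" is "\<lambda>i j. if j = i then 1 else 0"
  by (rule finite_nonzero_values_imp_summable_on) simp

lift_definition ell2_tensor :: "'i ell2 \<Rightarrow> 'j ell2 \<Rightarrow> ('i \<times> 'j) ell2"
  is "\<lambda>f g (i, j). f i * g j"
proof -
  fix f :: "'i \<Rightarrow> complex" and g :: "'j \<Rightarrow> complex"
  assume f: "(\<lambda>i. (cmod (f i))\<^sup>2) summable_on UNIV" and g: "(\<lambda>j. (cmod (g j))\<^sup>2) summable_on UNIV"
  let ?B = "(\<Sum>\<^sub>\<infinity>i. (cmod (f i))\<^sup>2) * (\<Sum>\<^sub>\<infinity>j. (cmod (g j))\<^sup>2)"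
  have "(\<Sum>p\<in>F. (cmod (case p of (i, j) \<Rightarrow> f i * g j))\<^sup>2) \<le> ?B" if "finite F" for F
  proof -
    have "(\<Sum>p\<in>F. (cmod (case p of (i, j) \<Rightarrow> f i * g j))\<^sup>2)
        \<le> (\<Sum>p\<in>fst ` F \<times> snd ` F. (cmod (case p of (i, j) \<Rightarrow> f i * g j))\<^sup>2)"
      using that by (intro sum_mono2) (auto simp: rev_image_eqI)
    also have "\<dots> = (\<Sum>i\<in>fst ` F. (cmod (f i))\<^sup>2) * (\<Sum>j\<in>snd ` F. (cmod (g j))\<^sup>2)"
      by (simp add: sum_product sum.cartesian_product norm_mult power_mult_distrib case_prod_unfold)
    also have "\<dots> \<le> ?B"
      using that f g by (intro mult_mono finite_sum_le_infsum sum_nonneg infsum_nonneg) auto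
    finally show ?thesis .
  qed
  then show "(\<lambda>p. (cmod (case p of (i, j) \<Rightarrow> f i * g j))\<^sup>2) summable_on UNIV"
    by (intro nonneg_bdd_above_summable_on bdd_aboveI[of _ ?B]) auto
qed


section \<open>Normed *-algebras\<close>

text \<open>Unital complex *-algebras on a carrier set. Norms are kept separate from the record,
  because several norms on the same algebra have to be compared.\<close>

record 'a star_algebra = "(complex, 'a) module" +
  star :: "'a \<Rightarrow> 'a"

definition cstar_norm :: "('a, 'm) star_algebra_scheme \<Rightarrow> ('a \<Rightarrow> real) \<Rightarrow> bool" where
  "cstar_norm M p \<longleftrightarrow>
    (\<forall>x\<in>carrier M. 0 \<le> p x \<and> (p x = 0 \<longleftrightarrow> x = \<zero>\<^bsub>M\<^esub>)) \<and>
    (\<forall>x\<in>carrier M. \<forall>y\<in>carrier M. p (x \<oplus>\<^bsub>M\<^esub> y) \<le> p x + p y) \<and>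
    (\<forall>c. \<forall>x\<in>carrier M. p (c \<odot>\<^bsub>M\<^esub> x) = cmod c * p x) \<and>
    (\<forall>x\<in>carrier M. \<forall>y\<in>carrier M. p (x \<otimes>\<^bsub>M\<^esub> y) \<le> p x * p y) \<and>
    (\<forall>x\<in>carrier M. p (star M x \<otimes>\<^bsub>M\<^esub> x) = (p x)\<^sup>2)"

definition norm_closure :: "('a, 'm) star_algebra_scheme \<Rightarrow> ('a \<Rightarrow> real) \<Rightarrow> 'a set \<Rightarrow> 'a set" where
  "norm_closure M p S = {x \<in> carrier M. \<forall>\<epsilon>>0. \<exists>y\<in>S. p (x \<ominus>\<^bsub>M\<^esub> y) < \<epsilon>}"

definition cstar_subalgebra :: "('a, 'm) star_algebra_scheme \<Rightarrow> ('a \<Rightarrow> real) \<Rightarrow> 'a set \<Rightarrow> bool" where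
  "cstar_subalgebra M p S \<longleftrightarrow>
    S \<subseteq> carrier M \<and> \<zero>\<^bsub>M\<^esub> \<in> S \<and>
    (\<forall>x\<in>S. \<forall>y\<in>S. x \<oplus>\<^bsub>M\<^esub> y \<in> S \<and> x \<otimes>\<^bsub>M\<^esub> y \<in> S) \<and>
    (\<forall>c. \<forall>x\<in>S. c \<odot>\<^bsub>M\<^esub> x \<in> S) \<and>
    (\<forall>x\<in>S. star M x \<in> S) \<and>
    norm_closure M p S \<subseteq> S"

definition cstar_generated :: "('a, 'm) star_algebra_scheme \<Rightarrow> ('a \<Rightarrow> real) \<Rightarrow> 'a set \<Rightarrow> 'a set" where
  "cstar_generated M p X = \<Inter>{S. cstar_subalgebra M p S \<and> X \<subseteq> S}"

definition abelian_subset :: "('a, 'm) star_algebra_scheme \<Rightarrow> 'a set \<Rightarrow> bool" where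
  "abelian_subset M S \<longleftrightarrow> (\<forall>x\<in>S. \<forall>y\<in>S. x \<otimes>\<^bsub>M\<^esub> y = y \<otimes>\<^bsub>M\<^esub> x)"

definition maximal_abelian :: "('a, 'm) star_algebra_scheme \<Rightarrow> ('a \<Rightarrow> real) \<Rightarrow> 'a set \<Rightarrow> bool" where
  "maximal_abelian M p S \<longleftrightarrow>
    cstar_subalgebra M p S \<and> abelian_subset M S \<and>
    (\<forall>D. cstar_subalgebra M p D \<and> abelian_subset M D \<and> S \<subseteq> D \<longrightarrow> D = S)"

definition star_hom ::
  "('a, 'm) star_algebra_scheme \<Rightarrow> ('b, 'n) star_algebra_scheme \<Rightarrow> ('a \<Rightarrow> 'b) \<Rightarrow> bool" where
  "star_hom M N \<phi> \<longleftrightarrow>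
    (\<forall>x\<in>carrier M. \<phi> x \<in> carrier N \<and> \<phi> (star M x) = star N (\<phi> x)) \<and>
    (\<forall>x\<in>carrier M. \<forall>y\<in>carrier M.
      \<phi> (x \<oplus>\<^bsub>M\<^esub> y) = \<phi> x \<oplus>\<^bsub>N\<^esub> \<phi> y \<and> \<phi> (x \<otimes>\<^bsub>M\<^esub> y) = \<phi> x \<otimes>\<^bsub>N\<^esub> \<phi> y) \<and>
    (\<forall>c. \<forall>x\<in>carrier M. \<phi> (c \<odot>\<^bsub>M\<^esub> x) = c \<odot>\<^bsub>N\<^esub> \<phi> x)"


subsection \<open>Completion\<close>

definition cauchy_seqs :: "('a, 'm) star_algebra_scheme \<Rightarrow> ('a \<Rightarrow> real) \<Rightarrow> (nat \<Rightarrow> 'a) set" where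
  "cauchy_seqs M p = {s. (\<forall>n. s n \<in> carrier M) \<and>
    (\<forall>\<epsilon>>0. \<exists>N. \<forall>m\<ge>N. \<forall>n\<ge>N. p (s m \<ominus>\<^bsub>M\<^esub> s n) < \<epsilon>)}"

definition cauchy_rel ::
  "('a, 'm) star_algebra_scheme \<Rightarrow> ('a \<Rightarrow> real) \<Rightarrow> ((nat \<Rightarrow> 'a) \<times> (nat \<Rightarrow> 'a)) set" where
  "cauchy_rel M p = {(s, t). s \<in> cauchy_seqs M p \<and> t \<in> cauchy_seqs M p \<and>
    (\<lambda>n. p (s n \<ominus>\<^bsub>M\<^esub> t n)) \<longlonglongrightarrow> 0}"

definition cstar_completion ::
  "('a, 'm) star_algebra_scheme \<Rightarrow> ('a \<Rightarrow> real) \<Rightarrow> (nat \<Rightarrow> 'a) set star_algebra" where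
  "cstar_completion M p = \<lparr>
    carrier = cauchy_seqs M p // cauchy_rel M p,
    monoid.mult = (\<lambda>X Y. \<Union>s\<in>X. \<Union>t\<in>Y. cauchy_rel M p `` {\<lambda>n. s n \<otimes>\<^bsub>M\<^esub> t n}),
    one = cauchy_rel M p `` {\<lambda>_. \<one>\<^bsub>M\<^esub>},
    zero = cauchy_rel M p `` {\<lambda>_. \<zero>\<^bsub>M\<^esub>},
    add = (\<lambda>X Y. \<Union>s\<in>X. \<Union>t\<in>Y. cauchy_rel M p `` {\<lambda>n. s n \<oplus>\<^bsub>M\<^esub> t n}),
    smult = (\<lambda>c X. \<Union>s\<in>X. cauchy_rel M p `` {\<lambda>n. c \<odot>\<^bsub>M\<^esub> s n}),
    star = (\<lambda>X. \<Union>s\<in>X. cauchy_rel M p `` {\<lambda>n. star M (s n)})\<rparr>"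

definition completion_norm :: "('a \<Rightarrow> real) \<Rightarrow> (nat \<Rightarrow> 'a) set \<Rightarrow> real" where
  "completion_norm p X = the_elem ((\<lambda>s. lim (\<lambda>n. p (s n))) ` X)"

definition completion_embed ::
  "('a, 'm) star_algebra_scheme \<Rightarrow> ('a \<Rightarrow> real) \<Rightarrow> 'a \<Rightarrow> (nat \<Rightarrow> 'a) set" where
  "completion_embed M p x = cauchy_rel M p `` {\<lambda>_. x}"


subsection \<open>Algebraic tensor products\<close>

text \<open>The quotient of the free complex vector space on \<open>carrier M \<times> carrier N\<close> by the bilinearity
  relations. The generators of \<open>tensor_null\<close> carry an arbitrary coefficient \<open>z\<close>, so that
  the additive closure is already the complex linear span.\<close>

inductive_set tensor_null ::
  "('a, 'm) star_algebra_scheme \<Rightarrow> ('b, 'n) star_algebra_scheme \<Rightarrow> (('a \<times> 'b) \<Rightarrow>\<^sub>0 complex) set"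
  for M :: "('a, 'm) star_algebra_scheme" and N :: "('b, 'n) star_algebra_scheme" where
  null_zero: "0 \<in> tensor_null M N"
| null_plus: "f \<in> tensor_null M N \<Longrightarrow> g \<in> tensor_null M N \<Longrightarrow> f + g \<in> tensor_null M N"
| left_add: "a \<in> carrier M \<Longrightarrow> a' \<in> carrier M \<Longrightarrow> b \<in> carrier N \<Longrightarrow>
    Poly_Mapping.single (a \<oplus>\<^bsub>M\<^esub> a', b) z - Poly_Mapping.single (a, b) z
      - Poly_Mapping.single (a', b) z \<in> tensor_null M N"
| right_add: "a \<in> carrier M \<Longrightarrow> b \<in> carrier N \<Longrightarrow> b' \<in> carrier N \<Longrightarrow>
    Poly_Mapping.single (a, b \<oplus>\<^bsub>N\<^esub> b') z - Poly_Mapping.single (a, b) z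
      - Poly_Mapping.single (a, b') z \<in> tensor_null M N"
| left_smult: "a \<in> carrier M \<Longrightarrow> b \<in> carrier N \<Longrightarrow>
    Poly_Mapping.single (c \<odot>\<^bsub>M\<^esub> a, b) z - Poly_Mapping.single (a, b) (c * z) \<in> tensor_null M N"
| right_smult: "a \<in> carrier M \<Longrightarrow> b \<in> carrier N \<Longrightarrow>
    Poly_Mapping.single (a, c \<odot>\<^bsub>N\<^esub> b) z - Poly_Mapping.single (a, b) (c * z) \<in> tensor_null M N"

definition formal_sums :: "'a set \<Rightarrow> 'b set \<Rightarrow> (('a \<times> 'b) \<Rightarrow>\<^sub>0 complex) set" where
  "formal_sums S T = {f. Poly_Mapping.keys f \<subseteq> S \<times> T}"

definition tensor_rel ::
  "('a, 'm) star_algebra_scheme \<Rightarrow> ('b, 'n) star_algebra_scheme \<Rightarrow>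
    ((('a \<times> 'b) \<Rightarrow>\<^sub>0 complex) \<times> (('a \<times> 'b) \<Rightarrow>\<^sub>0 complex)) set" where
  "tensor_rel M N = {(f, g). f \<in> formal_sums (carrier M) (carrier N) \<and>
    g \<in> formal_sums (carrier M) (carrier N) \<and> f - g \<in> tensor_null M N}"

definition formal_mult ::
  "('a, 'm) star_algebra_scheme \<Rightarrow> ('b, 'n) star_algebra_scheme \<Rightarrow>
    (('a \<times> 'b) \<Rightarrow>\<^sub>0 complex) \<Rightarrow> (('a \<times> 'b) \<Rightarrow>\<^sub>0 complex) \<Rightarrow> (('a \<times> 'b) \<Rightarrow>\<^sub>0 complex)" where
  "formal_mult M N f g = (\<Sum>(a, b)\<in>Poly_Mapping.keys f. \<Sum>(a', b')\<in>Poly_Mapping.keys g.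
    Poly_Mapping.single (a \<otimes>\<^bsub>M\<^esub> a', b \<otimes>\<^bsub>N\<^esub> b')
      (Poly_Mapping.lookup f (a, b) * Poly_Mapping.lookup g (a', b')))"

definition formal_star ::
  "('a, 'm) star_algebra_scheme \<Rightarrow> ('b, 'n) star_algebra_scheme \<Rightarrow>
    (('a \<times> 'b) \<Rightarrow>\<^sub>0 complex) \<Rightarrow> (('a \<times> 'b) \<Rightarrow>\<^sub>0 complex)" where
  "formal_star M N f = (\<Sum>(a, b)\<in>Poly_Mapping.keys f.
    Poly_Mapping.single (star M a, star N b) (cnj (Poly_Mapping.lookup f (a, b))))"

definition alg_tensor ::
  "('a, 'm) star_algebra_scheme \<Rightarrow> ('b, 'n) star_algebra_scheme \<Rightarrow>
    (('a \<times> 'b) \<Rightarrow>\<^sub>0 complex) set star_algebra" where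
  "alg_tensor M N = \<lparr>
    carrier = formal_sums (carrier M) (carrier N) // tensor_rel M N,
    monoid.mult = (\<lambda>X Y. \<Union>f\<in>X. \<Union>g\<in>Y. tensor_rel M N `` {formal_mult M N f g}),
    one = tensor_rel M N `` {Poly_Mapping.single (\<one>\<^bsub>M\<^esub>, \<one>\<^bsub>N\<^esub>) 1},
    zero = tensor_rel M N `` {0},
    add = (\<lambda>X Y. \<Union>f\<in>X. \<Union>g\<in>Y. tensor_rel M N `` {f + g}),
    smult = (\<lambda>c X. \<Union>f\<in>X. tensor_rel M N `` {Poly_Mapping.map ((*) c) f}),
    star = (\<lambda>X. \<Union>f\<in>X. tensor_rel M N `` {formal_star M N f})\<rparr>"

text \<open>The subspace of \<open>alg_tensor M N\<close> spanned by the tensors \<open>s \<otimes> t\<close> with \<open>s \<in> S\<close> and \<open>t \<in> T\<close>.\<close>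

definition alg_subtensor ::
  "('a, 'm) star_algebra_scheme \<Rightarrow> ('b, 'n) star_algebra_scheme \<Rightarrow> 'a set \<Rightarrow> 'b set \<Rightarrow>
    (('a \<times> 'b) \<Rightarrow>\<^sub>0 complex) set set" where
  "alg_subtensor M N S T = (\<lambda>f. tensor_rel M N `` {f}) ` formal_sums S T"

definition closed_subtensor ::
  "('a, 'm) star_algebra_scheme \<Rightarrow> ('b, 'n) star_algebra_scheme \<Rightarrow>
    ((('a \<times> 'b) \<Rightarrow>\<^sub>0 complex) set \<Rightarrow> real) \<Rightarrow> 'a set \<Rightarrow> 'b set \<Rightarrow>
    (nat \<Rightarrow> (('a \<times> 'b) \<Rightarrow>\<^sub>0 complex) set) set set" where
  "closed_subtensor M N p S T =
    norm_closure (cstar_completion (alg_tensor M N) p) (completion_norm p)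
      (completion_embed (alg_tensor M N) p ` alg_subtensor M N S T)"

text \<open>The largest C*-norm on \<open>alg_tensor M N\<close>.\<close>

definition max_norm ::
  "('a, 'm) star_algebra_scheme \<Rightarrow> ('b, 'n) star_algebra_scheme \<Rightarrow>
    (('a \<times> 'b) \<Rightarrow>\<^sub>0 complex) set \<Rightarrow> real" where
  "max_norm M N X = Sup {p X | p. cstar_norm (alg_tensor M N) p}"


section \<open>Operators on the Hilbert space\<close>

text \<open>The type \<open>'i ell2 \<Rightarrow>\<^sub>L 'j ell2\<close> consists of the bounded real-linear maps.\<close>

type_synonym 'i oper = "'i ell2 \<Rightarrow>\<^sub>L 'i ell2"

definition bounded_ops :: "'i oper set" where
  "bounded_ops = {T. \<forall>c x. blinfun_apply T (scaleC c x) = scaleC c (blinfun_apply T x)}"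

lemma bounded_linear_scaleC: "bounded_linear (scaleC c)"
  by (rule bounded_linear_intro[of _ "cmod c"])
    (simp_all add: scaleC_add_right scaleC_scaleR norm_scaleC mult.commute)

definition scaleC_oper :: "complex \<Rightarrow> 'i oper \<Rightarrow> 'i oper" where
  "scaleC_oper c T = Blinfun (scaleC c) o\<^sub>L T"

lemma scaleC_oper_apply: "blinfun_apply (scaleC_oper c T) x = scaleC c (blinfun_apply T x)"
  by (simp add: scaleC_oper_def bounded_linear_Blinfun_apply bounded_linear_scaleC)

definition adjoint_oper :: "'i oper \<Rightarrow> 'i oper" where
  "adjoint_oper T = (THE S. S \<in> bounded_ops \<and>
    (\<forall>x y. cinner (blinfun_apply S x) y = cinner x (blinfun_apply T y)))"

definition oper_alg :: "'i oper star_algebra" where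
  "oper_alg = \<lparr>carrier = bounded_ops, monoid.mult = (o\<^sub>L), one = id_blinfun, zero = 0, add = (+),
    smult = scaleC_oper, star = adjoint_oper\<rparr>"

definition compact_ops :: "'i oper set" where
  "compact_ops = {T \<in> bounded_ops. compact (closure (blinfun_apply T ` cball 0 1))}"

definition oper_on_basis :: "('i \<Rightarrow> 'i ell2) \<Rightarrow> 'i oper" where
  "oper_on_basis v = (THE T. T \<in> bounded_ops \<and> (\<forall>i. blinfun_apply T (ket i) = v i))"

definition oper_tensor :: "'i oper \<Rightarrow> 'j oper \<Rightarrow> ('i \<times> 'j) oper" where
  "oper_tensor a b = (THE T. T \<in> bounded_ops \<and>
    (\<forall>x y. blinfun_apply T (ell2_tensor x y) = ell2_tensor (blinfun_apply a x) (blinfun_apply b y)))"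

definition basis_proj :: "'i \<Rightarrow> 'i oper" where
  "basis_proj i = Blinfun (\<lambda>x. scaleC (cinner (ket i) x) (ket i))"

lemma basis_proj_apply: "blinfun_apply (basis_proj i) x = scaleC (cinner (ket i) x) (ket i)"
proof -
  have cinner: "cinner (ket i) x = Rep_ell2 x i" for x
  proof -
    have "cinner (ket i) x = (\<Sum>\<^sub>\<infinity>j\<in>{i}. Rep_ell2 x j)"
      unfolding cinner_def by (rule infsum_cong_neutral) (auto simp: ket.rep_eq)
    then show ?thesis by simp
  qed
  have "bounded_linear (\<lambda>x. scaleC (Rep_ell2 x i) (ket i))"
  proof (rule bounded_linear_intro[of _ "norm (ket i)"])
    show "scaleC (Rep_ell2 (x + y) i) (ket i) = scaleC (Rep_ell2 x i) (ket i) + scaleC (Rep_ell2 y i) (ket i)"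
      for x y :: "'a ell2" by transfer (simp add: algebra_simps)
    show "scaleC (Rep_ell2 (r *\<^sub>R x) i) (ket i) = r *\<^sub>R scaleC (Rep_ell2 x i) (ket i)" for r x
      unfolding scaleR_ell2_def by transfer (simp add: algebra_simps)
    have "cmod (Rep_ell2 x i) \<le> norm x" for x
      using l2_upper[of "Rep_ell2 x" "{i}"] Rep_ell2[of x] by (simp add: norm_ell2.rep_eq)
    then show "norm (scaleC (Rep_ell2 x i) (ket i)) \<le> norm x * norm (ket i)" for x
      by (simp add: norm_scaleC mult_right_mono)
  qed
  then show ?thesis by (simp add: basis_proj_def cinner bounded_linear_Blinfun_apply)
qed

text \<open>The linear map induced on an algebraic tensor product by an operator-valued bilinear map.\<close>

definition tensor_lift :: "('a \<Rightarrow> 'b \<Rightarrow> 'i oper) \<Rightarrow> (('a \<times> 'b) \<Rightarrow>\<^sub>0 complex) set \<Rightarrow> 'i oper" where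
  "tensor_lift \<phi> X = the_elem ((\<lambda>f. \<Sum>(a, b)\<in>Poly_Mapping.keys f.
    scaleC_oper (Poly_Mapping.lookup f (a, b)) (\<phi> a b)) ` X)"

text \<open>The minimal (spatial) norm of algebras of operators on \<open>\<ell>\<^sup>2(I)\<close> and \<open>\<ell>\<^sup>2(J)\<close>: the operator
  norm on \<open>\<ell>\<^sup>2(I) \<otimes> \<ell>\<^sup>2(J) = \<ell>\<^sup>2(I \<times> J)\<close>.\<close>

definition min_norm :: "(('i oper \<times> 'j oper) \<Rightarrow>\<^sub>0 complex) set \<Rightarrow> real" where
  "min_norm X = norm (tensor_lift oper_tensor X)"


section \<open>The algebras of the free group\<close>

definition left_translation :: "free2 \<Rightarrow> free2 oper" where
  "left_translation g = oper_on_basis (\<lambda>h. ket (g * h))"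

definition right_translation :: "free2 \<Rightarrow> free2 oper" where
  "right_translation g = oper_on_basis (\<lambda>h. ket (h * inverse g))"

definition reduced_alg :: "free2 oper star_algebra" where
  "reduced_alg = oper_alg\<lparr>carrier := cstar_generated oper_alg norm (range left_translation)\<rparr>"

definition A_alg :: "free2 oper star_algebra" where
  "A_alg = oper_alg\<lparr>carrier := {a + k | a k. a \<in> carrier reduced_alg \<and> k \<in> compact_ops}\<rparr>"

definition C_alg :: "free2 oper set" where
  "C_alg = cstar_generated A_alg norm (range basis_proj \<union> {id_blinfun})"

definition quotient_map :: "free2 oper \<Rightarrow> free2 oper" where
  "quotient_map T = (THE a. a \<in> carrier reduced_alg \<and> T - a \<in> compact_ops)"

text \<open>The representation \<open>\<lambda>\<close> is the inclusion. The representation \<open>\<rho>\<close> is determined on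
  \<open>reduced_alg\<close> by its values on the generators, since *-homomorphisms between C*-algebras
  are continuous.\<close>

definition left_rep :: "free2 oper \<Rightarrow> free2 oper" where
  "left_rep a = a"

definition right_rep :: "free2 oper \<Rightarrow> free2 oper" where
  "right_rep = (SOME \<phi>. star_hom reduced_alg oper_alg \<phi> \<and>
    (\<forall>g. \<phi> (left_translation g) = right_translation g))"

definition pi_r :: "((free2 oper \<times> free2 oper) \<Rightarrow>\<^sub>0 complex) set \<Rightarrow> free2 oper" where
  "pi_r = tensor_lift (\<lambda>a b. left_rep (quotient_map a) o\<^sub>L right_rep (quotient_map b))"

definition alpha_norm :: "((free2 oper \<times> free2 oper) \<Rightarrow>\<^sub>0 complex) set \<Rightarrow> real" where
  "alpha_norm X = max (min_norm X) (norm (pi_r X))"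

end

theory Submission
  imports Defs
begin

text \<open>
  Let \<open>x\<close> be the mean of the tensors \<open>\<lambda>\<^sub>s \<otimes> \<lambda>\<^sub>s\<close> over the two generators \<open>s\<close> and their inverses. The
  operator \<open>\<pi>\<^sub>r(x)\<close> fixes \<open>\<xi>\<^sub>1\<close>, whereas the minimal norm of \<open>x\<close> is at most \<open>\<surd>3 / 2\<close> (Kesten; by Schur's
  test with the weight \<open>3\<close> to the power \<open>-|g| / 2\<close>). If \<open>f\<close> is continuous, vanishes on \<open>[-r, r]\<close> for some \<open>r\<close> with
  \<open>\<surd>3 / 2 < r < 1\<close>, and \<open>f(1) > 0\<close>, then \<open>z = f(x)\<close> in the completion for \<open>\<beta>\<close> has minimal norm 0,
  but is not annihilated by \<open>\<pi>\<^sub>r\<close>. Since \<open>e\<^sub>g \<otimes> A\<close> and \<open>A \<otimes> e\<^sub>g\<close> carry only one C*-norm, \<open>z\<close> is annihilated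
  by \<open>e\<^sub>g \<otimes> 1\<close> and \<open>1 \<otimes> e\<^sub>g\<close>, so it commutes with \<open>C \<otimes> C\<close>. It does not belong to \<open>C \<otimes> C\<close>, because on
  \<open>C \<odot> C\<close> the representation \<open>\<pi>\<^sub>r\<close> is scalar and bounded by the minimal norm.

  That \<open>C\<close> is maximal abelian in \<open>A\<close> holds because elements of the reduced algebra have constant
  diagonal and the diagonal of a compact operator vanishes at infinity.
\<close>

section \<open>The Hilbert space and its operators\<close>

text \<open>To avoid extending maps to the completion, \<open>f(x)\<close> is represented by a
  Cauchy sequence of real polynomials in \<open>x\<close>, and \<open>\<pi>_r\<close> and the
  minimal norm are only ever applied to its terms. For a self-adjoint \<open>x\<close> and a C*-norm
  \<open>p\<close>, the map taking a real polynomial \<open>P\<close> to \<open>p(P(x))\<close> is a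
  C*-seminorm on polynomials, and this is all the functional calculus needs: applied to
  \<open>\<beta>\<close> it makes the sequence Cauchy, applied to the minimal norm it makes it a
  null sequence. The function is \<open>f = h + |h|\<close> with
  \<open>h(X) = (X^2 - r^2) / 2\<close>, because \<open>|h|\<close> is the square root of a square
  and square roots come from an elementary fixed-point iteration. The uniqueness of the norm on
  \<open>e_g \<otimes> A\<close> rests on the fact that a C*-seminorm on a C*-algebra of operators
  is dominated by the operator norm. The same fact bounds all C*-norms on a given element of
  \<open>A \<odot> A\<close> at once, so that the maximal norm is finite, and it makes
  \<open>\<rho>\<close> continuous, although \<open>\<rho>\<close> is only chosen as some
  *-homomorphism with prescribed values on the generators.\<close>

lemma Rep_add [simp]: "Rep_ell2 (x + y) i = Rep_ell2 x i + Rep_ell2 y i"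
  by (simp add: plus_ell2.rep_eq)

lemma Rep_uminus [simp]: "Rep_ell2 (- x) i = - Rep_ell2 x i"
  by (simp add: uminus_ell2.rep_eq)

lemma Rep_diff [simp]: "Rep_ell2 (x - y) i = Rep_ell2 x i - Rep_ell2 y i"
  unfolding minus_ell2_def by (simp only: Rep_add Rep_uminus) simp

lemma Rep_zero [simp]: "Rep_ell2 0 i = 0"
  by (simp add: zero_ell2.rep_eq)

lemma Rep_scaleC [simp]: "Rep_ell2 (scaleC c x) i = c * Rep_ell2 x i"
  by (simp add: scaleC.rep_eq)

lemma Rep_scaleR [simp]: "Rep_ell2 (r *\<^sub>R x) i = of_real r * Rep_ell2 x i"
  by (simp add: scaleR_ell2_def)

lemma Rep_sum [simp]: "Rep_ell2 (sum f F) i = (\<Sum>j\<in>F. Rep_ell2 (f j) i)"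
  by (induction F rule: infinite_finite_induct) auto

lemma Rep_ket: "Rep_ell2 (ket i) j = (if j = i then 1 else 0)"
  by (simp add: ket.rep_eq)

lemma ell2_eqI: "(\<And>i. Rep_ell2 x i = Rep_ell2 y i) \<Longrightarrow> x = y"
  by (simp add: Rep_ell2_inject[symmetric] fun_eq_iff)

lemma Rep_summable [simp]: "(\<lambda>i. (cmod (Rep_ell2 x i))\<^sup>2) summable_on A"
  using Rep_ell2[of x] by (auto intro: summable_on_subset_banach)

lemma norm_ell2_sq: "(norm x)\<^sup>2 = (\<Sum>\<^sub>\<infinity>i. (cmod (Rep_ell2 x i))\<^sup>2)"
  by (simp add: norm_ell2.rep_eq infsum_nonneg)

lemma L2_le_norm: "finite F \<Longrightarrow> L2_set (\<lambda>i. cmod (Rep_ell2 x i)) F \<le> norm x"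
  using l2_upper[OF Rep_summable[of x UNIV]] by (simp add: norm_ell2.rep_eq)

lemma sum_le_norm_sq: "finite F \<Longrightarrow> (\<Sum>i\<in>F. (cmod (Rep_ell2 x i))\<^sup>2) \<le> (norm x)\<^sup>2"
  unfolding norm_ell2_sq by (intro finite_sum_le_infsum) auto

lemma Rep_le_norm: "cmod (Rep_ell2 x i) \<le> norm x"
  using L2_le_norm[of "{i}" x] by simp

lemma norm_ell2_le: "(\<And>F. finite F \<Longrightarrow> L2_set (\<lambda>i. cmod (Rep_ell2 x i)) F \<le> B) \<Longrightarrow> norm x \<le> B"
  using l2_least(2)[of "Rep_ell2 x" B] by (simp add: norm_ell2.rep_eq)

text \<open>\<open>Abs_ell2 f\<close> means something only for square-summable \<open>f\<close>. A
  uniform bound over finite sets yields summability and the norm bound together; operators given by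
  formulas for their coordinates are constructed this way.\<close>

lemma Abs_ell2_bound:
  assumes "\<And>F. finite F \<Longrightarrow> L2_set (\<lambda>i. cmod (f i)) F \<le> B"
  shows "Rep_ell2 (Abs_ell2 f) = f" "norm (Abs_ell2 f) \<le> B"
proof -
  show r: "Rep_ell2 (Abs_ell2 f) = f"
    using l2_least(1)[of f B] assms by (intro Abs_ell2_inverse) auto
  show "norm (Abs_ell2 f) \<le> B"
    by (rule norm_ell2_le) (use assms r in auto)
qed

lemma L2_set_le_sqrt: "(\<Sum>i\<in>F. (cmod (f i))\<^sup>2) \<le> B\<^sup>2 \<Longrightarrow> 0 \<le> B \<Longrightarrow> L2_set (\<lambda>i. cmod (f i)) F \<le> B"
  by (simp add: L2_set_def real_le_lsqrt)

lemma scaleC_add_left: "scaleC (c + d) x = scaleC c x + scaleC d x"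
  by (rule ell2_eqI) (simp add: algebra_simps)

lemma scaleC_scaleC [simp]: "scaleC c (scaleC d x) = scaleC (c * d) x"
  by (rule ell2_eqI) simp

lemma scaleC_one [simp]: "scaleC 1 x = x"
  by (rule ell2_eqI) simp

lemma scaleC_zero_left [simp]: "scaleC 0 x = 0"
  by (rule ell2_eqI) simp

lemma scaleC_zero_right [simp]: "scaleC c 0 = 0"
  by (rule ell2_eqI) simp

lemma scaleC_minus_left [simp]: "scaleC (- c) x = - scaleC c x"
  by (rule ell2_eqI) simp

lemma scaleC_diff_right: "scaleC c (x - y) = scaleC c x - scaleC c y"
  by (rule ell2_eqI) (simp add: algebra_simps)

lemma scaleC_of_real: "scaleC (of_real r) x = r *\<^sub>R x"
  by (simp add: scaleR_ell2_def)

lemma norm_ket [simp]: "norm (ket i) = 1"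
proof -
  have "(norm (ket i))\<^sup>2 = (\<Sum>\<^sub>\<infinity>j\<in>{i}. 1)"
    unfolding norm_ell2_sq by (intro infsum_cong_neutral) (auto simp: Rep_ket)
  then have "(norm (ket i))\<^sup>2 = 1" by simp
  then show ?thesis using norm_ge_zero[of "ket i"] by (simp add: power2_eq_1_iff)
qed

text \<open>Coordinates are 1-Lipschitz, so a Cauchy sequence converges coordinatewise, and its
  estimates over a fixed finite set survive the limit. Completeness passes on to the operators and
  later supplies fixed points, limits of operators and compactness from total boundedness.\<close>

instance ell2 :: (type) banach
proof
  fix X :: "nat \<Rightarrow> 'a ell2" assume X: "Cauchy X"
  have "Cauchy (\<lambda>n. Rep_ell2 (X n) i)" for i
  proof (rule metric_CauchyI)
    fix e :: real assume "e > 0"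
    then obtain N where "\<And>m n. m \<ge> N \<Longrightarrow> n \<ge> N \<Longrightarrow> dist (X m) (X n) < e"
      using X by (meson metric_CauchyD)
    moreover have "dist (Rep_ell2 (X m) i) (Rep_ell2 (X n) i) \<le> dist (X m) (X n)" for m n
      using Rep_le_norm[of "X m - X n" i] by (simp add: dist_norm)
    ultimately show "\<exists>M. \<forall>m\<ge>M. \<forall>n\<ge>M. dist (Rep_ell2 (X m) i) (Rep_ell2 (X n) i) < e"
      by (meson le_less_trans)
  qed
  then have "\<exists>L. (\<lambda>n. Rep_ell2 (X n) i) \<longlonglongrightarrow> L" for i
    by (simp add: Cauchy_convergent_iff convergent_def)
  then obtain f where f: "\<And>i. (\<lambda>n. Rep_ell2 (X n) i) \<longlonglongrightarrow> f i"
    by metis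
  have L2: "\<exists>N. \<forall>n\<ge>N. \<forall>F. finite F \<longrightarrow> L2_set (\<lambda>i. cmod (f i - Rep_ell2 (X n) i)) F \<le> e" if "e > 0" for e
  proof -
    obtain N where N: "\<And>m n. m \<ge> N \<Longrightarrow> n \<ge> N \<Longrightarrow> dist (X m) (X n) < e"
      using metric_CauchyD[OF X \<open>e > 0\<close>] by blast
    have "L2_set (\<lambda>i. cmod (f i - Rep_ell2 (X n) i)) F \<le> e" if "n \<ge> N" "finite F" for n F
    proof (rule LIMSEQ_le_const2)
      show "(\<lambda>m. L2_set (\<lambda>i. cmod (Rep_ell2 (X m) i - Rep_ell2 (X n) i)) F)
          \<longlonglongrightarrow> L2_set (\<lambda>i. cmod (f i - Rep_ell2 (X n) i)) F"
        unfolding L2_set_def by (intro tendsto_intros f)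
      have "L2_set (\<lambda>i. cmod (Rep_ell2 (X m) i - Rep_ell2 (X n) i)) F \<le> e" if "m \<ge> N" for m
        using L2_le_norm[OF \<open>finite F\<close>, of "X m - X n"] N[OF that \<open>n \<ge> N\<close>] by (simp add: dist_norm)
      then show "\<exists>N. \<forall>m\<ge>N. L2_set (\<lambda>i. cmod (Rep_ell2 (X m) i - Rep_ell2 (X n) i)) F \<le> e" by blast
    qed
    then show ?thesis by blast
  qed
  obtain N where N: "\<And>F. finite F \<Longrightarrow> L2_set (\<lambda>i. cmod (f i - Rep_ell2 (X N) i)) F \<le> 1"
    using L2[of 1] by auto
  define y where "y = X N + Abs_ell2 (\<lambda>i. f i - Rep_ell2 (X N) i)"
  have y: "Rep_ell2 y i = f i" for i
    unfolding y_def using Abs_ell2_bound(1)[OF N] by simp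
  have "X \<longlonglongrightarrow> y"
  proof (rule LIMSEQ_I)
    fix e :: real assume "e > 0"
    then obtain N where "\<And>n F. n \<ge> N \<Longrightarrow> finite F \<Longrightarrow> L2_set (\<lambda>i. cmod (f i - Rep_ell2 (X n) i)) F \<le> e/2"
      using L2[of "e/2"] by auto
    then have "norm (y - X n) \<le> e/2" if "n \<ge> N" for n
      using that by (intro norm_ell2_le) (simp add: y)
    with \<open>e > 0\<close> show "\<exists>N. \<forall>n\<ge>N. norm (X n - y) < e"
      by (intro exI[of _ N]) (force simp: norm_minus_commute)
  qed
  then show "convergent X" by (auto simp: convergent_def)
qed

section \<open>Density of the finitely supported vectors\<close>

lemma ell2_truncate:
  assumes "e > 0"
  obtains F where "finite F" "norm (x - (\<Sum>i\<in>F. scaleC (Rep_ell2 x i) (ket i))) < e"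
proof -
  have "((\<lambda>i. (cmod (Rep_ell2 x i))\<^sup>2) has_sum (norm x)\<^sup>2) UNIV"
    unfolding norm_ell2_sq by (rule has_sum_infsum) simp
  then have "((sum (\<lambda>i. (cmod (Rep_ell2 x i))\<^sup>2)) \<longlongrightarrow> (norm x)\<^sup>2) (finite_subsets_at_top UNIV)"
    by (simp add: has_sum_def)
  then have "\<forall>\<^sub>F F in finite_subsets_at_top UNIV. dist (\<Sum>i\<in>F. (cmod (Rep_ell2 x i))\<^sup>2) ((norm x)\<^sup>2) < (e/2)\<^sup>2"
    using assms by (intro tendstoD) auto
  then obtain F where F: "finite F" "dist (\<Sum>i\<in>F. (cmod (Rep_ell2 x i))\<^sup>2) ((norm x)\<^sup>2) < (e/2)\<^sup>2"
    by (auto simp: eventually_finite_subsets_at_top)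
  let ?y = "x - (\<Sum>i\<in>F. scaleC (Rep_ell2 x i) (ket i))"
  have y: "Rep_ell2 ?y i = (if i \<in> F then 0 else Rep_ell2 x i)" for i
    using F(1) by (simp add: Rep_ket if_distrib cong: if_cong)
  have "norm ?y \<le> e/2"
  proof (rule norm_ell2_le, rule L2_set_le_sqrt)
    fix G :: "'a set" assume G: "finite G"
    have "(\<Sum>i\<in>G. (cmod (Rep_ell2 ?y i))\<^sup>2) = (\<Sum>i\<in>G - F. (cmod (Rep_ell2 x i))\<^sup>2)"
      unfolding y using G by (intro sum.mono_neutral_cong_right) auto
    also have "\<dots> = (\<Sum>i\<in>G \<union> F. (cmod (Rep_ell2 x i))\<^sup>2) - (\<Sum>i\<in>F. (cmod (Rep_ell2 x i))\<^sup>2)"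
      using G F by (subst sum_diff[symmetric]) (auto intro!: arg_cong2[where f = sum])
    also have "\<dots> \<le> (norm x)\<^sup>2 - (\<Sum>i\<in>F. (cmod (Rep_ell2 x i))\<^sup>2)"
      using sum_le_norm_sq[of "G \<union> F" x] G F by simp
    also have "\<dots> \<le> (e/2)\<^sup>2" using F(2) by (simp add: dist_real_def)
    finally show "(\<Sum>i\<in>G. (cmod (Rep_ell2 ?y i))\<^sup>2) \<le> (e/2)\<^sup>2" .
  qed (use assms in auto)
  then show ?thesis using F(1) that assms by force
qed

text \<open>Finite combinations of basis vectors are dense, so a closed property that is stable
  under the linear operations is decided on the basis.\<close>

lemma ell2_induct [consumes 1, case_names add scaleC ket]:
  assumes "closed {x. P x}" "\<And>x y. P x \<Longrightarrow> P y \<Longrightarrow> P (x + y)" "\<And>c x. P x \<Longrightarrow> P (scaleC c x)" "\<And>i. P (ket i)"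
  shows "P x"
proof -
  have P0: "P 0" using assms(3)[OF assms(4), of 0] by simp
  have sum: "P (\<Sum>i\<in>F. scaleC (c i) (ket i))" for F and c :: "'a \<Rightarrow> complex"
    by (induction F rule: infinite_finite_induct) (auto intro: assms(2-) P0)
  have "x \<in> closure {x. P x}"
    unfolding closure_approachable
  proof (intro allI impI)
    fix e :: real assume "e > 0"
    then obtain F where "norm (x - (\<Sum>i\<in>F. scaleC (Rep_ell2 x i) (ket i))) < e" by (rule ell2_truncate)
    then show "\<exists>y\<in>{x. P x}. dist y x < e"
      using sum by (metis dist_norm dist_commute mem_Collect_eq)
  qed
  then show ?thesis using assms(1) by simp
qed

subsection \<open>Inner product\<close>

lemma cinner_abs_summable: "(\<lambda>i. cmod (cnj (Rep_ell2 x i) * Rep_ell2 y i)) summable_on A"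
proof (rule Infinite_Sum.abs_summable_on_comparison_test')
  show "(\<lambda>i. (cmod (Rep_ell2 x i))\<^sup>2 + (cmod (Rep_ell2 y i))\<^sup>2) summable_on A"
    by (intro summable_on_add) auto
  fix i
  have "2 * (cmod (Rep_ell2 x i) * cmod (Rep_ell2 y i)) \<le> (cmod (Rep_ell2 x i))\<^sup>2 + (cmod (Rep_ell2 y i))\<^sup>2"
    using sum_squares_bound[of "cmod (Rep_ell2 x i)" "cmod (Rep_ell2 y i)"] by (simp add: mult.assoc)
  moreover have "0 \<le> cmod (Rep_ell2 x i) * cmod (Rep_ell2 y i)" by simp
  ultimately show "norm (cnj (Rep_ell2 x i) * Rep_ell2 y i) \<le> (cmod (Rep_ell2 x i))\<^sup>2 + (cmod (Rep_ell2 y i))\<^sup>2"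
    unfolding norm_mult complex_mod_cnj by linarith
qed

lemma cinner_summable: "(\<lambda>i. cnj (Rep_ell2 x i) * Rep_ell2 y i) summable_on A"
  by (rule abs_summable_summable[OF cinner_abs_summable])

lemma cinner_add_left: "cinner (x + y) z = cinner x z + cinner y z"
  unfolding cinner_def by (simp add: distrib_right infsum_add cinner_summable)

lemma cinner_add_right: "cinner x (y + z) = cinner x y + cinner x z"
  unfolding cinner_def by (simp add: distrib_left infsum_add cinner_summable)

lemma cinner_scaleC_left: "cinner (scaleC c x) y = cnj c * cinner x y"
  unfolding cinner_def by (simp add: mult.assoc infsum_cmult_right')

lemma cinner_scaleC_right: "cinner x (scaleC c y) = c * cinner x y"
  unfolding cinner_def by (simp add: mult.left_commute infsum_cmult_right')

lemma cnj_cinner: "cnj (cinner x y) = cinner y x"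
  unfolding cinner_def infsum_cnj[symmetric] by (simp add: mult.commute)

lemma cinner_self: "cinner x x = of_real ((norm x)\<^sup>2)"
proof -
  have "((\<lambda>i. (cmod (Rep_ell2 x i))\<^sup>2) has_sum (norm x)\<^sup>2) UNIV"
    unfolding norm_ell2_sq by (rule has_sum_infsum) simp
  then have "((\<lambda>i. complex_of_real ((cmod (Rep_ell2 x i))\<^sup>2)) has_sum of_real ((norm x)\<^sup>2)) UNIV"
    by (rule has_sum_of_real)
  then show ?thesis
    unfolding cinner_def by (intro infsumI) (simp add: complex_norm_square[symmetric] mult.commute)
qed

lemma cinner_ket_left [simp]: "cinner (ket i) x = Rep_ell2 x i"
proof -
  have "cinner (ket i) x = (\<Sum>\<^sub>\<infinity>j\<in>{i}. Rep_ell2 x j)"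
    unfolding cinner_def by (rule infsum_cong_neutral) (auto simp: Rep_ket)
  then show ?thesis by simp
qed

lemma cinner_ket_right [simp]: "cinner x (ket i) = cnj (Rep_ell2 x i)"
  by (metis cinner_ket_left cnj_cinner)

lemma cinner_bound: "cmod (cinner x y) \<le> norm x * norm y"
proof -
  have "cmod (cinner x y) \<le> (\<Sum>\<^sub>\<infinity>i. cmod (cnj (Rep_ell2 x i) * Rep_ell2 y i))"
    unfolding cinner_def by (rule norm_infsum_bound[OF cinner_abs_summable])
  also have "\<dots> \<le> norm x * norm y"
  proof (rule infsum_le_finite_sums)
    fix F :: "'a set" assume F: "finite F"
    have "(\<Sum>i\<in>F. cmod (cnj (Rep_ell2 x i) * Rep_ell2 y i)) = (\<Sum>i\<in>F. \<bar>cmod (Rep_ell2 x i)\<bar> * \<bar>cmod (Rep_ell2 y i)\<bar>)"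
      by (simp add: norm_mult)
    also have "\<dots> \<le> L2_set (\<lambda>i. cmod (Rep_ell2 x i)) F * L2_set (\<lambda>i. cmod (Rep_ell2 y i)) F"
      by (rule L2_set_mult_ineq)
    also have "\<dots> \<le> norm x * norm y"
      using F by (intro mult_mono L2_le_norm) auto
    finally show "(\<Sum>i\<in>F. cmod (cnj (Rep_ell2 x i) * Rep_ell2 y i)) \<le> norm x * norm y" .
  qed (rule cinner_abs_summable)
  finally show ?thesis .
qed

lemma bounded_linear_cinner_right: "bounded_linear (\<lambda>y. cinner x y)"
proof (rule bounded_linear_intro)
  show "cmod (cinner x y) \<le> norm y * norm x" for y using cinner_bound[of x y] by (simp add: mult.commute)
  show "cinner x (r *\<^sub>R y) = r *\<^sub>R cinner x y" for r y
    by (simp add: scaleC_of_real[symmetric] cinner_scaleC_right scaleR_conv_of_real)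
qed (rule cinner_add_right)

lemma bounded_linear_cinner_left: "bounded_linear (\<lambda>x. cinner x y)"
proof (rule bounded_linear_intro)
  show "cmod (cinner x y) \<le> norm x * norm y" for x by (rule cinner_bound)
  show "cinner (r *\<^sub>R x) y = r *\<^sub>R cinner x y" for r x
    by (simp add: scaleC_of_real[symmetric] cinner_scaleC_left scaleR_conv_of_real)
qed (rule cinner_add_left)

lemmas cinner_diff_right = linear_diff[OF bounded_linear.linear[OF bounded_linear_cinner_right]]
lemmas cinner_sum_right = linear_sum[OF bounded_linear.linear[OF bounded_linear_cinner_right]]
lemmas cinner_sum_left = linear_sum[OF bounded_linear.linear[OF bounded_linear_cinner_left]]
lemma cinner_eqI:
  assumes "\<And>z. cinner z x = cinner z y" shows "x = y"
  using assms[of "ket _"] by (intro ell2_eqI) simp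

lemma norm_le_cinner:
  assumes "\<And>z. cmod (cinner z x) \<le> B * norm z" "B \<ge> 0" shows "norm x \<le> B"
proof (cases "x = 0")
  case False
  have "norm x * norm x \<le> B * norm x"
    using assms(1)[of x] by (simp add: cinner_self power2_eq_square norm_mult)
  then show ?thesis using False by simp
qed (use assms in simp)

subsection \<open>Bounded operators and adjoints\<close>

lemma bounded_opsI: "(\<And>c x. blinfun_apply T (scaleC c x) = scaleC c (blinfun_apply T x)) \<Longrightarrow> T \<in> bounded_ops"
  by (simp add: bounded_ops_def)

lemma bounded_opsD: "T \<in> bounded_ops \<Longrightarrow> blinfun_apply T (scaleC c x) = scaleC c (blinfun_apply T x)"
  by (simp add: bounded_ops_def)

lemma bounded_ops_add: "S \<in> bounded_ops \<Longrightarrow> T \<in> bounded_ops \<Longrightarrow> S + T \<in> bounded_ops"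
  by (simp add: bounded_ops_def blinfun.add_left scaleC_add_right)

lemma bounded_ops_zero [simp]: "0 \<in> bounded_ops"
  by (simp add: bounded_ops_def)

lemma bounded_ops_id [simp]: "id_blinfun \<in> bounded_ops"
  by (simp add: bounded_ops_def)

lemma bounded_ops_uminus: "S \<in> bounded_ops \<Longrightarrow> - S \<in> bounded_ops"
  by (simp add: bounded_ops_def blinfun.minus_left) (metis scaleC_minus_left scaleC_one scaleC_scaleC mult.commute)

lemma bounded_ops_diff: "S \<in> bounded_ops \<Longrightarrow> T \<in> bounded_ops \<Longrightarrow> S - T \<in> bounded_ops"
  using bounded_ops_add[of S "- T"] bounded_ops_uminus[of T] by simp

lemma bounded_ops_compose: "S \<in> bounded_ops \<Longrightarrow> T \<in> bounded_ops \<Longrightarrow> S o\<^sub>L T \<in> bounded_ops"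
  by (simp add: bounded_ops_def)

lemma bounded_ops_scaleC: "S \<in> bounded_ops \<Longrightarrow> scaleC_oper c S \<in> bounded_ops"
  by (simp add: bounded_ops_def scaleC_oper_apply mult.commute)

lemma bounded_ops_sum: "(\<And>i. i \<in> F \<Longrightarrow> f i \<in> bounded_ops) \<Longrightarrow> sum f F \<in> bounded_ops"
  by (induction F rule: infinite_finite_induct) (auto intro: bounded_ops_add)

lemma closed_bounded_ops: "closed bounded_ops"
proof -
  have "closed {T :: 'a oper. blinfun_apply T (scaleC c x) = scaleC c (blinfun_apply T x)}" for c x
  proof (rule closed_Collect_eq)
    show "continuous_on UNIV (\<lambda>T :: 'a oper. scaleC c (blinfun_apply T x))"
      by (intro bounded_linear.continuous_on[OF bounded_linear_scaleC] continuous_intros)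
  qed (intro continuous_intros)
  then have "closed (\<Inter>c x. {T :: 'a oper. blinfun_apply T (scaleC c x) = scaleC c (blinfun_apply T x)})"
    by blast
  then show ?thesis by (simp add: bounded_ops_def INTER_eq Inter_eq) 
qed

lemma scaleC_oper_of_real: "scaleC_oper (of_real r) T = r *\<^sub>R T"
  by (rule blinfun_eqI) (simp add: scaleC_oper_apply scaleC_of_real blinfun.scaleR_left)

lemma scaleC_oper_add_right: "scaleC_oper c (S + T) = scaleC_oper c S + scaleC_oper c T"
  by (rule blinfun_eqI) (simp add: scaleC_oper_apply blinfun.add_left scaleC_add_right)

lemma scaleC_oper_diff_right: "scaleC_oper c (S - T) = scaleC_oper c S - scaleC_oper c T"
  by (rule blinfun_eqI) (simp add: scaleC_oper_apply blinfun.diff_left scaleC_diff_right)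

lemma scaleC_oper_add_left: "scaleC_oper (c + d) S = scaleC_oper c S + scaleC_oper d S"
  by (rule blinfun_eqI) (simp add: scaleC_oper_apply blinfun.add_left scaleC_add_left)

lemma scaleC_oper_scaleC_oper [simp]: "scaleC_oper c (scaleC_oper d S) = scaleC_oper (c * d) S"
  by (rule blinfun_eqI) (simp add: scaleC_oper_apply)

lemma scaleC_oper_one [simp]: "scaleC_oper 1 S = S"
  by (rule blinfun_eqI) (simp add: scaleC_oper_apply)

lemma scaleC_oper_zero [simp]: "scaleC_oper c 0 = 0"
  by (rule blinfun_eqI) (simp add: scaleC_oper_apply)

lemma scaleC_oper_zero_left [simp]: "scaleC_oper 0 S = 0"
  by (rule blinfun_eqI) (simp add: scaleC_oper_apply)

lemma scaleC_oper_minus_one: "scaleC_oper (- 1) S = - S"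
  by (rule blinfun_eqI) (simp add: scaleC_oper_apply blinfun.minus_left)

lemma scaleC_oper_minus_left: "scaleC_oper (- c) S = - scaleC_oper c S"
  by (rule blinfun_eqI) (simp add: scaleC_oper_apply blinfun.minus_left)

lemma scaleC_oper_sum: "scaleC_oper c (sum f F) = (\<Sum>i\<in>F. scaleC_oper c (f i))"
  by (induction F rule: infinite_finite_induct) (auto simp: scaleC_oper_add_right)

lemma scaleC_oper_compose_left: "scaleC_oper c S o\<^sub>L T = scaleC_oper c (S o\<^sub>L T)"
  by (rule blinfun_eqI) (simp add: scaleC_oper_apply)

lemma scaleC_oper_compose_right: "S \<in> bounded_ops \<Longrightarrow> S o\<^sub>L scaleC_oper c T = scaleC_oper c (S o\<^sub>L T)"
  by (rule blinfun_eqI) (simp add: scaleC_oper_apply bounded_opsD)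

lemma norm_scaleC_oper: "norm (scaleC_oper c T) = cmod c * norm T"
proof -
  have le: "norm (scaleC_oper c T) \<le> cmod c * norm T" for c and T :: "'a oper"
  proof (rule norm_blinfun_bound)
    fix x
    have "cmod c * norm (blinfun_apply T x) \<le> cmod c * (norm T * norm x)"
      by (intro mult_left_mono norm_blinfun) auto
    then show "norm (blinfun_apply (scaleC_oper c T) x) \<le> cmod c * norm T * norm x"
      by (simp add: scaleC_oper_apply norm_scaleC mult.assoc)
  qed auto
  show ?thesis
  proof (cases "c = 0")
    case False
    have "norm T = norm (scaleC_oper (inverse c) (scaleC_oper c T))" using False by simp
    also have "\<dots> \<le> cmod (inverse c) * norm (scaleC_oper c T)" by (rule le)
    finally have "cmod c * norm T \<le> norm (scaleC_oper c T)" using False by (simp add: norm_inverse norm_divide field_simps)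
    with le[of c T] show ?thesis by simp
  qed simp
qed

lemma bounded_ops_eqI:
  assumes "S \<in> bounded_ops" "T \<in> bounded_ops" "\<And>i. blinfun_apply S (ket i) = blinfun_apply T (ket i)"
  shows "S = T"
proof (rule blinfun_eqI)
  fix x
  have "closed {x. blinfun_apply S x = blinfun_apply T x}" by (intro closed_Collect_eq continuous_intros)
  then show "blinfun_apply S x = blinfun_apply T x"
    by (induction x rule: ell2_induct) (use assms in \<open>auto simp: blinfun.add_right bounded_opsD\<close>)
qed

text \<open>The i-th coordinate of the adjoint at \<open>y\<close> has to be the inner product
  \<open>c i\<close> of \<open>T (ket i)\<close> with \<open>y\<close>. These are square-summable
  because testing \<open>T\<close> on the truncated vector \<open>u\<close> with coordinates
  \<open>c i\<close> gives \<open>?L^2 = <T u, y>\<close>, which is at most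
  \<open>norm T * ?L * norm y\<close>, and one factor \<open>?L\<close> cancels.\<close>

lemma adjoint_exists:
  assumes T: "T \<in> bounded_ops"
  shows "\<exists>S\<in>bounded_ops. \<forall>x y. cinner (blinfun_apply S x) y = cinner x (blinfun_apply T y)"
proof -
  define f where "f y = Abs_ell2 (\<lambda>i. cinner (blinfun_apply T (ket i)) y)" for y
  have L2: "L2_set (\<lambda>i. cmod (cinner (blinfun_apply T (ket i)) y)) F \<le> norm T * norm y" if F: "finite F" for y F
  proof -
    define c where "c i = cinner (blinfun_apply T (ket i)) y" for i
    define u where "u = (\<Sum>i\<in>F. scaleC (c i) (ket i))"
    let ?L = "L2_set (\<lambda>i. cmod (c i)) F"
    have u: "Rep_ell2 u i = (if i \<in> F then c i else 0)" for i
      unfolding u_def using F by (simp add: Rep_ket if_distrib cong: if_cong)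
    have "norm u \<le> ?L"
    proof (rule norm_ell2_le)
      fix G :: "'a set" assume "finite G"
      have "L2_set (\<lambda>i. cmod (Rep_ell2 u i)) G \<le> L2_set (\<lambda>i. cmod (Rep_ell2 u i)) (G \<union> F)"
        unfolding L2_set_def using \<open>finite G\<close> F by (intro real_sqrt_le_mono sum_mono2) auto
      also have "\<dots> = ?L" unfolding L2_set_def u using \<open>finite G\<close> F
        by (intro arg_cong[where f=sqrt] sum.mono_neutral_cong_right) auto
      finally show "L2_set (\<lambda>i. cmod (Rep_ell2 u i)) G \<le> ?L" .
    qed
    have "of_real (?L\<^sup>2) = (\<Sum>i\<in>F. cnj (c i) * c i)"
      by (simp add: L2_set_def sum_nonneg complex_norm_square[symmetric] mult.commute)
    also have "\<dots> = cinner (blinfun_apply T u) y"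
      unfolding u_def by (simp add: blinfun.sum_right bounded_opsD[OF T] cinner_sum_left cinner_scaleC_left c_def)
    finally have "?L\<^sup>2 \<le> norm (blinfun_apply T u) * norm y"
      using cinner_bound[of "blinfun_apply T u" y] by (metis abs_power2 norm_of_real)
    also have "\<dots> \<le> (norm T * norm u) * norm y" by (intro mult_right_mono norm_blinfun) auto
    also have "\<dots> \<le> (norm T * ?L) * norm y" using \<open>norm u \<le> ?L\<close> by (intro mult_right_mono mult_left_mono) auto
    finally have "?L * ?L \<le> (norm T * norm y) * ?L" by (simp add: power2_eq_square mult_ac)
    moreover have "0 \<le> ?L" "0 \<le> norm T * norm y" by auto
    ultimately have "?L \<le> norm T * norm y" by (metis mult_le_cancel_right order_le_less)
    then show ?thesis by (simp add: c_def)
  qed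
  have f: "Rep_ell2 (f y) i = cinner (blinfun_apply T (ket i)) y" "norm (f y) \<le> norm y * norm T" for y i
    using Abs_ell2_bound[OF L2] by (simp_all add: f_def mult.commute)
  have "bounded_linear f"
    by (rule bounded_linear_intro[OF _ _ f(2)])
      (auto intro!: ell2_eqI simp: f(1) cinner_add_right cinner_scaleC_right scaleC_of_real[symmetric])
  then have Bf: "blinfun_apply (Blinfun f) = f" by (simp add: bounded_linear_Blinfun_apply)
  have "cinner (f x) y = cinner x (blinfun_apply T y)" for x y
  proof -
    have "closed {y. cinner (f x) y = cinner x (blinfun_apply T y)}"
      by (intro closed_Collect_eq bounded_linear.continuous_on[OF bounded_linear_cinner_right] continuous_intros)
    then show ?thesis
      by (induction y rule: ell2_induct)
        (auto simp: f cnj_cinner cinner_add_right blinfun.add_right cinner_scaleC_right bounded_opsD[OF T])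
  qed
  moreover have "Blinfun f \<in> bounded_ops"
    by (intro bounded_opsI ell2_eqI) (simp add: Bf f cinner_scaleC_right)
  ultimately show ?thesis by (intro bexI[of _ "Blinfun f"]) (auto simp: Bf)
qed

lemma adjoint_unique:
  assumes "S \<in> bounded_ops" "\<And>x y. cinner (blinfun_apply S x) y = cinner x (blinfun_apply T y)"
  shows "adjoint_oper T = S"
  unfolding adjoint_oper_def
proof (rule the_equality)
  fix S' assume S': "S' \<in> bounded_ops \<and> (\<forall>x y. cinner (blinfun_apply S' x) y = cinner x (blinfun_apply T y))"
  show "S' = S"
    by (intro blinfun_eqI cinner_eqI) (metis S' assms(2) cnj_cinner)
qed (use assms in blast)

lemma adjoint_bounded_ops: "T \<in> bounded_ops \<Longrightarrow> adjoint_oper T \<in> bounded_ops"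
  using adjoint_exists[of T] adjoint_unique by metis

lemma cinner_adjoint_left: "T \<in> bounded_ops \<Longrightarrow> cinner (blinfun_apply (adjoint_oper T) x) y = cinner x (blinfun_apply T y)"
  using adjoint_exists[of T] adjoint_unique by metis

lemma cinner_adjoint_right: "T \<in> bounded_ops \<Longrightarrow> cinner x (blinfun_apply (adjoint_oper T) y) = cinner (blinfun_apply T x) y"
  by (metis cinner_adjoint_left cnj_cinner)

lemma adjoint_adjoint: "T \<in> bounded_ops \<Longrightarrow> adjoint_oper (adjoint_oper T) = T"
  by (rule adjoint_unique) (auto simp: cinner_adjoint_right)

lemma adjoint_add:
  "S \<in> bounded_ops \<Longrightarrow> T \<in> bounded_ops \<Longrightarrow> adjoint_oper (S + T) = adjoint_oper S + adjoint_oper T"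
  by (rule adjoint_unique)
    (auto simp: bounded_ops_add adjoint_bounded_ops cinner_adjoint_left blinfun.add_left cinner_add_left cinner_add_right)

lemma adjoint_compose:
  "S \<in> bounded_ops \<Longrightarrow> T \<in> bounded_ops \<Longrightarrow> adjoint_oper (S o\<^sub>L T) = adjoint_oper T o\<^sub>L adjoint_oper S"
  by (rule adjoint_unique) (auto simp: bounded_ops_compose adjoint_bounded_ops cinner_adjoint_left)

lemma adjoint_scaleC:
  "S \<in> bounded_ops \<Longrightarrow> adjoint_oper (scaleC_oper c S) = scaleC_oper (cnj c) (adjoint_oper S)"
  by (rule adjoint_unique)
    (auto simp: bounded_ops_scaleC adjoint_bounded_ops cinner_adjoint_left scaleC_oper_apply cinner_scaleC_left cinner_scaleC_right)

lemma adjoint_id [simp]: "adjoint_oper id_blinfun = id_blinfun"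
  by (rule adjoint_unique) auto

lemma adjoint_zero [simp]: "adjoint_oper 0 = 0"
  by (rule adjoint_unique) (auto simp: cinner_def)

lemma adjoint_diff:
  assumes "S \<in> bounded_ops" "T \<in> bounded_ops"
  shows "adjoint_oper (S - T) = adjoint_oper S - adjoint_oper T"
  using adjoint_add[of "S - T" T] bounded_ops_diff[of S T] assms by (simp add: algebra_simps)

text \<open>Cauchy-Schwarz bounds the square of \<open>norm T\<close> by the norm of the adjoint
  times \<open>T\<close>, hence by the product of both norms. So \<open>T\<close> has at most the
  norm of its adjoint, and exchanging the two gives equality.\<close>

lemma norm_cstar: assumes T: "T \<in> bounded_ops" shows "norm (adjoint_oper T o\<^sub>L T) = (norm T)\<^sup>2"
  and norm_adjoint: "norm (adjoint_oper T) = norm T"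
proof -
  have sq: "(norm T)\<^sup>2 \<le> norm (adjoint_oper T o\<^sub>L T)" if T: "T \<in> bounded_ops" for T :: "'a oper"
  proof -
    let ?N = "norm (adjoint_oper T o\<^sub>L T)"
    have "norm T \<le> sqrt ?N"
    proof (rule norm_blinfun_bound)
      fix x
      have "cinner (blinfun_apply T x) (blinfun_apply T x) = cinner (blinfun_apply (adjoint_oper T o\<^sub>L T) x) x"
        by (simp add: cinner_adjoint_left T)
      then have "(norm (blinfun_apply T x))\<^sup>2 = cmod (cinner (blinfun_apply (adjoint_oper T o\<^sub>L T) x) x)"
        by (metis cinner_self abs_power2 norm_of_real)
      also have "\<dots> \<le> norm (blinfun_apply (adjoint_oper T o\<^sub>L T) x) * norm x" by (rule cinner_bound)
      also have "\<dots> \<le> ?N * norm x * norm x" by (intro mult_right_mono norm_blinfun) auto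
      also have "\<dots> = (sqrt ?N * norm x)\<^sup>2" by (simp add: power_mult_distrib power2_eq_square)
      finally show "norm (blinfun_apply T x) \<le> sqrt ?N * norm x"
        by (rule power2_le_imp_le) auto
    qed auto
    then show ?thesis by (simp add: real_le_rsqrt sqrt_ge_absD)
  qed
  have up: "norm (adjoint_oper T o\<^sub>L T) \<le> norm (adjoint_oper T) * norm T" for T :: "'a oper"
    by (rule norm_blinfun_compose)
  have le: "norm T \<le> norm (adjoint_oper T)" if "T \<in> bounded_ops" for T :: "'a oper"
  proof (cases "T = 0")
    case False
    have "norm T * norm T \<le> norm (adjoint_oper T) * norm T"
      using sq[OF that] up[of T] by (simp add: power2_eq_square)
    then show ?thesis using False by simp
  qed simp
  show *: "norm (adjoint_oper T) = norm T"
    using le[OF T] le[OF adjoint_bounded_ops[OF T]] by (simp add: adjoint_adjoint T)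
  show "norm (adjoint_oper T o\<^sub>L T) = (norm T)\<^sup>2"
    using sq[OF T] up[of T] * by (simp add: power2_eq_square)
qed

lemma oper_alg_simps [simp]: "carrier oper_alg = bounded_ops" "monoid.mult oper_alg = (o\<^sub>L)"
  "one oper_alg = id_blinfun" "zero oper_alg = 0" "add oper_alg = (+)" "smult oper_alg = scaleC_oper"
  "star oper_alg = adjoint_oper"
  by (simp_all add: oper_alg_def)

lemma blinfun_compose_id [simp]: "id_blinfun o\<^sub>L T = T" "T o\<^sub>L id_blinfun = T"
  by (rule blinfun_eqI, simp)+

subsection \<open>Coordinate permutations and translations\<close>

text \<open>Coordinates are pulled back along \<open>\<pi>\<close>, so basis vectors move by the
  inverse of \<open>\<pi>\<close> and composition is reversed. Left and right translations, the flip
  by inversion and the diagonal translations of pairs all have this form, so that a single norm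
  estimate can treat sums of them.\<close>

definition reindex :: "('i \<Rightarrow> 'i) \<Rightarrow> 'i oper" where
  "reindex \<pi> = Blinfun (\<lambda>x. Abs_ell2 (\<lambda>i. Rep_ell2 x (\<pi> i)))"

lemma Rep_reindex:
  assumes "inj \<pi>"
  shows "Rep_ell2 (blinfun_apply (reindex \<pi>) x) i = Rep_ell2 x (\<pi> i)"
    and "norm (blinfun_apply (reindex \<pi>) x) \<le> norm x"
proof -
  have L2: "L2_set (\<lambda>i. cmod (Rep_ell2 x (\<pi> i))) F \<le> norm x" if "finite F" for F and x
  proof -
    have "L2_set (\<lambda>i. cmod (Rep_ell2 x (\<pi> i))) F = L2_set (\<lambda>i. cmod (Rep_ell2 x i)) (\<pi> ` F)"
      unfolding L2_set_def using assms by (subst sum.reindex) (auto intro: inj_on_subset)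
    also have "\<dots> \<le> norm x" using that by (intro L2_le_norm) auto
    finally show ?thesis .
  qed
  define f where "f x = Abs_ell2 (\<lambda>i. Rep_ell2 x (\<pi> i))" for x
  have f: "Rep_ell2 (f x) = (\<lambda>i. Rep_ell2 x (\<pi> i))" "norm (f x) \<le> norm x * 1" for x
    using Abs_ell2_bound[of "\<lambda>i. Rep_ell2 x (\<pi> i)", OF L2] by (simp_all add: f_def)
  have "bounded_linear f"
    by (rule bounded_linear_intro[OF _ _ f(2)]) (auto intro!: ell2_eqI simp: f(1))
  then have "blinfun_apply (reindex \<pi>) = f"
    unfolding reindex_def f_def[symmetric] by (simp add: bounded_linear_Blinfun_apply)
  with f show "Rep_ell2 (blinfun_apply (reindex \<pi>) x) i = Rep_ell2 x (\<pi> i)"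
    "norm (blinfun_apply (reindex \<pi>) x) \<le> norm x" by simp_all
qed

lemma norm_reindex: "inj \<pi> \<Longrightarrow> norm (reindex \<pi>) \<le> 1"
  by (rule norm_blinfun_bound) (auto simp: Rep_reindex)

lemma reindex_bounded_ops: "inj \<pi> \<Longrightarrow> reindex \<pi> \<in> bounded_ops"
  by (intro bounded_opsI ell2_eqI) (simp add: Rep_reindex)

lemma reindex_ket: "inj \<pi> \<Longrightarrow> blinfun_apply (reindex \<pi>) (ket (\<pi> i)) = ket i"
  by (rule ell2_eqI) (auto simp: Rep_reindex Rep_ket inj_eq)

lemma reindex_compose: "inj \<pi> \<Longrightarrow> inj \<sigma> \<Longrightarrow> reindex \<pi> o\<^sub>L reindex \<sigma> = reindex (\<sigma> \<circ> \<pi>)"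
  by (intro blinfun_eqI ell2_eqI) (simp add: Rep_reindex inj_compose)

lemma reindex_id: "reindex (\<lambda>x. x) = id_blinfun"
  by (intro blinfun_eqI ell2_eqI) (simp add: Rep_reindex)

lemma adjoint_reindex:
  assumes "\<And>i. \<pi> (\<sigma> i) = i" "\<And>i. \<sigma> (\<pi> i) = i"
  shows "adjoint_oper (reindex \<pi>) = reindex \<sigma>"
proof (rule adjoint_unique)
  have inj: "inj \<pi>" "inj \<sigma>" using assms by (metis injI)+
  show "reindex \<sigma> \<in> bounded_ops" using inj by (simp add: reindex_bounded_ops)
  have bij: "bij \<pi>" using assms by (metis bijI')
  show "cinner (blinfun_apply (reindex \<sigma>) x) y = cinner x (blinfun_apply (reindex \<pi>) y)" for x y
    unfolding cinner_def using infsum_reindex_bij_betw[of \<pi> UNIV UNIV "\<lambda>i. cnj (Rep_ell2 x (\<sigma> i)) * Rep_ell2 y i"] bij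
    by (simp add: Rep_reindex inj assms)
qed

section \<open>Group laws of the free group and its translation unitaries\<close>

lemma free2_right_inverse: "g * inverse g = 1" for g :: free2
  by (metis free2_left_inverse mult.assoc mult_1)

lemma free2_inverse_cancel [simp]: "inverse g * (g * h) = h" "g * (inverse g * h) = h"
  "h * g * inverse g = h" "h * inverse g * g = h" for g h :: free2
  by (simp_all add: mult.assoc free2_left_inverse free2_right_inverse)
    (simp_all add: mult.assoc[symmetric] free2_left_inverse free2_right_inverse)

lemma free2_inverse_inverse [simp]: "inverse (inverse g) = g" for g :: free2
  by (metis free2_inverse_cancel(1) free2_left_inverse mult_1_right)

lemma free2_inverse_mult: "inverse (g * h) = inverse h * inverse g" for g h :: free2
  by (metis free2_inverse_cancel(1,2) free2_right_inverse mult.assoc mult_1_right)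

lemma free2_inverse_one [simp]: "inverse (1 :: free2) = 1"
  by (metis free2_left_inverse mult_1_right)

lemma inj_translations: "inj (\<lambda>h :: free2. g * h)" "inj (\<lambda>h :: free2. h * g)"
  by (metis free2_inverse_cancel(1) injI, metis free2_inverse_cancel(3) injI)

lemma left_translation_reindex: "left_translation g = reindex (\<lambda>h. inverse g * h)"
  unfolding left_translation_def oper_on_basis_def
proof (rule the_equality)
  let ?T = "reindex (\<lambda>h. inverse g * h)"
  have T: "?T \<in> bounded_ops" "blinfun_apply ?T (ket h) = ket (g * h)" for h
    using reindex_ket[OF inj_translations(1), of "inverse g" "g * h"]
    by (simp_all add: reindex_bounded_ops inj_translations)
  then show "?T \<in> bounded_ops \<and> (\<forall>h. blinfun_apply ?T (ket h) = ket (g * h))" by blast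
  show "T = ?T" if "T \<in> bounded_ops \<and> (\<forall>h. blinfun_apply T (ket h) = ket (g * h))" for T
    using that T by (intro bounded_ops_eqI) auto
qed

lemma right_translation_reindex: "right_translation g = reindex (\<lambda>h. h * g)"
  unfolding right_translation_def oper_on_basis_def
proof (rule the_equality)
  let ?T = "reindex (\<lambda>h. h * g)"
  have T: "?T \<in> bounded_ops" "blinfun_apply ?T (ket h) = ket (h * inverse g)" for h
    using reindex_ket[OF inj_translations(2), of g "h * inverse g"]
    by (simp_all add: reindex_bounded_ops inj_translations)
  then show "?T \<in> bounded_ops \<and> (\<forall>h. blinfun_apply ?T (ket h) = ket (h * inverse g))" by blast
  show "T = ?T" if "T \<in> bounded_ops \<and> (\<forall>h. blinfun_apply T (ket h) = ket (h * inverse g))" for T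
    using that T by (intro bounded_ops_eqI) auto
qed

lemma left_translation_bounded_ops: "left_translation g \<in> bounded_ops"
  by (simp add: left_translation_reindex reindex_bounded_ops inj_translations)

lemma right_translation_bounded_ops: "right_translation g \<in> bounded_ops"
  by (simp add: right_translation_reindex reindex_bounded_ops inj_translations)

lemma Rep_left_translation: "Rep_ell2 (blinfun_apply (left_translation g) x) h = Rep_ell2 x (inverse g * h)"
  by (simp add: left_translation_reindex Rep_reindex inj_translations)

lemma Rep_right_translation: "Rep_ell2 (blinfun_apply (right_translation g) x) h = Rep_ell2 x (h * g)"
  by (simp add: right_translation_reindex Rep_reindex inj_translations)

lemma left_translation_ket: "blinfun_apply (left_translation g) (ket h) = ket (g * h)"
  using reindex_ket[OF inj_translations(1), of "inverse g" "g * h"] by (simp add: left_translation_reindex)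

lemma right_translation_ket: "blinfun_apply (right_translation g) (ket h) = ket (h * inverse g)"
  using reindex_ket[OF inj_translations(2), of g "h * inverse g"] by (simp add: right_translation_reindex)

lemma right_translation_mult: "right_translation g o\<^sub>L right_translation h = right_translation (g * h)"
  by (intro blinfun_eqI ell2_eqI) (simp add: Rep_right_translation mult.assoc)

lemma left_translation_one: "left_translation 1 = id_blinfun"
  by (intro blinfun_eqI ell2_eqI) (simp add: Rep_left_translation)

lemma right_translation_one: "right_translation 1 = id_blinfun"
  by (intro blinfun_eqI ell2_eqI) (simp add: Rep_right_translation)

lemma left_right_commute: "left_translation g o\<^sub>L right_translation h = right_translation h o\<^sub>L left_translation g"
  by (intro blinfun_eqI ell2_eqI) (simp add: Rep_left_translation Rep_right_translation mult.assoc)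

lemma adjoint_left_translation: "adjoint_oper (left_translation g) = left_translation (inverse g)"
  unfolding left_translation_reindex by (rule adjoint_reindex) auto

lemma adjoint_right_translation: "adjoint_oper (right_translation g) = right_translation (inverse g)"
  unfolding right_translation_reindex by (rule adjoint_reindex) auto

lemma norm_right_translation: "norm (blinfun_apply (right_translation g) x) \<le> norm x"
  by (simp add: right_translation_reindex Rep_reindex inj_translations)

lemma cinner_right_translation:
  "cinner (blinfun_apply (right_translation g) x) (blinfun_apply (right_translation g) y) = cinner x y"
  using cinner_adjoint_left[OF right_translation_bounded_ops, of "inverse g" x y]
    cinner_adjoint_right[OF right_translation_bounded_ops, of x g "blinfun_apply (right_translation g) y"]
  by (simp add: adjoint_right_translation blinfun_apply_blinfun_compose[symmetric]
      right_translation_mult free2_left_inverse right_translation_one del: blinfun_apply_blinfun_compose)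

subsection \<open>Compact operators\<close>

lemma compact_ops_bounded: "T \<in> compact_ops \<Longrightarrow> T \<in> bounded_ops"
  by (simp add: compact_ops_def)

lemma compact_opsI:
  assumes "T \<in> bounded_ops" "compact K" "blinfun_apply T ` cball 0 1 \<subseteq> K"
  shows "T \<in> compact_ops"
proof -
  have "closure (blinfun_apply T ` cball 0 1) \<subseteq> K"
    using assms compact_imp_closed closure_minimal by blast
  then have "closure (blinfun_apply T ` cball 0 1) = K \<inter> closure (blinfun_apply T ` cball 0 1)" by auto
  then have "compact (closure (blinfun_apply T ` cball 0 1))"
    using compact_Int_closed[OF assms(2) closed_closure] by metis
  then show ?thesis using assms by (simp add: compact_ops_def)
qed

lemma compact_ops_image: "T \<in> compact_ops \<Longrightarrow> norm x \<le> 1 \<Longrightarrow> blinfun_apply T x \<in> closure (blinfun_apply T ` cball 0 1)"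
  by (rule closure_subset[THEN subsetD]) auto

lemma compact_ops_add:
  assumes "S \<in> compact_ops" "T \<in> compact_ops" shows "S + T \<in> compact_ops"
proof (rule compact_opsI)
  let ?c = "\<lambda>T. closure (blinfun_apply T ` cball 0 1)"
  show "S + T \<in> bounded_ops" using assms by (simp add: compact_ops_bounded bounded_ops_add)
  show "compact {x + y | x y. x \<in> ?c S \<and> y \<in> ?c T}"
    using assms by (intro compact_sums) (auto simp: compact_ops_def)
  show "blinfun_apply (S + T) ` cball 0 1 \<subseteq> {x + y | x y. x \<in> ?c S \<and> y \<in> ?c T}"
    using assms by (auto simp: blinfun.add_left intro!: exI compact_ops_image)
qed

lemma compact_ops_compose_left:
  assumes "S \<in> bounded_ops" "T \<in> compact_ops" shows "S o\<^sub>L T \<in> compact_ops"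
proof (rule compact_opsI)
  let ?c = "closure (blinfun_apply T ` cball 0 1)"
  show "S o\<^sub>L T \<in> bounded_ops" using assms by (simp add: compact_ops_bounded bounded_ops_compose)
  show "compact (blinfun_apply S ` ?c)"
    using assms by (intro compact_continuous_image) (auto simp: compact_ops_def intro: continuous_intros)
  show "blinfun_apply (S o\<^sub>L T) ` cball 0 1 \<subseteq> blinfun_apply S ` ?c"
    using assms by (auto intro!: imageI compact_ops_image)
qed

lemma compact_ops_compose_right:
  assumes "S \<in> compact_ops" "T \<in> bounded_ops" shows "S o\<^sub>L T \<in> compact_ops"
proof (rule compact_opsI)
  \<comment> \<open>The image of the unit ball under \<open>T\<close> lies in the ball of radius
    \<open>?r\<close>; the \<open>+ 1\<close> keeps \<open>?r\<close> invertible for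
    \<open>T = 0\<close>.\<close>
  let ?c = "closure (blinfun_apply S ` cball 0 1)" and ?r = "norm T + 1"
  show "S o\<^sub>L T \<in> bounded_ops" using assms by (simp add: compact_ops_bounded bounded_ops_compose)
  show "compact ((\<lambda>x. ?r *\<^sub>R x) ` ?c)"
    using assms by (intro compact_continuous_image) (auto simp: compact_ops_def intro: continuous_intros)
  show "blinfun_apply (S o\<^sub>L T) ` cball 0 1 \<subseteq> (\<lambda>x. ?r *\<^sub>R x) ` ?c"
  proof safe
    fix x :: "'a ell2" assume "x \<in> cball 0 1"
    then have "norm x \<le> 1" by simp
    have r: "?r > 0" by (smt (verit) norm_ge_zero)
    have "norm (blinfun_apply T x) \<le> norm T * norm x" by (rule norm_blinfun)
    also have "\<dots> \<le> norm T * 1" by (intro mult_left_mono \<open>norm x \<le> 1\<close>) auto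
    also have "\<dots> \<le> ?r" by simp
    finally have "norm (inverse ?r *\<^sub>R blinfun_apply T x) \<le> 1"
      using r by (simp add: field_simps)
    then have "blinfun_apply S (inverse ?r *\<^sub>R blinfun_apply T x) \<in> ?c" by (rule compact_ops_image[OF assms(1)])
    moreover have "blinfun_apply (S o\<^sub>L T) x = ?r *\<^sub>R blinfun_apply S (inverse ?r *\<^sub>R blinfun_apply T x)"
      using r by (simp add: blinfun.scaleR_right)
    ultimately show "blinfun_apply (S o\<^sub>L T) x \<in> (\<lambda>x. ?r *\<^sub>R x) ` ?c" by blast
  qed
qed

lemma compact_ops_zero [simp]: "0 \<in> compact_ops"
  by (rule compact_opsI[of _ "{0}"]) auto

lemma compact_ops_scaleC: "T \<in> compact_ops \<Longrightarrow> scaleC_oper c T \<in> compact_ops"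
  using compact_ops_compose_left[of "scaleC_oper c id_blinfun" T]
  by (simp add: bounded_ops_scaleC scaleC_oper_compose_left)

lemma compact_ops_uminus: "T \<in> compact_ops \<Longrightarrow> - T \<in> compact_ops"
  using compact_ops_scaleC[of T "- 1"] by (simp add: scaleC_oper_minus_one)

lemma compact_ops_diff: "S \<in> compact_ops \<Longrightarrow> T \<in> compact_ops \<Longrightarrow> S - T \<in> compact_ops"
  using compact_ops_add[of S "- T"] compact_ops_uminus[of T] by simp

lemma compact_ops_sum: "(\<And>i. i \<in> F \<Longrightarrow> f i \<in> compact_ops) \<Longrightarrow> sum f F \<in> compact_ops"
  by (induction F rule: infinite_finite_induct) (auto intro: compact_ops_add)

lemma norm_blinfun_unit_bound:
  assumes "\<And>x. norm x \<le> 1 \<Longrightarrow> norm (blinfun_apply T x) \<le> b" "0 \<le> b"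
  shows "norm T \<le> b"
proof (rule norm_blinfun_bound[OF \<open>0 \<le> b\<close>])
  fix x
  show "norm (blinfun_apply T x) \<le> b * norm x"
  proof (cases "x = 0")
    case False
    then have "norm (blinfun_apply T (inverse (norm x) *\<^sub>R x)) \<le> b" by (intro assms) simp
    then show ?thesis using False by (simp add: blinfun.scaleR_right field_simps)
  qed simp
qed

text \<open>A finite net for the image under a close operator \<open>S\<close> is a slightly coarser
  net for the image under \<open>T\<close>, so total boundedness passes to norm limits.\<close>

lemma compact_ops_limit:
  assumes "T \<in> bounded_ops" "\<And>e. e > 0 \<Longrightarrow> \<exists>S\<in>compact_ops. norm (T - S) \<le> e"
  shows "T \<in> compact_ops"
proof -
  let ?c = "\<lambda>T. closure (blinfun_apply T ` cball 0 1)"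
  have "\<exists>N. finite N \<and> ?c T \<subseteq> (\<Union>x\<in>N. ball x e)" if "e > 0" for e
  proof -
    obtain S where S: "S \<in> compact_ops" "norm (T - S) \<le> e/3" using assms(2)[of "e/3"] \<open>e > 0\<close> by auto
    then obtain N where N: "finite N" "?c S \<subseteq> (\<Union>x\<in>N. ball x (e/3))"
      using \<open>e > 0\<close> unfolding compact_ops_def compact_eq_totally_bounded by (fastforce dest: spec[of _ "e/3"])
    \<comment> \<open>Closed balls of radius \<open>2*e/3\<close> are used so that the inclusion
      extends to the closure; only afterwards are they enlarged to open balls of radius
      \<open>e\<close>.\<close>
    have "blinfun_apply T ` cball 0 1 \<subseteq> (\<Union>x\<in>N. cball x (2*e/3))"
    proof safe
      fix x :: "'a ell2" assume "x \<in> cball 0 1"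
      then have x: "norm x \<le> 1" by simp
      then obtain y where y: "y \<in> N" "dist y (blinfun_apply S x) < e/3"
        using N(2) compact_ops_image[OF S(1)] by fastforce
      have "norm (blinfun_apply (T - S) x) \<le> norm (T - S) * norm x" by (rule norm_blinfun)
      also have "\<dots> \<le> e/3 * 1" using S x that by (intro mult_mono) auto
      finally have "dist (blinfun_apply S x) (blinfun_apply T x) \<le> e/3"
        by (simp add: dist_norm blinfun.diff_left norm_minus_commute)
      then have "dist y (blinfun_apply T x) \<le> 2*e/3"
        using y(2) dist_triangle[of y "blinfun_apply T x" "blinfun_apply S x"] by simp
      then show "blinfun_apply T x \<in> (\<Union>x\<in>N. cball x (2*e/3))" using y(1) by auto
    qed
    then have "?c T \<subseteq> (\<Union>x\<in>N. cball x (2*e/3))"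
      by (rule closure_minimal) (use N in auto)
    also have "\<dots> \<subseteq> (\<Union>x\<in>N. ball x e)" using that by (force simp: subset_iff)
    finally show ?thesis using N by blast
  qed
  moreover have "complete (?c T)" by (simp add: complete_eq_closed)
  ultimately have "compact (?c T)" by (simp add: compact_eq_totally_bounded)
  then show ?thesis using assms by (simp add: compact_ops_def)
qed

section \<open>Finite-rank projections and the approximation of compact operators\<close>

lemma Rep_basis_proj: "Rep_ell2 (blinfun_apply (basis_proj i) x) j = (if j = i then Rep_ell2 x i else 0)"
  by (simp add: basis_proj_apply Rep_ket)

lemma basis_proj_bounded: "basis_proj i \<in> bounded_ops"
  by (intro bounded_opsI ell2_eqI) (simp add: Rep_basis_proj)

lemma basis_proj_compact: "basis_proj i \<in> compact_ops"
proof (rule compact_opsI[OF basis_proj_bounded])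
  let ?f = "\<lambda>c. scaleC c (ket i)"
  have "bounded_linear ?f"
    by (rule bounded_linear_intro[of _ 1])
      (auto simp: scaleC_add_left norm_scaleC scaleR_conv_of_real scaleC_of_real[symmetric])
  then show "compact (?f ` cball 0 1)"
    by (intro compact_continuous_image compact_cball) (rule linear_continuous_on)
  show "blinfun_apply (basis_proj i) ` cball 0 1 \<subseteq> ?f ` cball 0 1"
    by (auto simp: basis_proj_apply intro!: imageI order_trans[OF Rep_le_norm])
qed

lemma basis_proj_ket: "blinfun_apply (basis_proj i) (ket j) = (if i = j then ket i else 0)"
  by (simp add: basis_proj_apply Rep_ket)

lemma adjoint_basis_proj: "adjoint_oper (basis_proj i) = basis_proj i"
  by (rule adjoint_unique)
    (auto simp: basis_proj_bounded basis_proj_apply cinner_scaleC_left cinner_scaleC_right)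

text \<open>The projection onto the span of the basis vectors in a finite set \<open>F\<close>. For
  infinite \<open>F\<close> the sum is 0 by convention, so finiteness of \<open>F\<close>
  accompanies the coordinate formula.\<close>

definition coord_proj :: "'i set \<Rightarrow> 'i oper" where
  "coord_proj F = (\<Sum>i\<in>F. basis_proj i)"

lemma Rep_coord_proj: "finite F \<Longrightarrow> Rep_ell2 (blinfun_apply (coord_proj F) x) i = (if i \<in> F then Rep_ell2 x i else 0)"
  by (simp add: coord_proj_def blinfun.sum_left Rep_basis_proj)

lemma norm_ell2_mono:
  assumes "\<And>i. cmod (Rep_ell2 x i) \<le> cmod (Rep_ell2 y i)"
  shows "norm x \<le> norm y"
proof (rule norm_ell2_le)
  fix F :: "'a set" assume "finite F"
  have "L2_set (\<lambda>i. cmod (Rep_ell2 x i)) F \<le> L2_set (\<lambda>i. cmod (Rep_ell2 y i)) F"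
    by (intro L2_set_mono assms) auto
  also have "\<dots> \<le> norm y" by (rule L2_le_norm[OF \<open>finite F\<close>])
  finally show "L2_set (\<lambda>i. cmod (Rep_ell2 x i)) F \<le> norm y" .
qed

lemma coord_proj_bounded: "coord_proj F \<in> bounded_ops"
  by (simp add: coord_proj_def bounded_ops_sum basis_proj_bounded)

lemma cinner_coord_proj: "cinner (blinfun_apply (coord_proj F) u) w = cinner u (blinfun_apply (coord_proj F) w)"
  by (simp add: coord_proj_def blinfun.sum_left cinner_sum_left cinner_sum_right
      basis_proj_apply cinner_scaleC_left cinner_scaleC_right mult.commute)

lemma coord_proj_approx:
  assumes "finite Y" "e > 0"
  obtains F where "finite F" "\<And>y. y \<in> Y \<Longrightarrow> norm (y - blinfun_apply (coord_proj F) y) < e"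
proof -
  have "\<exists>F. finite F \<and> norm (y - blinfun_apply (coord_proj F) y) < e" for y :: "'a ell2"
  proof -
    obtain F where F: "finite F" "norm (y - (\<Sum>i\<in>F. scaleC (Rep_ell2 y i) (ket i))) < e"
      using ell2_truncate[OF assms(2)] by blast
    then show ?thesis by (intro exI[of _ F]) (simp add: coord_proj_def blinfun.sum_left basis_proj_apply)
  qed
  then obtain f where f: "\<And>y :: 'a ell2. finite (f y)" "\<And>y. norm (y - blinfun_apply (coord_proj (f y)) y) < e"
    by metis
  let ?F = "\<Union>(f ` Y)"
  have fin: "finite ?F" using assms f by blast
  have "norm (y - blinfun_apply (coord_proj ?F) y) < e" if "y \<in> Y" for y
  proof -
    have "norm (y - blinfun_apply (coord_proj ?F) y) \<le> norm (y - blinfun_apply (coord_proj (f y)) y)"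
      using that by (intro norm_ell2_mono) (auto simp: Rep_coord_proj[OF fin] Rep_coord_proj[OF f(1)])
    with f(2)[of y] show ?thesis by simp
  qed
  with fin show ?thesis using that by blast
qed

text \<open>Take a finite net of the image of the unit ball and \<open>F\<close> so large that the
  projection nearly fixes every point of the net. Since the complementary projection is a
  contraction, it does not enlarge the distance from a point of the image to the net.\<close>

lemma compact_ops_approx:
  assumes "k \<in> compact_ops" "e > 0"
  obtains F where "finite F" "norm (k - (coord_proj F o\<^sub>L k)) \<le> e"
proof -
  let ?c = "closure (blinfun_apply k ` cball 0 1)"
  obtain N where N: "finite N" "?c \<subseteq> (\<Union>x\<in>N. ball x (e/2))"
    using assms unfolding compact_ops_def compact_eq_totally_bounded by (fastforce dest: spec[of _ "e/2"])
  obtain F where F: "finite F" "\<And>y. y \<in> N \<Longrightarrow> norm (y - blinfun_apply (coord_proj F) y) < e/2"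
    using coord_proj_approx[OF N(1), of "e/2"] assms(2) by auto
  have "norm (k - (coord_proj F o\<^sub>L k)) \<le> e"
  proof (rule norm_blinfun_unit_bound)
    fix x :: "'a ell2" assume x: "norm x \<le> 1"
    then obtain y where y: "y \<in> N" "dist y (blinfun_apply k x) < e/2"
      using N(2) compact_ops_image[OF assms(1)] by fastforce
    let ?u = "blinfun_apply k x" and ?P = "blinfun_apply (coord_proj F)"
    have "norm ((?u - y) - ?P (?u - y)) \<le> norm (?u - y)"
      by (intro norm_ell2_mono) (auto simp: Rep_coord_proj[OF F(1)])
    then have "norm ((?u - y) - ?P (?u - y)) \<le> e/2" using y(2) by (simp add: dist_norm norm_minus_commute)
    moreover have "norm (y - ?P y) \<le> e/2" using F(2)[OF y(1)] by simp
    moreover have "blinfun_apply (k - (coord_proj F o\<^sub>L k)) x = ((?u - y) - ?P (?u - y)) + (y - ?P y)"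
      by (simp add: blinfun.diff_left blinfun.diff_right)
    ultimately show "norm (blinfun_apply (k - (coord_proj F o\<^sub>L k)) x) \<le> e"
      by (metis norm_triangle_mono field_sum_of_halves)
  qed (use assms in simp)
  with F(1) show ?thesis by (rule that)
qed

text \<open>The adjoint of \<open>P o k\<close> is the adjoint of \<open>k\<close> followed after
  the finite-rank projection \<open>P\<close>, hence compact. Taking adjoints is isometric, so these
  operators approximate the adjoint of \<open>k\<close>.\<close>

lemma compact_ops_adjoint:
  assumes "k \<in> compact_ops" shows "adjoint_oper k \<in> compact_ops"
proof (rule compact_ops_limit)
  note k = compact_ops_bounded[OF assms]
  show "adjoint_oper k \<in> bounded_ops" by (rule adjoint_bounded_ops[OF k])
  fix e :: real assume "e > 0"
  then obtain F where F: "finite F" "norm (k - (coord_proj F o\<^sub>L k)) \<le> e" by (rule compact_ops_approx[OF assms])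
  let ?P = "coord_proj F"
  have P: "adjoint_oper ?P = ?P"
    by (rule adjoint_unique) (simp_all add: coord_proj_bounded cinner_coord_proj)
  have "adjoint_oper (k - (?P o\<^sub>L k)) = adjoint_oper k - (adjoint_oper k o\<^sub>L ?P)"
    by (simp add: adjoint_diff adjoint_compose P k coord_proj_bounded bounded_ops_compose)
  then have "norm (adjoint_oper k - (adjoint_oper k o\<^sub>L ?P)) \<le> e"
    using F(2) norm_adjoint[of "k - (?P o\<^sub>L k)"] k
    by (simp add: coord_proj_bounded bounded_ops_compose bounded_ops_diff)
  moreover have "?P \<in> compact_ops"
    unfolding coord_proj_def by (intro compact_ops_sum basis_proj_compact)
  then have "adjoint_oper k o\<^sub>L ?P \<in> compact_ops"
    by (intro compact_ops_compose_left adjoint_bounded_ops k)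
  ultimately show "\<exists>S\<in>compact_ops. norm (adjoint_oper k - S) \<le> e" by blast
qed

text \<open>Split off \<open>P o k\<close> and move \<open>P\<close> to the left vector. The bound
  is small as soon as \<open>u\<close> has little mass on the finite set \<open>F\<close>: this
  serves both for basis vectors outside \<open>F\<close> and for vectors that a translation has
  pushed off \<open>F\<close>.\<close>

lemma compact_ops_cinner_bound:
  assumes "k \<in> compact_ops" "e > 0"
  obtains F where "finite F"
    "\<And>u v. cmod (cinner u (blinfun_apply k v)) \<le> e * norm u * norm v + norm (blinfun_apply (coord_proj F) u) * norm k * norm v"
proof -
  obtain F where F: "finite F" "norm (k - (coord_proj F o\<^sub>L k)) \<le> e" by (rule compact_ops_approx[OF assms])
  let ?P = "coord_proj F"
  have "cmod (cinner u (blinfun_apply k v)) \<le> e * norm u * norm v + norm (blinfun_apply ?P u) * norm k * norm v" for u v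
  proof -
    have "cinner u (blinfun_apply k v) = cinner u (blinfun_apply (k - (?P o\<^sub>L k)) v) + cinner (blinfun_apply ?P u) (blinfun_apply k v)"
      by (simp add: blinfun.diff_left cinner_diff_right cinner_coord_proj)
    then have "cmod (cinner u (blinfun_apply k v)) \<le> norm u * norm (blinfun_apply (k - (?P o\<^sub>L k)) v) + norm (blinfun_apply ?P u) * norm (blinfun_apply k v)"
      by (metis norm_triangle_mono cinner_bound)
    also have "\<dots> \<le> norm u * (e * norm v) + norm (blinfun_apply ?P u) * (norm k * norm v)"
      by (intro add_mono mult_left_mono norm_blinfun order_trans[OF norm_blinfun mult_right_mono[OF F(2)]]) auto
    finally show ?thesis by (simp add: mult_ac)
  qed
  with F(1) show ?thesis by (rule that)
qed

lemma compact_ops_diagonal: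
  assumes "k \<in> compact_ops" "e > 0"
  obtains F where "finite F" "\<And>i. i \<notin> F \<Longrightarrow> cmod (cinner (ket i) (blinfun_apply k (ket i))) \<le> e"
proof -
  obtain F where F: "finite F"
    "\<And>u v. cmod (cinner u (blinfun_apply k v)) \<le> e * norm u * norm v + norm (blinfun_apply (coord_proj F) u) * norm k * norm v"
    using compact_ops_cinner_bound[OF assms] by blast
  have "blinfun_apply (coord_proj F) (ket i) = 0" if "i \<notin> F" for i
    using that by (intro ell2_eqI) (auto simp: Rep_coord_proj[OF F(1)] Rep_ket)
  then have "cmod (cinner (ket i) (blinfun_apply k (ket i))) \<le> e" if "i \<notin> F" for i
    using F(2)[of "ket i" "ket i"] that by simp
  with F(1) show ?thesis by (rule that)
qed

section \<open>Reduced words and the norm of the symmetric random walk\<close>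

text \<open>Van der Waerden's method: a letter acts on the reduced words by left multiplication.
  Folding this action over a word produces its normal form, and invariance under cancellation
  follows without a confluence argument.\<close>

fun push :: "letter \<Rightarrow> letter list \<Rightarrow> letter list" where
  "push (x, s) ((y, t) # w) = (if y = x \<and> t = (\<not> s) then w else (x, s) # (y, t) # w)"
| "push a [] = [a]"

fun reduced :: "letter list \<Rightarrow> bool" where
  "reduced ((x, s) # (y, t) # w) \<longleftrightarrow> \<not> (y = x \<and> t = (\<not> s)) \<and> reduced ((y, t) # w)"
| "reduced _ = True"

definition reduce :: "letter list \<Rightarrow> letter list" where
  "reduce w = foldr push w []"

lemma reduced_Cons: "reduced (a # w) \<Longrightarrow> reduced w"
  by (cases "a # w" rule: reduced.cases) auto

lemma reduced_push: "reduced w \<Longrightarrow> reduced (push a w)"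
  by (cases "(a, w)" rule: push.cases) (auto dest: reduced_Cons)

lemma reduced_reduce: "reduced (foldr push u w)" if "reduced w"
  using that by (induction u) (auto intro: reduced_push)

text \<open>A letter and its inverse act inversely to each other. Reducedness matters when the inner
  \<open>push\<close> deletes the first letter: the remaining word then cannot begin with the
  inverse of the deleted letter, so the outer \<open>push\<close> restores it.\<close>

lemma push_push: "reduced w \<Longrightarrow> push (x, s) (push (x, \<not> s) w) = w"
  by (cases w rule: reduced.cases) auto

lemma reduce_cancels: "cancels u v \<Longrightarrow> reduce u = reduce v"
  by (induction rule: cancels.induct) (simp add: reduce_def push_push reduced_reduce)

lemma reduce_equivclp:
  assumes "equivclp cancels u v" shows "reduce u = reduce v"
  using assms by (induction rule: equivclp_induct) (auto dest: reduce_cancels)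

lift_definition word_length :: "free2 \<Rightarrow> nat" is "\<lambda>w. length (reduce w)"
  by (simp add: reduce_equivclp)

lift_definition word :: "letter list \<Rightarrow> free2" is "\<lambda>w. w" .

abbreviation gen :: "letter \<Rightarrow> free2" where "gen a \<equiv> word [a]"

lemma inverse_gen: "inverse (gen (x, s)) = gen (x, \<not> s)"
  by transfer (simp add: inv_word_def)

lemma length_push: "length w \<le> Suc (length (push a w))"
  by (cases "(a, w)" rule: push.cases) auto

lemma word_length_gen_ge: "word_length g \<le> Suc (word_length (gen a * g))"
  by transfer (simp add: reduce_def length_push)

text \<open>In the Cayley tree at most one neighbour of \<open>g\<close> is closer to the root, the
  one obtained by cancelling the first letter. At the root there is none and any \<open>b\<close>
  will do.\<close>

lemma word_length_gen: "\<exists>b. \<forall>a. a \<noteq> b \<longrightarrow> word_length (gen a * g) = Suc (word_length g)"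
proof transfer
  fix w
  show "\<exists>b. \<forall>a. a \<noteq> b \<longrightarrow> length (reduce ([a] @ w)) = Suc (length (reduce w))"
  proof (cases "reduce w")
    case Nil
    then show ?thesis by (auto simp: reduce_def)
  next
    case (Cons c v)
    obtain y t where "c = (y, t)" by fastforce
    with Cons show ?thesis by (intro exI[of _ "(y, \<not> t)"]) (auto simp: reduce_def)
  qed
qed

lemma infinite_free2: "infinite (UNIV :: free2 set)"
proof
  assume "finite (UNIV :: free2 set)"
  have "reduce (replicate n (True, True)) = replicate n (True, True)" for n
  proof (induction n)
    case (Suc n)
    then show ?case by (cases n) (simp_all add: reduce_def)
  qed (simp add: reduce_def)
  then have "word_length (word (replicate n (True, True))) = n" for n by transfer simp
  then have "surj word_length" by (rule surjI)
  with finite_imageI[OF \<open>finite UNIV\<close>, of word_length] show False by simp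
qed

section \<open>Kesten's bound through Schur's test\<close>

lemma UNIV_letter: "(UNIV :: letter set) = {(True, True), (True, False), (False, True), (False, False)}"
  by (auto simp: UNIV_bool)

text \<open>Three neighbours are farther from the root and contribute \<open>f g / sqrt 3\<close>
  each, together \<open>sqrt 3 * f g\<close>; the remaining one contributes at most
  \<open>sqrt 3 * f g\<close>. The base \<open>1 / sqrt 3\<close> of the weight is the one that
  balances the two contributions.\<close>

lemma sum_weight_le:
  fixes g :: free2
  defines "f \<equiv> \<lambda>g. (1 / sqrt 3) ^ word_length g"
  shows "(\<Sum>a\<in>UNIV. f (gen a * g)) \<le> 2 * sqrt 3 * f g"
proof -
  obtain b where b: "\<And>a. a \<noteq> b \<Longrightarrow> word_length (gen a * g) = Suc (word_length g)"
    using word_length_gen by blast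
  have "f (gen b * g) / sqrt 3 \<le> f g"
    using power_decreasing[OF word_length_gen_ge[of g b], of "1 / sqrt 3"] by (simp add: f_def)
  then have fb: "f (gen b * g) \<le> sqrt 3 * f g" by (simp add: field_simps)
  have "card (UNIV :: letter set) = 4" by (simp add: UNIV_letter)
  then have "card (UNIV - {b}) = 3" by (simp add: card_Diff_singleton)
  then have "(\<Sum>a\<in>UNIV - {b}. f (gen a * g)) = 3 * (f g / sqrt 3)"
    by (simp add: b f_def)
  also have "\<dots> = sqrt 3 * f g" by (simp add: field_simps)
  finally have "(\<Sum>a\<in>UNIV - {b}. f (gen a * g)) = sqrt 3 * f g" .
  moreover have "(\<Sum>a\<in>UNIV. f (gen a * g)) = f (gen b * g) + (\<Sum>a\<in>UNIV - {b}. f (gen a * g))"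
    by (rule sum.remove) auto
  ultimately show ?thesis using fb by (simp add: mult_ac)
qed

text \<open>Each coordinate of the image is a sum to which Cauchy-Schwarz is applied after
  multiplying and dividing by the square root of the weight at \<open>\<sigma> a p\<close>. The
  first weight inequality bounds one factor; after summation over \<open>p\<close> and the
  substitution \<open>q = \<sigma> a p\<close>, the second one bounds what is left.\<close>

lemma schur_test_reindex:
  fixes \<sigma> \<tau> :: "'a \<Rightarrow> 'i \<Rightarrow> 'i" and f :: "'i \<Rightarrow> real"
  assumes "finite L" "\<And>a p. \<tau> a (\<sigma> a p) = p" "\<And>a p. \<sigma> a (\<tau> a p) = p" "\<And>p. f p > 0" "\<kappa> \<ge> 0"
    and le: "\<And>p. (\<Sum>a\<in>L. f (\<sigma> a p)) \<le> \<kappa> * f p" "\<And>p. (\<Sum>a\<in>L. f (\<tau> a p)) \<le> \<kappa> * f p"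
  shows "norm (\<Sum>a\<in>L. reindex (\<sigma> a)) \<le> \<kappa>"
proof (rule norm_blinfun_bound[OF \<open>\<kappa> \<ge> 0\<close>], rule norm_ell2_le, rule L2_set_le_sqrt)
  fix \<xi> :: "'i ell2" and F :: "'i set" assume F: "finite F"
  have inj: "inj (\<sigma> a)" for a using assms(2) by (metis injI)
  let ?x = "\<lambda>p. cmod (Rep_ell2 \<xi> p)"
  have pt: "(cmod (Rep_ell2 (blinfun_apply (\<Sum>a\<in>L. reindex (\<sigma> a)) \<xi>) p))\<^sup>2
      \<le> \<kappa> * (\<Sum>a\<in>L. (?x (\<sigma> a p))\<^sup>2 * f p / f (\<sigma> a p))" for p
  proof -
    have "cmod (Rep_ell2 (blinfun_apply (\<Sum>a\<in>L. reindex (\<sigma> a)) \<xi>) p) \<le> (\<Sum>a\<in>L. ?x (\<sigma> a p))"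
      by (simp add: blinfun.sum_left Rep_reindex inj norm_sum)
    also have "\<dots> = (\<Sum>a\<in>L. sqrt (f (\<sigma> a p)) * (?x (\<sigma> a p) / sqrt (f (\<sigma> a p))))"
      using assms(4) by (simp add: less_imp_neq[symmetric])
    finally have "(cmod (Rep_ell2 (blinfun_apply (\<Sum>a\<in>L. reindex (\<sigma> a)) \<xi>) p))\<^sup>2
        \<le> (\<Sum>a\<in>L. sqrt (f (\<sigma> a p)) * (?x (\<sigma> a p) / sqrt (f (\<sigma> a p))))\<^sup>2"
      by (intro power_mono) auto
    also have "\<dots> \<le> (\<Sum>a\<in>L. (sqrt (f (\<sigma> a p)))\<^sup>2) * (\<Sum>a\<in>L. (?x (\<sigma> a p) / sqrt (f (\<sigma> a p)))\<^sup>2)"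
      by (rule Cauchy_Schwarz_ineq_sum)
    also have "\<dots> = (\<Sum>a\<in>L. f (\<sigma> a p)) * (\<Sum>a\<in>L. (?x (\<sigma> a p))\<^sup>2 / f (\<sigma> a p))"
      using assms(4) by (simp add: less_imp_le power_divide)
    also have "\<dots> \<le> (\<kappa> * f p) * (\<Sum>a\<in>L. (?x (\<sigma> a p))\<^sup>2 / f (\<sigma> a p))"
      using assms(4) by (intro mult_right_mono le sum_nonneg) (auto simp: less_imp_le)
    finally show ?thesis by (simp add: sum_distrib_left mult_ac)
  qed
  \<comment> \<open>One finite set containing all the shifted copies of \<open>F\<close>, so that
    after the substitution the sum over \<open>a\<close> can be taken inside.\<close>
  let ?G = "\<Union>a\<in>L. \<sigma> a ` F"
  have "(\<Sum>p\<in>F. (cmod (Rep_ell2 (blinfun_apply (\<Sum>a\<in>L. reindex (\<sigma> a)) \<xi>) p))\<^sup>2)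
      \<le> (\<Sum>p\<in>F. \<kappa> * (\<Sum>a\<in>L. (?x (\<sigma> a p))\<^sup>2 * f p / f (\<sigma> a p)))"
    by (intro sum_mono pt)
  also have "\<dots> = \<kappa> * (\<Sum>a\<in>L. \<Sum>p\<in>F. (?x (\<sigma> a p))\<^sup>2 * f p / f (\<sigma> a p))"
    by (simp add: sum_distrib_left[symmetric] sum.swap[of _ L])
  \<comment> \<open>The substitution \<open>q = \<sigma> a p\<close>, under which \<open>p\<close>
    becomes \<open>\<tau> a q\<close>.\<close>
  also have "\<dots> = \<kappa> * (\<Sum>a\<in>L. \<Sum>q\<in>\<sigma> a ` F. (?x q)\<^sup>2 * f (\<tau> a q) / f q)"
    using inj assms(2) by (subst sum.reindex) (auto intro: inj_on_subset)
  also have "\<dots> \<le> \<kappa> * (\<Sum>a\<in>L. \<Sum>q\<in>?G. (?x q)\<^sup>2 * f (\<tau> a q) / f q)"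
    using assms F by (intro mult_left_mono sum_mono sum_mono2) (auto simp: less_imp_le)
  also have "\<dots> = \<kappa> * (\<Sum>q\<in>?G. (?x q)\<^sup>2 / f q * (\<Sum>a\<in>L. f (\<tau> a q)))"
    by (subst sum.swap) (simp add: sum_distrib_left)
  also have "\<dots> \<le> \<kappa> * (\<Sum>q\<in>?G. (?x q)\<^sup>2 / f q * (\<kappa> * f q))"
    using assms(4,5) by (intro mult_left_mono sum_mono le) (auto simp: less_imp_le)
  also have "\<dots> = \<kappa> * \<kappa> * (\<Sum>q\<in>?G. (?x q)\<^sup>2)"
    using assms(4) by (simp add: sum_distrib_left less_imp_neq[symmetric] mult_ac)
  also have "\<dots> \<le> \<kappa> * \<kappa> * (norm \<xi>)\<^sup>2"
    using assms(1,5) F by (intro mult_left_mono sum_le_norm_sq) auto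
  finally show "(\<Sum>p\<in>F. (cmod (Rep_ell2 (blinfun_apply (\<Sum>a\<in>L. reindex (\<sigma> a)) \<xi>) p))\<^sup>2) \<le> (\<kappa> * norm \<xi>)\<^sup>2"
    by (simp add: power_mult_distrib power2_eq_square mult_ac)
qed (use assms in simp)

lemma bij_letter_flip: "bij (\<lambda>(x, s). (x, \<not> s) :: letter)"
  by (rule involuntory_imp_bij) auto

text \<open>The diagonal action on pairs is free already on the first coordinate, so the weight may
  ignore the second one and the bound for the walk on the group carries over. This plays the part of
  Fell's absorption principle.\<close>

lemma norm_diagonal_walk_le:
  "norm (\<Sum>a\<in>UNIV. reindex (\<lambda>(g, h :: free2). (inverse (gen a) * g, inverse (gen a) * h))) \<le> 2 * sqrt 3"
proof (rule schur_test_reindex[where \<tau> = "\<lambda>a (g, h). (gen a * g, gen a * h)"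
      and f = "\<lambda>(g, h). (1 / sqrt 3) ^ word_length g"])
  show "(\<Sum>a\<in>UNIV. case case p of (g, h) \<Rightarrow> (gen a * g, gen a * h) of (g, h) \<Rightarrow> (1 / sqrt 3) ^ word_length g)
      \<le> 2 * sqrt 3 * (case p of (g, h) \<Rightarrow> (1 / sqrt 3) ^ word_length g)" for p :: "free2 \<times> free2"
    using sum_weight_le by (simp add: case_prod_unfold)
  \<comment> \<open>The inverse of a generator is the generator with flipped sign, so passing to
    inverses only permutes the four terms.\<close>
  have "(\<Sum>a\<in>UNIV. (1 / sqrt 3) ^ word_length (inverse (gen a) * g)) = (\<Sum>a\<in>UNIV. (1 / sqrt 3) ^ word_length (gen a * g))" for g
    by (rule sum.reindex_bij_betw[OF bij_letter_flip, symmetric, THEN trans]) (simp add: case_prod_unfold inverse_gen[symmetric])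
  then show "(\<Sum>a\<in>UNIV. case case p of (g, h) \<Rightarrow> (inverse (gen a) * g, inverse (gen a) * h) of (g, h) \<Rightarrow> (1 / sqrt 3) ^ word_length g)
      \<le> 2 * sqrt 3 * (case p of (g, h) \<Rightarrow> (1 / sqrt 3) ^ word_length g)" for p :: "free2 \<times> free2"
    using sum_weight_le by (simp add: case_prod_unfold)
qed (auto split: prod.splits)

section \<open>C*-seminorms on operator algebras\<close>

text \<open>The subtraction of a ring record is a definite description over its carrier. It agrees
  with the subtraction of the type once the carrier is known to contain the negative.\<close>

lemma a_minus_type_class:
  fixes M :: "('b :: ab_group_add, 'm) ring_scheme"
  assumes "zero M = 0" "add M = (+)" "y \<in> carrier M" "- y \<in> carrier M"
  shows "x \<ominus>\<^bsub>M\<^esub> y = x - y"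
proof -
  have "(THE z. z \<in> carrier M \<and> y + z = 0 \<and> z + y = 0) = - y"
    by (rule the_equality) (use assms in \<open>auto simp: eq_neg_iff_add_eq_0\<close>)
  then show ?thesis using assms by (simp add: a_minus_def a_inv_def m_inv_def)
qed

lemma cstar_subalgebra_oper:
  assumes "\<And>x. x \<in> B \<Longrightarrow> - x \<in> B"
  shows "cstar_subalgebra (oper_alg\<lparr>carrier := B\<rparr>) norm S \<longleftrightarrow>
    S \<subseteq> B \<and> 0 \<in> S \<and> (\<forall>x\<in>S. \<forall>y\<in>S. x + y \<in> S \<and> x o\<^sub>L y \<in> S) \<and> (\<forall>c. \<forall>x\<in>S. scaleC_oper c x \<in> S) \<and>
    (\<forall>x\<in>S. adjoint_oper x \<in> S) \<and> (\<forall>x\<in>B. (\<forall>e>0. \<exists>y\<in>S. norm (x - y) < e) \<longrightarrow> x \<in> S)"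
proof -
  have "S \<subseteq> B \<Longrightarrow> norm_closure (oper_alg\<lparr>carrier := B\<rparr>) norm S = {x \<in> B. \<forall>e>0. \<exists>y\<in>S. norm (x - y) < e}"
    unfolding norm_closure_def using assms by (auto simp: a_minus_type_class subset_iff)
  then show ?thesis
    unfolding cstar_subalgebra_def by (cases "S \<subseteq> B") auto
qed

lemma oper_alg_carrier: "oper_alg\<lparr>carrier := bounded_ops\<rparr> = oper_alg"
  by (simp add: oper_alg_def)

lemma cstar_subalgebra_oper_alg:
  "cstar_subalgebra oper_alg norm S \<longleftrightarrow>
    S \<subseteq> bounded_ops \<and> 0 \<in> S \<and> (\<forall>x\<in>S. \<forall>y\<in>S. x + y \<in> S \<and> x o\<^sub>L y \<in> S) \<and> (\<forall>c. \<forall>x\<in>S. scaleC_oper c x \<in> S) \<and>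
    (\<forall>x\<in>S. adjoint_oper x \<in> S) \<and> (\<forall>x\<in>bounded_ops. (\<forall>e>0. \<exists>y\<in>S. norm (x - y) < e) \<longrightarrow> x \<in> S)"
  using cstar_subalgebra_oper[of bounded_ops S] by (simp add: bounded_ops_uminus oper_alg_carrier)

lemma cstar_subalgebra_bounded_ops: "cstar_subalgebra oper_alg norm bounded_ops"
  by (simp add: cstar_subalgebra_oper_alg bounded_ops_add bounded_ops_compose bounded_ops_scaleC adjoint_bounded_ops)

lemma cstar_subalgebra_closed:
  assumes "cstar_subalgebra oper_alg norm S" shows "closed S"
proof -
  have "x \<in> S" if "x \<in> closure S" for x
  proof -
    have "x \<in> bounded_ops"
      using that assms closure_minimal[OF _ closed_bounded_ops, of S] by (auto simp: cstar_subalgebra_oper_alg)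
    moreover have "\<forall>e>0. \<exists>y\<in>S. norm (x - y) < e"
      using that by (auto simp: closure_approachable dist_norm norm_minus_commute)
    ultimately show ?thesis using assms by (auto simp: cstar_subalgebra_oper_alg)
  qed
  then show ?thesis by (metis closure_subset_eq subsetI)
qed

section \<open>Rules for composition, square roots, and contractivity of C*-seminorms\<close>

lemma compose_diff_left: "(S - T) o\<^sub>L R = (S o\<^sub>L R) - (T o\<^sub>L R)"
  by (rule blinfun_eqI) (simp add: blinfun.diff_left)

lemma compose_diff_right: "R o\<^sub>L (S - T) = (R o\<^sub>L S) - (R o\<^sub>L T)"
  by (rule blinfun_eqI) (simp add: blinfun.diff_left blinfun.diff_right)

lemma compose_add_left: "(S + T) o\<^sub>L R = (S o\<^sub>L R) + (T o\<^sub>L R)"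
  by (rule blinfun_eqI) (simp add: blinfun.add_left)

lemma compose_add_right: "R o\<^sub>L (S + T) = (R o\<^sub>L S) + (R o\<^sub>L T)"
  by (rule blinfun_eqI) (simp add: blinfun.add_left blinfun.add_right)

lemma compose_scaleR_left: "(r *\<^sub>R S) o\<^sub>L R = r *\<^sub>R (S o\<^sub>L R)"
  by (rule blinfun_eqI) (simp add: blinfun.scaleR_left)

lemma compose_scaleR_right: "R o\<^sub>L (r *\<^sub>R S) = r *\<^sub>R (R o\<^sub>L S)"
  by (rule blinfun_eqI) (simp add: blinfun.scaleR_left blinfun.scaleR_right)

lemma compose_assoc: "(R o\<^sub>L S) o\<^sub>L T = R o\<^sub>L (S o\<^sub>L T)"
  by (rule blinfun_eqI) simp

lemma compose_zero [simp]: "0 o\<^sub>L T = 0" "T o\<^sub>L 0 = 0"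
  by (rule blinfun_eqI, simp)+

lemmas compose_simps = compose_diff_left compose_diff_right compose_add_left compose_add_right
  compose_scaleR_left compose_scaleR_right compose_assoc

text \<open>With \<open>b = id - y\<close>, the equation \<open>b\<^sup>2 = id - h\<^sup>2\<close> reads \<open>y = (h\<^sup>2 + y\<^sup>2) / 2\<close>, which is a
  contraction on a ball of radius less than 1.\<close>

lemma sqrt_one_minus_square:
  assumes S: "cstar_subalgebra oper_alg norm S" "id_blinfun \<in> S"
    and h: "h \<in> S" "adjoint_oper h = h" "norm h < 1"
  obtains b where "b \<in> S" "adjoint_oper b = b" "b o\<^sub>L h = h o\<^sub>L b" "b o\<^sub>L b = id_blinfun - (h o\<^sub>L h)"
proof -
  let ?sa = "\<lambda>y. \<forall>u v. cinner (blinfun_apply y u) v = cinner u (blinfun_apply y v)"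
  define r where "r = norm h"
  define Y where "Y = {y \<in> S. ?sa y \<and> y o\<^sub>L h = h o\<^sub>L y \<and> norm y \<le> r}"
  define f where "f y = (1/2) *\<^sub>R ((h o\<^sub>L h) + (y o\<^sub>L y))" for y
  have Sb: "S \<subseteq> bounded_ops" and S0: "0 \<in> S"
    and Sadd: "\<And>x y. x \<in> S \<Longrightarrow> y \<in> S \<Longrightarrow> x + y \<in> S" and Scomp: "\<And>x y. x \<in> S \<Longrightarrow> y \<in> S \<Longrightarrow> x o\<^sub>L y \<in> S"
    and Ssc: "\<And>c x. x \<in> S \<Longrightarrow> scaleC_oper c x \<in> S"
    using S(1) by (auto simp: cstar_subalgebra_oper_alg)
  have SscR: "c *\<^sub>R x \<in> S" if "x \<in> S" for c x using Ssc[OF that, of "of_real c"] by (simp add: scaleC_oper_of_real)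
  have sah: "?sa h" using h Sb by (metis cinner_adjoint_left subsetD)
  have r: "0 \<le> r" "r < 1" using h by (auto simp: r_def)
  have "closed Y"
  proof -
    have 1: "closed {y. ?sa y}"
      by (intro closed_Collect_all closed_Collect_eq
          bounded_linear.continuous_on[OF bounded_linear_cinner_left]
          bounded_linear.continuous_on[OF bounded_linear_cinner_right] continuous_intros)
    have 2: "closed {y. y o\<^sub>L h = h o\<^sub>L y}"
      by (intro closed_Collect_eq bounded_bilinear.continuous_on[OF bounded_bilinear_blinfun_compose] continuous_intros)
    have "Y = S \<inter> {y. ?sa y} \<inter> {y. y o\<^sub>L h = h o\<^sub>L y} \<inter> cball 0 r" by (auto simp: Y_def)
    then show ?thesis using 1 2 cstar_subalgebra_closed[OF S(1)] by auto
  qed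
  then have "complete Y" by (simp add: complete_eq_closed)
  moreover have "0 \<in> Y" using S0 r by (simp add: Y_def cinner_def)
  moreover have "f y \<in> Y" if "y \<in> Y" for y
  proof -
    have y: "y \<in> S" "?sa y" "y o\<^sub>L h = h o\<^sub>L y" "norm y \<le> r" using that by (auto simp: Y_def)
    have "?sa (f y)"
      using sah y(2)
      by (auto simp: f_def blinfun.scaleR_left blinfun.add_left scaleC_of_real[symmetric]
          cinner_scaleC_left cinner_scaleC_right cinner_add_left cinner_add_right)
    moreover have "f y o\<^sub>L h = h o\<^sub>L f y"
      unfolding f_def compose_simps by (metis y(3) compose_assoc)
    moreover have "norm (f y) \<le> r"
    proof -
      have "norm (h o\<^sub>L h) \<le> r * r" "norm (y o\<^sub>L y) \<le> r * r"
        using norm_blinfun_compose[of h h] norm_blinfun_compose[of y y] mult_mono[OF y(4) y(4)] r by (auto simp: r_def)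
      then have "norm ((h o\<^sub>L h) + (y o\<^sub>L y)) \<le> r * r + r * r" by (rule norm_triangle_mono)
      also have "\<dots> \<le> r + r" using r by (intro add_mono mult_left_le) auto
      finally show ?thesis by (simp add: f_def)
    qed
    ultimately show ?thesis using y(1) h(1) by (simp add: Y_def) (simp add: f_def SscR Sadd Scomp)
  qed
  moreover have "dist (f x) (f y) \<le> r * dist x y" if "x \<in> Y \<and> y \<in> Y" for x y
  proof -
    have xy: "norm x \<le> r" "norm y \<le> r" using that by (auto simp: Y_def)
    have "f x - f y = (1/2) *\<^sub>R ((x o\<^sub>L (x - y)) + ((x - y) o\<^sub>L y))"
      by (simp add: f_def compose_simps algebra_simps)
    then have "norm (f x - f y) \<le> (1/2) * (norm (x o\<^sub>L (x - y)) + norm ((x - y) o\<^sub>L y))"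
      using norm_triangle_ineq by simp
    also have "\<dots> \<le> (1/2) * (norm x * norm (x - y) + norm (x - y) * norm y)"
      by (intro mult_left_mono add_mono norm_blinfun_compose) auto
    also have "\<dots> \<le> (1/2) * (r * norm (x - y) + norm (x - y) * r)"
      using xy by (intro mult_left_mono add_mono mult_right_mono) auto
    finally show ?thesis by (simp add: dist_norm mult.commute)
  qed
  ultimately have "\<exists>!y\<in>Y. f y = y"
    using r by (intro Banach_fix) auto
  then obtain y where y: "y \<in> Y" "f y = y" by blast
  have fy: "y + y = (h o\<^sub>L h) + (y o\<^sub>L y)"
    using arg_cong[OF y(2), of "\<lambda>z. z + z"] by (simp add: f_def scaleR_add_left[symmetric] del: scaleR_left_distrib scaleR_add_right)
  show thesis
  proof (rule that[of "id_blinfun - y"])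
    show "id_blinfun - y \<in> S"
      using Sadd[OF S(2) SscR[of y "- 1"]] y(1) by (simp add: Y_def)
    have "adjoint_oper y = y"
      using y(1) Sb by (intro adjoint_unique) (auto simp: Y_def)
    then show "adjoint_oper (id_blinfun - y) = id_blinfun - y"
      using y(1) Sb by (subst adjoint_diff) (auto simp: Y_def)
    show "(id_blinfun - y) o\<^sub>L h = h o\<^sub>L (id_blinfun - y)" using y(1) by (simp add: compose_simps Y_def)
    have "(id_blinfun - y) o\<^sub>L (id_blinfun - y) = id_blinfun - (y + y) + (y o\<^sub>L y)" by (simp add: compose_simps)
    then show "(id_blinfun - y) o\<^sub>L (id_blinfun - y) = id_blinfun - (h o\<^sub>L h)" by (simp add: fy)
  qed
qed

text \<open>A self-adjoint strict contraction \<open>h\<close> is the mean of the unitaries \<open>h \<plusminus> i\<surd>(1 - h\<^sup>2)\<close>, whose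
  seminorm is at most 1 by the C*-identity.\<close>

lemma cstar_seminorm_le_norm:
  assumes S: "cstar_subalgebra oper_alg norm S" "id_blinfun \<in> S"
    and P_add: "\<And>x y. x \<in> S \<Longrightarrow> y \<in> S \<Longrightarrow> P (x + y) \<le> P x + P y"
    and P_scale: "\<And>c x. x \<in> S \<Longrightarrow> P (scaleC_oper c x) = cmod c * P x"
    and P_star: "\<And>x. x \<in> S \<Longrightarrow> P (adjoint_oper x o\<^sub>L x) = (P x)\<^sup>2"
    and P_id: "P id_blinfun \<le> 1"
    and a: "a \<in> S"
  shows "P a \<le> norm a"
proof -
  have Sb: "S \<subseteq> bounded_ops" 
    and Sadd: "\<And>x y. x \<in> S \<Longrightarrow> y \<in> S \<Longrightarrow> x + y \<in> S" and Scomp: "\<And>x y. x \<in> S \<Longrightarrow> y \<in> S \<Longrightarrow> x o\<^sub>L y \<in> S"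
    and Ssc: "\<And>c x. x \<in> S \<Longrightarrow> scaleC_oper c x \<in> S" and Sadj: "\<And>x. x \<in> S \<Longrightarrow> adjoint_oper x \<in> S"
    using S(1) by (auto simp: cstar_subalgebra_oper_alg)
  have P_unitary: "P U \<le> 1" if "U \<in> S" "adjoint_oper U o\<^sub>L U = id_blinfun" for U
    using P_star[OF that(1)] P_id that(2) by (metis power2_le_imp_le one_power2 zero_le_one)
  have contr: "P h \<le> 1" if h: "h \<in> S" "adjoint_oper h = h" "norm h < 1" for h
  proof -
    obtain b where b: "b \<in> S" "adjoint_oper b = b" "b o\<^sub>L h = h o\<^sub>L b" "b o\<^sub>L b = id_blinfun - (h o\<^sub>L h)"
      by (rule sqrt_one_minus_square[OF S h])
    have bb: "b \<in> bounded_ops" "h \<in> bounded_ops" using b(1) h(1) Sb by auto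
    have U: "h + scaleC_oper c b \<in> S" "P (h + scaleC_oper c b) \<le> 1" if c: "c = \<i> \<or> c = - \<i>" for c
    proof -
      show US: "h + scaleC_oper c b \<in> S" using b(1) h(1) by (simp add: Sadd Ssc)
      have "adjoint_oper (h + scaleC_oper c b) = h + scaleC_oper (- c) b"
        using c bb b(2) h(2) by (auto simp: adjoint_add adjoint_scaleC bounded_ops_scaleC)
      then have "adjoint_oper (h + scaleC_oper c b) o\<^sub>L (h + scaleC_oper c b) = (h o\<^sub>L h) + (b o\<^sub>L b)"
        using c bb b(3) by (auto simp: compose_simps scaleC_oper_compose_left scaleC_oper_compose_right
            scaleC_oper_minus_left)
      also have "\<dots> = id_blinfun" by (simp add: b)
      finally show "P (h + scaleC_oper c b) \<le> 1" using US by (rule P_unitary[rotated])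
    qed
    let ?U = "h + scaleC_oper \<i> b" and ?V = "h + scaleC_oper (- \<i>) b"
    have "scaleC_oper (1/2) h + scaleC_oper (1/2) h = h" by (simp flip: scaleC_oper_add_left)
    then have "h = scaleC_oper (1/2) ?U + scaleC_oper (1/2) ?V"
      by (simp add: scaleC_oper_add_right scaleC_oper_diff_right scaleC_oper_minus_left)
    then have "P h \<le> P (scaleC_oper (1/2) ?U) + P (scaleC_oper (1/2) ?V)"
      using P_add[of "scaleC_oper (1/2) ?U" "scaleC_oper (1/2) ?V"] U Ssc by metis
    also have "\<dots> = (1/2) * P ?U + (1/2) * P ?V" using U by (simp add: P_scale)
    also have "\<dots> \<le> 1" using U(2)[of \<i>] U(2)[of "- \<i>"] by simp
    finally show ?thesis .
  qed
  have sa: "P h \<le> norm h" if h: "h \<in> S" "adjoint_oper h = h" for h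
  proof (rule field_le_epsilon)
    fix e :: real assume "e > 0"
    define t where "t = norm h + e"
    have t: "t > 0" "norm h < t" using \<open>e > 0\<close> by (auto simp: t_def add_nonneg_pos)
    have "P (scaleC_oper (of_real (1/t)) h) \<le> 1"
      using h t Sb by (intro contr) (auto simp: Ssc adjoint_scaleC norm_scaleC_oper norm_divide)
    then have "P h \<le> t" using t h by (simp add: P_scale norm_divide field_simps)
    then show "P h \<le> norm h + e" by (simp add: t_def)
  qed
  have ab: "a \<in> bounded_ops" using a Sb by auto
  have "(P a)\<^sup>2 = P (adjoint_oper a o\<^sub>L a)" by (simp add: P_star a)
  also have "\<dots> \<le> norm (adjoint_oper a o\<^sub>L a)"
    using a ab by (intro sa) (auto simp: Scomp Sadj adjoint_compose adjoint_bounded_ops adjoint_adjoint)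
  also have "\<dots> = (norm a)\<^sup>2" by (rule norm_cstar[OF ab])
  finally show ?thesis by (rule power2_le_imp_le) simp
qed

section \<open>The algebra of the free group and its extension by the compact operators\<close>

lemma cstar_generated_superset: "X \<subseteq> cstar_generated M p X"
  by (auto simp: cstar_generated_def)

lemma cstar_generated_least: "cstar_subalgebra M p S \<Longrightarrow> X \<subseteq> S \<Longrightarrow> cstar_generated M p X \<subseteq> S"
  by (auto simp: cstar_generated_def)

lemma cstar_subalgebra_generated:
  assumes "cstar_subalgebra M p S" "X \<subseteq> S"
  shows "cstar_subalgebra M p (cstar_generated M p X)"
proof -
  have "norm_closure M p (cstar_generated M p X) \<subseteq> T" if "cstar_subalgebra M p T" "X \<subseteq> T" for T
  proof -
    have "norm_closure M p (cstar_generated M p X) \<subseteq> norm_closure M p T"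
      using cstar_generated_least[OF that] unfolding norm_closure_def by blast
    then show ?thesis using that(1) by (auto simp: cstar_subalgebra_def)
  qed
  then have "norm_closure M p (cstar_generated M p X) \<subseteq> cstar_generated M p X"
    by (auto simp: cstar_generated_def)
  moreover have "cstar_generated M p X \<subseteq> carrier M"
    using cstar_generated_least[OF assms] assms(1) by (auto simp: cstar_subalgebra_def)
  ultimately show ?thesis
    unfolding cstar_subalgebra_def cstar_generated_def by blast
qed

text \<open>Reduces commutation with a whole generated C*-algebra to commutation with its
  generators: once the generators lie in such a commutant, so does everything generated by
  them.\<close>

lemma cstar_subalgebra_commutant:
  assumes "X \<subseteq> bounded_ops" "\<And>x. x \<in> X \<Longrightarrow> adjoint_oper x \<in> X"
  shows "cstar_subalgebra oper_alg norm {a \<in> bounded_ops. \<forall>x\<in>X. a o\<^sub>L x = x o\<^sub>L a}"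
proof -
  let ?C = "{a \<in> bounded_ops. \<forall>x\<in>X. a o\<^sub>L x = x o\<^sub>L a}"
  have "closed (bounded_ops \<inter> (\<Inter>x\<in>X. {a. a o\<^sub>L x = x o\<^sub>L a}))"
    by (intro closed_Int closed_INT ballI closed_bounded_ops closed_Collect_eq
        bounded_bilinear.continuous_on[OF bounded_bilinear_blinfun_compose] continuous_intros)
  moreover have "?C = bounded_ops \<inter> (\<Inter>x\<in>X. {a. a o\<^sub>L x = x o\<^sub>L a})" by auto
  ultimately have "closed ?C" by simp
  then have lim: "a \<in> ?C" if "\<forall>e>0. \<exists>y\<in>?C. norm (a - y) < e" for a
    using that by (metis (no_types, lifting) closed_approachable dist_commute dist_norm)
  have adj: "adjoint_oper a o\<^sub>L x = x o\<^sub>L adjoint_oper a" if "a \<in> ?C" "x \<in> X" for a x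
  proof -
    have x: "x \<in> bounded_ops" "adjoint_oper x \<in> X" using that assms by auto
    then have "a o\<^sub>L adjoint_oper x = adjoint_oper x o\<^sub>L a" using that by blast
    then have "adjoint_oper (a o\<^sub>L adjoint_oper x) = adjoint_oper (adjoint_oper x o\<^sub>L a)" by simp
    then show ?thesis using that(1) x(1)
      by (simp add: adjoint_compose adjoint_bounded_ops adjoint_adjoint)
  qed
  have comp: "a o\<^sub>L b o\<^sub>L x = x o\<^sub>L (a o\<^sub>L b)" if "a \<in> ?C" "b \<in> ?C" "x \<in> X" for a b x
  proof -
    have "b o\<^sub>L x = x o\<^sub>L b" "a o\<^sub>L x = x o\<^sub>L a" using that by auto
    then show ?thesis by (metis compose_assoc)
  qed
  show ?thesis
    unfolding cstar_subalgebra_oper_alg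
  proof (intro conjI ballI allI impI)
    fix a b c assume ab: "a \<in> ?C" "b \<in> ?C"
    show "a o\<^sub>L b \<in> ?C" using ab comp[OF ab] by (simp add: bounded_ops_compose)
    show "a + b \<in> ?C" using ab by (simp add: bounded_ops_add compose_add_left compose_add_right)
    show "adjoint_oper a \<in> ?C" using ab adj[OF ab(1)] by (simp add: adjoint_bounded_ops)
    have "scaleC_oper c a o\<^sub>L x = x o\<^sub>L scaleC_oper c a" if "x \<in> X" for x
    proof -
      have "a o\<^sub>L x = x o\<^sub>L a" "x \<in> bounded_ops" using ab that assms by auto
      then show ?thesis by (simp add: scaleC_oper_compose_left scaleC_oper_compose_right)
    qed
    then show "scaleC_oper c a \<in> ?C" using ab by (simp add: bounded_ops_scaleC)
  next
    fix a assume "\<forall>e>0. \<exists>y\<in>?C. norm (a - y) < e"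
    then show "a \<in> ?C" by (rule lim)
  qed auto
qed

section \<open>The reduced algebra and its trivial intersection with the compact operators\<close>

lemma carrier_reduced_alg: "carrier reduced_alg = cstar_generated oper_alg norm (range left_translation)"
  by (simp add: reduced_alg_def)

lemma reduced_alg_simps [simp]: "monoid.mult reduced_alg = (o\<^sub>L)"
  "one reduced_alg = id_blinfun" "zero reduced_alg = 0" "add reduced_alg = (+)" "smult reduced_alg = scaleC_oper"
  "star reduced_alg = adjoint_oper"
  by (simp_all add: reduced_alg_def)

lemma reduced_subalgebra: "cstar_subalgebra oper_alg norm (carrier reduced_alg)"
  unfolding carrier_reduced_alg
  by (rule cstar_subalgebra_generated[OF cstar_subalgebra_bounded_ops]) (auto simp: left_translation_bounded_ops)

lemma left_translation_reduced: "left_translation g \<in> carrier reduced_alg"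
  unfolding carrier_reduced_alg by (rule subsetD[OF cstar_generated_superset]) simp

lemma id_reduced: "id_blinfun \<in> carrier reduced_alg"
  using left_translation_reduced[of 1] by (simp add: left_translation_one)

lemma reduced_bounded: "a \<in> carrier reduced_alg \<Longrightarrow> a \<in> bounded_ops"
  and reduced_add: "a \<in> carrier reduced_alg \<Longrightarrow> b \<in> carrier reduced_alg \<Longrightarrow> a + b \<in> carrier reduced_alg"
  and reduced_compose: "a \<in> carrier reduced_alg \<Longrightarrow> b \<in> carrier reduced_alg \<Longrightarrow> a o\<^sub>L b \<in> carrier reduced_alg"
  and reduced_scaleC: "a \<in> carrier reduced_alg \<Longrightarrow> scaleC_oper c a \<in> carrier reduced_alg"
  and reduced_adjoint: "a \<in> carrier reduced_alg \<Longrightarrow> adjoint_oper a \<in> carrier reduced_alg"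
  and reduced_zero: "0 \<in> carrier reduced_alg"
  using reduced_subalgebra by (auto simp: cstar_subalgebra_oper_alg)

lemma reduced_diff: "a \<in> carrier reduced_alg \<Longrightarrow> b \<in> carrier reduced_alg \<Longrightarrow> a - b \<in> carrier reduced_alg"
  using reduced_add[of a "scaleC_oper (- 1) b"] reduced_scaleC[of b "- 1"] by (simp add: scaleC_oper_minus_one)

lemma reduced_commutes_right:
  assumes "a \<in> carrier reduced_alg" shows "a o\<^sub>L right_translation g = right_translation g o\<^sub>L a"
proof -
  let ?C = "{a \<in> bounded_ops. \<forall>x\<in>range right_translation. a o\<^sub>L x = x o\<^sub>L a}"
  have "carrier reduced_alg \<subseteq> ?C"
    unfolding carrier_reduced_alg
    by (intro cstar_generated_least cstar_subalgebra_commutant)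
      (auto simp: right_translation_bounded_ops left_translation_bounded_ops adjoint_right_translation left_right_commute)
  with assms show ?thesis by blast
qed

lemma finite_large_coords: "e > 0 \<Longrightarrow> finite {i. e \<le> cmod (Rep_ell2 u i)}"
proof -
  assume "e > 0"
  then obtain F where F: "finite F" "norm (u - (\<Sum>i\<in>F. scaleC (Rep_ell2 u i) (ket i))) < e" by (rule ell2_truncate)
  have "cmod (Rep_ell2 u i) < e" if "i \<notin> F" for i
    using Rep_le_norm[of "u - (\<Sum>i\<in>F. scaleC (Rep_ell2 u i) (ket i))" i] F that
    by (simp add: Rep_ket if_distrib cong: if_cong)
  then have "{i. e \<le> cmod (Rep_ell2 u i)} \<subseteq> F" by force
  then show ?thesis using F(1) finite_subset by blast
qed

text \<open>Only finitely many coordinates of \<open>u\<close> are large, so only finitely many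
  \<open>g\<close> bring one of them into \<open>F\<close>; the group is infinite, hence some
  \<open>g\<close> avoids all of these.\<close>

lemma right_translation_vanishing:
  assumes F: "finite F" and "e > 0"
  shows "\<exists>g. norm (blinfun_apply (coord_proj F) (blinfun_apply (right_translation g) u)) \<le> e"
proof -
  \<comment> \<open>A threshold that is summed once for each element of \<open>F\<close>; the
    \<open>+ 1\<close> covers empty \<open>F\<close>.\<close>
  define d where "d = e / (card F + 1)"
  have d: "d > 0" using \<open>e > 0\<close> by (simp add: d_def)
  let ?L = "{i. d \<le> cmod (Rep_ell2 u i)}"
  have "finite (\<Union>h\<in>F. (\<lambda>i. inverse h * i) ` ?L)" using F finite_large_coords[OF d] by blast
  then obtain g where g: "g \<notin> (\<Union>h\<in>F. (\<lambda>i. inverse h * i) ` ?L)"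
    using infinite_free2 by (metis UNIV_I ex_new_if_finite)
  have small: "cmod (Rep_ell2 u (h * g)) \<le> d" if "h \<in> F" for h
  proof (rule ccontr)
    assume "\<not> ?thesis"
    then have "inverse h * (h * g) \<in> (\<lambda>i. inverse h * i) ` ?L" by (intro imageI) simp
    with g that show False by auto
  qed
  have "norm (blinfun_apply (coord_proj F) (blinfun_apply (right_translation g) u))
      = norm (\<Sum>h\<in>F. scaleC (Rep_ell2 u (h * g)) (ket h))"
    by (simp add: coord_proj_def blinfun.sum_left basis_proj_apply Rep_right_translation)
  also have "\<dots> \<le> (\<Sum>h\<in>F. d)"
    by (intro sum_norm_le) (simp add: norm_scaleC small)
  also have "\<dots> \<le> e" using \<open>e > 0\<close> by (simp add: d_def field_simps)
  finally show ?thesis by blast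
qed

text \<open>Conjugation by right translations fixes \<open>a\<close> and pushes the compact perturbation to infinity.\<close>

lemma norm_le_compact_perturbation:
  assumes a: "a \<in> carrier reduced_alg" and k: "k \<in> compact_ops"
  shows "norm a \<le> norm (a + k)"
proof (rule norm_blinfun_bound)
  fix v
  show "norm (blinfun_apply a v) \<le> norm (a + k) * norm v"
  proof (rule norm_le_cinner)
    fix u
    show "cmod (cinner u (blinfun_apply a v)) \<le> norm (a + k) * norm v * norm u"
    proof (rule field_le_epsilon)
      fix e' :: real assume "e' > 0"
      \<comment> \<open>Chosen so that both error terms together stay below \<open>e'\<close>: the
        compact part contributes at most \<open>e * (norm u * norm v + norm k * norm v)\<close>. The
        \<open>+ 1\<close> keeps the quotient defined.\<close>
      define e where "e = e' / (norm u * norm v + norm k * norm v + 1)"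
      have den: "norm u * norm v + norm k * norm v + 1 > 0" by (simp add: add_nonneg_pos)
      have e: "e > 0" using \<open>e' > 0\<close> den by (simp add: e_def)
      obtain F where F: "finite F" "\<And>u v. cmod (cinner u (blinfun_apply k v)) \<le> e * norm u * norm v + norm (blinfun_apply (coord_proj F) u) * norm k * norm v"
        using compact_ops_cinner_bound[OF k e] by blast
      obtain g where g: "norm (blinfun_apply (coord_proj F) (blinfun_apply (right_translation g) u)) \<le> e"
        using right_translation_vanishing[OF F(1) e] by blast
      let ?u = "blinfun_apply (right_translation g) u" and ?v = "blinfun_apply (right_translation g) v"
      have "blinfun_apply (right_translation g) (blinfun_apply a v) = blinfun_apply a ?v"
        using reduced_commutes_right[OF a, of g] by (metis blinfun_apply_blinfun_compose)
      then have "cinner u (blinfun_apply a v) = cinner ?u (blinfun_apply a ?v)"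
        by (metis cinner_right_translation)
      also have "\<dots> = cinner ?u (blinfun_apply (a + k) ?v) - cinner ?u (blinfun_apply k ?v)"
        by (simp add: blinfun.add_left cinner_add_right)
      finally have "cmod (cinner u (blinfun_apply a v)) \<le> cmod (cinner ?u (blinfun_apply (a + k) ?v)) + cmod (cinner ?u (blinfun_apply k ?v))"
        by (metis norm_triangle_ineq4)
      also have "\<dots> \<le> norm (a + k) * norm v * norm u + e'"
      proof (rule add_mono)
        have "cmod (cinner ?u (blinfun_apply (a + k) ?v)) \<le> norm ?u * (norm (a + k) * norm ?v)"
          by (intro order_trans[OF cinner_bound mult_left_mono[OF norm_blinfun]]) auto
        also have "\<dots> \<le> norm u * (norm (a + k) * norm v)"
          by (intro mult_mono mult_left_mono norm_right_translation) auto
        finally show "cmod (cinner ?u (blinfun_apply (a + k) ?v)) \<le> norm (a + k) * norm v * norm u" by (simp add: mult_ac)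
        have "cmod (cinner ?u (blinfun_apply k ?v)) \<le> e * norm ?u * norm ?v + norm (blinfun_apply (coord_proj F) ?u) * norm k * norm ?v"
          by (rule F(2))
        also have "\<dots> \<le> e * norm u * norm v + e * norm k * norm v"
          using e g by (intro add_mono mult_mono norm_right_translation) auto
        also have "\<dots> = e * (norm u * norm v + norm k * norm v)" by (simp add: algebra_simps)
        also have "\<dots> \<le> e'" using \<open>e' > 0\<close> den by (simp add: e_def field_simps)
        finally show "cmod (cinner ?u (blinfun_apply k ?v)) \<le> e'" .
      qed
      finally show "cmod (cinner u (blinfun_apply a v)) \<le> norm (a + k) * norm v * norm u + e'" .
    qed
  qed simp
qed simp

text \<open>The preceding bound with \<open>k = - a\<close>. It makes the decomposition of an
  element of \<open>A\<close> unique, and so turns the definite description behind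
  \<open>quotient_map\<close> into a function that can be computed.\<close>

lemma reduced_compact_zero: "a \<in> carrier reduced_alg \<Longrightarrow> a \<in> compact_ops \<Longrightarrow> a = 0"
  using norm_le_compact_perturbation[of a "- a"] compact_ops_uminus[of a] by simp

subsection \<open>The extension and the quotient map\<close>

lemma carrier_A_alg: "carrier A_alg = {a + k | a k. a \<in> carrier reduced_alg \<and> k \<in> compact_ops}"
  by (simp add: A_alg_def)

lemma A_alg_carrier: "A_alg = oper_alg\<lparr>carrier := carrier A_alg\<rparr>"
  by (simp add: A_alg_def)

lemma A_alg_simps [simp]: "monoid.mult A_alg = (o\<^sub>L)"
  "one A_alg = id_blinfun" "zero A_alg = 0" "add A_alg = (+)" "smult A_alg = scaleC_oper"
  "star A_alg = adjoint_oper"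
  by (simp_all add: A_alg_def)

lemma quotient_map_eq:
  assumes "a \<in> carrier reduced_alg" "T - a \<in> compact_ops"
  shows "quotient_map T = a"
  unfolding quotient_map_def
proof (rule the_equality)
  fix b assume b: "b \<in> carrier reduced_alg \<and> T - b \<in> compact_ops"
  have "b - a = (T - a) - (T - b)" by simp
  then have "b - a \<in> compact_ops" using b assms compact_ops_diff by metis
  then show "b = a" using b assms reduced_diff reduced_compact_zero by (metis eq_iff_diff_eq_0)
qed (use assms in blast)

lemma A_algE:
  assumes "T \<in> carrier A_alg"
  shows quotient_map_reduced: "quotient_map T \<in> carrier reduced_alg"
    and quotient_map_compact: "T - quotient_map T \<in> compact_ops"
proof -
  obtain a k where ak: "T = a + k" "a \<in> carrier reduced_alg" "k \<in> compact_ops"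
    using assms by (auto simp: carrier_A_alg)
  then have "quotient_map T = a" by (intro quotient_map_eq) auto
  with ak show "quotient_map T \<in> carrier reduced_alg" "T - quotient_map T \<in> compact_ops" by auto
qed

lemma A_algI: "a \<in> carrier reduced_alg \<Longrightarrow> T - a \<in> compact_ops \<Longrightarrow> T \<in> carrier A_alg"
  unfolding carrier_A_alg by force

lemma reduced_subset_A: "a \<in> carrier reduced_alg \<Longrightarrow> a \<in> carrier A_alg"
  by (rule A_algI) auto

lemma compact_subset_A: "k \<in> compact_ops \<Longrightarrow> k \<in> carrier A_alg"
  by (rule A_algI[of 0]) (auto simp: reduced_zero)

lemma A_bounded: "T \<in> carrier A_alg \<Longrightarrow> T \<in> bounded_ops"
  by (auto simp: carrier_A_alg reduced_bounded compact_ops_bounded bounded_ops_add)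

lemma quotient_map_id_on_reduced: "a \<in> carrier reduced_alg \<Longrightarrow> quotient_map a = a"
  by (rule quotient_map_eq) auto

lemma quotient_map_add:
  assumes "S \<in> carrier A_alg" "T \<in> carrier A_alg"
  shows "S + T \<in> carrier A_alg" "quotient_map (S + T) = quotient_map S + quotient_map T"
proof -
  have 1: "quotient_map S + quotient_map T \<in> carrier reduced_alg"
    using assms by (simp add: reduced_add quotient_map_reduced)
  have "S + T - (quotient_map S + quotient_map T) = (S - quotient_map S) + (T - quotient_map T)" by simp
  then have 2: "S + T - (quotient_map S + quotient_map T) \<in> compact_ops"
    using assms by (metis compact_ops_add quotient_map_compact)
  show "S + T \<in> carrier A_alg" "quotient_map (S + T) = quotient_map S + quotient_map T"
    using A_algI[OF 1 2] quotient_map_eq[OF 1 2] by auto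
qed

lemma quotient_map_scaleC:
  assumes "S \<in> carrier A_alg"
  shows "scaleC_oper c S \<in> carrier A_alg" "quotient_map (scaleC_oper c S) = scaleC_oper c (quotient_map S)"
proof -
  have 1: "scaleC_oper c (quotient_map S) \<in> carrier reduced_alg"
    using assms by (simp add: reduced_scaleC quotient_map_reduced)
  have 2: "scaleC_oper c S - scaleC_oper c (quotient_map S) \<in> compact_ops"
    using assms by (metis compact_ops_scaleC quotient_map_compact scaleC_oper_diff_right)
  show "scaleC_oper c S \<in> carrier A_alg" "quotient_map (scaleC_oper c S) = scaleC_oper c (quotient_map S)"
    using A_algI[OF 1 2] quotient_map_eq[OF 1 2] by auto
qed

lemma quotient_map_adjoint:
  assumes "S \<in> carrier A_alg"
  shows "adjoint_oper S \<in> carrier A_alg" "quotient_map (adjoint_oper S) = adjoint_oper (quotient_map S)"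
proof -
  note b = A_bounded[OF assms] reduced_bounded[OF quotient_map_reduced[OF assms]]
  have 1: "adjoint_oper (quotient_map S) \<in> carrier reduced_alg"
    using assms by (simp add: reduced_adjoint quotient_map_reduced)
  have 2: "adjoint_oper S - adjoint_oper (quotient_map S) \<in> compact_ops"
    using compact_ops_adjoint[OF quotient_map_compact[OF assms]] b by (simp add: adjoint_diff)
  show "adjoint_oper S \<in> carrier A_alg" "quotient_map (adjoint_oper S) = adjoint_oper (quotient_map S)"
    using A_algI[OF 1 2] quotient_map_eq[OF 1 2] by auto
qed

lemma quotient_map_compose:
  assumes "S \<in> carrier A_alg" "T \<in> carrier A_alg"
  shows "S o\<^sub>L T \<in> carrier A_alg" "quotient_map (S o\<^sub>L T) = quotient_map S o\<^sub>L quotient_map T"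
proof -
  note b = A_bounded[OF assms(2)] reduced_bounded[OF quotient_map_reduced[OF assms(1)]]
  have 1: "quotient_map S o\<^sub>L quotient_map T \<in> carrier reduced_alg"
    using assms by (simp add: reduced_compose quotient_map_reduced)
  have "(S o\<^sub>L T) - (quotient_map S o\<^sub>L quotient_map T)
      = ((S - quotient_map S) o\<^sub>L T) + (quotient_map S o\<^sub>L (T - quotient_map T))"
    by (simp add: compose_simps)
  then have 2: "(S o\<^sub>L T) - (quotient_map S o\<^sub>L quotient_map T) \<in> compact_ops"
    using assms b by (simp add: compact_ops_add compact_ops_compose_left compact_ops_compose_right quotient_map_compact
        del: compose_diff_left compose_diff_right)
  show "S o\<^sub>L T \<in> carrier A_alg" "quotient_map (S o\<^sub>L T) = quotient_map S o\<^sub>L quotient_map T"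
    using A_algI[OF 1 2] quotient_map_eq[OF 1 2] by auto
qed

lemma id_A: "id_blinfun \<in> carrier A_alg"
  by (rule reduced_subset_A[OF id_reduced])

lemma zero_A: "0 \<in> carrier A_alg"
  by (rule reduced_subset_A[OF reduced_zero])

lemma uminus_A: "T \<in> carrier A_alg \<Longrightarrow> - T \<in> carrier A_alg"
  using quotient_map_scaleC(1)[of T "- 1"] by (simp add: scaleC_oper_minus_one)

lemma quotient_map_diff:
  assumes "S \<in> carrier A_alg" "T \<in> carrier A_alg"
  shows "S - T \<in> carrier A_alg" "quotient_map (S - T) = quotient_map S - quotient_map T"
  using quotient_map_add[OF assms(1) uminus_A[OF assms(2)]] quotient_map_scaleC(2)[OF assms(2), of "- 1"]
  by (simp_all add: scaleC_oper_minus_one)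

lemma sum_A: "(\<And>i. i \<in> F \<Longrightarrow> f i \<in> carrier A_alg) \<Longrightarrow> sum f F \<in> carrier A_alg"
  by (induction F rule: infinite_finite_induct) (auto intro: quotient_map_add(1) zero_A)

lemma norm_quotient_map_le: "T \<in> carrier A_alg \<Longrightarrow> norm (quotient_map T) \<le> norm T"
  using norm_le_compact_perturbation[OF quotient_map_reduced quotient_map_compact, of T T] by simp

text \<open>The sum of the two closed summands is closed because the quotient map is contractive:
  along a convergent sequence the reduced parts form a Cauchy sequence, and the compact parts, being
  differences, then converge to a compact operator.\<close>

lemma A_subalgebra: "cstar_subalgebra oper_alg norm (carrier A_alg)"
proof -
  have "x \<in> carrier A_alg" if x: "x \<in> bounded_ops" and appr: "\<forall>e>0. \<exists>y\<in>carrier A_alg. norm (x - y) < e" for x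
  proof -
    have "\<exists>y\<in>carrier A_alg. norm (x - y) < inverse (real (Suc n))" for n using appr by simp
    then obtain y where y: "\<And>n. y n \<in> carrier A_alg" "\<And>n. norm (x - y n) < inverse (real (Suc n))" by metis
    have "(\<lambda>n. norm (x - y n)) \<longlonglongrightarrow> 0"
      by (rule tendsto_sandwich[OF _ _ tendsto_const LIMSEQ_inverse_real_of_nat])
        (use y(2) in \<open>auto intro!: always_eventually less_imp_le simp del: of_nat_Suc\<close>)
    then have "(\<lambda>n. norm (y n - x)) \<longlonglongrightarrow> 0" by (simp add: norm_minus_commute)
    then have yx: "y \<longlonglongrightarrow> x" by (rule LIM_zero_cancel[OF tendsto_norm_zero_cancel])
    let ?a = "\<lambda>n. quotient_map (y n)"
    have "Cauchy ?a"
    proof (rule metric_CauchyI)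
      fix e :: real assume "e > 0"
      then obtain N where "\<And>m n. m \<ge> N \<Longrightarrow> n \<ge> N \<Longrightarrow> dist (y m) (y n) < e"
        using metric_CauchyD[OF LIMSEQ_imp_Cauchy[OF yx]] by blast
      moreover have "dist (?a m) (?a n) \<le> dist (y m) (y n)" for m n
        using norm_quotient_map_le[OF quotient_map_diff(1)[OF y(1) y(1)], of m n] y(1)
        by (simp add: dist_norm quotient_map_diff)
      ultimately show "\<exists>M. \<forall>m\<ge>M. \<forall>n\<ge>M. dist (?a m) (?a n) < e" by (meson le_less_trans)
    qed
    then obtain a where a: "?a \<longlonglongrightarrow> a" by (metis Cauchy_convergent_iff convergent_def)
    then have aR: "a \<in> carrier reduced_alg"
      using closed_sequentially[OF cstar_subalgebra_closed[OF reduced_subalgebra], of ?a] quotient_map_reduced[OF y(1)] by blast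
    have lim: "(\<lambda>n. y n - ?a n) \<longlonglongrightarrow> x - a" by (intro tendsto_diff yx a)
    have "x - a \<in> compact_ops"
    proof (rule compact_ops_limit)
      show "x - a \<in> bounded_ops" using x aR by (simp add: bounded_ops_diff reduced_bounded)
      fix e :: real assume "e > 0"
      then obtain n where "norm ((y n - ?a n) - (x - a)) < e" using LIMSEQ_D[OF lim] by blast
      then show "\<exists>S\<in>compact_ops. norm (x - a - S) \<le> e"
        using quotient_map_compact[OF y(1), of n] by (metis norm_minus_commute less_imp_le)
    qed
    with aR show ?thesis by (rule A_algI)
  qed
  then show ?thesis
    by (auto simp: cstar_subalgebra_oper_alg A_bounded zero_A quotient_map_add quotient_map_compose
        quotient_map_scaleC quotient_map_adjoint)
qed

subsection \<open>The right regular representation\<close>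

text \<open>The witness is conjugation by the self-adjoint unitary that exchanges
  \<open>ket h\<close> and \<open>ket (inverse h)\<close>, which carries left translations to right
  translations.\<close>

lemma right_rep_exists:
  "\<exists>\<phi>. star_hom reduced_alg oper_alg \<phi> \<and> (\<forall>g. \<phi> (left_translation g) = right_translation g)"
proof -
  let ?W = "reindex (inverse :: free2 \<Rightarrow> free2)"
  have inj: "inj (inverse :: free2 \<Rightarrow> free2)" by (metis free2_inverse_inverse injI)
  have W: "?W \<in> bounded_ops" by (rule reindex_bounded_ops[OF inj])
  have WW: "?W o\<^sub>L ?W = id_blinfun"
    using reindex_compose[OF inj inj] by (simp add: comp_def reindex_id)
  have Wadj: "adjoint_oper ?W = ?W" by (rule adjoint_reindex) auto
  have WWx: "?W o\<^sub>L (?W o\<^sub>L T) = T" for T by (simp add: compose_assoc[symmetric] WW)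
  let ?f = "\<lambda>a. ?W o\<^sub>L (a o\<^sub>L ?W)"
  have "star_hom reduced_alg oper_alg ?f"
    unfolding star_hom_def
    by (auto simp: reduced_bounded bounded_ops_compose adjoint_compose Wadj W compose_assoc WWx
        compose_add_left compose_add_right scaleC_oper_compose_left scaleC_oper_compose_right)
  moreover have "?f (left_translation g) = right_translation g" for g
    by (intro blinfun_eqI ell2_eqI) (simp add: Rep_reindex inj Rep_left_translation Rep_right_translation free2_inverse_mult)
  ultimately show ?thesis by blast
qed

lemma star_hom_right_rep: "star_hom reduced_alg oper_alg right_rep"
  and right_rep_left_translation: "right_rep (left_translation g) = right_translation g"
  using someI_ex[OF right_rep_exists] by (auto simp: right_rep_def)

lemma right_rep_bounded: "a \<in> carrier reduced_alg \<Longrightarrow> right_rep a \<in> bounded_ops"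
  and right_rep_adjoint: "a \<in> carrier reduced_alg \<Longrightarrow> right_rep (adjoint_oper a) = adjoint_oper (right_rep a)"
  and right_rep_add: "a \<in> carrier reduced_alg \<Longrightarrow> b \<in> carrier reduced_alg \<Longrightarrow> right_rep (a + b) = right_rep a + right_rep b"
  and right_rep_compose: "a \<in> carrier reduced_alg \<Longrightarrow> b \<in> carrier reduced_alg \<Longrightarrow> right_rep (a o\<^sub>L b) = right_rep a o\<^sub>L right_rep b"
  and right_rep_scaleC: "a \<in> carrier reduced_alg \<Longrightarrow> right_rep (scaleC_oper c a) = scaleC_oper c (right_rep a)"
  using star_hom_right_rep by (auto simp: star_hom_def)

lemma right_rep_id: "right_rep id_blinfun = id_blinfun"
  using right_rep_left_translation[of 1] by (simp add: left_translation_one right_translation_one)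

text \<open>\<open>right_rep\<close> is an arbitrary choice among *-homomorphisms with given values
  on generators, and continuity is not part of that specification. It follows because the norm of
  the image is a C*-seminorm on the reduced algebra.\<close>

lemma norm_right_rep_le: "a \<in> carrier reduced_alg \<Longrightarrow> norm (right_rep a) \<le> norm a"
proof (rule cstar_seminorm_le_norm[OF reduced_subalgebra id_reduced])
  show "norm (right_rep (adjoint_oper x o\<^sub>L x)) = (norm (right_rep x))\<^sup>2" if "x \<in> carrier reduced_alg" for x
    using that by (simp add: right_rep_compose right_rep_adjoint reduced_adjoint norm_cstar right_rep_bounded)
qed (auto simp: right_rep_add right_rep_scaleC norm_scaleC_oper norm_triangle_ineq right_rep_id norm_blinfun_id_le)

lemma right_rep_diff:
  "a \<in> carrier reduced_alg \<Longrightarrow> b \<in> carrier reduced_alg \<Longrightarrow> right_rep (a - b) = right_rep a - right_rep b"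
  using right_rep_add[of "a - b" b] reduced_diff[of a b] by (simp add: algebra_simps)

text \<open>The two variables are treated in turn. In \<open>gens\<close> the left factor is a
  translation and \<open>b\<close> varies over a set that is closed by the continuity of
  \<open>right_rep\<close>; afterwards \<open>b\<close> is fixed and \<open>a\<close> varies over a
  commutant.\<close>

lemma right_rep_commutes:
  assumes a: "a \<in> carrier reduced_alg" and b: "b \<in> carrier reduced_alg"
  shows "a o\<^sub>L right_rep b = right_rep b o\<^sub>L a"
proof -
  have gens: "left_translation g o\<^sub>L right_rep b = right_rep b o\<^sub>L left_translation g" if b: "b \<in> carrier reduced_alg" for b g
  proof -
    define C where "C = {a \<in> bounded_ops. \<forall>x\<in>range left_translation. a o\<^sub>L x = x o\<^sub>L a}"
    let ?S = "{b \<in> carrier reduced_alg. right_rep b \<in> C}"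
    have C: "cstar_subalgebra oper_alg norm C"
      unfolding C_def by (rule cstar_subalgebra_commutant) (auto simp: left_translation_bounded_ops adjoint_left_translation)
    have "x \<in> ?S" if x: "x \<in> bounded_ops" "\<forall>e>0. \<exists>y\<in>?S. norm (x - y) < e" for x
    proof -
      have xR: "x \<in> carrier reduced_alg"
        using x reduced_subalgebra unfolding cstar_subalgebra_oper_alg by blast
      moreover have "\<forall>e>0. \<exists>y\<in>C. norm (right_rep x - y) < e"
      proof (intro allI impI)
        fix e :: real assume "e > 0"
        then obtain y where y: "y \<in> ?S" "norm (x - y) < e" using x(2) by meson
        then have "norm (right_rep x - right_rep y) < e"
          using norm_right_rep_le[OF reduced_diff[of x y]] xR by (simp add: right_rep_diff)
        with y(1) show "\<exists>y\<in>C. norm (right_rep x - y) < e" by blast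
      qed
      then have "right_rep x \<in> C"
        using C right_rep_bounded[OF xR] unfolding cstar_subalgebra_oper_alg by blast
      ultimately show ?thesis by blast
    qed
    moreover have "0 \<in> ?S"
      using right_rep_diff[OF reduced_zero reduced_zero] by (simp add: reduced_zero C_def)
    moreover have "?S \<subseteq> bounded_ops" by (auto simp: reduced_bounded)
    moreover have "\<forall>x\<in>C. \<forall>y\<in>C. x + y \<in> C \<and> x o\<^sub>L y \<in> C" "\<forall>c. \<forall>x\<in>C. scaleC_oper c x \<in> C" "\<forall>x\<in>C. adjoint_oper x \<in> C"
      using C unfolding cstar_subalgebra_oper_alg by blast+
    then have "\<forall>x\<in>?S. \<forall>y\<in>?S. x + y \<in> ?S \<and> x o\<^sub>L y \<in> ?S" "\<forall>c. \<forall>x\<in>?S. scaleC_oper c x \<in> ?S" "\<forall>x\<in>?S. adjoint_oper x \<in> ?S"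
      by (auto simp only: mem_Collect_eq reduced_add reduced_compose reduced_scaleC reduced_adjoint
          right_rep_add right_rep_compose right_rep_scaleC right_rep_adjoint)
    ultimately have "cstar_subalgebra oper_alg norm ?S"
      unfolding cstar_subalgebra_oper_alg by blast
    moreover have "range left_translation \<subseteq> ?S"
      by (auto simp: C_def left_translation_reduced right_rep_left_translation right_translation_bounded_ops left_right_commute)
    ultimately have "carrier reduced_alg \<subseteq> ?S"
      unfolding carrier_reduced_alg[symmetric] by (subst carrier_reduced_alg) (rule cstar_generated_least)
    with b have "right_rep b \<in> C" by blast
    then show ?thesis by (auto simp: C_def)
  qed
  \<comment> \<open>The adjoint is included to make the set self-adjoint, so that its commutant is a
    C*-subalgebra; \<open>gens\<close> covers it as the image of the adjoint of
    \<open>b\<close>.\<close>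
  let ?X = "{right_rep b, adjoint_oper (right_rep b)}"
  let ?C = "{a \<in> bounded_ops. \<forall>x\<in>?X. a o\<^sub>L x = x o\<^sub>L a}"
  have "carrier reduced_alg \<subseteq> ?C"
    unfolding carrier_reduced_alg
    by (intro cstar_generated_least cstar_subalgebra_commutant)
      (auto simp: right_rep_bounded b adjoint_bounded_ops adjoint_adjoint left_translation_bounded_ops gens
        right_rep_adjoint[symmetric] reduced_adjoint adjoint_adjoint[OF reduced_bounded[OF b]])
  with a show ?thesis by blast
qed

section \<open>The diagonal subalgebra\<close>

text \<open>The commutant of the projections \<open>e_g\<close> within \<open>A\<close>. It turns
  out to be \<open>C\<close> itself, which is exactly maximality: an abelian algebra containing
  \<open>C\<close> commutes with every \<open>e_g\<close>.\<close>

definition diagonal_ops :: "free2 oper set" where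
  "diagonal_ops = {T \<in> carrier A_alg. \<forall>g. T o\<^sub>L basis_proj g = basis_proj g o\<^sub>L T}"

lemma cstar_subalgebra_A_alg:
  "cstar_subalgebra A_alg norm S \<longleftrightarrow>
    S \<subseteq> carrier A_alg \<and> 0 \<in> S \<and> (\<forall>x\<in>S. \<forall>y\<in>S. x + y \<in> S \<and> x o\<^sub>L y \<in> S) \<and> (\<forall>c. \<forall>x\<in>S. scaleC_oper c x \<in> S) \<and>
    (\<forall>x\<in>S. adjoint_oper x \<in> S) \<and> (\<forall>x\<in>carrier A_alg. (\<forall>e>0. \<exists>y\<in>S. norm (x - y) < e) \<longrightarrow> x \<in> S)"
  using cstar_subalgebra_oper[of "carrier A_alg" S] by (simp add: uminus_A flip: A_alg_carrier)

lemma cstar_subalgebra_diagonal: "cstar_subalgebra A_alg norm diagonal_ops"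
proof -
  define D where "D = {a \<in> bounded_ops. \<forall>x\<in>range basis_proj. a o\<^sub>L x = x o\<^sub>L (a :: free2 oper)}"
  have D: "cstar_subalgebra oper_alg norm D"
    unfolding D_def
    by (rule cstar_subalgebra_commutant) (auto simp: basis_proj_bounded adjoint_basis_proj)
  have eq: "diagonal_ops = carrier A_alg \<inter> D" by (auto simp: diagonal_ops_def D_def A_bounded)
  note D' = D[unfolded cstar_subalgebra_oper_alg] and A' = A_subalgebra[unfolded cstar_subalgebra_oper_alg]
  have "x \<in> carrier A_alg \<inter> D"
    if "x \<in> carrier A_alg" "\<forall>e>0. \<exists>y\<in>carrier A_alg \<inter> D. norm (x - y) < e" for x
  proof -
    have "\<forall>e>0. \<exists>y\<in>D. norm (x - y) < e" using that(2) by blast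
    then show ?thesis using that(1) D' A_bounded by blast
  qed
  moreover have "x + y \<in> carrier A_alg \<inter> D" "x o\<^sub>L y \<in> carrier A_alg \<inter> D" "scaleC_oper c x \<in> carrier A_alg \<inter> D"
    "adjoint_oper x \<in> carrier A_alg \<inter> D" if "x \<in> carrier A_alg \<inter> D" "y \<in> carrier A_alg \<inter> D" for x y c
    using that D' A' by simp_all
  moreover have "0 \<in> carrier A_alg \<inter> D" using D' A' by simp
  ultimately show ?thesis unfolding eq cstar_subalgebra_A_alg by simp
qed

lemma diagonal_Rep:
  assumes "T \<in> diagonal_ops"
  shows "Rep_ell2 (blinfun_apply T x) g = cinner (ket g) (blinfun_apply T (ket g)) * Rep_ell2 x g"
proof -
  have T: "T o\<^sub>L basis_proj g = basis_proj g o\<^sub>L T" "T \<in> bounded_ops"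
    using assms by (auto simp: diagonal_ops_def A_bounded)
  have "blinfun_apply T (blinfun_apply (basis_proj g) x) = blinfun_apply (basis_proj g) (blinfun_apply T x)"
    using T(1) by (metis blinfun_apply_blinfun_compose)
  then have "scaleC (Rep_ell2 x g) (blinfun_apply T (ket g)) = scaleC (Rep_ell2 (blinfun_apply T x) g) (ket g)"
    by (simp add: basis_proj_apply bounded_opsD[OF T(2)])
  then have "Rep_ell2 (scaleC (Rep_ell2 x g) (blinfun_apply T (ket g))) g = Rep_ell2 (scaleC (Rep_ell2 (blinfun_apply T x) g) (ket g)) g"
    by simp
  then show ?thesis by (simp add: Rep_ket mult.commute)
qed

lemma diagonal_commute:
  assumes "S \<in> diagonal_ops" "T \<in> diagonal_ops" shows "S o\<^sub>L T = T o\<^sub>L S"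
proof (intro blinfun_eqI ell2_eqI)
  fix x g
  note S = diagonal_Rep[OF assms(1)] and T = diagonal_Rep[OF assms(2)]
  show "Rep_ell2 (blinfun_apply (S o\<^sub>L T) x) g = Rep_ell2 (blinfun_apply (T o\<^sub>L S) x) g"
    using S[of "blinfun_apply T x" g] S[of x g] T[of "blinfun_apply S x" g] T[of x g] by simp
qed

lemma basis_proj_diagonal: "basis_proj g \<in> diagonal_ops"
proof -
  have "basis_proj g o\<^sub>L basis_proj h = basis_proj h o\<^sub>L basis_proj g" for h
    by (intro blinfun_eqI ell2_eqI) (auto simp: Rep_basis_proj)
  then show ?thesis by (simp add: diagonal_ops_def compact_subset_A basis_proj_compact)
qed

lemma id_diagonal: "id_blinfun \<in> diagonal_ops"
  by (simp add: diagonal_ops_def id_A)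

lemma generators_diagonal: "range basis_proj \<union> {id_blinfun} \<subseteq> diagonal_ops"
  using basis_proj_diagonal id_diagonal by auto

lemma cstar_subalgebra_C_alg: "cstar_subalgebra A_alg norm C_alg"
  unfolding C_alg_def by (rule cstar_subalgebra_generated[OF cstar_subalgebra_diagonal generators_diagonal])

lemma C_alg_diagonal: "T \<in> C_alg \<Longrightarrow> T \<in> diagonal_ops"
  unfolding C_alg_def using cstar_generated_least[OF cstar_subalgebra_diagonal generators_diagonal] by blast

lemma basis_proj_C_alg: "basis_proj g \<in> C_alg"
  and id_C_alg: "id_blinfun \<in> C_alg"
  unfolding C_alg_def by (rule subsetD[OF cstar_generated_superset], simp)+

lemma C_alg_A: "T \<in> C_alg \<Longrightarrow> T \<in> carrier A_alg"
  using cstar_subalgebra_C_alg by (auto simp: cstar_subalgebra_def)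

lemma C_alg_sum: "(\<And>i. i \<in> F \<Longrightarrow> f i \<in> C_alg) \<Longrightarrow> sum f F \<in> C_alg"
  using cstar_subalgebra_C_alg
  by (induction F rule: infinite_finite_induct) (auto simp: cstar_subalgebra_A_alg)

text \<open>The diagonal of an element of the reduced algebra is constant, since right translations act
  transitively on the basis; the diagonal of a compact operator vanishes at infinity.\<close>

lemma diagonal_reduced:
  assumes "a \<in> carrier reduced_alg"
  shows "cinner (ket g) (blinfun_apply a (ket g)) = cinner (ket 1) (blinfun_apply a (ket 1))"
proof -
  let ?R = "right_translation (inverse g)"
  have "blinfun_apply ?R (blinfun_apply a (ket 1)) = blinfun_apply a (ket g)"
    using reduced_commutes_right[OF assms, of "inverse g"]
    by (metis blinfun_apply_blinfun_compose right_translation_ket free2_inverse_inverse mult_1)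
  moreover have "blinfun_apply ?R (ket 1) = ket g" by (simp add: right_translation_ket)
  ultimately show ?thesis by (metis cinner_right_translation)
qed

text \<open>The diagonal of \<open>T\<close> is the constant \<open>t\<close> coming from the
  reduced part plus a family \<open>d\<close> vanishing at infinity. Correcting on a finite set
  leaves a multiplication operator with entries at most \<open>e\<close>. The scalar
  \<open>t\<close> is independent of \<open>e\<close>, so the same approximants also show that
  \<open>T\<close> minus this scalar is compact.\<close>

lemma diagonal_approx:
  assumes T: "T \<in> diagonal_ops"
  obtains t where "\<And>e. e > 0 \<Longrightarrow> \<exists>F c. finite F \<and>
    norm (T - (scaleC_oper t id_blinfun + (\<Sum>g\<in>F. scaleC_oper (c g) (basis_proj g)))) \<le> e"
proof -
  define t where "t = cinner (ket 1) (blinfun_apply (quotient_map T) (ket 1))"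
  let ?k = "T - quotient_map T"
  have TA: "T \<in> carrier A_alg" using T by (simp add: diagonal_ops_def)
  note k = quotient_map_compact[OF TA] and a = quotient_map_reduced[OF TA]
  define d where "d g = cinner (ket g) (blinfun_apply ?k (ket g))" for g
  have diag: "cinner (ket g) (blinfun_apply T (ket g)) = t + d g" for g
    unfolding t_def diagonal_reduced[OF a, of g, symmetric] d_def by (simp add: blinfun.diff_left cinner_diff_right)
  have "\<exists>F c. finite F \<and> norm (T - (scaleC_oper t id_blinfun + (\<Sum>g\<in>F. scaleC_oper (c g) (basis_proj g)))) \<le> e"
    if "e > 0" for e
  proof -
    obtain F where F: "finite F" "\<And>g. g \<notin> F \<Longrightarrow> cmod (d g) \<le> e"
      using compact_ops_diagonal[OF k \<open>e > 0\<close>] unfolding d_def by blast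
    let ?D = "T - (scaleC_oper t id_blinfun + (\<Sum>g\<in>F. scaleC_oper (d g) (basis_proj g)))"
    have "norm ?D \<le> e"
    proof (rule norm_blinfun_bound)
      fix x
      have "Rep_ell2 (blinfun_apply ?D x) g = (if g \<in> F then 0 else d g * Rep_ell2 x g)" for g
        using F(1)
        by (simp add: blinfun.diff_left blinfun.add_left blinfun.sum_left scaleC_oper_apply Rep_basis_proj
            diagonal_Rep[OF T, of x] diag[unfolded cinner_ket_left] algebra_simps if_distrib cong: if_cong)
      then have "cmod (Rep_ell2 (blinfun_apply ?D x) g) \<le> cmod (Rep_ell2 (e *\<^sub>R x) g)" for g
        using F(2)[of g] \<open>e > 0\<close> by (simp add: norm_mult mult_right_mono)
      then show "norm (blinfun_apply ?D x) \<le> e * norm x"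
        using norm_ell2_mono[of "blinfun_apply ?D x" "e *\<^sub>R x"] \<open>e > 0\<close> by simp
    qed (use that in simp)
    with F(1) show ?thesis by (intro exI[of _ F] exI[of _ d]) simp
  qed
  then show ?thesis by (rule that)
qed

lemma diagonal_C_alg:
  assumes "T \<in> diagonal_ops" shows "T \<in> C_alg"
proof -
  obtain t where t: "\<And>e. e > 0 \<Longrightarrow> \<exists>F c. finite F \<and>
    norm (T - (scaleC_oper t id_blinfun + (\<Sum>g\<in>F. scaleC_oper (c g) (basis_proj g)))) \<le> e"
    using diagonal_approx[OF assms] by blast
  have "\<exists>y\<in>C_alg. norm (T - y) < e" if "e > 0" for e
  proof -
    obtain F c where "norm (T - (scaleC_oper t id_blinfun + (\<Sum>g\<in>F. scaleC_oper (c g) (basis_proj g)))) \<le> e/2"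
      using t[of "e/2"] \<open>e > 0\<close> by auto
    moreover have "scaleC_oper t id_blinfun + (\<Sum>g\<in>F. scaleC_oper (c g) (basis_proj g)) \<in> C_alg"
      using cstar_subalgebra_C_alg basis_proj_C_alg id_C_alg C_alg_sum[of F "\<lambda>g. scaleC_oper (c g) (basis_proj g)"]
      unfolding cstar_subalgebra_A_alg by blast
    ultimately show ?thesis using that by (intro bexI) auto
  qed
  moreover have "T \<in> carrier A_alg" using assms by (simp add: diagonal_ops_def)
  ultimately show ?thesis
    using cstar_subalgebra_C_alg unfolding cstar_subalgebra_A_alg by blast
qed

text \<open>Consequently the quotient map is scalar on \<open>C\<close>, which is why
  \<open>pi_r\<close> is scalar on \<open>C \<odot> C\<close>.\<close>

lemma C_alg_scalar_plus_compact:
  assumes "T \<in> C_alg"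
  obtains t where "T - scaleC_oper t id_blinfun \<in> compact_ops"
proof -
  obtain t where t: "\<And>e. e > 0 \<Longrightarrow> \<exists>F c. finite F \<and>
    norm (T - (scaleC_oper t id_blinfun + (\<Sum>g\<in>F. scaleC_oper (c g) (basis_proj g)))) \<le> e"
    using diagonal_approx[OF C_alg_diagonal[OF assms]] by blast
  have "T - scaleC_oper t id_blinfun \<in> compact_ops"
  proof (rule compact_ops_limit)
    show "T - scaleC_oper t id_blinfun \<in> bounded_ops"
      using assms by (simp add: bounded_ops_diff bounded_ops_scaleC C_alg_A A_bounded)
    fix e :: real assume "e > 0"
    then obtain F c where F: "norm (T - (scaleC_oper t id_blinfun + (\<Sum>g\<in>F. scaleC_oper (c g) (basis_proj g)))) \<le> e"
      using t by blast
    show "\<exists>S\<in>compact_ops. norm (T - scaleC_oper t id_blinfun - S) \<le> e"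
      by (rule bexI[of _ "\<Sum>g\<in>F. scaleC_oper (c g) (basis_proj g)"])
        (use F in \<open>auto simp: diff_diff_add intro!: compact_ops_sum compact_ops_scaleC basis_proj_compact\<close>)
  qed
  then show ?thesis by (rule that)
qed

lemma maximal_abelian_C_alg: "maximal_abelian A_alg norm C_alg"
  unfolding maximal_abelian_def
proof (intro conjI allI impI cstar_subalgebra_C_alg)
  show "abelian_subset A_alg C_alg"
    by (auto simp: abelian_subset_def intro!: diagonal_commute C_alg_diagonal)
  fix D assume D: "cstar_subalgebra A_alg norm D \<and> abelian_subset A_alg D \<and> C_alg \<subseteq> D"
  have "T \<in> C_alg" if "T \<in> D" for T
  proof (rule diagonal_C_alg)
    have "T o\<^sub>L basis_proj g = basis_proj g o\<^sub>L T" for g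
      using D that basis_proj_C_alg[of g] unfolding abelian_subset_def A_alg_simps by blast
    moreover have "T \<in> carrier A_alg" using D that by (auto simp: cstar_subalgebra_def)
    ultimately show "T \<in> diagonal_ops" by (simp add: diagonal_ops_def)
  qed
  with D show "D = C_alg" by blast
qed

section \<open>Tensor products of operators\<close>

text \<open>\<open>a\<close> is applied to every slice of \<open>\<xi>\<close> in one coordinate
  direction; boundedness holds because the squared norms of the slices sum to at most the squared
  norm of \<open>\<xi>\<close>. The abstract pairing \<open>enc\<close> lets one construction yield
  the amplifications in the first and in the second coordinate.\<close>

lemma amplify_exists:
  fixes enc :: "'i \<Rightarrow> 'j \<Rightarrow> 'k" and l :: "'k \<Rightarrow> 'i" and r :: "'k \<Rightarrow> 'j"
  assumes a: "a \<in> bounded_ops"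
    and enc: "\<And>p. enc (l p) (r p) = p" "\<And>i j. l (enc i j) = i" "\<And>i j. r (enc i j) = j"
  defines "slice \<equiv> \<lambda>\<xi> j. Abs_ell2 (\<lambda>i. Rep_ell2 \<xi> (enc i j))"
  shows "\<exists>T\<in>bounded_ops. \<forall>\<xi> p. Rep_ell2 (blinfun_apply T \<xi>) p = Rep_ell2 (blinfun_apply a (slice \<xi> (r p))) (l p)"
    and "Rep_ell2 (slice \<xi> j) i = Rep_ell2 \<xi> (enc i j)"
proof -
  have L2: "L2_set (\<lambda>i. cmod (Rep_ell2 \<xi> (enc i j))) F \<le> norm \<xi>" if "finite F" for F \<xi> j
  proof -
    have "inj_on (\<lambda>i. enc i j) F" using enc(2) by (metis inj_onI)
    then have "L2_set (\<lambda>i. cmod (Rep_ell2 \<xi> (enc i j))) F = L2_set (\<lambda>p. cmod (Rep_ell2 \<xi> p)) ((\<lambda>i. enc i j) ` F)"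
      unfolding L2_set_def by (subst sum.reindex) auto
    also have "\<dots> \<le> norm \<xi>" using that by (intro L2_le_norm) auto
    finally show ?thesis .
  qed
  have slice: "Rep_ell2 (slice \<xi> j) = (\<lambda>i. Rep_ell2 \<xi> (enc i j))" for \<xi> j
    unfolding slice_def by (rule Abs_ell2_bound(1)[OF L2])
  then show "Rep_ell2 (slice \<xi> j) i = Rep_ell2 \<xi> (enc i j)" by simp
  have slice_linear: "slice (\<xi> + \<eta>) j = slice \<xi> j + slice \<eta> j" "slice (scaleC c \<xi>) j = scaleC c (slice \<xi> j)" for \<xi> \<eta> c j
    by (auto intro!: ell2_eqI simp: slice)
  have slices: "(\<Sum>j\<in>G. (norm (slice \<xi> j))\<^sup>2) \<le> (norm \<xi>)\<^sup>2" if G: "finite G" for G \<xi>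
  proof -
    have "((\<lambda>i. \<Sum>j\<in>G. (cmod (Rep_ell2 (slice \<xi> j) i))\<^sup>2) has_sum (\<Sum>j\<in>G. (norm (slice \<xi> j))\<^sup>2)) UNIV"
      using G by (induction G rule: finite_induct) (auto intro!: has_sum_add simp: norm_ell2_sq)
    then show ?thesis
    proof (rule has_sum_le_finite_sums)
      fix F :: "'i set" assume F: "finite F"
      have inj: "inj_on (\<lambda>(i, j). enc i j) (F \<times> G)" by (rule inj_on_inverseI[of _ "\<lambda>p. (l p, r p)"]) (auto simp: enc)
      have "(\<Sum>i\<in>F. \<Sum>j\<in>G. (cmod (Rep_ell2 (slice \<xi> j) i))\<^sup>2) = (\<Sum>p\<in>(\<lambda>(i, j). enc i j) ` (F \<times> G). (cmod (Rep_ell2 \<xi> p))\<^sup>2)"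
        by (subst sum.reindex[OF inj]) (simp add: sum.cartesian_product slice case_prod_unfold)
      also have "\<dots> \<le> (norm \<xi>)\<^sup>2" using F G by (intro sum_le_norm_sq) auto
      finally show "(\<Sum>i\<in>F. \<Sum>j\<in>G. (cmod (Rep_ell2 (slice \<xi> j) i))\<^sup>2) \<le> (norm \<xi>)\<^sup>2" .
    qed
  qed
  define f where "f \<xi> = Abs_ell2 (\<lambda>p. Rep_ell2 (blinfun_apply a (slice \<xi> (r p))) (l p))" for \<xi>
  have L2a: "L2_set (\<lambda>p. cmod (Rep_ell2 (blinfun_apply a (slice \<xi> (r p))) (l p))) F \<le> norm \<xi> * norm a" if F: "finite F" for \<xi> F
  proof (rule L2_set_le_sqrt)
    let ?h = "\<lambda>i j. (cmod (Rep_ell2 (blinfun_apply a (slice \<xi> j)) i))\<^sup>2"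
    have inj: "inj_on (\<lambda>p. (r p, l p)) F" by (rule inj_on_inverseI[of _ "\<lambda>(j, i). enc i j"]) (simp add: enc(1))
    have "(\<Sum>p\<in>F. ?h (l p) (r p)) = (\<Sum>(j, i)\<in>(\<lambda>p. (r p, l p)) ` F. ?h i j)"
      by (subst sum.reindex[OF inj]) simp
    \<comment> \<open>The finite index set is enlarged to a rectangle so that the sum splits along
      slices.\<close>
    also have "\<dots> \<le> (\<Sum>(j, i)\<in>r ` F \<times> l ` F. ?h i j)"
      using F by (intro sum_mono2) auto
    also have "\<dots> = (\<Sum>j\<in>r ` F. \<Sum>i\<in>l ` F. ?h i j)" by (simp add: sum.cartesian_product)
    also have "\<dots> \<le> (\<Sum>j\<in>r ` F. (norm (blinfun_apply a (slice \<xi> j)))\<^sup>2)"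
      using F by (intro sum_mono sum_le_norm_sq) auto
    also have "\<dots> \<le> (\<Sum>j\<in>r ` F. (norm a * norm (slice \<xi> j))\<^sup>2)"
      by (intro sum_mono power_mono norm_blinfun) auto
    also have "\<dots> = (norm a)\<^sup>2 * (\<Sum>j\<in>r ` F. (norm (slice \<xi> j))\<^sup>2)"
      by (simp add: power_mult_distrib sum_distrib_left)
    also have "\<dots> \<le> (norm a)\<^sup>2 * (norm \<xi>)\<^sup>2" using F by (intro mult_left_mono slices) auto
    finally show "(\<Sum>p\<in>F. ?h (l p) (r p)) \<le> (norm \<xi> * norm a)\<^sup>2" by (simp add: power_mult_distrib mult.commute)
  qed simp
  have f: "Rep_ell2 (f \<xi>) = (\<lambda>p. Rep_ell2 (blinfun_apply a (slice \<xi> (r p))) (l p))" "norm (f \<xi>) \<le> norm \<xi> * norm a" for \<xi>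
    unfolding f_def by (rule Abs_ell2_bound[OF L2a], assumption)+
  have "bounded_linear f"
    by (rule bounded_linear_intro[OF _ _ f(2)])
      (auto intro!: ell2_eqI simp: f(1) slice_linear blinfun.add_right bounded_opsD[OF a] simp flip: scaleC_of_real)
  then have "blinfun_apply (Blinfun f) = f" by (simp add: bounded_linear_Blinfun_apply)
  moreover have "f (scaleC c \<xi>) = scaleC c (f \<xi>)" for c \<xi>
    by (auto intro!: ell2_eqI simp: f(1) slice_linear bounded_opsD[OF a])
  ultimately show "\<exists>T\<in>bounded_ops. \<forall>\<xi> p. Rep_ell2 (blinfun_apply T \<xi>) p = Rep_ell2 (blinfun_apply a (slice \<xi> (r p))) (l p)"
    by (intro bexI[of _ "Blinfun f"] bounded_opsI) (simp_all add: f(1))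
qed

section \<open>The tensor product of two operators\<close>

lemma Rep_ell2_tensor: "Rep_ell2 (ell2_tensor x y) (i, j) = Rep_ell2 x i * Rep_ell2 y j"
  by (simp add: ell2_tensor.rep_eq)

lemma ell2_tensor_ket: "ell2_tensor (ket i) (ket j) = ket (i, j)"
  by (rule ell2_eqI) (auto simp: ell2_tensor.rep_eq Rep_ket split: prod.splits)

text \<open>The witness is the product of the amplification of \<open>a\<close> in the first
  coordinate with that of \<open>b\<close> in the second.\<close>

lemma oper_tensor_exists:
  fixes a :: "'a oper" and b :: "'b oper"
  assumes a: "a \<in> bounded_ops" and b: "b \<in> bounded_ops"
  shows "\<exists>T\<in>bounded_ops. \<forall>x y. blinfun_apply T (ell2_tensor x y) = ell2_tensor (blinfun_apply a x) (blinfun_apply b y)"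
proof -
  let ?sa = "\<lambda>\<xi> j. Abs_ell2 (\<lambda>i. Rep_ell2 \<xi> (i, j))" and ?sb = "\<lambda>\<xi> i. Abs_ell2 (\<lambda>j. Rep_ell2 \<xi> (i, j))"
  obtain S :: "('a \<times> 'b) oper" where S: "S \<in> bounded_ops" "\<And>\<xi> p. Rep_ell2 (blinfun_apply S \<xi>) p = Rep_ell2 (blinfun_apply a (?sa \<xi> (snd p))) (fst p)"
  proof -
    have "\<exists>S\<in>bounded_ops. \<forall>\<xi> (p :: 'a \<times> 'b). Rep_ell2 (blinfun_apply S \<xi>) p = Rep_ell2 (blinfun_apply a (?sa \<xi> (snd p))) (fst p)"
      by (rule amplify_exists(1)[OF a]) simp_all
    then show thesis using that by blast
  qed
  obtain T :: "('a \<times> 'b) oper" where T: "T \<in> bounded_ops" "\<And>\<xi> p. Rep_ell2 (blinfun_apply T \<xi>) p = Rep_ell2 (blinfun_apply b (?sb \<xi> (fst p))) (snd p)"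
  proof -
    have "\<exists>T\<in>bounded_ops. \<forall>\<xi> (p :: 'a \<times> 'b). Rep_ell2 (blinfun_apply T \<xi>) p = Rep_ell2 (blinfun_apply b (?sb \<xi> (fst p))) (snd p)"
      by (rule amplify_exists(1)[OF b]) simp_all
    then show thesis using that by blast
  qed
  have sa: "?sa (ell2_tensor x y) j = scaleC (Rep_ell2 y j) x" for x :: "'a ell2" and y :: "'b ell2" and j
    using amplify_exists(2)[OF a, of Pair fst snd "ell2_tensor x y"]
    by (intro ell2_eqI) (simp add: Rep_ell2_tensor)
  have sb: "?sb (ell2_tensor x y) i = scaleC (Rep_ell2 x i) y" for x :: "'a ell2" and y :: "'b ell2" and i
    using amplify_exists(2)[OF b, of "\<lambda>j i. (i, j)" snd fst "ell2_tensor x y"]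
    by (intro ell2_eqI) (simp add: Rep_ell2_tensor)
  have "blinfun_apply T (ell2_tensor x y) = ell2_tensor x (blinfun_apply b y)" for x y
  proof (rule ell2_eqI)
    fix p
    have "Rep_ell2 (blinfun_apply T (ell2_tensor x y)) p = Rep_ell2 (scaleC (Rep_ell2 x (fst p)) (blinfun_apply b y)) (snd p)"
      using T(2)[of "ell2_tensor x y" p] sb[of x y "fst p"] bounded_opsD[OF b] by metis
    then show "Rep_ell2 (blinfun_apply T (ell2_tensor x y)) p = Rep_ell2 (ell2_tensor x (blinfun_apply b y)) p"
      by (cases p) (simp add: Rep_ell2_tensor)
  qed
  moreover have "blinfun_apply S (ell2_tensor x y) = ell2_tensor (blinfun_apply a x) y" for x y
  proof (rule ell2_eqI)
    fix p
    have "Rep_ell2 (blinfun_apply S (ell2_tensor x y)) p = Rep_ell2 (scaleC (Rep_ell2 y (snd p)) (blinfun_apply a x)) (fst p)"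
      using S(2)[of "ell2_tensor x y" p] sa[of x y "snd p"] bounded_opsD[OF a] by metis
    then show "Rep_ell2 (blinfun_apply S (ell2_tensor x y)) p = Rep_ell2 (ell2_tensor (blinfun_apply a x) y) p"
      by (cases p) (simp add: Rep_ell2_tensor)
  qed
  ultimately show ?thesis
    by (intro bexI[of _ "S o\<^sub>L T"]) (simp_all add: bounded_ops_compose S T)
qed

lemma oper_tensor_eqI:
  assumes "S \<in> bounded_ops" "T \<in> bounded_ops"
    "\<And>x y. blinfun_apply S (ell2_tensor x y) = blinfun_apply T (ell2_tensor x y)"
  shows "S = T"
  by (rule bounded_ops_eqI[OF assms(1,2)]) (metis assms(3) ell2_tensor_ket surj_pair)

lemma oper_tensor:
  fixes a :: "'i oper" and b :: "'j oper"
  assumes "a \<in> bounded_ops" "b \<in> bounded_ops"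
  shows oper_tensor_bounded: "oper_tensor a b \<in> bounded_ops"
    and oper_tensor_apply: "blinfun_apply (oper_tensor a b) (ell2_tensor x y) = ell2_tensor (blinfun_apply a x) (blinfun_apply b y)"
proof -
  let ?P = "\<lambda>T :: ('i \<times> 'j) oper. T \<in> bounded_ops \<and> (\<forall>x y. blinfun_apply T (ell2_tensor x y) = ell2_tensor (blinfun_apply a x) (blinfun_apply b y))"
  have "\<exists>!T. ?P T"
    using oper_tensor_exists[OF assms] by (metis (no_types, lifting) oper_tensor_eqI)
  from theI'[OF this] show "oper_tensor a b \<in> bounded_ops"
    "blinfun_apply (oper_tensor a b) (ell2_tensor x y) = ell2_tensor (blinfun_apply a x) (blinfun_apply b y)"
    unfolding oper_tensor_def by blast+
qed

lemma ell2_tensor_add: "ell2_tensor (x + x') y = ell2_tensor x y + ell2_tensor x' y"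
  "ell2_tensor x (y + y') = ell2_tensor x y + ell2_tensor x y'"
  by (auto intro!: ell2_eqI simp: ell2_tensor.rep_eq algebra_simps split: prod.splits)

lemma ell2_tensor_scaleC: "ell2_tensor (scaleC c x) y = scaleC c (ell2_tensor x y)"
  "ell2_tensor x (scaleC c y) = scaleC c (ell2_tensor x y)"
  by (auto intro!: ell2_eqI simp: ell2_tensor.rep_eq algebra_simps split: prod.splits)

lemma oper_tensor_add_left:
  assumes "a \<in> bounded_ops" "a' \<in> bounded_ops" "b \<in> bounded_ops"
  shows "oper_tensor (a + a') b = oper_tensor a b + oper_tensor a' b"
  by (rule oper_tensor_eqI) (simp_all add: oper_tensor assms bounded_ops_add blinfun.add_left ell2_tensor_add)

lemma oper_tensor_add_right:
  assumes "a \<in> bounded_ops" "b \<in> bounded_ops" "b' \<in> bounded_ops"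
  shows "oper_tensor a (b + b') = oper_tensor a b + oper_tensor a b'"
  by (rule oper_tensor_eqI) (simp_all add: oper_tensor assms bounded_ops_add blinfun.add_left ell2_tensor_add)

lemma oper_tensor_scaleC:
  assumes "a \<in> bounded_ops" "b \<in> bounded_ops"
  shows "oper_tensor (scaleC_oper c a) b = scaleC_oper c (oper_tensor a b)"
    "oper_tensor a (scaleC_oper c b) = scaleC_oper c (oper_tensor a b)"
  by (rule oper_tensor_eqI;
      simp add: oper_tensor assms bounded_ops_scaleC scaleC_oper_apply ell2_tensor_scaleC)+

lemma oper_tensor_compose:
  assumes "a \<in> bounded_ops" "a' \<in> bounded_ops" "b \<in> bounded_ops" "b' \<in> bounded_ops"
  shows "oper_tensor a b o\<^sub>L oper_tensor a' b' = oper_tensor (a o\<^sub>L a') (b o\<^sub>L b')"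
  by (rule oper_tensor_eqI) (simp_all add: oper_tensor assms bounded_ops_compose)

lemma oper_tensor_ket:
  assumes "a \<in> bounded_ops" "b \<in> bounded_ops"
  shows "Rep_ell2 (blinfun_apply (oper_tensor a b) (ket (k, l))) (i, j)
    = Rep_ell2 (blinfun_apply a (ket k)) i * Rep_ell2 (blinfun_apply b (ket l)) j"
  by (simp add: oper_tensor_apply[OF assms] Rep_ell2_tensor flip: ell2_tensor_ket)

lemma Rep_adjoint_ket:
  assumes "T \<in> bounded_ops"
  shows "Rep_ell2 (blinfun_apply (adjoint_oper T) (ket j)) i = cnj (Rep_ell2 (blinfun_apply T (ket i)) j)"
  using cinner_adjoint_right[OF assms, of "ket i" "ket j"] by simp

text \<open>Both sides have the same matrix: an entry of a tensor product is a product of entries,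
  and the adjoint transposes and conjugates entries.\<close>

lemma adjoint_oper_tensor:
  fixes a :: "'i oper" and b :: "'j oper"
  assumes "a \<in> bounded_ops" "b \<in> bounded_ops"
  shows "adjoint_oper (oper_tensor a b) = oper_tensor (adjoint_oper a) (adjoint_oper b)"
proof (rule bounded_ops_eqI)
  note bd = assms adjoint_bounded_ops[OF assms(1)] adjoint_bounded_ops[OF assms(2)]
  fix p :: "'i \<times> 'j"
  obtain k l where p: "p = (k, l)" by fastforce
  show "blinfun_apply (adjoint_oper (oper_tensor a b)) (ket p) = blinfun_apply (oper_tensor (adjoint_oper a) (adjoint_oper b)) (ket p)"
  proof (rule ell2_eqI)
    fix q :: "'i \<times> 'j"
    obtain i j where q: "q = (i, j)" by fastforce
    show "Rep_ell2 (blinfun_apply (adjoint_oper (oper_tensor a b)) (ket p)) q =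
      Rep_ell2 (blinfun_apply (oper_tensor (adjoint_oper a) (adjoint_oper b)) (ket p)) q"
      unfolding p q by (simp add: Rep_adjoint_ket oper_tensor_bounded oper_tensor_ket bd)
  qed
qed (simp_all add: assms oper_tensor_bounded adjoint_bounded_ops)

lemma oper_tensor_id: "oper_tensor id_blinfun id_blinfun = id_blinfun"
  by (rule oper_tensor_eqI) (simp_all add: oper_tensor)

lemma norm_ell2_inj:
  fixes \<iota> :: "'j \<Rightarrow> 'k"
  assumes inj: "inj \<iota>" and on: "\<And>j. Rep_ell2 w (\<iota> j) = Rep_ell2 v j" and off: "\<And>p. p \<notin> range \<iota> \<Longrightarrow> Rep_ell2 w p = 0"
  shows "norm w = norm v"
proof (rule antisym)
  show "norm v \<le> norm w"
  proof (rule norm_ell2_le, rule L2_set_le_sqrt)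
    fix F :: "'j set" assume "finite F"
    then have "(\<Sum>p\<in>\<iota> ` F. (cmod (Rep_ell2 w p))\<^sup>2) \<le> (norm w)\<^sup>2" by (intro sum_le_norm_sq) auto
    then show "(\<Sum>j\<in>F. (cmod (Rep_ell2 v j))\<^sup>2) \<le> (norm w)\<^sup>2"
      using inj by (subst (asm) sum.reindex) (auto intro: inj_on_subset simp: on)
  qed simp
  show "norm w \<le> norm v"
  proof (rule norm_ell2_le, rule L2_set_le_sqrt)
    fix F :: "'k set" assume F: "finite F"
    let ?G = "\<iota> -` F"
    have "(\<Sum>p\<in>F. (cmod (Rep_ell2 w p))\<^sup>2) = (\<Sum>p\<in>\<iota> ` ?G. (cmod (Rep_ell2 w p))\<^sup>2)"
      using F off by (intro sum.mono_neutral_right) auto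
    also have "\<dots> = (\<Sum>j\<in>?G. (cmod (Rep_ell2 v j))\<^sup>2)"
      using inj by (subst sum.reindex) (auto intro: inj_on_subset simp: on)
    also have "\<dots> \<le> (norm v)\<^sup>2" using F inj by (intro sum_le_norm_sq finite_vimageI)
    finally show "(\<Sum>p\<in>F. (cmod (Rep_ell2 w p))\<^sup>2) \<le> (norm v)\<^sup>2" .
  qed simp
qed

lemma norm_ell2_tensor_ket: "norm (ell2_tensor (ket i) v) = norm v" "norm (ell2_tensor v (ket i)) = norm v"
  by (rule norm_ell2_inj[of "Pair i"]; force simp: inj_on_def ell2_tensor.rep_eq Rep_ket split: prod.splits)
    (rule norm_ell2_inj[of "\<lambda>j. (j, i)"]; force simp: inj_on_def ell2_tensor.rep_eq Rep_ket split: prod.splits)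

text \<open>Tensoring with \<open>ket i\<close> embeds the space isometrically, and on the image the
  tensor product acts as \<open>b\<close>. This bounds the minimal norm from below on the corners
  cut out by basis projections.\<close>

lemma norm_le_oper_tensor_basis_proj:
  assumes "b \<in> bounded_ops"
  shows "norm b \<le> norm (oper_tensor (basis_proj i) b)" "norm b \<le> norm (oper_tensor b (basis_proj i))"
proof -
  show "norm b \<le> norm (oper_tensor (basis_proj i) b)"
  proof (rule norm_blinfun_bound)
    fix v
    have "norm (blinfun_apply b v) = norm (blinfun_apply (oper_tensor (basis_proj i) b) (ell2_tensor (ket i) v))"
      by (simp add: oper_tensor_apply basis_proj_bounded assms basis_proj_ket norm_ell2_tensor_ket)
    also have "\<dots> \<le> norm (oper_tensor (basis_proj i) b) * norm (ell2_tensor (ket i) v)" by (rule norm_blinfun)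
    finally show "norm (blinfun_apply b v) \<le> norm (oper_tensor (basis_proj i) b) * norm v"
      by (simp add: norm_ell2_tensor_ket)
  qed simp
  show "norm b \<le> norm (oper_tensor b (basis_proj i))"
  proof (rule norm_blinfun_bound)
    fix v
    have "norm (blinfun_apply b v) = norm (blinfun_apply (oper_tensor b (basis_proj i)) (ell2_tensor v (ket i)))"
      by (simp add: oper_tensor_apply basis_proj_bounded assms basis_proj_ket norm_ell2_tensor_ket)
    also have "\<dots> \<le> norm (oper_tensor b (basis_proj i)) * norm (ell2_tensor v (ket i))" by (rule norm_blinfun)
    finally show "norm (blinfun_apply b v) \<le> norm (oper_tensor b (basis_proj i)) * norm v"
      by (simp add: norm_ell2_tensor_ket)
  qed simp
qed

section \<open>The algebraic tensor product as an algebra of operators\<close>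

text \<open>The sum that \<open>tensor_lift\<close> evaluates on the members of a class, here as a
  map on formal sums, where it is linear before any quotient is taken.\<close>

definition linear_ext :: "('a \<Rightarrow> 'b \<Rightarrow> 'k oper) \<Rightarrow> (('a \<times> 'b) \<Rightarrow>\<^sub>0 complex) \<Rightarrow> 'k oper" where
  "linear_ext \<phi> f = (\<Sum>(a, b)\<in>Poly_Mapping.keys f. scaleC_oper (Poly_Mapping.lookup f (a, b)) (\<phi> a b))"

lemma linear_ext_add: "linear_ext \<phi> (f + g) = linear_ext \<phi> f + linear_ext \<phi> g"
  unfolding linear_ext_def case_prod_unfold prod.collapse
  by (rule Poly_Mapping.setsum_keys_plus_distrib[where f = "\<lambda>p c. scaleC_oper c (\<phi> (fst p) (snd p))"])
    (simp_all add: scaleC_oper_add_left)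

lemma linear_ext_zero [simp]: "linear_ext \<phi> 0 = 0"
  by (simp add: linear_ext_def)

lemma linear_ext_diff: "linear_ext \<phi> (f - g) = linear_ext \<phi> f - linear_ext \<phi> g"
  using linear_ext_add[of \<phi> "f - g" g] by (simp add: algebra_simps)

lemma linear_ext_single: "linear_ext \<phi> (Poly_Mapping.single (a, b) z) = scaleC_oper z (\<phi> a b)"
  by (cases "z = 0") (simp_all add: linear_ext_def)

lemma linear_ext_sum: "linear_ext \<phi> (sum f I) = (\<Sum>i\<in>I. linear_ext \<phi> (f i))"
  by (induction I rule: infinite_finite_induct) (auto simp: linear_ext_add)

section \<open>The bilinearity relations and the faithfulness of the spatial map\<close>

abbreviation "A_null \<equiv> tensor_null A_alg A_alg"

text \<open>\<open>tensor_null\<close> is generated by sums only; negatives come from the arbitrary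
  coefficient \<open>z\<close> in its generators.\<close>

lemma A_null_uminus: "f \<in> A_null \<Longrightarrow> - f \<in> A_null"
proof (induction rule: tensor_null.induct)
  case (left_add a a' b z)
  then show ?case using tensor_null.left_add[OF left_add, where z = "- z"] by (simp add: single_uminus algebra_simps)
next
  case (right_add a b b' z)
  then show ?case using tensor_null.right_add[OF right_add, where z = "- z"] by (simp add: single_uminus algebra_simps)
next
  case (left_smult a b c z)
  then show ?case using tensor_null.left_smult[OF left_smult, where z = "- z" and c = c] by (simp add: single_uminus algebra_simps)
next
  case (right_smult a b c z)
  then show ?case using tensor_null.right_smult[OF right_smult, where z = "- z" and c = c] by (simp add: single_uminus algebra_simps)
next
  case (null_plus f g)
  then show ?case using tensor_null.null_plus[OF null_plus.IH] by simp
qed (simp add: tensor_null.null_zero)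

lemma A_null_diff: "f \<in> A_null \<Longrightarrow> g \<in> A_null \<Longrightarrow> f - g \<in> A_null"
  using tensor_null.null_plus[of f A_alg A_alg "- g"] A_null_uminus[of g] by simp

lemma A_null_sum: "(\<And>i. i \<in> I \<Longrightarrow> f i \<in> A_null) \<Longrightarrow> sum f I \<in> A_null"
  by (induction I rule: infinite_finite_induct) (auto intro: tensor_null.intros)

abbreviation pure :: "'a \<Rightarrow> 'b \<Rightarrow> ('a \<times> 'b) \<Rightarrow>\<^sub>0 complex" where
  "pure a b \<equiv> Poly_Mapping.single (a, b) 1"

lemma A_null_scalar:
  assumes "a \<in> carrier A_alg" "b \<in> carrier A_alg"
  shows "Poly_Mapping.single (a, b) z - pure (scaleC_oper z a) b \<in> A_null"
    "pure a (scaleC_oper c b) - pure (scaleC_oper c a) b \<in> A_null"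
proof -
  have *: "pure (scaleC_oper c a) b - Poly_Mapping.single (a, b) c \<in> A_null" for c
    using tensor_null.left_smult[of a A_alg b A_alg c 1] assms by simp
  from A_null_uminus[OF this[of z]] show "Poly_Mapping.single (a, b) z - pure (scaleC_oper z a) b \<in> A_null" by simp
  have "pure a (scaleC_oper c b) - Poly_Mapping.single (a, b) c \<in> A_null"
    using tensor_null.right_smult[of a A_alg b A_alg c 1] assms by simp
  from A_null_diff[OF this *[of c]] show "pure a (scaleC_oper c b) - pure (scaleC_oper c a) b \<in> A_null" by simp
qed

lemma A_null_zero_left: "b \<in> carrier A_alg \<Longrightarrow> pure 0 b \<in> A_null"
  using tensor_null.left_smult[of 0 A_alg b A_alg 0 1] by (simp add: zero_A)

lemma A_null_sum_right:
  assumes "finite I" "a \<in> carrier A_alg" "\<And>i. i \<in> I \<Longrightarrow> f i \<in> carrier A_alg"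
  shows "pure a (sum f I) - (\<Sum>i\<in>I. pure a (f i)) \<in> A_null"
  using assms(1,3)
proof (induction I rule: finite_induct)
  case empty
  then show ?case using tensor_null.right_smult[of a A_alg 0 A_alg 0 1] assms(2) by (simp add: zero_A)
next
  case (insert i I)
  then have "pure a (f i + sum f I) - pure a (f i) - pure a (sum f I) \<in> A_null"
    using tensor_null.right_add[of a A_alg "f i" A_alg "sum f I" 1] assms(2) by (simp add: sum_A)
  from tensor_null.null_plus[OF this insert.IH] insert show ?case by (simp add: algebra_simps)
qed

lemma sum_oper_tensor_right:
  "a \<in> bounded_ops \<Longrightarrow> (\<And>i. i \<in> I \<Longrightarrow> f i \<in> bounded_ops) \<Longrightarrow> finite I \<Longrightarrow>
    oper_tensor a (sum f I) = (\<Sum>i\<in>I. oper_tensor a (f i))"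
proof (induction I rule: infinite_finite_induct)
  case empty
  then show ?case using oper_tensor_scaleC(2)[of a 0 0] by simp
qed (simp_all add: oper_tensor_add_right bounded_ops_sum)

text \<open>Eliminating one term at a time: if a term \<open>a\<^sub>k \<otimes> b\<^sub>k\<close> with \<open>a\<^sub>k \<noteq> 0\<close> occurs in a vanishing sum
  of operators, a matrix coefficient of \<open>a\<^sub>k\<close> expresses \<open>b\<^sub>k\<close> by the other \<open>b\<^sub>i\<close>.\<close>

lemma tensor_independence:
  fixes a b :: "'k \<Rightarrow> free2 oper"
  assumes "finite I" "\<And>i. i \<in> I \<Longrightarrow> a i \<in> carrier A_alg" "\<And>i. i \<in> I \<Longrightarrow> b i \<in> carrier A_alg"
    "(\<Sum>i\<in>I. oper_tensor (a i) (b i)) = 0"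
  shows "(\<Sum>i\<in>I. pure (a i) (b i)) \<in> A_null"
  using assms
proof (induction "card I" arbitrary: I a rule: less_induct)
  case less
  note aA = less.prems(2) and bA = less.prems(3)
  show ?case
  proof (cases "\<forall>i\<in>I. a i = 0")
    case True
    then have "(\<Sum>i\<in>I. pure (a i) (b i)) = (\<Sum>i\<in>I. pure 0 (b i))" by simp
    then show ?thesis using bA by (auto intro!: A_null_sum A_null_zero_left)
  next
    case False
    then obtain k where k: "k \<in> I" "a k \<noteq> 0" by blast
    obtain p q where pq: "Rep_ell2 (blinfun_apply (a k) (ket q)) p \<noteq> 0"
    proof (rule ccontr)
      assume *: "\<not> thesis"
      then have "Rep_ell2 (blinfun_apply (a k) (ket q)) p = 0" for p q using that by blast
      then have "a k = 0"
        by (intro bounded_ops_eqI ell2_eqI) (use k aA in \<open>auto simp: A_bounded\<close>)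
      with k show False by simp
    qed
    define \<mu> where "\<mu> i = Rep_ell2 (blinfun_apply (a i) (ket q)) p" for i
    \<comment> \<open>Taking the entry \<open>(p, q)\<close> in the first leg turns the vanishing
      sum into \<open>\<Sum> \<mu> i b i = 0\<close>; solving for \<open>b k\<close> gives
      \<open>b k = \<Sum> c i b i\<close> over the other indices.\<close>
    define c where "c i = - (\<mu> i / \<mu> k)" for i
    let ?J = "I - {k}"
    have J: "finite ?J" "card ?J < card I" using card_Diff1_less[OF less.prems(1) k(1)] less.prems(1) by auto
    have bb: "b i \<in> bounded_ops" "a i \<in> bounded_ops" if "i \<in> I" for i using that aA bA by (auto simp: A_bounded)
    have "(\<Sum>i\<in>I. scaleC_oper (\<mu> i) (b i)) = 0"
    proof (rule bounded_ops_eqI)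
      fix s
      show "blinfun_apply (\<Sum>i\<in>I. scaleC_oper (\<mu> i) (b i)) (ket s) = blinfun_apply 0 (ket s)"
      proof (rule ell2_eqI)
        fix r
        have "Rep_ell2 (blinfun_apply (\<Sum>i\<in>I. oper_tensor (a i) (b i)) (ket (q, s))) (p, r) = 0"
          using less.prems(4) by simp
        then have "(\<Sum>i\<in>I. \<mu> i * Rep_ell2 (blinfun_apply (b i) (ket s)) r) = 0"
          using bb by (simp add: blinfun.sum_left oper_tensor_ket \<mu>_def)
        then show "Rep_ell2 (blinfun_apply (\<Sum>i\<in>I. scaleC_oper (\<mu> i) (b i)) (ket s)) r = Rep_ell2 (blinfun_apply 0 (ket s)) r"
          by (simp add: blinfun.sum_left scaleC_oper_apply)
      qed
    qed (auto intro!: bounded_ops_sum bounded_ops_scaleC bb)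
    then have "scaleC_oper (\<mu> k) (b k) + (\<Sum>i\<in>?J. scaleC_oper (\<mu> i) (b i)) = 0"
      using sum.remove[OF less.prems(1) k(1)] by metis
    then have "scaleC_oper (inverse (\<mu> k)) (scaleC_oper (\<mu> k) (b k) + (\<Sum>i\<in>?J. scaleC_oper (\<mu> i) (b i))) = 0" by simp
    then have "b k + (\<Sum>i\<in>?J. scaleC_oper (inverse (\<mu> k) * \<mu> i) (b i)) = 0"
      using pq by (simp add: scaleC_oper_add_right scaleC_oper_sum \<mu>_def[of k])
    then have bk: "b k = (\<Sum>i\<in>?J. scaleC_oper (c i) (b i))"
      by (simp add: c_def scaleC_oper_minus_left sum_negf eq_neg_iff_add_eq_0 divide_inverse mult.commute)
    \<comment> \<open>Substituting for \<open>b k\<close> distributes the term of index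
      \<open>k\<close> over the others: \<open>a i\<close> becomes \<open>a i + c i a k\<close>, and
      the index set loses \<open>k\<close>.\<close>
    define a' where "a' i = a i + scaleC_oper (c i) (a k)" for i
    have a'A: "a' i \<in> carrier A_alg" if "i \<in> I" for i
      using that k aA by (simp add: a'_def quotient_map_add quotient_map_scaleC)
    have "(\<Sum>i\<in>?J. oper_tensor (a' i) (b i)) = (\<Sum>i\<in>?J. oper_tensor (a i) (b i)) + (\<Sum>i\<in>?J. oper_tensor (a k) (scaleC_oper (c i) (b i)))"
      using k(1) unfolding sum.distrib[symmetric]
      by (intro sum.cong) (simp_all add: a'_def oper_tensor_add_left oper_tensor_scaleC bb bounded_ops_scaleC)
    also have "\<dots> = (\<Sum>i\<in>?J. oper_tensor (a i) (b i)) + oper_tensor (a k) (b k)"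
      unfolding bk using k(1) less.prems(1)
      by (subst sum_oper_tensor_right) (auto simp: bb intro!: bounded_ops_scaleC)
    also have "\<dots> = 0" using less.prems(4) sum.remove[OF less.prems(1) k(1), of "\<lambda>i. oper_tensor (a i) (b i)"]
      by (simp add: add.commute)
    finally have IH: "(\<Sum>i\<in>?J. pure (a' i) (b i)) \<in> A_null"
      using a'A bA by (intro less.hyps[OF J(2) J(1)]) auto
    have "pure (a' i) (b i) - pure (a i) (b i) - pure (a k) (scaleC_oper (c i) (b i)) \<in> A_null" if i: "i \<in> I" for i
    proof -
      have 1: "pure (a' i) (b i) - pure (a i) (b i) - pure (scaleC_oper (c i) (a k)) (b i) \<in> A_null"
        using tensor_null.left_add[of "a i" A_alg "scaleC_oper (c i) (a k)" "b i" A_alg 1] i k aA bA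
        by (simp add: a'_def quotient_map_scaleC)
      have 2: "pure (a k) (scaleC_oper (c i) (b i)) - pure (scaleC_oper (c i) (a k)) (b i) \<in> A_null"
        using i k aA bA by (intro A_null_scalar) auto
      from A_null_diff[OF 1 2] show ?thesis by (simp add: algebra_simps)
    qed
    then have "(\<Sum>i\<in>?J. pure (a' i) (b i) - pure (a i) (b i) - pure (a k) (scaleC_oper (c i) (b i))) \<in> A_null"
      by (intro A_null_sum) auto
    from A_null_diff[OF IH this]
    have 3: "(\<Sum>i\<in>?J. pure (a i) (b i)) + (\<Sum>i\<in>?J. pure (a k) (scaleC_oper (c i) (b i))) \<in> A_null"
      by (simp add: sum.distrib[symmetric] sum_subtractf[symmetric] algebra_simps)
    have "pure (a k) (b k) - (\<Sum>i\<in>?J. pure (a k) (scaleC_oper (c i) (b i))) \<in> A_null"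
      unfolding bk using k J aA bA by (intro A_null_sum_right) (auto simp: quotient_map_scaleC)
    from tensor_null.null_plus[OF 3 this] have "(\<Sum>i\<in>?J. pure (a i) (b i)) + pure (a k) (b k) \<in> A_null"
      by (simp add: algebra_simps)
    then show ?thesis using sum.remove[OF less.prems(1) k(1), of "\<lambda>i. pure (a i) (b i)"] by (simp add: add.commute)
  qed
qed

abbreviation "A_sums \<equiv> formal_sums (carrier A_alg) (carrier A_alg)"

lemma poly_mapping_eq_sum: "f = (\<Sum>p\<in>Poly_Mapping.keys f. Poly_Mapping.single p (Poly_Mapping.lookup f p))"
  by (rule poly_mapping_eqI) (simp add: lookup_sum lookup_single when_def in_keys_iff)

text \<open>Once the coefficients are absorbed into the left factors, linear independence applies.
  Hence the spatial representation is faithful on \<open>A \<odot> A\<close>, and identities between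
  classes of formal sums can be verified between operators.\<close>

lemma linear_ext_kernel:
  assumes f: "f \<in> A_sums" and zero: "linear_ext oper_tensor f = 0"
  shows "f \<in> A_null"
proof -
  let ?K = "Poly_Mapping.keys f" and ?z = "Poly_Mapping.lookup f"
  have K: "fst p \<in> carrier A_alg" "snd p \<in> carrier A_alg" if "p \<in> ?K" for p
    using f that by (auto simp: formal_sums_def)
  have "(\<Sum>p\<in>?K. pure (scaleC_oper (?z p) (fst p)) (snd p)) \<in> A_null"
  proof (rule tensor_independence)
    show "(\<Sum>p\<in>?K. oper_tensor (scaleC_oper (?z p) (fst p)) (snd p)) = 0"
      using zero K by (simp add: linear_ext_def case_prod_unfold oper_tensor_scaleC A_bounded)
  qed (auto simp: K quotient_map_scaleC)
  moreover have "(\<Sum>p\<in>?K. Poly_Mapping.single p (?z p) - pure (scaleC_oper (?z p) (fst p)) (snd p)) \<in> A_null"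
    using A_null_scalar(1)[OF K] by (intro A_null_sum) auto
  ultimately have "(\<Sum>p\<in>?K. pure (scaleC_oper (?z p) (fst p)) (snd p)) +
    (\<Sum>p\<in>?K. Poly_Mapping.single p (?z p) - pure (scaleC_oper (?z p) (fst p)) (snd p)) \<in> A_null"
    by (rule tensor_null.null_plus)
  then have "(\<Sum>p\<in>?K. Poly_Mapping.single p (?z p)) \<in> A_null" by (simp add: sum_subtractf)
  then show ?thesis using poly_mapping_eq_sum[of f] by simp
qed

section \<open>C*-normed algebras and their completions\<close>

text \<open>\<open>cstar_norm\<close> speaks of the norm only; this adds the *-algebra axioms. The
  locale is used for the tensor square under different norms as well as for its completion, so that
  commutants and norm estimates are available on both levels.\<close>

locale cstar_normed = ring M for M :: "('a, 'm) star_algebra_scheme" (structure) +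
  fixes p :: "'a \<Rightarrow> real"
  assumes smult_closed [simp]: "x \<in> carrier M \<Longrightarrow> c \<odot> x \<in> carrier M"
    and smult_r_distr: "x \<in> carrier M \<Longrightarrow> y \<in> carrier M \<Longrightarrow> c \<odot> (x \<oplus> y) = c \<odot> x \<oplus> c \<odot> y"
    and smult_l_distr: "x \<in> carrier M \<Longrightarrow> (c + d) \<odot> x = c \<odot> x \<oplus> d \<odot> x"
    and smult_smult: "x \<in> carrier M \<Longrightarrow> c \<odot> (d \<odot> x) = (c * d) \<odot> x"
    and smult_one [simp]: "x \<in> carrier M \<Longrightarrow> 1 \<odot> x = x"
    and smult_mult_left: "x \<in> carrier M \<Longrightarrow> y \<in> carrier M \<Longrightarrow> (c \<odot> x) \<otimes> y = c \<odot> (x \<otimes> y)"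
    and smult_mult_right: "x \<in> carrier M \<Longrightarrow> y \<in> carrier M \<Longrightarrow> x \<otimes> (c \<odot> y) = c \<odot> (x \<otimes> y)"
    and star_closed [simp]: "x \<in> carrier M \<Longrightarrow> star M x \<in> carrier M"
    and star_star [simp]: "x \<in> carrier M \<Longrightarrow> star M (star M x) = x"
    and star_add: "x \<in> carrier M \<Longrightarrow> y \<in> carrier M \<Longrightarrow> star M (x \<oplus> y) = star M x \<oplus> star M y"
    and star_smult: "x \<in> carrier M \<Longrightarrow> star M (c \<odot> x) = cnj c \<odot> star M x"
    and star_mult: "x \<in> carrier M \<Longrightarrow> y \<in> carrier M \<Longrightarrow> star M (x \<otimes> y) = star M y \<otimes> star M x"
    and cstar_norm: "cstar_norm M p"
begin

lemma p_nonneg [simp]: "x \<in> carrier M \<Longrightarrow> 0 \<le> p x"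
  and p_eq_0: "x \<in> carrier M \<Longrightarrow> p x = 0 \<longleftrightarrow> x = \<zero>"
  and p_add: "x \<in> carrier M \<Longrightarrow> y \<in> carrier M \<Longrightarrow> p (x \<oplus> y) \<le> p x + p y"
  and p_smult: "x \<in> carrier M \<Longrightarrow> p (c \<odot> x) = cmod c * p x"
  and p_mult: "x \<in> carrier M \<Longrightarrow> y \<in> carrier M \<Longrightarrow> p (x \<otimes> y) \<le> p x * p y"
  and p_cstar: "x \<in> carrier M \<Longrightarrow> p (star M x \<otimes> x) = (p x)\<^sup>2"
  using cstar_norm by (auto simp: cstar_norm_def)

lemma p_zero [simp]: "p \<zero> = 0" by (simp add: p_eq_0)

lemma smult_zero_left [simp]: "x \<in> carrier M \<Longrightarrow> 0 \<odot> x = \<zero>"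
  using smult_l_distr[of x 0 0] by (metis add_0 add.r_cancel_one' smult_closed)

lemma smult_minus_one: "x \<in> carrier M \<Longrightarrow> (- 1) \<odot> x = \<ominus> x"
  using smult_l_distr[of x "- 1" 1] by (simp add: minus_equality)

lemma p_uminus: "x \<in> carrier M \<Longrightarrow> p (\<ominus> x) = p x"
  by (simp add: p_smult flip: smult_minus_one)

lemma p_minus: "x \<in> carrier M \<Longrightarrow> y \<in> carrier M \<Longrightarrow> p (x \<ominus> y) \<le> p x + p y"
  using p_add[of x "\<ominus> y"] by (simp add: p_uminus minus_eq)

lemma p_minus_commute: "x \<in> carrier M \<Longrightarrow> y \<in> carrier M \<Longrightarrow> p (x \<ominus> y) = p (y \<ominus> x)"
  using p_uminus[of "x \<ominus> y"] by (simp add: minus_eq minus_add add.m_comm)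

lemma minus_triangle:
  "x \<in> carrier M \<Longrightarrow> y \<in> carrier M \<Longrightarrow> z \<in> carrier M \<Longrightarrow> x \<ominus> z = (x \<ominus> y) \<oplus> (y \<ominus> z)"
  by algebra

lemma p_triangle:
  "x \<in> carrier M \<Longrightarrow> y \<in> carrier M \<Longrightarrow> z \<in> carrier M \<Longrightarrow> p (x \<ominus> z) \<le> p (x \<ominus> y) + p (y \<ominus> z)"
  using p_add[of "x \<ominus> y" "y \<ominus> z"] by (simp flip: minus_triangle)

lemma p_diff_le: "x \<in> carrier M \<Longrightarrow> y \<in> carrier M \<Longrightarrow> \<bar>p x - p y\<bar> \<le> p (x \<ominus> y)"
  using p_triangle[of x y \<zero>] p_triangle[of y x \<zero>] p_minus_commute[of x y] by (simp add: minus_eq)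

text \<open>Isometry of the involution is not a clause of \<open>cstar_norm\<close>; it comes from
  the C*-identity and submultiplicativity after cancelling \<open>p x\<close>.\<close>

lemma p_star: "x \<in> carrier M \<Longrightarrow> p (star M x) = p x"
proof -
  have le: "p x \<le> p (star M x)" if "x \<in> carrier M" for x
  proof (cases "p x = 0")
    case False
    have "p x * p x \<le> p (star M x) * p x"
      using p_mult[of "star M x" x] that by (simp add: p_cstar power2_eq_square)
    moreover have "p x > 0" using False p_nonneg[OF that] by linarith
    ultimately show ?thesis by simp
  qed (use that in simp)
  show "x \<in> carrier M \<Longrightarrow> p (star M x) = p x" using le[of x] le[of "star M x"] by simp
qed

lemma star_uminus: "x \<in> carrier M \<Longrightarrow> star M (\<ominus> x) = \<ominus> star M x"
  by (simp add: star_smult flip: smult_minus_one)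

lemma star_minus: "x \<in> carrier M \<Longrightarrow> y \<in> carrier M \<Longrightarrow> star M (x \<ominus> y) = star M x \<ominus> star M y"
  by (simp add: minus_eq star_add star_uminus)

lemma star_one [simp]: "star M \<one> = \<one>"
  by (metis l_one one_closed star_closed star_mult star_star)

lemma star_zero [simp]: "star M \<zero> = \<zero>"
  by (metis star_smult smult_zero_left zero_closed star_closed complex_cnj_zero)

lemma p_one_le: "p \<one> \<le> 1"
proof -
  have "p \<one> = (p \<one>)\<^sup>2" using p_cstar[of \<one>] by simp
  then show ?thesis by (auto simp: power2_eq_square)
qed

subsection \<open>Commutants\<close>

definition commutant :: "'a set \<Rightarrow> 'a set" where
  "commutant S = {y \<in> carrier M. \<forall>s\<in>S. s \<otimes> y = y \<otimes> s}"

lemma cstar_subalgebra_commutant: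
  assumes S: "S \<subseteq> carrier M" "\<And>s. s \<in> S \<Longrightarrow> star M s \<in> S"
  shows "cstar_subalgebra M p (commutant S)"
proof -
  have S': "s \<in> carrier M" if "s \<in> S" for s using S that by blast
  have star: "star M x \<in> commutant S" if "x \<in> commutant S" for x
  proof -
    have x: "x \<in> carrier M" using that by (simp add: commutant_def)
    have "s \<otimes> star M x = star M x \<otimes> s" if s: "s \<in> S" for s
    proof -
      have "star M (star M s \<otimes> x) = star M (x \<otimes> star M s)"
        using \<open>x \<in> commutant S\<close> S(2)[OF s] by (simp add: commutant_def)
      then show ?thesis using S'[OF s] x by (simp add: star_mult)
    qed
    then show ?thesis using x by (simp add: commutant_def)
  qed
  have mult: "x \<otimes> y \<in> commutant S" if "x \<in> commutant S" "y \<in> commutant S" for x y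
  proof -
    have xy: "x \<in> carrier M" "y \<in> carrier M" using that by (simp_all add: commutant_def)
    have "s \<otimes> (x \<otimes> y) = (x \<otimes> y) \<otimes> s" if s: "s \<in> S" for s
    proof -
      have c: "s \<otimes> x = x \<otimes> s" "s \<otimes> y = y \<otimes> s" using \<open>x \<in> commutant S\<close> \<open>y \<in> commutant S\<close> s by (auto simp: commutant_def)
      then show ?thesis using xy S'[OF s] by (metis m_assoc)
    qed
    then show ?thesis using xy by (simp add: commutant_def)
  qed
  have closed: "x \<in> commutant S" if "x \<in> norm_closure M p (commutant S)" for x
  proof -
    have x: "x \<in> carrier M" and appr: "\<And>e. e > 0 \<Longrightarrow> \<exists>y\<in>commutant S. p (x \<ominus> y) < e"
      using that by (auto simp: norm_closure_def)
    have "s \<otimes> x = x \<otimes> s" if s: "s \<in> S" for s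
    proof -
      note sc = S'[OF s]
      have "p (s \<otimes> x \<ominus> x \<otimes> s) \<le> 0"
      proof (rule field_le_epsilon)
        fix e :: real assume "e > 0"
        define d where "d = e / (2 * p s + 1)"
        have den: "2 * p s + 1 > 0" using p_nonneg[OF sc] by linarith
        have "d > 0" using \<open>e > 0\<close> den by (simp add: d_def)
        then obtain y where y: "y \<in> commutant S" "p (x \<ominus> y) < d" using appr by blast
        have yc: "y \<in> carrier M" "s \<otimes> y = y \<otimes> s" using y(1) s by (auto simp: commutant_def)
        have "s \<otimes> x \<ominus> x \<otimes> s = s \<otimes> (x \<ominus> y) \<ominus> (x \<ominus> y) \<otimes> s \<oplus> (s \<otimes> y \<ominus> y \<otimes> s)"
          using sc x yc(1) by algebra
        also have "\<dots> = s \<otimes> (x \<ominus> y) \<ominus> (x \<ominus> y) \<otimes> s" using sc x yc by (simp add: minus_eq r_neg)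
        finally have "p (s \<otimes> x \<ominus> x \<otimes> s) \<le> p (s \<otimes> (x \<ominus> y)) + p ((x \<ominus> y) \<otimes> s)"
          using sc x yc by (simp add: p_minus)
        also have "\<dots> \<le> p s * p (x \<ominus> y) + p (x \<ominus> y) * p s"
          using sc x yc by (intro add_mono p_mult) auto
        also have "\<dots> = 2 * p s * p (x \<ominus> y)" by simp
        also have "\<dots> \<le> 2 * p s * d" using y(2) sc by (intro mult_left_mono) auto
        also have "\<dots> \<le> e" using \<open>e > 0\<close> den by (simp add: d_def field_simps)
        finally show "p (s \<otimes> x \<ominus> x \<otimes> s) \<le> 0 + e" by simp
      qed
      then have "p (s \<otimes> x \<ominus> x \<otimes> s) = 0" using sc x by (simp add: order_antisym)
      then have "s \<otimes> x \<ominus> x \<otimes> s = \<zero>" using sc x by (simp add: p_eq_0)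
      then show ?thesis using sc x minus_equality[of "x \<otimes> s" "\<ominus> (s \<otimes> x)"] minus_equality[of "s \<otimes> x" "\<ominus> (x \<otimes> s)"]
        by (metis a_inv_closed m_closed minus_eq minus_minus minus_equality)
    qed
    then show ?thesis using x by (simp add: commutant_def)
  qed
  have add: "x \<oplus> y \<in> commutant S" if "x \<in> commutant S" "y \<in> commutant S" for x y
    using that S' by (simp add: commutant_def l_distr r_distr)
  have smult: "c \<odot> x \<in> commutant S" if "x \<in> commutant S" for c x
    using that S' by (simp add: commutant_def smult_mult_left smult_mult_right)
  have "commutant S \<subseteq> carrier M" "\<zero> \<in> commutant S" using S' by (simp_all add: commutant_def)
  then show ?thesis
    unfolding cstar_subalgebra_def using subsetI[OF closed] by (simp add: star mult add smult)
qed

text \<open>The double commutant of \<open>E \<union> {z}\<close> is abelian.\<close>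

lemma maximal_abelian_contains:
  assumes E: "maximal_abelian M p E" and z: "z \<in> carrier M" "star M z = z" "\<And>e. e \<in> E \<Longrightarrow> z \<otimes> e = e \<otimes> z"
  shows "z \<in> E"
proof -
  have sub: "cstar_subalgebra M p E" and ab: "abelian_subset M E"
    and max: "\<And>D. cstar_subalgebra M p D \<Longrightarrow> abelian_subset M D \<Longrightarrow> E \<subseteq> D \<Longrightarrow> D = E"
    using E unfolding maximal_abelian_def by blast+
  have Ec: "E \<subseteq> carrier M" and Es: "\<And>x. x \<in> E \<Longrightarrow> star M x \<in> E" using sub by (auto simp: cstar_subalgebra_def)
  let ?S = "insert z E"
  have S: "?S \<subseteq> carrier M" "\<And>s. s \<in> ?S \<Longrightarrow> star M s \<in> ?S" using Ec Es z by auto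
  have S': "commutant ?S \<subseteq> carrier M" "\<And>s. s \<in> commutant ?S \<Longrightarrow> star M s \<in> commutant ?S"
    using cstar_subalgebra_commutant[OF S] by (auto simp: cstar_subalgebra_def)
  let ?D = "commutant (commutant ?S)"
  have SD: "?S \<subseteq> ?D"
  proof
    fix x assume x: "x \<in> ?S"
    have "x \<otimes> s = s \<otimes> x" if "s \<in> commutant ?S" for s
      using that x unfolding commutant_def by blast
    then show "x \<in> ?D" using x S(1) unfolding commutant_def[of "commutant ?S"] by auto
  qed
  have "s \<otimes> x = x \<otimes> s" if "x \<in> ?S" "s \<in> ?S" for x s
    using that ab z(3) unfolding abelian_subset_def by auto
  \<comment> \<open>Forming commutants reverses inclusions, so the double commutant lies in the
    commutant, every element of which commutes with the double commutant. This is what makes it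
    abelian.\<close>
  then have SS': "?S \<subseteq> commutant ?S" using S(1) unfolding commutant_def by blast
  then have DS': "?D \<subseteq> commutant ?S"
    unfolding commutant_def[of "commutant ?S"] unfolding commutant_def[of ?S] by auto
  have "abelian_subset M ?D"
    unfolding abelian_subset_def
  proof (intro ballI)
    fix x y assume "x \<in> ?D" "y \<in> ?D"
    then have "x \<in> commutant ?S" using DS' by blast
    then show "x \<otimes> y = y \<otimes> x" using \<open>y \<in> ?D\<close> unfolding commutant_def[of "commutant ?S"] by blast
  qed
  then have "?D = E" using SD by (intro max cstar_subalgebra_commutant S') auto
  then show ?thesis using SD by auto
qed

subsection \<open>Completion\<close>

abbreviation "CS \<equiv> cauchy_seqs M p"
abbreviation "cls s \<equiv> cauchy_rel M p `` {s}"

lemma CS_carrier: "s \<in> CS \<Longrightarrow> s n \<in> carrier M"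
  by (simp add: cauchy_seqs_def)

lemma CS_norm_Cauchy:
  assumes "s \<in> CS" shows "Cauchy (\<lambda>n. p (s n))"
proof (rule metric_CauchyI)
  fix e :: real assume "e > 0"
  then obtain N where "\<And>m n. m \<ge> N \<Longrightarrow> n \<ge> N \<Longrightarrow> p (s m \<ominus> s n) < e" using assms unfolding cauchy_seqs_def by blast
  then show "\<exists>N. \<forall>m\<ge>N. \<forall>n\<ge>N. dist (p (s m)) (p (s n)) < e"
    using p_diff_le[OF CS_carrier[OF assms] CS_carrier[OF assms]] by (metis dist_real_def le_less_trans)
qed

lemma CS_bounded:
  assumes "s \<in> CS" obtains B where "B > 0" "\<And>n. p (s n) \<le> B"
  using Cauchy_Bseq[OF CS_norm_Cauchy[OF assms]] CS_carrier[OF assms] unfolding Bseq_def by auto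

text \<open>One criterion for all operations on Cauchy sequences: the increments of \<open>s\<close>
  are controlled by those of two sequences. Unary operations use the same sequence twice.\<close>

lemma CS_I:
  assumes "\<And>n. s n \<in> carrier M" "t \<in> CS" "u \<in> CS" "B \<ge> 0"
    "\<And>m n. p (s m \<ominus> s n) \<le> B * (p (t m \<ominus> t n) + p (u m \<ominus> u n))"
  shows "s \<in> CS"
  unfolding cauchy_seqs_def
proof (safe intro!: assms(1))
  fix e :: real assume "e > 0"
  define d where "d = e / (B + 1) / 2"
  have "d > 0" using \<open>e > 0\<close> assms(4) by (simp add: d_def)
  obtain N1 where N1: "\<And>m n. m \<ge> N1 \<Longrightarrow> n \<ge> N1 \<Longrightarrow> p (t m \<ominus> t n) < d" using assms(2) \<open>d > 0\<close> unfolding cauchy_seqs_def by blast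
  obtain N2 where N2: "\<And>m n. m \<ge> N2 \<Longrightarrow> n \<ge> N2 \<Longrightarrow> p (u m \<ominus> u n) < d" using assms(3) \<open>d > 0\<close> unfolding cauchy_seqs_def by blast
  have "p (s m \<ominus> s n) < e" if "m \<ge> max N1 N2" "n \<ge> max N1 N2" for m n
  proof -
    have "p (s m \<ominus> s n) \<le> B * (p (t m \<ominus> t n) + p (u m \<ominus> u n))" by (rule assms(5))
    also have "\<dots> \<le> B * (d + d)" using N1[of m n] N2[of m n] that assms(4) by (intro mult_left_mono) auto
    also have "\<dots> < (B + 1) * (d + d)" using \<open>d > 0\<close> by (intro mult_strict_right_mono) auto
    also have "d + d = e / (B + 1)" unfolding d_def by (rule field_sum_of_halves)
    also have "(B + 1) * (e / (B + 1)) = e" using assms(4) by simp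
    finally show ?thesis .
  qed
  then show "\<exists>N. \<forall>m\<ge>N. \<forall>n\<ge>N. p (s m \<ominus> s n) < e" by blast
qed

lemma CS_const: "x \<in> carrier M \<Longrightarrow> (\<lambda>_. x) \<in> CS"
  by (simp add: cauchy_seqs_def minus_eq r_neg)

lemma add_minus_add:
  "x \<in> carrier M \<Longrightarrow> y \<in> carrier M \<Longrightarrow> x' \<in> carrier M \<Longrightarrow> y' \<in> carrier M \<Longrightarrow>
    (x \<oplus> y) \<ominus> (x' \<oplus> y') = (x \<ominus> x') \<oplus> (y \<ominus> y')"
  by algebra

lemma mult_minus_mult:
  "x \<in> carrier M \<Longrightarrow> y \<in> carrier M \<Longrightarrow> x' \<in> carrier M \<Longrightarrow> y' \<in> carrier M \<Longrightarrow>
    (x \<otimes> y) \<ominus> (x' \<otimes> y') = x \<otimes> (y \<ominus> y') \<oplus> (x \<ominus> x') \<otimes> y'"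
  by algebra

lemma p_add_minus:
  "x \<in> carrier M \<Longrightarrow> y \<in> carrier M \<Longrightarrow> x' \<in> carrier M \<Longrightarrow> y' \<in> carrier M \<Longrightarrow>
    p ((x \<oplus> y) \<ominus> (x' \<oplus> y')) \<le> p (x \<ominus> x') + p (y \<ominus> y')"
  by (simp add: add_minus_add p_add)

lemma p_mult_minus:
  assumes "x \<in> carrier M" "y \<in> carrier M" "x' \<in> carrier M" "y' \<in> carrier M" "p x \<le> B" "p y' \<le> B"
  shows "p ((x \<otimes> y) \<ominus> (x' \<otimes> y')) \<le> B * (p (x \<ominus> x') + p (y \<ominus> y'))"
proof -
  have "p ((x \<otimes> y) \<ominus> (x' \<otimes> y')) \<le> p (x \<otimes> (y \<ominus> y')) + p ((x \<ominus> x') \<otimes> y')"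
    using assms by (simp add: mult_minus_mult p_add)
  also have "\<dots> \<le> p x * p (y \<ominus> y') + p (x \<ominus> x') * p y'"
    using assms by (intro add_mono p_mult) auto
  also have "\<dots> \<le> B * p (y \<ominus> y') + p (x \<ominus> x') * B"
    using assms by (intro add_mono mult_right_mono mult_left_mono) auto
  finally show ?thesis by (simp add: algebra_simps)
qed

lemma p_smult_minus:
  "x \<in> carrier M \<Longrightarrow> y \<in> carrier M \<Longrightarrow> p (c \<odot> x \<ominus> c \<odot> y) = cmod c * p (x \<ominus> y)"
proof -
  assume xy: "x \<in> carrier M" "y \<in> carrier M"
  then have "c \<odot> x \<ominus> c \<odot> y = c \<odot> (x \<ominus> y)"
    by (simp add: minus_eq smult_r_distr smult_smult flip: smult_minus_one)
  then show ?thesis using xy by (simp add: p_smult)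
qed

lemma p_star_minus: "x \<in> carrier M \<Longrightarrow> y \<in> carrier M \<Longrightarrow> p (star M x \<ominus> star M y) = p (x \<ominus> y)"
  by (simp add: p_star flip: star_minus)

lemma CS_add: "s \<in> CS \<Longrightarrow> t \<in> CS \<Longrightarrow> (\<lambda>n. s n \<oplus> t n) \<in> CS"
  by (rule CS_I[of _ s t 1]) (simp_all add: CS_carrier p_add_minus)

lemma CS_smult: "s \<in> CS \<Longrightarrow> (\<lambda>n. c \<odot> s n) \<in> CS"
  by (rule CS_I[of _ s s "cmod c"]) (simp_all add: CS_carrier p_smult_minus)

lemma CS_star: "s \<in> CS \<Longrightarrow> (\<lambda>n. star M (s n)) \<in> CS"
  by (rule CS_I[of _ s s 1]) (simp_all add: CS_carrier p_star_minus)

lemma CS_mult: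
  assumes "s \<in> CS" "t \<in> CS" shows "(\<lambda>n. s n \<otimes> t n) \<in> CS"
proof -
  obtain B where B: "B > 0" "\<And>n. p (s n) \<le> B" using CS_bounded[OF assms(1)] by blast
  obtain B' where B': "B' > 0" "\<And>n. p (t n) \<le> B'" using CS_bounded[OF assms(2)] by blast
  show ?thesis
  proof (rule CS_I[OF _ assms, of _ "max B B'"])
    show "p (s m \<otimes> t m \<ominus> s n \<otimes> t n) \<le> max B B' * (p (s m \<ominus> s n) + p (t m \<ominus> t n))" for m n
      using B(2)[of m] B'(2)[of n] by (intro p_mult_minus CS_carrier assms) auto
  qed (use B assms in \<open>auto simp: CS_carrier\<close>)
qed

lemma cauchy_rel_iff:
  "(s, t) \<in> cauchy_rel M p \<longleftrightarrow> s \<in> CS \<and> t \<in> CS \<and> (\<lambda>n. p (s n \<ominus> t n)) \<longlonglongrightarrow> 0"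
  by (simp add: cauchy_rel_def)

lemma null_seqI:
  fixes f g h :: "nat \<Rightarrow> real"
  assumes "g \<longlonglongrightarrow> 0" "h \<longlonglongrightarrow> 0" "\<And>n. 0 \<le> f n" "\<And>n. f n \<le> B * (g n + h n)"
  shows "f \<longlonglongrightarrow> 0"
proof (rule tendsto_sandwich[OF _ _ tendsto_const])
  show "(\<lambda>n. B * (g n + h n)) \<longlonglongrightarrow> 0"
    using tendsto_mult_left[OF tendsto_add[OF assms(1,2)], of B] by simp
qed (use assms in auto)

lemma equiv_cauchy_rel: "equiv CS (cauchy_rel M p)"
proof (rule equivI)
  show "cauchy_rel M p \<subseteq> CS \<times> CS" by (auto simp: cauchy_rel_def)
  show "refl_on CS (cauchy_rel M p)"
    by (rule refl_onI) (auto simp: cauchy_rel_iff minus_eq r_neg CS_carrier)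
  show "sym (cauchy_rel M p)"
    by (rule symI) (auto simp: cauchy_rel_iff p_minus_commute CS_carrier)
  show "trans (cauchy_rel M p)"
  proof (rule transI)
    fix s t u assume "(s, t) \<in> cauchy_rel M p" "(t, u) \<in> cauchy_rel M p"
    then have st: "s \<in> CS" "t \<in> CS" "u \<in> CS" "(\<lambda>n. p (s n \<ominus> t n)) \<longlonglongrightarrow> 0" "(\<lambda>n. p (t n \<ominus> u n)) \<longlonglongrightarrow> 0"
      by (auto simp: cauchy_rel_iff)
    have "(\<lambda>n. p (s n \<ominus> u n)) \<longlonglongrightarrow> 0"
      by (rule null_seqI[OF st(4,5), of _ 1]) (simp_all add: st CS_carrier p_triangle)
    with st show "(s, u) \<in> cauchy_rel M p" by (simp add: cauchy_rel_iff)
  qed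
qed

lemma cls_eq_iff: "s \<in> CS \<Longrightarrow> t \<in> CS \<Longrightarrow> cls s = cls t \<longleftrightarrow> (\<lambda>n. p (s n \<ominus> t n)) \<longlonglongrightarrow> 0"
  using eq_equiv_class_iff[OF equiv_cauchy_rel] by (simp add: cauchy_rel_iff)

abbreviation "Mc \<equiv> cstar_completion M p"
abbreviation "pc \<equiv> completion_norm p"

lemma carrier_completion: "carrier Mc = cls ` CS"
  by (auto simp: cstar_completion_def quotient_def)

text \<open>The constant \<open>B\<close> may depend on the sequences, because multiplication is
  Lipschitz only on bounded sets.\<close>

lemma congruent2_completionI:
  assumes "\<And>s t. s \<in> CS \<Longrightarrow> t \<in> CS \<Longrightarrow> f s t \<in> CS"
    "\<And>s s' t t'. s \<in> CS \<Longrightarrow> s' \<in> CS \<Longrightarrow> t \<in> CS \<Longrightarrow> t' \<in> CS \<Longrightarrow>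
      \<exists>B. \<forall>n. p (f s t n \<ominus> f s' t' n) \<le> B * (p (s n \<ominus> s' n) + p (t n \<ominus> t' n))"
  shows "congruent2 (cauchy_rel M p) (cauchy_rel M p) (\<lambda>s t. cls (f s t))"
proof (rule congruent2I')
  fix s s' t t' assume "(s, s') \<in> cauchy_rel M p" "(t, t') \<in> cauchy_rel M p"
  then have st: "s \<in> CS" "s' \<in> CS" "t \<in> CS" "t' \<in> CS" "(\<lambda>n. p (s n \<ominus> s' n)) \<longlonglongrightarrow> 0" "(\<lambda>n. p (t n \<ominus> t' n)) \<longlonglongrightarrow> 0"
    by (auto simp: cauchy_rel_iff)
  obtain B where "\<And>n. p (f s t n \<ominus> f s' t' n) \<le> B * (p (s n \<ominus> s' n) + p (t n \<ominus> t' n))"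
    using assms(2)[OF st(1-4)] by blast
  then have "(\<lambda>n. p (f s t n \<ominus> f s' t' n)) \<longlonglongrightarrow> 0"
    by (rule null_seqI[OF st(5,6), rotated]) (simp add: st assms(1) CS_carrier)
  then show "cls (f s t) = cls (f s' t')" using st assms(1) by (simp add: cls_eq_iff)
qed

lemma completion_add:
  assumes "s \<in> CS" "t \<in> CS" shows "cls s \<oplus>\<^bsub>Mc\<^esub> cls t = cls (\<lambda>n. s n \<oplus> t n)"
proof -
  have "congruent2 (cauchy_rel M p) (cauchy_rel M p) (\<lambda>s t. cls (\<lambda>n. s n \<oplus> t n))"
    by (rule congruent2_completionI) (auto simp: CS_add CS_carrier p_add_minus intro!: exI[of _ 1])
  from UN_equiv_class2[OF equiv_cauchy_rel equiv_cauchy_rel this assms] show ?thesis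
    by (simp add: cstar_completion_def)
qed

lemma completion_mult:
  assumes "s \<in> CS" "t \<in> CS" shows "cls s \<otimes>\<^bsub>Mc\<^esub> cls t = cls (\<lambda>n. s n \<otimes> t n)"
proof -
  have "congruent2 (cauchy_rel M p) (cauchy_rel M p) (\<lambda>s t. cls (\<lambda>n. s n \<otimes> t n))"
  proof (rule congruent2_completionI)
    fix s s' t t' assume st: "s \<in> CS" "s' \<in> CS" "t \<in> CS" "t' \<in> CS"
    obtain B where B: "B > 0" "\<And>n. p (s n) \<le> B" using CS_bounded[OF st(1)] by blast
    obtain B' where B': "B' > 0" "\<And>n. p (t' n) \<le> B'" using CS_bounded[OF st(4)] by blast
    have "p (s n \<otimes> t n \<ominus> s' n \<otimes> t' n) \<le> max B B' * (p (s n \<ominus> s' n) + p (t n \<ominus> t' n))" for n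
      using B(2)[of n] B'(2)[of n] by (intro p_mult_minus CS_carrier st) auto
    then show "\<exists>B. \<forall>n. p (s n \<otimes> t n \<ominus> s' n \<otimes> t' n) \<le> B * (p (s n \<ominus> s' n) + p (t n \<ominus> t' n))" by blast
  qed (rule CS_mult)
  from UN_equiv_class2[OF equiv_cauchy_rel equiv_cauchy_rel this assms] show ?thesis
    by (simp add: cstar_completion_def)
qed

lemma congruent_completionI:
  assumes "\<And>s. s \<in> CS \<Longrightarrow> f s \<in> CS"
    "\<And>s t n. s \<in> CS \<Longrightarrow> t \<in> CS \<Longrightarrow> p (f s n \<ominus> f t n) \<le> B * p (s n \<ominus> t n)"
  shows "congruent (cauchy_rel M p) (\<lambda>s. cls (f s))"
proof (rule congruentI)
  fix s t assume "(s, t) \<in> cauchy_rel M p"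
  then have st: "s \<in> CS" "t \<in> CS" "(\<lambda>n. p (s n \<ominus> t n)) \<longlonglongrightarrow> 0" by (auto simp: cauchy_rel_iff)
  then have "(\<lambda>n. p (f s n \<ominus> f t n)) \<longlonglongrightarrow> 0"
    by (intro null_seqI[OF st(3) tendsto_const[of 0], of _ B]) (simp_all add: assms CS_carrier)
  then show "cls (f s) = cls (f t)" using st assms(1) by (simp add: cls_eq_iff)
qed

lemma completion_smult:
  assumes "s \<in> CS" shows "c \<odot>\<^bsub>Mc\<^esub> cls s = cls (\<lambda>n. c \<odot> s n)"
proof -
  have "congruent (cauchy_rel M p) (\<lambda>s. cls (\<lambda>n. c \<odot> s n))"
    by (rule congruent_completionI[of _ "cmod c"]) (auto simp: CS_smult CS_carrier p_smult_minus)
  from UN_equiv_class[OF equiv_cauchy_rel this assms] show ?thesis by (simp add: cstar_completion_def)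
qed

lemma completion_star:
  assumes "s \<in> CS" shows "star Mc (cls s) = cls (\<lambda>n. star M (s n))"
proof -
  have "congruent (cauchy_rel M p) (\<lambda>s. cls (\<lambda>n. star M (s n)))"
    by (rule congruent_completionI[of _ 1]) (auto simp: CS_star CS_carrier p_star_minus)
  from UN_equiv_class[OF equiv_cauchy_rel this assms] show ?thesis by (simp add: cstar_completion_def)
qed

lemma completion_one: "\<one>\<^bsub>Mc\<^esub> = cls (\<lambda>_. \<one>)" and completion_zero: "\<zero>\<^bsub>Mc\<^esub> = cls (\<lambda>_. \<zero>)"
  by (simp_all add: cstar_completion_def)

text \<open>\<open>the_elem\<close> in the definition of the norm is legitimate because equivalent
  sequences have the same limit of norms.\<close>

lemma completion_norm_tendsto:
  assumes "s \<in> CS" shows "(\<lambda>n. p (s n)) \<longlonglongrightarrow> pc (cls s)"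
proof -
  have conv: "(\<lambda>n. p (t n)) \<longlonglongrightarrow> lim (\<lambda>n. p (t n))" if "t \<in> CS" for t
    using CS_norm_Cauchy[OF that] by (simp add: Cauchy_convergent_iff convergent_LIMSEQ_iff)
  have "lim (\<lambda>n. p (t n)) = lim (\<lambda>n. p (s n))" if "t \<in> cls s" for t
  proof -
    have t: "t \<in> CS" "(\<lambda>n. p (s n \<ominus> t n)) \<longlonglongrightarrow> 0" using that by (auto simp: cauchy_rel_iff)
    have "(\<lambda>n. p (t n) - p (s n)) \<longlonglongrightarrow> 0"
    proof (rule Lim_null_comparison[OF _ t(2)], rule always_eventually, rule allI)
      show "norm (p (t n) - p (s n)) \<le> p (s n \<ominus> t n)" for n
        using p_diff_le[OF CS_carrier[OF t(1)] CS_carrier[OF assms], of n n]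
          p_minus_commute[OF CS_carrier[OF t(1)] CS_carrier[OF assms], of n n] by simp
    qed
    from tendsto_add[OF this conv[OF assms]] have "(\<lambda>n. p (t n)) \<longlonglongrightarrow> lim (\<lambda>n. p (s n))" by simp
    then show ?thesis by (rule limI)
  qed
  moreover have "s \<in> cls s" using assms by (rule equiv_class_self[OF equiv_cauchy_rel])
  ultimately have "(\<lambda>s. lim (\<lambda>n. p (s n))) ` cls s = {lim (\<lambda>n. p (s n))}" by blast
  then have "pc (cls s) = lim (\<lambda>n. p (s n))" by (simp add: completion_norm_def)
  with conv[OF assms] show ?thesis by simp
qed

lemma completion_embed_norm: "x \<in> carrier M \<Longrightarrow> pc (cls (\<lambda>_. x)) = p x"
  using completion_norm_tendsto[OF CS_const] by (metis LIMSEQ_unique tendsto_const)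

lemmas completion_ops = completion_add completion_mult completion_smult completion_star completion_one completion_zero
lemmas CS_ops = CS_add CS_mult CS_smult CS_star CS_const[OF one_closed] CS_const[OF zero_closed]

lemma ring_completion: "ring Mc"
proof (rule ringI)
  show "abelian_group Mc"
  proof (rule abelian_groupI)
    fix x assume "x \<in> carrier Mc"
    then obtain s where s: "x = cls s" "s \<in> CS" by (auto simp: carrier_completion)
    have "cls (\<lambda>n. (- 1) \<odot> s n) \<oplus>\<^bsub>Mc\<^esub> x = cls (\<lambda>n. (- 1) \<odot> s n \<oplus> s n)"
      by (simp only: s completion_add CS_smult)
    also have "\<dots> = \<zero>\<^bsub>Mc\<^esub>"
      using s by (simp add: completion_zero CS_carrier smult_minus_one l_neg)
    finally have "cls (\<lambda>n. (- 1) \<odot> s n) \<oplus>\<^bsub>Mc\<^esub> x = \<zero>\<^bsub>Mc\<^esub>" .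
    then show "\<exists>y\<in>carrier Mc. y \<oplus>\<^bsub>Mc\<^esub> x = \<zero>\<^bsub>Mc\<^esub>"
      using s by (intro bexI) (auto simp: carrier_completion CS_ops)
  qed (auto simp: carrier_completion completion_ops CS_ops CS_carrier a_assoc a_comm a_lcomm intro!: imageI)
  show "monoid Mc"
    by (rule monoidI) (auto simp: carrier_completion completion_ops CS_ops CS_carrier m_assoc intro!: imageI)
qed (auto simp: carrier_completion completion_ops CS_ops CS_carrier l_distr r_distr)

lemma cstar_norm_completion: "cstar_norm Mc pc"
  unfolding cstar_norm_def carrier_completion ball_simps
proof (intro conjI ballI allI)
  fix s assume s: "s \<in> CS"
  note ls = completion_norm_tendsto[OF s]
  show "0 \<le> pc (cls s)" by (rule LIMSEQ_le_const[OF ls]) (simp add: s CS_carrier)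
  show "pc (cls s) = 0 \<longleftrightarrow> cls s = \<zero>\<^bsub>Mc\<^esub>"
  proof -
    have "cls s = \<zero>\<^bsub>Mc\<^esub> \<longleftrightarrow> (\<lambda>n. p (s n)) \<longlonglongrightarrow> 0"
      using s by (simp add: completion_zero cls_eq_iff CS_ops CS_carrier minus_eq)
    then show ?thesis using ls LIMSEQ_unique by metis
  qed
  show "pc (c \<odot>\<^bsub>Mc\<^esub> cls s) = cmod c * pc (cls s)" for c
  proof -
    have "(\<lambda>n. p (c \<odot> s n)) \<longlonglongrightarrow> pc (cls (\<lambda>n. c \<odot> s n))" by (rule completion_norm_tendsto[OF CS_smult[OF s]])
    then have "(\<lambda>n. cmod c * p (s n)) \<longlonglongrightarrow> pc (cls (\<lambda>n. c \<odot> s n))" using s by (simp add: p_smult CS_carrier)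
    from LIMSEQ_unique[OF this tendsto_mult_left[OF ls]] show ?thesis using s by (simp add: completion_smult)
  qed
  show "pc (star Mc (cls s) \<otimes>\<^bsub>Mc\<^esub> cls s) = (pc (cls s))\<^sup>2"
  proof -
    have "(\<lambda>n. p (star M (s n) \<otimes> s n)) \<longlonglongrightarrow> pc (cls (\<lambda>n. star M (s n) \<otimes> s n))"
      by (rule completion_norm_tendsto[OF CS_mult[OF CS_star[OF s] s]])
    then have "(\<lambda>n. (p (s n))\<^sup>2) \<longlonglongrightarrow> pc (cls (\<lambda>n. star M (s n) \<otimes> s n))" using s by (simp add: p_cstar CS_carrier)
    from LIMSEQ_unique[OF this tendsto_power[OF ls]] show ?thesis
      using s by (simp add: completion_star completion_mult CS_star)
  qed
  fix t assume t: "t \<in> CS"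
  note lt = completion_norm_tendsto[OF t]
  show "pc (cls s \<oplus>\<^bsub>Mc\<^esub> cls t) \<le> pc (cls s) + pc (cls t)"
    unfolding completion_add[OF s t]
    by (rule LIMSEQ_le[OF completion_norm_tendsto[OF CS_add[OF s t]] tendsto_add[OF ls lt]])
      (simp add: s t CS_carrier p_add)
  show "pc (cls s \<otimes>\<^bsub>Mc\<^esub> cls t) \<le> pc (cls s) * pc (cls t)"
    unfolding completion_mult[OF s t]
    by (rule LIMSEQ_le[OF completion_norm_tendsto[OF CS_mult[OF s t]] tendsto_mult[OF ls lt]])
      (simp add: s t CS_carrier p_mult)
qed

lemma cstar_normed_completion: "cstar_normed Mc pc"
proof (intro cstar_normed.intro ring_completion cstar_normed_axioms.intro cstar_norm_completion)
qed (auto simp: carrier_completion completion_ops CS_ops CS_carrier smult_r_distr smult_l_distr smult_smult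
    smult_mult_left smult_mult_right star_add star_smult star_mult intro!: imageI)

end

section \<open>Functional calculus for one self-adjoint element\<close>

text \<open>The iterates converge to \<open>1 - \<surd>(1 - w)\<close>.\<close>

primrec sqrt_iter :: "real poly \<Rightarrow> nat \<Rightarrow> real poly" where
  "sqrt_iter w 0 = 0"
| "sqrt_iter w (Suc n) = Polynomial.smult (1/2) (w + sqrt_iter w n * sqrt_iter w n)"

text \<open>The properties of \<open>P \<mapsto> p(P(x))\<close> for a self-adjoint
  \<open>x\<close>. Real coefficients keep the values self-adjoint, so \<open>N_square\<close> is
  the C*-identity. \<open>N_sum_squares\<close> stands in for the order structure: adding a square
  to a square does not decrease the norm.\<close>

locale poly_cstar_seminorm =
  fixes N :: "real poly \<Rightarrow> real"
  assumes N_nonneg: "0 \<le> N P"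
    and N_add: "N (P + Q) \<le> N P + N Q"
    and N_smult: "N (Polynomial.smult c P) = \<bar>c\<bar> * N P"
    and N_mult: "N (P * Q) \<le> N P * N Q"
    and N_square: "N (P * P) = (N P)\<^sup>2"
    and N_sum_squares: "(N P)\<^sup>2 \<le> N (P * P + Q * Q)"
    and N_one: "N 1 \<le> 1"
begin

lemma N_zero [simp]: "N 0 = 0"
  using N_smult[of 0 0] by simp

lemma N_uminus [simp]: "N (- P) = N P"
  using N_smult[of "- 1" P] by simp

lemma N_minus: "N (P - Q) \<le> N P + N Q"
  using N_add[of P "- Q"] by simp

lemma N_const: "N [:c:] \<le> \<bar>c\<bar>"
  using N_smult[of c 1] N_one mult_left_mono[OF N_one, of "\<bar>c\<bar>"] by (simp add: smult_one)

lemma sqrt_iter_le: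
  assumes "N w \<le> r * r" "0 \<le> r" "r \<le> 1" shows "N (sqrt_iter w n) \<le> r"
proof (induction n)
  case (Suc n)
  have "N (sqrt_iter w (Suc n)) \<le> (N w + (N (sqrt_iter w n))\<^sup>2) / 2"
    using N_add[of w "sqrt_iter w n * sqrt_iter w n"] by (simp add: N_smult N_square)
  also have "\<dots> \<le> (r * r + r\<^sup>2) / 2"
    using assms Suc N_nonneg by (intro divide_right_mono add_mono power_mono) auto
  also have "\<dots> = r * r" by (simp add: power2_eq_square)
  also have "\<dots> \<le> r" using assms by (simp add: mult_left_le)
  finally show ?case .
qed (use assms in simp)

lemma N_half_difference:
  "N (Polynomial.smult (1/2) (w + a * a) - Polynomial.smult (1/2) (w + b * b)) \<le> N (a - b) * (N a + N b) / 2"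
proof -
  have "Polynomial.smult (1/2) (w + a * a) - Polynomial.smult (1/2) (w + b * b) = Polynomial.smult (1/2) ((a - b) * (a + b))"
    by (simp add: smult_diff_right[symmetric] algebra_simps)
  then have "N (Polynomial.smult (1/2) (w + a * a) - Polynomial.smult (1/2) (w + b * b)) \<le> N (a - b) * N (a + b) / 2"
    using N_mult[of "a - b" "a + b"] by (simp add: N_smult)
  also have "\<dots> \<le> N (a - b) * (N a + N b) / 2"
    by (intro divide_right_mono mult_left_mono N_add N_nonneg) auto
  finally show ?thesis .
qed

text \<open>With \<open>b n = 1 - y n\<close> for the square root iterates \<open>y n\<close>, the
  square of \<open>b n\<close> approximates \<open>1 - h^2\<close>. Since \<open>b n^2 + h^2\<close>
  is close to 1, \<open>N_sum_squares\<close> bounds \<open>b n^2\<close> by nearly 1. Strictness of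
  \<open>N h < 1\<close> makes the error decay geometrically.\<close>

lemma N_one_minus_square_strict:
  assumes "N h < 1" shows "N (1 - h * h) \<le> 1"
proof -
  define r where "r = N h"
  let ?y = "sqrt_iter (h * h)"
  have r: "0 \<le> r" "r < 1" using assms N_nonneg by (auto simp: r_def)
  have le: "N (?y n) \<le> r" for n
    using r by (intro sqrt_iter_le) (auto simp: N_square power2_eq_square r_def)
  define \<delta> where "\<delta> n = ?y (Suc n) - ?y n" for n
  have \<delta>: "N (\<delta> n) \<le> r * r ^ n" for n
  proof (induction n)
    case 0
    then show ?case using le[of "Suc 0"] by (simp add: \<delta>_def)
  next
    case (Suc n)
    have "N (\<delta> (Suc n)) \<le> N (\<delta> n) * (N (?y (Suc n)) + N (?y n)) / 2" unfolding \<delta>_def sqrt_iter.simps(2) by (rule N_half_difference)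
    also have "\<dots> \<le> (r * r ^ n) * (r + r) / 2"
      using r by (intro divide_right_mono mult_mono add_mono le Suc add_nonneg_nonneg N_nonneg) auto
    finally show ?case by (simp add: mult_ac)
  qed
  have bound: "N (1 - h * h) \<le> 1 + 4 * (r * r ^ n)" for n
  proof -
    let ?b = "1 - ?y n"
    have "?y (Suc n) + ?y (Suc n) = h * h + ?y n * ?y n" by (simp flip: smult_add_left)
    moreover have two: "Polynomial.smult 2 P = P + P" for P :: "real poly"
      using Polynomial.smult_add_left[of 1 1 P] by simp
    \<comment> \<open>The error is twice the increment of the iteration, because
      \<open>2 * y (n + 1) = h^2 + y n^2\<close>.\<close>
    ultimately have b: "?b * ?b = 1 - h * h + Polynomial.smult 2 (\<delta> n)"
      by (simp add: \<delta>_def algebra_simps smult_diff_right two del: sqrt_iter.simps(2))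
    have 1: "N (?b * ?b) \<le> 1 + 2 * N (\<delta> n)"
    proof -
      have "N (?b * ?b) = (N ?b)\<^sup>2" by (rule N_square)
      also have "\<dots> \<le> N (?b * ?b + h * h)" by (rule N_sum_squares)
      also have "\<dots> = N (1 + Polynomial.smult 2 (\<delta> n))" by (simp add: b)
      also have "\<dots> \<le> 1 + 2 * N (\<delta> n)" using N_add[of 1 "Polynomial.smult 2 (\<delta> n)"] N_one by (simp add: N_smult)
      finally show ?thesis .
    qed
    have "1 - h * h = ?b * ?b - Polynomial.smult 2 (\<delta> n)" by (simp add: b)
    then have "N (1 - h * h) \<le> N (?b * ?b) + 2 * N (\<delta> n)"
      using N_minus[of "?b * ?b" "Polynomial.smult 2 (\<delta> n)"] by (simp add: N_smult)
    with 1 \<delta>[of n] show ?thesis by simp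
  qed
  have "(\<lambda>n. 1 + 4 * (r * r ^ n)) \<longlonglongrightarrow> 1 + 4 * (r * 0)"
    using r by (intro tendsto_intros LIMSEQ_power_zero) auto
  then show ?thesis using bound by (intro LIMSEQ_le_const) auto
qed

text \<open>The strict case applied to \<open>t * h\<close> for \<open>t < 1\<close>, followed by
  the limit as \<open>t\<close> tends to 1.\<close>

lemma N_one_minus_square:
  assumes "N h \<le> 1" shows "N (1 - h * h) \<le> 1"
proof -
  have "N (1 - h * h) \<le> 1 + (1 - t * t)" if t: "0 < t" "t < 1" for t
  proof -
    have "N (Polynomial.smult t h) < 1"
    proof -
      have "t * N h \<le> t" using t assms by (intro mult_left_le) auto
      then show ?thesis unfolding N_smult abs_of_pos[OF t(1)] using t by linarith
    qed
    have tt: "t * t \<le> 1" using t by (simp add: mult_le_one less_imp_le)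
    from \<open>N (Polynomial.smult t h) < 1\<close> have 1: "N (1 - Polynomial.smult t h * Polynomial.smult t h) \<le> 1" by (rule N_one_minus_square_strict)
    have "1 - h * h = (1 - Polynomial.smult t h * Polynomial.smult t h) - Polynomial.smult (1 - t * t) (h * h)"
      by (simp add: smult_diff_left)
    then have "N (1 - h * h) \<le> N (1 - Polynomial.smult t h * Polynomial.smult t h) + N (Polynomial.smult (1 - t * t) (h * h))"
      by (metis N_minus)
    also have "N (Polynomial.smult (1 - t * t) (h * h)) = (1 - t * t) * (N h)\<^sup>2"
      using tt by (simp add: N_smult N_square)
    also have "\<dots> \<le> (1 - t * t) * 1"
      using tt assms N_nonneg[of h] by (intro mult_left_mono) (auto simp: power_le_one)
    finally show ?thesis using 1 by simp
  qed
  then have ev: "\<forall>\<^sub>F t in at_left 1. N (1 - h * h) \<le> 1 + (1 - t * t)"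
    using eventually_at_left_real[of 0 "1::real"] by (auto elim!: eventually_mono)
  have "((\<lambda>t::real. 1 + (1 - t * t)) \<longlongrightarrow> 1 + (1 - 1 * 1)) (at_left 1)"
    by (intro tendsto_intros)
  from tendsto_lowerbound[OF this ev] show ?thesis by simp
qed

end

text \<open>The square root iteration for the scalar \<open>w = 1\<close>. It dominates the
  seminorms of the iterates and of their increments whenever \<open>w\<close> has seminorm at most
  1. In that borderline case the contraction factor is not below 1, and convergence comes from this
  increasing bounded majorant instead.\<close>

primrec scalar_iter :: "nat \<Rightarrow> real" where
  "scalar_iter 0 = 0"
| "scalar_iter (Suc n) = (1 + scalar_iter n * scalar_iter n) / 2"

lemma scalar_iter_bounds: "0 \<le> scalar_iter n" "scalar_iter n \<le> 1"
proof -
  have "0 \<le> scalar_iter n \<and> scalar_iter n \<le> 1"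
    by (induction n) (auto simp: mult_le_one)
  then show "0 \<le> scalar_iter n" "scalar_iter n \<le> 1" by auto
qed

lemma scalar_iter_incseq: "incseq scalar_iter"
proof (rule incseq_SucI)
  fix n
  have "0 \<le> (1 - scalar_iter n) * (1 - scalar_iter n)" by simp
  then show "scalar_iter n \<le> scalar_iter (Suc n)" by (simp add: algebra_simps)
qed

lemma scalar_iter_Cauchy: "Cauchy scalar_iter"
  using incseq_convergent[OF scalar_iter_incseq, of 1] scalar_iter_bounds
  by (metis LIMSEQ_imp_Cauchy)

text \<open>With \<open>h = (X\<^sup>2 - r\<^sup>2) / 2\<close>, the polynomials \<open>cutoff r n\<close> converge to \<open>h + \<bar>h\<bar>\<close>, which vanishes
  exactly for \<open>\<bar>X\<bar> \<le> r\<close>.\<close>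

definition cutoff_h :: "real \<Rightarrow> real poly" where
  "cutoff_h r = [:- r\<^sup>2 / 2, 0, 1/2:]"

text \<open>For \<open>w = 1 - h^2\<close> the limit \<open>1 - sqrt (1 - w)\<close> of the
  iteration is \<open>1 - |h|\<close>.\<close>

abbreviation cutoff_iter :: "real \<Rightarrow> nat \<Rightarrow> real poly" where
  "cutoff_iter r \<equiv> sqrt_iter (1 - cutoff_h r * cutoff_h r)"

definition cutoff :: "real \<Rightarrow> nat \<Rightarrow> real poly" where
  "cutoff r n = 1 + cutoff_h r - cutoff_iter r n"

text \<open>The iterates have value at most 1 at the point 1, so every cutoff polynomial is at least
  \<open>h(1) = (1 - r^2) / 2\<close> there. This is half of the limiting value, and it holds for
  every \<open>n\<close>.\<close>

lemma cutoff_at_one: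
  assumes "0 \<le> r" "r \<le> 1" shows "(1 - r\<^sup>2) / 2 \<le> poly (cutoff r n) 1"
proof -
  let ?c = "poly (cutoff_h r) 1"
  have c: "?c = (1 - r\<^sup>2) / 2" by (simp add: cutoff_h_def field_simps)
  have "r\<^sup>2 \<le> 1" using assms by (simp add: power_le_one)
  have c1: "\<bar>?c\<bar> \<le> 1"
  proof (rule abs_leI)
    show "?c \<le> 1" unfolding c using zero_le_power2[of r] by argo
    show "- ?c \<le> 1" unfolding c using \<open>r\<^sup>2 \<le> 1\<close> by argo
  qed
  have "?c * ?c \<le> 1" using abs_le_square_iff[of ?c 1] c1 by (simp add: power2_eq_square)
  moreover have "0 \<le> ?c * ?c" by simp
  ultimately have "\<bar>poly (cutoff_iter r n) 1\<bar> \<le> 1"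
  proof (induction n)
    case (Suc n)
    have "(poly (cutoff_iter r n) 1)\<^sup>2 \<le> 1" using Suc abs_le_square_iff[of "poly (cutoff_iter r n) 1" 1] by simp
    then have "0 \<le> poly (cutoff_iter r n) 1 * poly (cutoff_iter r n) 1" "poly (cutoff_iter r n) 1 * poly (cutoff_iter r n) 1 \<le> 1"
      by (simp_all add: power2_eq_square)
    moreover have "\<bar>(1 - C + Y) / 2\<bar> \<le> 1" if "0 \<le> C" "C \<le> 1" "0 \<le> Y" "Y \<le> 1" for C Y :: real
      using that by (simp add: abs_le_iff)
    moreover have "poly (cutoff_iter r (Suc n)) 1 = (1 - ?c * ?c + poly (cutoff_iter r n) 1 * poly (cutoff_iter r n) 1) / 2"
      by simp
    ultimately show ?case using Suc.prems by metis
  qed simp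
  then have "poly (cutoff_iter r n) 1 \<le> 1" by simp
  moreover have "poly (cutoff r n) 1 = 1 + ?c - poly (cutoff_iter r n) 1" by (simp add: cutoff_def)
  ultimately show ?thesis unfolding c[symmetric] by linarith
qed

section \<open>Convergence of the cutoff polynomials in a C*-seminorm\<close>

context poly_cstar_seminorm begin

lemma N_X_square: "N [:0, 0, c:] \<le> \<bar>c\<bar> * (N [:0, 1:])\<^sup>2"
  using N_smult[of c "[:0, 1:] * [:0, 1:]"] N_square[of "[:0, 1:]"] by simp

lemma N_cutoff_h_le:
  assumes "N [:0, 1:] \<le> 1" "0 \<le> r" "r \<le> 1"
  shows "N (cutoff_h r) \<le> 1" "N (1 - cutoff_h r * cutoff_h r) \<le> 1"
proof -
  have "cutoff_h r = [:- r\<^sup>2 / 2:] + [:0, 0, 1/2:]" by (simp add: cutoff_h_def)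
  then have "N (cutoff_h r) \<le> N [:- r\<^sup>2 / 2:] + N [:0, 0, 1/2:]" by (metis N_add)
  also have "\<dots> \<le> \<bar>- r\<^sup>2 / 2\<bar> + \<bar>1/2\<bar> * (N [:0, 1:])\<^sup>2" by (intro add_mono N_const N_X_square)
  also have "\<dots> \<le> 1" using assms N_nonneg[of "[:0, 1:]"] power_le_one[of r 2] power_le_one[of "N [:0, 1:]" 2] by simp
  finally show "N (cutoff_h r) \<le> 1" .
  then show "N (1 - cutoff_h r * cutoff_h r) \<le> 1" by (rule N_one_minus_square)
qed

lemma N_cutoff_iter:
  assumes "N [:0, 1:] \<le> 1" "0 \<le> r" "r \<le> 1"
  shows "N (cutoff_iter r n) \<le> scalar_iter n"
proof (induction n)
  case (Suc n)
  let ?w = "1 - cutoff_h r * cutoff_h r" and ?y = "cutoff_iter r n"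
  have "N (cutoff_iter r (Suc n)) \<le> (N ?w + (N ?y)\<^sup>2) / 2"
    using N_add[of ?w "?y * ?y"] by (simp add: N_smult N_square)
  also have "\<dots> \<le> (1 + (scalar_iter n)\<^sup>2) / 2"
    using N_cutoff_h_le(2)[OF assms] Suc N_nonneg by (intro divide_right_mono add_mono power_mono) auto
  finally show ?case by (simp add: power2_eq_square)
qed simp

text \<open>The factorization estimate of \<open>N_half_difference\<close> is an equality for the
  scalar iteration, so the induction passes from each increment to the next without loss.\<close>

lemma N_cutoff_iter_Suc_diff:
  assumes "N [:0, 1:] \<le> 1" "0 \<le> r" "r \<le> 1"
  shows "N (cutoff_iter r (Suc n) - cutoff_iter r n) \<le> scalar_iter (Suc n) - scalar_iter n"
proof (induction n)
  case 0
  then show ?case using N_cutoff_iter[OF assms, of "Suc 0"] by simp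
next
  case (Suc n)
  have "N (cutoff_iter r (Suc (Suc n)) - cutoff_iter r (Suc n))
      \<le> N (cutoff_iter r (Suc n) - cutoff_iter r n) * (N (cutoff_iter r (Suc n)) + N (cutoff_iter r n)) / 2"
    unfolding sqrt_iter.simps(2) by (rule N_half_difference)
  also have "\<dots> \<le> (scalar_iter (Suc n) - scalar_iter n) * (scalar_iter (Suc n) + scalar_iter n) / 2"
    using incseq_SucD[OF scalar_iter_incseq, of n]
    by (intro divide_right_mono mult_mono add_mono Suc N_cutoff_iter assms add_nonneg_nonneg N_nonneg) auto
  also have "\<dots> = scalar_iter (Suc (Suc n)) - scalar_iter (Suc n)"
    by (subst (2) scalar_iter.simps(2), subst (5) scalar_iter.simps(2)) (simp add: field_simps)
  finally show ?case .
qed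

lemma N_cutoff_Cauchy:
  assumes "N [:0, 1:] \<le> 1" "0 \<le> r" "r \<le> 1" "e > 0"
  shows "\<exists>K. \<forall>m\<ge>K. \<forall>n\<ge>K. N (cutoff r m - cutoff r n) < e"
proof -
  have mono: "N (cutoff_iter r (n + k) - cutoff_iter r n) \<le> scalar_iter (n + k) - scalar_iter n" for n k
  proof (induction k)
    case (Suc k)
    have "cutoff_iter r (n + Suc k) - cutoff_iter r n
      = (cutoff_iter r (Suc (n + k)) - cutoff_iter r (n + k)) + (cutoff_iter r (n + k) - cutoff_iter r n)" by simp
    then have "N (cutoff_iter r (n + Suc k) - cutoff_iter r n)
      \<le> N (cutoff_iter r (Suc (n + k)) - cutoff_iter r (n + k)) + N (cutoff_iter r (n + k) - cutoff_iter r n)"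
      by (metis N_add)
    then show ?case using Suc N_cutoff_iter_Suc_diff[OF assms(1-3), of "n + k"] by simp
  qed simp
  have sym: "N (P - Q) = N (Q - P)" for P Q using N_smult[of "- 1" "P - Q"] by simp
  have le: "N (cutoff r m - cutoff r n) \<le> \<bar>scalar_iter m - scalar_iter n\<bar>" for m n
  proof -
    have *: "N (cutoff r m - cutoff r n) = N (cutoff_iter r m - cutoff_iter r n)" for m n
      using sym[of "cutoff_iter r m" "cutoff_iter r n"] by (simp add: cutoff_def)
    show ?thesis
    proof (cases "n \<le> m")
      case True
      then show ?thesis using mono[of n "m - n"] * by simp
    next
      case False
      then show ?thesis using mono[of m "n - m"] * sym[of "cutoff_iter r m" "cutoff_iter r n"] by simp
    qed
  qed
  obtain K where "\<And>m n. m \<ge> K \<Longrightarrow> n \<ge> K \<Longrightarrow> dist (scalar_iter m) (scalar_iter n) < e"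
    using metric_CauchyD[OF scalar_iter_Cauchy \<open>e > 0\<close>] by blast
  then show ?thesis using le by (metis dist_real_def le_less_trans)
qed

text \<open>If \<open>N X < r\<close>, then \<open>1 + h\<close> has seminorm less than 1 and is a fixed point of the iteration.\<close>

lemma N_cutoff_tendsto_0:
  assumes "N [:0, 1:] < r" "r \<le> 1"
  shows "(\<lambda>n. N (cutoff r n)) \<longlonglongrightarrow> 0"
proof -
  define s where "s = N [:0, 1:]"
  have s: "0 \<le> s" "s < r" "r \<le> 1" using assms N_nonneg by (auto simp: s_def)
  have N1: "N [:0, 1:] \<le> 1" "0 \<le> r" using s by (auto simp: s_def)
  let ?y = "1 + cutoff_h r"
  \<comment> \<open>An upper bound for the seminorm of \<open>1 + h\<close>, whose constant part is
    \<open>1 - r^2 / 2\<close> and whose quadratic part contributes \<open>s^2 / 2\<close>. It is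
    below 1 exactly because \<open>s < r\<close>.\<close>
  define \<rho> where "\<rho> = 1 - r\<^sup>2 / 2 + s\<^sup>2 / 2"
  have "s\<^sup>2 < r\<^sup>2" using s by (intro power_strict_mono) auto
  moreover have "r\<^sup>2 \<le> 1" using s by (simp add: power_le_one)
  ultimately have \<rho>: "0 \<le> \<rho>" "\<rho> < 1" by (auto simp: \<rho>_def)
  have "?y = [:1 - r\<^sup>2 / 2:] + [:0, 0, 1/2:]" by (simp add: cutoff_h_def one_pCons)
  then have "N ?y \<le> N [:1 - r\<^sup>2 / 2:] + N [:0, 0, 1/2:]" by (metis N_add)
  also have "\<dots> \<le> \<bar>1 - r\<^sup>2 / 2\<bar> + \<bar>1/2\<bar> * (N [:0, 1:])\<^sup>2" by (intro add_mono N_const N_X_square)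
  also have "\<dots> = \<rho>" using \<open>r\<^sup>2 \<le> 1\<close> by (simp add: \<rho>_def s_def)
  finally have Ny: "N ?y \<le> \<rho>" .
  have fixpoint: "Polynomial.smult (1/2) (1 - cutoff_h r * cutoff_h r + ?y * ?y) = ?y"
  proof -
    have "1 - cutoff_h r * cutoff_h r + ?y * ?y = ?y + ?y" by (simp add: algebra_simps)
    then have "Polynomial.smult (1/2) (1 - cutoff_h r * cutoff_h r + ?y * ?y) = Polynomial.smult (1/2) ?y + Polynomial.smult (1/2) ?y"
      by (simp only: smult_add_right)
    also have "\<dots> = Polynomial.smult (1/2 + 1/2) ?y" by (rule Polynomial.smult_add_left[symmetric])
    finally show ?thesis by simp
  qed
  \<comment> \<open>The contraction factor is the mean of the bounds \<open>\<rho>\<close> for the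
    fixed point and 1 for the iterate.\<close>
  have step: "N (cutoff r (Suc n)) \<le> N (cutoff r n) * ((\<rho> + 1) / 2)" for n
  proof -
    have "N (cutoff r (Suc n)) = N (Polynomial.smult (1/2) (1 - cutoff_h r * cutoff_h r + ?y * ?y) - cutoff_iter r (Suc n))"
      unfolding fixpoint by (simp add: cutoff_def)
    also have "\<dots> \<le> N (?y - cutoff_iter r n) * (N ?y + N (cutoff_iter r n)) / 2"
      unfolding sqrt_iter.simps(2) by (rule N_half_difference)
    also have "\<dots> \<le> N (?y - cutoff_iter r n) * (\<rho> + 1) / 2"
      using N_cutoff_iter[OF N1 s(3), of n] scalar_iter_bounds(2)[of n] Ny
      by (intro divide_right_mono mult_left_mono add_mono N_nonneg) auto
    finally show ?thesis by (simp add: cutoff_def)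
  qed
  have geo: "N (cutoff r n) \<le> N (cutoff r 0) * ((\<rho> + 1) / 2) ^ n" for n
  proof (induction n)
    case (Suc n)
    have "N (cutoff r (Suc n)) \<le> N (cutoff r n) * ((\<rho> + 1) / 2)" by (rule step)
    also have "\<dots> \<le> (N (cutoff r 0) * ((\<rho> + 1) / 2) ^ n) * ((\<rho> + 1) / 2)"
      using Suc \<rho> by (intro mult_right_mono) auto
    finally show ?case by (simp add: mult_ac)
  qed simp
  have "(\<lambda>n. N (cutoff r 0) * ((\<rho> + 1) / 2) ^ n) \<longlonglongrightarrow> N (cutoff r 0) * 0"
    using \<rho> by (intro tendsto_intros LIMSEQ_power_zero) auto
  then have lim: "(\<lambda>n. N (cutoff r 0) * ((\<rho> + 1) / 2) ^ n) \<longlonglongrightarrow> 0" by simp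
  show ?thesis
    by (rule tendsto_sandwich[OF _ _ tendsto_const lim]) (rule always_eventually, simp add: N_nonneg geo)+
qed

end

section \<open>Evaluation of real polynomials at a self-adjoint element\<close>

context cstar_normed begin

definition peval :: "'a \<Rightarrow> real poly \<Rightarrow> 'a" where
  "peval x P = fold_coeffs (\<lambda>a s. of_real a \<odot> \<one> \<oplus> x \<otimes> s) P \<zero>"

lemma smult_zero_right [simp]: "c \<odot> \<zero> = \<zero>"
  using smult_smult[of \<zero> c 0] by simp

context
  fixes x assumes x: "x \<in> carrier M"
begin

lemma peval_zero [simp]: "peval x 0 = \<zero>"
  by (simp add: peval_def)

lemma peval_pCons: "peval x (pCons a P) = of_real a \<odot> \<one> \<oplus> x \<otimes> peval x P"
  using x by (cases "pCons a P = 0") (auto simp: peval_def)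

lemma peval_closed [simp]: "peval x P \<in> carrier M"
  using x by (induction P) (auto simp: peval_pCons)

lemma peval_add: "peval x (P + Q) = peval x P \<oplus> peval x Q"
proof (induction P Q rule: poly_induct2)
  case (pCons a P b Q)
  have "peval x (pCons a P + pCons b Q) = (of_real a \<odot> \<one> \<oplus> of_real b \<odot> \<one>) \<oplus> x \<otimes> (peval x P \<oplus> peval x Q)"
    by (simp add: peval_pCons pCons.IH smult_l_distr)
  also have "\<dots> = peval x (pCons a P) \<oplus> peval x (pCons b Q)"
    using x by (simp add: peval_pCons r_distr a_assoc a_comm a_lcomm)
  finally show ?case .
qed simp

lemma peval_smult: "peval x (Polynomial.smult c P) = of_real c \<odot> peval x P"
  using x by (induction P) (simp_all add: peval_pCons smult_r_distr smult_smult smult_mult_right)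

lemma peval_mult: "peval x (P * Q) = peval x P \<otimes> peval x Q"
proof (induction P)
  case (pCons a P)
  have "peval x (pCons a P * Q) = of_real a \<odot> peval x Q \<oplus> (x \<otimes> (peval x P \<otimes> peval x Q))"
    using x by (simp add: mult_pCons_left peval_add peval_smult peval_pCons pCons.IH)
  also have "\<dots> = peval x (pCons a P) \<otimes> peval x Q"
    using x by (simp add: peval_pCons l_distr smult_mult_left m_assoc)
  finally show ?case .
qed simp

lemma peval_one: "peval x 1 = \<one>"
  using x by (simp add: peval_pCons one_pCons)

lemma peval_X: "peval x [:0, 1:] = x"
  using x by (simp add: peval_pCons)

lemma peval_diff: "peval x (P - Q) = peval x P \<ominus> peval x Q"
  using peval_add[of P "- Q"] peval_smult[of "- 1" Q] by (simp add: smult_minus_one minus_eq)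

lemma peval_star:
  assumes "star M x = x" shows "star M (peval x P) = peval x P"
proof (induction P)
  case (pCons a P)
  have "peval x P \<otimes> x = x \<otimes> peval x P"
    using peval_mult[of P "[:0, 1:]"] peval_mult[of "[:0, 1:]" P] by (simp only: peval_X mult.commute)
  then show ?case using pCons x assms by (simp add: peval_pCons star_add star_mult star_smult)
qed simp

lemma poly_cstar_seminorm_peval:
  assumes sa: "star M x = x"
  shows "poly_cstar_seminorm (\<lambda>P. p (peval x P))"
proof
  fix P Q :: "real poly" and c :: real
  show "0 \<le> p (peval x P)" by simp
  show "p (peval x (P + Q)) \<le> p (peval x P) + p (peval x Q)" by (simp add: peval_add p_add)
  show "p (peval x (Polynomial.smult c P)) = \<bar>c\<bar> * p (peval x P)" by (simp add: peval_smult p_smult)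
  show "p (peval x (P * Q)) \<le> p (peval x P) * p (peval x Q)" by (simp add: peval_mult p_mult)
  show "p (peval x (P * P)) = (p (peval x P))\<^sup>2"
    using p_cstar[of "peval x P"] by (simp add: peval_mult peval_star[OF sa])
  show "p (peval x 1) \<le> 1" by (simp add: peval_one p_one_le)
  show "(p (peval x P))\<^sup>2 \<le> p (peval x (P * P + Q * Q))"
  proof -
    let ?P = "peval x P" and ?Q = "peval x Q"
    \<comment> \<open>The two values commute and are self-adjoint, so \<open>P + i Q\<close> is
      normal: the product of its adjoint with itself is \<open>P^2 + Q^2\<close>, while
      \<open>P\<close> is the mean of \<open>u\<close> and its adjoint.\<close>
    define u where "u = ?P \<oplus> \<i> \<odot> ?Q"
    have u: "u \<in> carrier M" by (simp add: u_def)
    have star_u: "star M u = ?P \<oplus> (- \<i>) \<odot> ?Q" by (simp add: u_def star_add star_smult peval_star[OF sa])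
    have QP: "?Q \<otimes> ?P = ?P \<otimes> ?Q" by (metis peval_mult mult.commute)
    have "u \<oplus> star M u = (?P \<oplus> ?P) \<oplus> (\<i> \<odot> ?Q \<oplus> (- \<i>) \<odot> ?Q)"
      unfolding star_u by (simp add: u_def a_assoc a_lcomm)
    also have "\<dots> = 2 \<odot> ?P"
      using smult_l_distr[of ?P 1 1] smult_l_distr[of ?Q \<i> "- \<i>"] by simp
    finally have "2 * p ?P \<le> p u + p (star M u)"
      using p_add[OF u star_closed[OF u]] by (simp add: p_smult)
    then have "p ?P \<le> p u" by (simp add: p_star u)
    then have "(p ?P)\<^sup>2 \<le> (p u)\<^sup>2" by (intro power_mono) auto
    also have "\<dots> = p (star M u \<otimes> u)" by (simp add: p_cstar u)
    also have "star M u \<otimes> u = (?P \<otimes> ?P \<oplus> ?Q \<otimes> ?Q) \<oplus> (\<i> \<odot> (?P \<otimes> ?Q) \<oplus> (- \<i>) \<odot> (?P \<otimes> ?Q))"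
      unfolding star_u
      by (simp add: u_def l_distr r_distr smult_mult_left smult_mult_right smult_r_distr smult_smult QP a_assoc a_comm a_lcomm)
    also have "\<dots> = peval x (P * P + Q * Q)"
      using smult_l_distr[of "?P \<otimes> ?Q" \<i> "- \<i>"] by (simp add: peval_add peval_mult)
    finally show ?thesis .
  qed
qed

end

end

section \<open>C*-norms on the algebraic tensor square\<close>

abbreviation "AA \<equiv> alg_tensor A_alg A_alg"
abbreviation "A_rel \<equiv> tensor_rel A_alg A_alg"
abbreviation tcls :: "((free2 oper \<times> free2 oper) \<Rightarrow>\<^sub>0 complex) \<Rightarrow> ((free2 oper \<times> free2 oper) \<Rightarrow>\<^sub>0 complex) set" where
  "tcls f \<equiv> A_rel `` {f}"

text \<open>What \<open>oper_tensor\<close> and the map behind \<open>pi_r\<close> have in common: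
  bilinear, compatible with adjoints, and multiplicative in both variables jointly. Such a map
  induces a *-representation of the tensor square, so both representations are handled at
  once.\<close>

definition star_bihom :: "(free2 oper \<Rightarrow> free2 oper \<Rightarrow> 'k oper) \<Rightarrow> bool" where
  "star_bihom \<phi> \<longleftrightarrow>
    (\<forall>a\<in>carrier A_alg. \<forall>b\<in>carrier A_alg. \<phi> a b \<in> bounded_ops \<and>
      \<phi> (adjoint_oper a) (adjoint_oper b) = adjoint_oper (\<phi> a b) \<and>
      (\<forall>c. \<phi> (scaleC_oper c a) b = scaleC_oper c (\<phi> a b) \<and> \<phi> a (scaleC_oper c b) = scaleC_oper c (\<phi> a b)) \<and>
      (\<forall>a'\<in>carrier A_alg. \<phi> (a + a') b = \<phi> a b + \<phi> a' b) \<and>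
      (\<forall>b'\<in>carrier A_alg. \<phi> a (b + b') = \<phi> a b + \<phi> a b') \<and>
      (\<forall>a'\<in>carrier A_alg. \<forall>b'\<in>carrier A_alg. \<phi> (a o\<^sub>L a') (b o\<^sub>L b') = \<phi> a b o\<^sub>L \<phi> a' b'))"

lemma star_bihom_oper_tensor: "star_bihom oper_tensor"
  unfolding star_bihom_def
  by (auto simp: oper_tensor_bounded A_bounded adjoint_oper_tensor oper_tensor_scaleC oper_tensor_add_left
      oper_tensor_add_right oper_tensor_compose)

definition pi_r_bihom :: "free2 oper \<Rightarrow> free2 oper \<Rightarrow> free2 oper" where
  "pi_r_bihom a b = left_rep (quotient_map a) o\<^sub>L right_rep (quotient_map b)"

lemma pi_r_eq: "pi_r = tensor_lift pi_r_bihom"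
  by (simp add: pi_r_def pi_r_bihom_def[abs_def])

lemma star_bihom_pi_r: "star_bihom pi_r_bihom"
proof -
  have adj: "adjoint_oper a o\<^sub>L adjoint_oper (right_rep b) = adjoint_oper (a o\<^sub>L right_rep b)"
    if "a \<in> carrier reduced_alg" "b \<in> carrier reduced_alg" for a b
    unfolding right_rep_commutes[OF that] using that by (simp add: adjoint_compose reduced_bounded right_rep_bounded)
  have mult: "(a o\<^sub>L a') o\<^sub>L (right_rep b o\<^sub>L right_rep b') = (a o\<^sub>L right_rep b) o\<^sub>L (a' o\<^sub>L right_rep b')"
    if "a' \<in> carrier reduced_alg" "b \<in> carrier reduced_alg" for a a' b b'
    using right_rep_commutes[OF that] by (metis compose_assoc)
  show ?thesis
    unfolding star_bihom_def pi_r_bihom_def left_rep_def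
    by (auto simp: quotient_map_reduced reduced_bounded right_rep_bounded bounded_ops_compose
        quotient_map_adjoint right_rep_adjoint adj quotient_map_scaleC right_rep_scaleC scaleC_oper_compose_left
        scaleC_oper_compose_right quotient_map_add right_rep_add compose_add_left compose_add_right
        quotient_map_compose right_rep_compose mult)
qed

lemma sum_compose_left: "sum f I o\<^sub>L T = (\<Sum>i\<in>I. f i o\<^sub>L T)"
  by (rule bounded_bilinear.sum_left[OF bounded_bilinear_blinfun_compose])

lemma sum_compose_right: "T o\<^sub>L sum f I = (\<Sum>i\<in>I. T o\<^sub>L f i)"
  by (rule bounded_bilinear.sum_right[OF bounded_bilinear_blinfun_compose])

lemma adjoint_sum: "(\<And>i. i \<in> I \<Longrightarrow> f i \<in> bounded_ops) \<Longrightarrow> adjoint_oper (sum f I) = (\<Sum>i\<in>I. adjoint_oper (f i))"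
  by (induction I rule: infinite_finite_induct) (auto simp: adjoint_add bounded_ops_sum)

section \<open>Representations of formal sums\<close>

lemma A_sums_keys: "f \<in> A_sums \<Longrightarrow> (a, b) \<in> Poly_Mapping.keys f \<Longrightarrow> a \<in> carrier A_alg \<and> b \<in> carrier A_alg"
  by (auto simp: formal_sums_def)

lemma formal_sums_zero: "0 \<in> formal_sums S T"
  by (simp add: formal_sums_def)

lemma formal_sums_add: "f \<in> formal_sums S T \<Longrightarrow> g \<in> formal_sums S T \<Longrightarrow> f + g \<in> formal_sums S T"
  using Poly_Mapping.keys_add[of f g] by (auto simp: formal_sums_def)

lemma formal_sums_single: "a \<in> S \<Longrightarrow> b \<in> T \<Longrightarrow> Poly_Mapping.single (a, b) z \<in> formal_sums S T"
  by (simp add: formal_sums_def)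

lemma formal_sums_diff: "f \<in> formal_sums S T \<Longrightarrow> g \<in> formal_sums S T \<Longrightarrow> f - g \<in> formal_sums S T"
  using Poly_Mapping.keys_diff[of f g] by (auto simp: formal_sums_def)

lemma formal_sums_sum: "(\<And>i. i \<in> I \<Longrightarrow> f i \<in> formal_sums S T) \<Longrightarrow> sum f I \<in> formal_sums S T"
  by (induction I rule: infinite_finite_induct) (auto intro: formal_sums_zero formal_sums_add)

lemma keys_map_times: "Poly_Mapping.keys (Poly_Mapping.map ((*) c) f) \<subseteq> Poly_Mapping.keys f"
  and lookup_map_times: "Poly_Mapping.lookup (Poly_Mapping.map ((*) c) f) k = c * Poly_Mapping.lookup f k" for c :: complex
proof -
  show *: "Poly_Mapping.lookup (Poly_Mapping.map ((*) c) f) k = c * Poly_Mapping.lookup f k" for k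
    by (simp add: Poly_Mapping.map.rep_eq when_def)
  show "Poly_Mapping.keys (Poly_Mapping.map ((*) c) f) \<subseteq> Poly_Mapping.keys f"
    by (auto simp: in_keys_iff *)
qed

lemma formal_sums_map: "f \<in> formal_sums S T \<Longrightarrow> Poly_Mapping.map ((*) c) f \<in> formal_sums S T" for c :: complex
  using keys_map_times[of c f] by (auto simp: formal_sums_def)

lemma A_sums_mult: "f \<in> A_sums \<Longrightarrow> g \<in> A_sums \<Longrightarrow> formal_mult A_alg A_alg f g \<in> A_sums"
  unfolding formal_mult_def
  by (auto intro!: formal_sums_sum formal_sums_single quotient_map_compose(1) dest: A_sums_keys)

lemma A_sums_star: "f \<in> A_sums \<Longrightarrow> formal_star A_alg A_alg f \<in> A_sums"
  unfolding formal_star_def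
  by (auto intro!: formal_sums_sum formal_sums_single quotient_map_adjoint(1) dest: A_sums_keys)

lemma linear_ext_superset:
  assumes "finite S" "Poly_Mapping.keys f \<subseteq> S"
  shows "linear_ext \<phi> f = (\<Sum>(a, b)\<in>S. scaleC_oper (Poly_Mapping.lookup f (a, b)) (\<phi> a b))"
  unfolding linear_ext_def using assms by (intro sum.mono_neutral_left) (auto simp: in_keys_iff)

lemma linear_ext_map: "linear_ext \<phi> (Poly_Mapping.map ((*) c) f) = scaleC_oper c (linear_ext \<phi> f)"
  unfolding linear_ext_superset[OF finite_keys keys_map_times]
  by (simp add: linear_ext_def lookup_map_times scaleC_oper_sum case_prod_unfold)

context
  fixes \<phi> :: "free2 oper \<Rightarrow> free2 oper \<Rightarrow> 'k oper"
  assumes \<phi>: "star_bihom \<phi>"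
begin

lemma bihom_bounded: "a \<in> carrier A_alg \<Longrightarrow> b \<in> carrier A_alg \<Longrightarrow> \<phi> a b \<in> bounded_ops"
  and bihom_star: "a \<in> carrier A_alg \<Longrightarrow> b \<in> carrier A_alg \<Longrightarrow> \<phi> (adjoint_oper a) (adjoint_oper b) = adjoint_oper (\<phi> a b)"
  and bihom_scale_left: "a \<in> carrier A_alg \<Longrightarrow> b \<in> carrier A_alg \<Longrightarrow> \<phi> (scaleC_oper c a) b = scaleC_oper c (\<phi> a b)"
  and bihom_scale_right: "a \<in> carrier A_alg \<Longrightarrow> b \<in> carrier A_alg \<Longrightarrow> \<phi> a (scaleC_oper c b) = scaleC_oper c (\<phi> a b)"
  and bihom_add_left: "a \<in> carrier A_alg \<Longrightarrow> a' \<in> carrier A_alg \<Longrightarrow> b \<in> carrier A_alg \<Longrightarrow> \<phi> (a + a') b = \<phi> a b + \<phi> a' b"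
  and bihom_add_right: "a \<in> carrier A_alg \<Longrightarrow> b \<in> carrier A_alg \<Longrightarrow> b' \<in> carrier A_alg \<Longrightarrow> \<phi> a (b + b') = \<phi> a b + \<phi> a b'"
  and bihom_mult: "a \<in> carrier A_alg \<Longrightarrow> a' \<in> carrier A_alg \<Longrightarrow> b \<in> carrier A_alg \<Longrightarrow> b' \<in> carrier A_alg \<Longrightarrow>
    \<phi> (a o\<^sub>L a') (b o\<^sub>L b') = \<phi> a b o\<^sub>L \<phi> a' b'"
  using \<phi> unfolding star_bihom_def by blast+

lemma linear_ext_null: "f \<in> A_null \<Longrightarrow> linear_ext \<phi> f = 0"
proof (induction rule: tensor_null.induct)
  case (left_smult a b c z)
  then show ?case by (simp add: linear_ext_diff linear_ext_single bihom_scale_left mult.commute)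
next
  case (right_smult a b c z)
  then show ?case by (simp add: linear_ext_diff linear_ext_single bihom_scale_right mult.commute)
qed (simp_all add: linear_ext_add linear_ext_diff linear_ext_single bihom_add_left bihom_add_right scaleC_oper_add_right)

lemma linear_ext_bounded: "f \<in> A_sums \<Longrightarrow> linear_ext \<phi> f \<in> bounded_ops"
  unfolding linear_ext_def by (auto intro!: bounded_ops_sum bounded_ops_scaleC bihom_bounded dest: A_sums_keys)

lemma linear_ext_formal_mult:
  assumes f: "f \<in> A_sums" and g: "g \<in> A_sums"
  shows "linear_ext \<phi> (formal_mult A_alg A_alg f g) = linear_ext \<phi> f o\<^sub>L linear_ext \<phi> g"
proof -
  let ?lf = "Poly_Mapping.lookup f" and ?lg = "Poly_Mapping.lookup g"
  have "linear_ext \<phi> (formal_mult A_alg A_alg f g) = (\<Sum>p\<in>Poly_Mapping.keys f. \<Sum>q\<in>Poly_Mapping.keys g.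
      scaleC_oper (?lf p * ?lg q) (\<phi> (fst p o\<^sub>L fst q) (snd p o\<^sub>L snd q)))"
    by (simp add: formal_mult_def case_prod_unfold linear_ext_sum linear_ext_single)
  also have "\<dots> = (\<Sum>p\<in>Poly_Mapping.keys f. \<Sum>q\<in>Poly_Mapping.keys g.
      scaleC_oper (?lf p) (\<phi> (fst p) (snd p)) o\<^sub>L scaleC_oper (?lg q) (\<phi> (fst q) (snd q)))"
  proof (intro sum.cong refl)
    fix p q assume "p \<in> Poly_Mapping.keys f" "q \<in> Poly_Mapping.keys g"
    then have "fst p \<in> carrier A_alg" "snd p \<in> carrier A_alg" "fst q \<in> carrier A_alg" "snd q \<in> carrier A_alg"
      using A_sums_keys[OF f, of "fst p" "snd p"] A_sums_keys[OF g, of "fst q" "snd q"] by simp_all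
    then show "scaleC_oper (?lf p * ?lg q) (\<phi> (fst p o\<^sub>L fst q) (snd p o\<^sub>L snd q)) =
      scaleC_oper (?lf p) (\<phi> (fst p) (snd p)) o\<^sub>L scaleC_oper (?lg q) (\<phi> (fst q) (snd q))"
      by (simp add: bihom_mult bihom_bounded scaleC_oper_compose_left scaleC_oper_compose_right)
  qed
  also have "\<dots> = linear_ext \<phi> f o\<^sub>L linear_ext \<phi> g"
    unfolding linear_ext_def case_prod_unfold prod.collapse sum_compose_left by (simp only: sum_compose_right)
  finally show ?thesis .
qed

lemma linear_ext_formal_star:
  assumes f: "f \<in> A_sums"
  shows "linear_ext \<phi> (formal_star A_alg A_alg f) = adjoint_oper (linear_ext \<phi> f)"
proof -
  have K: "fst p \<in> carrier A_alg" "snd p \<in> carrier A_alg" if "p \<in> Poly_Mapping.keys f" for p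
    using A_sums_keys[OF f, of "fst p" "snd p"] that by simp_all
  have "linear_ext \<phi> (formal_star A_alg A_alg f) = (\<Sum>p\<in>Poly_Mapping.keys f.
      scaleC_oper (cnj (Poly_Mapping.lookup f p)) (\<phi> (adjoint_oper (fst p)) (adjoint_oper (snd p))))"
    by (simp add: formal_star_def case_prod_unfold linear_ext_sum linear_ext_single)
  also have "\<dots> = (\<Sum>p\<in>Poly_Mapping.keys f. adjoint_oper (scaleC_oper (Poly_Mapping.lookup f p) (\<phi> (fst p) (snd p))))"
    by (intro sum.cong refl) (simp add: K bihom_star bihom_bounded adjoint_scaleC)
  also have "\<dots> = adjoint_oper (linear_ext \<phi> f)"
    unfolding linear_ext_def case_prod_unfold prod.collapse
    by (rule adjoint_sum[symmetric]) (simp add: K bihom_bounded bounded_ops_scaleC)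
  finally show ?thesis .
qed

end

text \<open>Faithfulness of the spatial map replaces the inductively generated relations by an
  equation between operators; well-definedness of the product and the involution on classes then
  follows from their compatibility with that map.\<close>

lemma A_rel_iff:
  "(f, g) \<in> A_rel \<longleftrightarrow> f \<in> A_sums \<and> g \<in> A_sums \<and> linear_ext oper_tensor f = linear_ext oper_tensor g"
  using linear_ext_kernel[OF formal_sums_diff, of f g] linear_ext_null[OF star_bihom_oper_tensor, of "f - g"]
  by (auto simp: tensor_rel_def linear_ext_diff)

lemma equiv_A_rel: "equiv A_sums A_rel"
  by (rule equivI) (auto simp: A_rel_iff refl_on_def sym_def trans_def)

lemma carrier_AA: "carrier AA = tcls ` A_sums"
  by (auto simp: alg_tensor_def quotient_def)

lemma tcls_eq_iff: "f \<in> A_sums \<Longrightarrow> g \<in> A_sums \<Longrightarrow> tcls f = tcls g \<longleftrightarrow> linear_ext oper_tensor f = linear_ext oper_tensor g"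
  using eq_equiv_class_iff[OF equiv_A_rel] by (simp add: A_rel_iff)

section \<open>The tensor square as a *-algebra\<close>

lemma AA_add: "f \<in> A_sums \<Longrightarrow> g \<in> A_sums \<Longrightarrow> tcls f \<oplus>\<^bsub>AA\<^esub> tcls g = tcls (f + g)"
proof -
  assume fg: "f \<in> A_sums" "g \<in> A_sums"
  have "congruent2 A_rel A_rel (\<lambda>f g. tcls (f + g))"
    by (rule congruent2I') (auto simp: A_rel_iff tcls_eq_iff formal_sums_add linear_ext_add)
  from UN_equiv_class2[OF equiv_A_rel equiv_A_rel this fg] show ?thesis by (simp add: alg_tensor_def)
qed

lemma AA_mult: "f \<in> A_sums \<Longrightarrow> g \<in> A_sums \<Longrightarrow> tcls f \<otimes>\<^bsub>AA\<^esub> tcls g = tcls (formal_mult A_alg A_alg f g)"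
proof -
  assume fg: "f \<in> A_sums" "g \<in> A_sums"
  have "congruent2 A_rel A_rel (\<lambda>f g. tcls (formal_mult A_alg A_alg f g))"
    by (rule congruent2I')
      (auto simp: A_rel_iff tcls_eq_iff A_sums_mult linear_ext_formal_mult[OF star_bihom_oper_tensor])
  from UN_equiv_class2[OF equiv_A_rel equiv_A_rel this fg] show ?thesis by (simp add: alg_tensor_def)
qed

lemma AA_smult: "f \<in> A_sums \<Longrightarrow> c \<odot>\<^bsub>AA\<^esub> tcls f = tcls (Poly_Mapping.map ((*) c) f)"
proof -
  assume f: "f \<in> A_sums"
  have "congruent A_rel (\<lambda>f. tcls (Poly_Mapping.map ((*) c) f))"
    by (rule congruentI) (auto simp: A_rel_iff tcls_eq_iff formal_sums_map linear_ext_map)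
  from UN_equiv_class[OF equiv_A_rel this f] show ?thesis by (simp add: alg_tensor_def)
qed

lemma AA_star: "f \<in> A_sums \<Longrightarrow> star AA (tcls f) = tcls (formal_star A_alg A_alg f)"
proof -
  assume f: "f \<in> A_sums"
  have "congruent A_rel (\<lambda>f. tcls (formal_star A_alg A_alg f))"
    by (rule congruentI) (auto simp: A_rel_iff tcls_eq_iff A_sums_star linear_ext_formal_star[OF star_bihom_oper_tensor])
  from UN_equiv_class[OF equiv_A_rel this f] show ?thesis by (simp add: alg_tensor_def)
qed

lemma AA_zero: "\<zero>\<^bsub>AA\<^esub> = tcls 0" and AA_one: "\<one>\<^bsub>AA\<^esub> = tcls (pure id_blinfun id_blinfun)"
  by (simp_all add: alg_tensor_def)

lemma AA_closed:
  shows AA_zero_closed: "\<zero>\<^bsub>AA\<^esub> \<in> carrier AA"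
    and AA_one_closed: "\<one>\<^bsub>AA\<^esub> \<in> carrier AA"
    and AA_add_closed: "X \<in> carrier AA \<Longrightarrow> Y \<in> carrier AA \<Longrightarrow> X \<oplus>\<^bsub>AA\<^esub> Y \<in> carrier AA"
    and AA_mult_closed: "X \<in> carrier AA \<Longrightarrow> Y \<in> carrier AA \<Longrightarrow> X \<otimes>\<^bsub>AA\<^esub> Y \<in> carrier AA"
    and AA_smult_closed: "X \<in> carrier AA \<Longrightarrow> c \<odot>\<^bsub>AA\<^esub> X \<in> carrier AA"
    and AA_star_closed: "X \<in> carrier AA \<Longrightarrow> star AA X \<in> carrier AA"
  by (auto simp: carrier_AA AA_zero AA_one AA_add AA_mult AA_smult AA_star formal_sums_zero formal_sums_single
      formal_sums_add A_sums_mult formal_sums_map A_sums_star id_A)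

lemma tensor_lift_tcls:
  assumes "star_bihom \<phi>" "f \<in> A_sums" shows "tensor_lift \<phi> (tcls f) = linear_ext \<phi> f"
proof -
  have "linear_ext \<phi> g = linear_ext \<phi> f" if "g \<in> tcls f" for g
    using that linear_ext_null[OF assms(1), of "f - g"] by (auto simp: tensor_rel_def linear_ext_diff)
  moreover have "f \<in> tcls f" using assms(2) by (rule equiv_class_self[OF equiv_A_rel])
  ultimately have "linear_ext \<phi> ` tcls f = {linear_ext \<phi> f}" by blast
  then show ?thesis by (simp add: tensor_lift_def flip: linear_ext_def)
qed

lemma tensor_lift_hom:
  assumes "star_bihom \<phi>"
  shows tensor_lift_bounded: "X \<in> carrier AA \<Longrightarrow> tensor_lift \<phi> X \<in> bounded_ops"
    and tensor_lift_add: "X \<in> carrier AA \<Longrightarrow> Y \<in> carrier AA \<Longrightarrow> tensor_lift \<phi> (X \<oplus>\<^bsub>AA\<^esub> Y) = tensor_lift \<phi> X + tensor_lift \<phi> Y"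
    and tensor_lift_mult: "X \<in> carrier AA \<Longrightarrow> Y \<in> carrier AA \<Longrightarrow> tensor_lift \<phi> (X \<otimes>\<^bsub>AA\<^esub> Y) = tensor_lift \<phi> X o\<^sub>L tensor_lift \<phi> Y"
    and tensor_lift_smult: "X \<in> carrier AA \<Longrightarrow> tensor_lift \<phi> (c \<odot>\<^bsub>AA\<^esub> X) = scaleC_oper c (tensor_lift \<phi> X)"
    and tensor_lift_star: "X \<in> carrier AA \<Longrightarrow> tensor_lift \<phi> (star AA X) = adjoint_oper (tensor_lift \<phi> X)"
    and tensor_lift_zero: "tensor_lift \<phi> \<zero>\<^bsub>AA\<^esub> = 0"
    and tensor_lift_one: "tensor_lift \<phi> \<one>\<^bsub>AA\<^esub> = \<phi> id_blinfun id_blinfun"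
  by (auto simp: carrier_AA AA_zero AA_one AA_add AA_mult AA_smult AA_star formal_sums_zero formal_sums_single
      formal_sums_add A_sums_mult formal_sums_map A_sums_star id_A tensor_lift_tcls[OF assms] linear_ext_add
      linear_ext_formal_mult[OF assms] linear_ext_map linear_ext_formal_star[OF assms] linear_ext_bounded[OF assms]
      linear_ext_single)

abbreviation "spatial \<equiv> tensor_lift oper_tensor"

text \<open>All axioms of the tensor square, and all identities between elementary tensors, are
  pulled back from operators through this faithful representation.\<close>

lemma AA_eqI:
  assumes "X \<in> carrier AA" "Y \<in> carrier AA" "spatial X = spatial Y" shows "X = Y"
proof -
  obtain f g where "f \<in> A_sums" "g \<in> A_sums" "X = tcls f" "Y = tcls g" using assms by (auto simp: carrier_AA)
  then show ?thesis using assms(3) by (simp add: tensor_lift_tcls[OF star_bihom_oper_tensor] tcls_eq_iff)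
qed

lemmas spatial_simps = tensor_lift_bounded[OF star_bihom_oper_tensor] tensor_lift_add[OF star_bihom_oper_tensor] tensor_lift_mult[OF star_bihom_oper_tensor]
  tensor_lift_smult[OF star_bihom_oper_tensor] tensor_lift_star[OF star_bihom_oper_tensor]
  tensor_lift_zero[OF star_bihom_oper_tensor] tensor_lift_one[OF star_bihom_oper_tensor, unfolded oper_tensor_id]

lemmas AA_closed_simps = AA_zero_closed AA_one_closed AA_add_closed AA_mult_closed AA_smult_closed AA_star_closed

lemma ring_AA: "ring AA"
proof (rule ringI)
  show "abelian_group AA"
  proof (rule abelian_groupI)
    fix X assume X: "X \<in> carrier AA"
    have "(- 1) \<odot>\<^bsub>AA\<^esub> X \<oplus>\<^bsub>AA\<^esub> X = \<zero>\<^bsub>AA\<^esub>"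
      by (rule AA_eqI) (simp_all add: X AA_closed_simps spatial_simps scaleC_oper_minus_one)
    then show "\<exists>Y\<in>carrier AA. Y \<oplus>\<^bsub>AA\<^esub> X = \<zero>\<^bsub>AA\<^esub>" using X AA_smult_closed by blast
  qed ((rule AA_eqI)?, simp add: AA_closed_simps spatial_simps add_ac)+
  show "monoid AA"
    by (rule monoidI) ((rule AA_eqI)?, simp add: AA_closed_simps spatial_simps compose_assoc)+
qed ((rule AA_eqI)?, simp add: AA_closed_simps spatial_simps compose_add_left compose_add_right)+

lemma cstar_normed_AA: "cstar_norm AA p \<Longrightarrow> cstar_normed AA p"
  by (intro cstar_normed.intro ring_AA cstar_normed_axioms.intro)
    ((rule AA_eqI)?, simp add: AA_closed_simps spatial_simps scaleC_oper_add_right scaleC_oper_add_left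
      scaleC_oper_compose_left scaleC_oper_compose_right adjoint_adjoint adjoint_add adjoint_scaleC adjoint_compose)+

lemma min_norm_spatial: "min_norm X = norm (spatial X)"
  by (simp add: min_norm_def)

lemma cstar_norm_min: "cstar_norm AA min_norm"
proof -
  have "spatial X = 0 \<longleftrightarrow> X = \<zero>\<^bsub>AA\<^esub>" if "X \<in> carrier AA" for X
    using AA_eqI[OF that AA_zero_closed] by (auto simp: spatial_simps)
  then show ?thesis
    unfolding cstar_norm_def min_norm_spatial
    by (simp add: AA_closed_simps spatial_simps norm_triangle_ineq norm_scaleC_oper norm_blinfun_compose norm_cstar)
qed

lemma cstar_norm_alpha: "cstar_norm AA alpha_norm"
proof -
  let ?n = "\<lambda>X. norm (pi_r X)"
  note pi = tensor_lift_hom[OF star_bihom_pi_r, folded pi_r_eq]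
  have m: "0 \<le> min_norm X" "min_norm X = 0 \<longleftrightarrow> X = \<zero>\<^bsub>AA\<^esub>" "min_norm (c \<odot>\<^bsub>AA\<^esub> X) = cmod c * min_norm X"
    "min_norm (star AA X \<otimes>\<^bsub>AA\<^esub> X) = (min_norm X)\<^sup>2" if "X \<in> carrier AA" for X c
    using that cstar_norm_min by (auto simp: cstar_norm_def)
  have m2: "min_norm (X \<oplus>\<^bsub>AA\<^esub> Y) \<le> min_norm X + min_norm Y" "min_norm (X \<otimes>\<^bsub>AA\<^esub> Y) \<le> min_norm X * min_norm Y"
    if "X \<in> carrier AA" "Y \<in> carrier AA" for X Y
    using that cstar_norm_min by (auto simp: cstar_norm_def)
  show ?thesis
    unfolding cstar_norm_def alpha_norm_def
  proof (intro conjI ballI allI)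
    fix X assume X: "X \<in> carrier AA"
    show "0 \<le> max (min_norm X) (?n X)" by (simp add: le_max_iff_disj)
    show "max (min_norm X) (?n X) = 0 \<longleftrightarrow> X = \<zero>\<^bsub>AA\<^esub>"
    proof
      assume "max (min_norm X) (?n X) = 0"
      then have "min_norm X = 0" using m(1)[OF X] by (metis max.cobounded1 order_antisym)
      then show "X = \<zero>\<^bsub>AA\<^esub>" using m(2)[OF X] by simp
    next
      assume "X = \<zero>\<^bsub>AA\<^esub>"
      then show "max (min_norm X) (?n X) = 0" using m(2)[OF X] pi by simp
    qed
    show "max (min_norm (c \<odot>\<^bsub>AA\<^esub> X)) (?n (c \<odot>\<^bsub>AA\<^esub> X)) = cmod c * max (min_norm X) (?n X)" for c
      using X by (simp add: m pi norm_scaleC_oper max_mult_distrib_left)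
    have sq: "max (s\<^sup>2) (t\<^sup>2) = (max s t)\<^sup>2" if "0 \<le> s" "0 \<le> t" for s t :: real
      using that power_mono[of s t 2] power_mono[of t s 2] by (auto simp: max_def)
    show "max (min_norm (star AA X \<otimes>\<^bsub>AA\<^esub> X)) (?n (star AA X \<otimes>\<^bsub>AA\<^esub> X)) = (max (min_norm X) (?n X))\<^sup>2"
      using X m(1)[OF X] by (simp add: m pi AA_closed_simps norm_cstar sq)
    fix Y assume Y: "Y \<in> carrier AA"
    have "?n (X \<oplus>\<^bsub>AA\<^esub> Y) \<le> ?n X + ?n Y" using X Y by (simp add: pi norm_triangle_ineq)
    with m2(1)[OF X Y] show "max (min_norm (X \<oplus>\<^bsub>AA\<^esub> Y)) (?n (X \<oplus>\<^bsub>AA\<^esub> Y)) \<le> max (min_norm X) (?n X) + max (min_norm Y) (?n Y)"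
      by linarith
    have "?n (X \<otimes>\<^bsub>AA\<^esub> Y) \<le> ?n X * ?n Y" using X Y by (simp add: pi norm_blinfun_compose)
    also have "\<dots> \<le> max (min_norm X) (?n X) * max (min_norm Y) (?n Y)"
      by (intro mult_mono) (auto simp: le_max_iff_disj)
    finally have 1: "?n (X \<otimes>\<^bsub>AA\<^esub> Y) \<le> max (min_norm X) (?n X) * max (min_norm Y) (?n Y)" .
    have "min_norm X * min_norm Y \<le> max (min_norm X) (?n X) * max (min_norm Y) (?n Y)"
      using m(1)[OF X] m(1)[OF Y] by (intro mult_mono) (auto simp: le_max_iff_disj)
    with m2(2)[OF X Y] 1 show "max (min_norm (X \<otimes>\<^bsub>AA\<^esub> Y)) (?n (X \<otimes>\<^bsub>AA\<^esub> Y)) \<le> max (min_norm X) (?n X) * max (min_norm Y) (?n Y)"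
      by simp
  qed
qed

subsection \<open>Elementary tensors and the maximal norm\<close>

abbreviation "tens a b \<equiv> tcls (pure a b)"

lemma tens_closed: "a \<in> carrier A_alg \<Longrightarrow> b \<in> carrier A_alg \<Longrightarrow> tens a b \<in> carrier AA"
  by (auto simp: carrier_AA formal_sums_single)

lemma tensor_lift_tens: "star_bihom \<phi> \<Longrightarrow> a \<in> carrier A_alg \<Longrightarrow> b \<in> carrier A_alg \<Longrightarrow> tensor_lift \<phi> (tens a b) = \<phi> a b"
  by (simp add: tensor_lift_tcls formal_sums_single linear_ext_single)

lemmas spatial_tens = tensor_lift_tens[OF star_bihom_oper_tensor]

lemma formal_sums_induct [consumes 1, case_names zero single add]:
  assumes f: "f \<in> formal_sums S T"
    and "P 0" "\<And>a b z. a \<in> S \<Longrightarrow> b \<in> T \<Longrightarrow> P (Poly_Mapping.single (a, b) z)"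
    "\<And>f g. f \<in> formal_sums S T \<Longrightarrow> g \<in> formal_sums S T \<Longrightarrow> P f \<Longrightarrow> P g \<Longrightarrow> P (f + g)"
  shows "P f"
proof -
  have "P (\<Sum>p\<in>K. Poly_Mapping.single p (Poly_Mapping.lookup f p)) \<and>
      (\<Sum>p\<in>K. Poly_Mapping.single p (Poly_Mapping.lookup f p)) \<in> formal_sums S T"
    if "finite K" "K \<subseteq> Poly_Mapping.keys f" for K
    using that
  proof (induction K rule: finite_induct)
    case (insert p K)
    then have "p \<in> S \<times> T" using f by (auto simp: formal_sums_def)
    then have "P (Poly_Mapping.single p (Poly_Mapping.lookup f p))"
      "Poly_Mapping.single p (Poly_Mapping.lookup f p) \<in> formal_sums S T"
      using assms(3) by (auto intro: formal_sums_single)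
    then show ?case using insert assms(4) by (simp add: formal_sums_add)
  qed (use assms(2) formal_sums_zero in auto)
  then show ?thesis using poly_mapping_eq_sum[of f] by (metis finite_keys subset_refl)
qed

text \<open>A coefficient can be absorbed into the left factor, so only tensors with coefficient 1
  remain to be considered.\<close>

lemma alg_subtensor_induct [consumes 1, case_names subset_left subset_right zero_left zero_right scale tens add]:
  assumes X: "X \<in> alg_subtensor A_alg A_alg S T"
    and S: "S \<subseteq> carrier A_alg" "T \<subseteq> carrier A_alg" "0 \<in> S" "0 \<in> T"
    and scale: "\<And>c a. a \<in> S \<Longrightarrow> scaleC_oper c a \<in> S"
    and tens: "\<And>a b. a \<in> S \<Longrightarrow> b \<in> T \<Longrightarrow> P (tens a b)"
    and add: "\<And>X Y. X \<in> carrier AA \<Longrightarrow> Y \<in> carrier AA \<Longrightarrow> P X \<Longrightarrow> P Y \<Longrightarrow> P (X \<oplus>\<^bsub>AA\<^esub> Y)"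
  shows "P X"
proof -
  obtain f where f: "f \<in> formal_sums S T" "X = tcls f" using X by (auto simp: alg_subtensor_def)
  have sub: "f \<in> A_sums" if "f \<in> formal_sums S T" for f using that S(1,2) by (auto simp: formal_sums_def)
  have single_tens: "tcls (Poly_Mapping.single (a, b) z) = tens (scaleC_oper z a) b" if "a \<in> S" "b \<in> T" for a b z
  proof -
    have "a \<in> carrier A_alg" "b \<in> carrier A_alg" using that S by auto
    then show ?thesis
      by (subst tcls_eq_iff)
        (auto simp: formal_sums_single quotient_map_scaleC linear_ext_single oper_tensor_scaleC A_bounded)
  qed
  have "P (tcls f)" using f(1)
  proof (induction rule: formal_sums_induct)
    case zero
    have "tcls 0 = tens 0 0" using single_tens[OF S(3,4), of 0] by simp
    then show ?case using tens[OF S(3,4)] by simp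
  next
    case (single a b z)
    show ?case by (subst single_tens) (use single in \<open>auto intro: tens scale\<close>)
  next
    case (add f g)
    have "P (tcls f \<oplus>\<^bsub>AA\<^esub> tcls g)"
      by (rule assms(8)) (use add sub in \<open>simp_all add: carrier_AA\<close>)
    then show ?case using AA_add[OF sub sub] add by simp
  qed
  then show ?thesis by (simp add: f)
qed

lemma AA_induct [consumes 1, case_names tens add]:
  assumes X: "X \<in> carrier AA"
    and tens: "\<And>a b. a \<in> carrier A_alg \<Longrightarrow> b \<in> carrier A_alg \<Longrightarrow> P (tens a b)"
    and add: "\<And>X Y. X \<in> carrier AA \<Longrightarrow> Y \<in> carrier AA \<Longrightarrow> P X \<Longrightarrow> P Y \<Longrightarrow> P (X \<oplus>\<^bsub>AA\<^esub> Y)"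
  shows "P X"
proof -
  have "X \<in> alg_subtensor A_alg A_alg (carrier A_alg) (carrier A_alg)"
    using X by (auto simp: carrier_AA alg_subtensor_def)
  then show ?thesis
    by (induction rule: alg_subtensor_induct) (auto simp: zero_A quotient_map_scaleC tens add)
qed

lemmas tens_simps = tens_closed AA_closed_simps spatial_simps spatial_tens id_A zero_A quotient_map_add quotient_map_scaleC
  quotient_map_compose quotient_map_adjoint A_bounded oper_tensor_bounded oper_tensor_add_left oper_tensor_add_right
  oper_tensor_scaleC oper_tensor_compose adjoint_oper_tensor oper_tensor_id

text \<open>Restricted to \<open>A \<otimes> 1\<close> or to \<open>1 \<otimes> A\<close>, a C*-norm
  is a C*-seminorm on \<open>A\<close> and hence dominated by the operator norm; a general
  elementary tensor is a product of one element of each kind.\<close>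

lemma cstar_norm_tens_le:
  assumes "cstar_norm AA p" and a: "a \<in> carrier A_alg" and b: "b \<in> carrier A_alg"
  shows "p (tens a b) \<le> norm a * norm b"
proof -
  interpret AA: cstar_normed AA p by (rule cstar_normed_AA[OF assms(1)])
  have one: "tens id_blinfun id_blinfun = \<one>\<^bsub>AA\<^esub>" by (simp add: AA_one)
  have 1: "p (tens a id_blinfun) \<le> norm a"
  proof (rule cstar_seminorm_le_norm[OF A_subalgebra id_A _ _ _ _ a, where P = "\<lambda>a. p (tens a id_blinfun)"])
    fix x y c assume x: "x \<in> carrier A_alg"
    have "tens (scaleC_oper c x) id_blinfun = c \<odot>\<^bsub>AA\<^esub> tens x id_blinfun" by (rule AA_eqI) (simp_all add: x tens_simps)
    then show "p (tens (scaleC_oper c x) id_blinfun) = cmod c * p (tens x id_blinfun)" by (simp add: AA.p_smult tens_closed x id_A)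
    have "tens (adjoint_oper x o\<^sub>L x) id_blinfun = star AA (tens x id_blinfun) \<otimes>\<^bsub>AA\<^esub> tens x id_blinfun"
      by (rule AA_eqI) (simp_all add: x tens_simps)
    then show "p (tens (adjoint_oper x o\<^sub>L x) id_blinfun) = (p (tens x id_blinfun))\<^sup>2" by (simp add: AA.p_cstar tens_closed x id_A)
    assume y: "y \<in> carrier A_alg"
    have "tens (x + y) id_blinfun = tens x id_blinfun \<oplus>\<^bsub>AA\<^esub> tens y id_blinfun" by (rule AA_eqI) (simp_all add: x y tens_simps)
    then show "p (tens (x + y) id_blinfun) \<le> p (tens x id_blinfun) + p (tens y id_blinfun)" by (simp add: AA.p_add tens_closed x y id_A)
  qed (simp add: one AA.p_one_le)
  have 2: "p (tens id_blinfun b) \<le> norm b"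
  proof (rule cstar_seminorm_le_norm[OF A_subalgebra id_A _ _ _ _ b, where P = "\<lambda>b. p (tens id_blinfun b)"])
    fix x y c assume x: "x \<in> carrier A_alg"
    have "tens id_blinfun (scaleC_oper c x) = c \<odot>\<^bsub>AA\<^esub> tens id_blinfun x" by (rule AA_eqI) (simp_all add: x tens_simps)
    then show "p (tens id_blinfun (scaleC_oper c x)) = cmod c * p (tens id_blinfun x)" by (simp add: AA.p_smult tens_closed x id_A)
    have "tens id_blinfun (adjoint_oper x o\<^sub>L x) = star AA (tens id_blinfun x) \<otimes>\<^bsub>AA\<^esub> tens id_blinfun x"
      by (rule AA_eqI) (simp_all add: x tens_simps)
    then show "p (tens id_blinfun (adjoint_oper x o\<^sub>L x)) = (p (tens id_blinfun x))\<^sup>2" by (simp add: AA.p_cstar tens_closed x id_A)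
    assume y: "y \<in> carrier A_alg"
    have "tens id_blinfun (x + y) = tens id_blinfun x \<oplus>\<^bsub>AA\<^esub> tens id_blinfun y" by (rule AA_eqI) (simp_all add: x y tens_simps)
    then show "p (tens id_blinfun (x + y)) \<le> p (tens id_blinfun x) + p (tens id_blinfun y)" by (simp add: AA.p_add tens_closed x y id_A)
  qed (simp add: one AA.p_one_le)
  have "tens a b = tens a id_blinfun \<otimes>\<^bsub>AA\<^esub> tens id_blinfun b" by (rule AA_eqI) (simp_all add: a b tens_simps)
  then have "p (tens a b) \<le> p (tens a id_blinfun) * p (tens id_blinfun b)" by (simp add: AA.p_mult tens_closed a b id_A)
  also have "\<dots> \<le> norm a * norm b" using 1 2 by (intro mult_mono) (simp_all add: tens_closed b id_A)
  finally show ?thesis .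
qed

text \<open>The supremum of reals is meaningful only over a nonempty bounded set. The minimal norm
  provides an element, and the bound on elementary tensors, independent of the norm, provides
  boundedness. The clauses of a C*-norm then pass to the supremum.\<close>

lemma cstar_norm_max: "cstar_norm AA (max_norm A_alg A_alg)"
  and le_max_norm: "cstar_norm AA p \<Longrightarrow> X \<in> carrier AA \<Longrightarrow> p X \<le> max_norm A_alg A_alg X"
proof -
  let ?\<mu> = "max_norm A_alg A_alg" and ?C = "cstar_norm AA"
  have "\<exists>B. \<forall>p. ?C p \<longrightarrow> p X \<le> B" if "X \<in> carrier AA" for X
    using that
  proof (induction rule: AA_induct)
    case (tens a b)
    then show ?case using cstar_norm_tens_le by blast
  next
    case (add X Y)
    then obtain B B' where "\<And>p. ?C p \<Longrightarrow> p X \<le> B" "\<And>p. ?C p \<Longrightarrow> p Y \<le> B'" by blast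
    then have "p (X \<oplus>\<^bsub>AA\<^esub> Y) \<le> B + B'" if "?C p" for p
      using add(1,2) that unfolding cstar_norm_def by (smt (verit))
    then show ?case by blast
  qed
  then have bdd: "bdd_above {p X | p. ?C p}" if "X \<in> carrier AA" for X
    using that by (force simp: bdd_above_def)
  show le: "p X \<le> ?\<mu> X" if "?C p" "X \<in> carrier AA" for p X
    unfolding max_norm_def using that by (intro cSup_upper bdd) auto
  have least: "?\<mu> X \<le> B" if "\<And>p. ?C p \<Longrightarrow> p X \<le> B" for X B
    unfolding max_norm_def using cstar_norm_min that by (intro cSup_least) auto
  note C = cstar_normed_AA
  show "?C ?\<mu>"
    unfolding cstar_norm_def
  proof (intro conjI ballI allI)
    fix X assume X: "X \<in> carrier AA"
    have nonneg: "0 \<le> ?\<mu> Y" if "Y \<in> carrier AA" for Y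
      using le[OF cstar_norm_min that] by (simp add: min_norm_spatial order_trans[OF norm_ge_zero])
    show "0 \<le> ?\<mu> X" by (rule nonneg[OF X])
    show "?\<mu> X = 0 \<longleftrightarrow> X = \<zero>\<^bsub>AA\<^esub>"
    proof
      assume "?\<mu> X = 0"
      then have "min_norm X \<le> 0" using le[OF cstar_norm_min X] by simp
      then show "X = \<zero>\<^bsub>AA\<^esub>" by (intro AA_eqI) (simp_all add: X AA_closed_simps spatial_simps min_norm_spatial)
    next
      assume "X = \<zero>\<^bsub>AA\<^esub>"
      then have "p X \<le> 0" if "?C p" for p using that X by (auto simp: cstar_norm_def)
      then have "?\<mu> X \<le> 0" by (rule least)
      with nonneg[OF X] show "?\<mu> X = 0" by simp
    qed
    show "?\<mu> (c \<odot>\<^bsub>AA\<^esub> X) = cmod c * ?\<mu> X" for c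
    proof (rule antisym)
      show "?\<mu> (c \<odot>\<^bsub>AA\<^esub> X) \<le> cmod c * ?\<mu> X"
      proof (rule least)
        fix p assume p: "?C p"
        have "p (c \<odot>\<^bsub>AA\<^esub> X) = cmod c * p X" using p X by (auto simp: cstar_norm_def)
        also have "\<dots> \<le> cmod c * ?\<mu> X" by (intro mult_left_mono le p X) auto
        finally show "p (c \<odot>\<^bsub>AA\<^esub> X) \<le> cmod c * ?\<mu> X" .
      qed
      show "cmod c * ?\<mu> X \<le> ?\<mu> (c \<odot>\<^bsub>AA\<^esub> X)"
      proof (cases "c = 0")
        case False
        have "?\<mu> X \<le> ?\<mu> (c \<odot>\<^bsub>AA\<^esub> X) / cmod c"
        proof (rule least)
          fix p assume p: "?C p"
          have "cmod c * p X = p (c \<odot>\<^bsub>AA\<^esub> X)" using p X by (auto simp: cstar_norm_def)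
          also have "\<dots> \<le> ?\<mu> (c \<odot>\<^bsub>AA\<^esub> X)" by (intro le p AA_smult_closed X)
          finally show "p X \<le> ?\<mu> (c \<odot>\<^bsub>AA\<^esub> X) / cmod c" using False by (simp add: field_simps)
        qed
        then show ?thesis using False by (simp add: field_simps)
      qed (simp add: nonneg AA_smult_closed X)
    qed
    show "?\<mu> (star AA X \<otimes>\<^bsub>AA\<^esub> X) = (?\<mu> X)\<^sup>2"
    proof (rule antisym)
      show "?\<mu> (star AA X \<otimes>\<^bsub>AA\<^esub> X) \<le> (?\<mu> X)\<^sup>2"
      proof (rule least)
        fix p assume p: "?C p"
        then have "p (star AA X \<otimes>\<^bsub>AA\<^esub> X) = (p X)\<^sup>2" "0 \<le> p X" using X by (auto simp: cstar_norm_def)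
        then show "p (star AA X \<otimes>\<^bsub>AA\<^esub> X) \<le> (?\<mu> X)\<^sup>2" using le[OF p X] by (simp add: power_mono)
      qed
      have "?\<mu> X \<le> sqrt (?\<mu> (star AA X \<otimes>\<^bsub>AA\<^esub> X))"
      proof (rule least)
        fix p assume p: "?C p"
        have "(p X)\<^sup>2 = p (star AA X \<otimes>\<^bsub>AA\<^esub> X)" using p X by (auto simp: cstar_norm_def)
        also have "\<dots> \<le> ?\<mu> (star AA X \<otimes>\<^bsub>AA\<^esub> X)" by (intro le p AA_closed_simps X)
        finally show "p X \<le> sqrt (?\<mu> (star AA X \<otimes>\<^bsub>AA\<^esub> X))" by (rule real_le_rsqrt)
      qed
      then have "(?\<mu> X)\<^sup>2 \<le> (sqrt (?\<mu> (star AA X \<otimes>\<^bsub>AA\<^esub> X)))\<^sup>2" by (intro power_mono nonneg X)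
      then show "(?\<mu> X)\<^sup>2 \<le> ?\<mu> (star AA X \<otimes>\<^bsub>AA\<^esub> X)" by (simp add: nonneg AA_closed_simps X)
    qed
    fix Y assume Y: "Y \<in> carrier AA"
    show "?\<mu> (X \<oplus>\<^bsub>AA\<^esub> Y) \<le> ?\<mu> X + ?\<mu> Y"
    proof (rule least)
      fix p assume p: "?C p"
      then have "p (X \<oplus>\<^bsub>AA\<^esub> Y) \<le> p X + p Y" using X Y by (auto simp: cstar_norm_def)
      also have "\<dots> \<le> ?\<mu> X + ?\<mu> Y" by (intro add_mono le p X Y)
      finally show "p (X \<oplus>\<^bsub>AA\<^esub> Y) \<le> ?\<mu> X + ?\<mu> Y" .
    qed
    show "?\<mu> (X \<otimes>\<^bsub>AA\<^esub> Y) \<le> ?\<mu> X * ?\<mu> Y"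
    proof (rule least)
      fix p assume p: "?C p"
      then have "0 \<le> p Y" using Y by (auto simp: cstar_norm_def)
      have "p (X \<otimes>\<^bsub>AA\<^esub> Y) \<le> p X * p Y" using p X Y by (auto simp: cstar_norm_def)
      also have "p X * p Y \<le> ?\<mu> X * ?\<mu> Y" using \<open>0 \<le> p Y\<close> by (intro mult_mono le p X Y nonneg)
      finally show "p (X \<otimes>\<^bsub>AA\<^esub> Y) \<le> ?\<mu> X * ?\<mu> Y" .
    qed
  qed
qed

section \<open>The element of the completion commuting with the diagonal\<close>

context cstar_normed begin

abbreviation "emb \<equiv> completion_embed M p"

lemma emb_cls: "emb x = cls (\<lambda>_. x)"
  by (simp add: completion_embed_def)

lemma emb_closed: "x \<in> carrier M \<Longrightarrow> emb x \<in> carrier Mc"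
  by (auto simp: emb_cls carrier_completion CS_const)

lemma emb_add: "x \<in> carrier M \<Longrightarrow> y \<in> carrier M \<Longrightarrow> emb (x \<oplus> y) = emb x \<oplus>\<^bsub>Mc\<^esub> emb y"
  and emb_mult: "x \<in> carrier M \<Longrightarrow> y \<in> carrier M \<Longrightarrow> emb (x \<otimes> y) = emb x \<otimes>\<^bsub>Mc\<^esub> emb y"
  and emb_smult: "x \<in> carrier M \<Longrightarrow> emb (c \<odot> x) = c \<odot>\<^bsub>Mc\<^esub> emb x"
  and emb_star: "x \<in> carrier M \<Longrightarrow> emb (star M x) = star Mc (emb x)"
  and emb_zero: "emb \<zero> = \<zero>\<^bsub>Mc\<^esub>"
  and pc_emb: "x \<in> carrier M \<Longrightarrow> pc (emb x) = p x"
  by (simp_all add: emb_cls completion_ops CS_const completion_embed_norm)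

lemma cls_minus:
  assumes "s \<in> CS" "t \<in> CS"
  shows "cls s \<ominus>\<^bsub>Mc\<^esub> cls t = cls (\<lambda>n. s n \<ominus> t n)" "(\<lambda>n. s n \<ominus> t n) \<in> CS"
proof -
  interpret Mc: cstar_normed Mc pc by (rule cstar_normed_completion)
  have eq: "(\<lambda>n. s n \<oplus> (- 1) \<odot> t n) = (\<lambda>n. s n \<ominus> t n)"
    using assms by (simp add: smult_minus_one minus_eq CS_carrier)
  have "cls s \<ominus>\<^bsub>Mc\<^esub> cls t = cls s \<oplus>\<^bsub>Mc\<^esub> (- 1) \<odot>\<^bsub>Mc\<^esub> cls t"
    using assms by (subst Mc.smult_minus_one) (auto simp: carrier_completion a_minus_def)
  also have "\<dots> = cls (\<lambda>n. s n \<oplus> (- 1) \<odot> t n)"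
    using assms by (simp only: completion_smult completion_add CS_smult)
  finally show "cls s \<ominus>\<^bsub>Mc\<^esub> cls t = cls (\<lambda>n. s n \<ominus> t n)" unfolding eq .
  show "(\<lambda>n. s n \<ominus> t n) \<in> CS" using CS_add[OF assms(1) CS_smult[OF assms(2), of "- 1"]] unfolding eq .
qed

lemma emb_minus: "x \<in> carrier M \<Longrightarrow> y \<in> carrier M \<Longrightarrow> emb x \<ominus>\<^bsub>Mc\<^esub> emb y = emb (x \<ominus> y)"
  unfolding emb_cls by (rule cls_minus) (simp_all add: CS_const)

end

subsection \<open>The symmetric random walk in the tensor square\<close>

definition walk_sum :: "(free2 oper \<times> free2 oper) \<Rightarrow>\<^sub>0 complex" where
  "walk_sum = (\<Sum>a\<in>UNIV. Poly_Mapping.single (left_translation (gen a), left_translation (gen a)) (1/4))"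

abbreviation "walk \<equiv> tcls walk_sum"

lemma left_translation_A: "left_translation g \<in> carrier A_alg"
  by (rule reduced_subset_A[OF left_translation_reduced])

lemma walk_sum_A: "walk_sum \<in> A_sums"
  unfolding walk_sum_def by (intro formal_sums_sum formal_sums_single left_translation_A)

lemma walk_closed: "walk \<in> carrier AA"
  using walk_sum_A by (simp add: carrier_AA)

lemma tensor_lift_walk:
  "star_bihom \<phi> \<Longrightarrow> tensor_lift \<phi> walk = (\<Sum>a\<in>UNIV. scaleC_oper (1/4) (\<phi> (left_translation (gen a)) (left_translation (gen a))))"
  by (subst tensor_lift_tcls[OF _ walk_sum_A]) (simp_all add: walk_sum_def linear_ext_sum linear_ext_single)

lemma oper_tensor_left_translation:
  "oper_tensor (left_translation g) (left_translation g) = reindex (\<lambda>(h, k). (inverse g * h, inverse g * k))"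
proof (rule oper_tensor_eqI)
  let ?\<pi> = "\<lambda>(h, k). (inverse g * h, inverse g * k)"
  have inj: "inj ?\<pi>" using inj_translations(1)[of "inverse g"] by (auto simp: inj_def)
  show "reindex ?\<pi> \<in> bounded_ops" by (rule reindex_bounded_ops[OF inj])
  show "blinfun_apply (oper_tensor (left_translation g) (left_translation g)) (ell2_tensor x y) = blinfun_apply (reindex ?\<pi>) (ell2_tensor x y)" for x y
    by (rule ell2_eqI)
      (auto simp: oper_tensor_apply left_translation_bounded_ops Rep_reindex[OF inj] ell2_tensor.rep_eq Rep_left_translation)
qed (simp add: oper_tensor_bounded left_translation_bounded_ops)

text \<open>Four terms of weight \<open>1/4\<close>, so a quarter of the bound
  \<open>2 * sqrt 3\<close> for the unnormalized walk.\<close>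

lemma min_norm_walk: "min_norm walk \<le> sqrt 3 / 2"
proof -
  have "spatial walk = scaleC_oper (1/4) (\<Sum>a\<in>UNIV. reindex (\<lambda>(h, k). (inverse (gen a) * h, inverse (gen a) * k)))"
    by (simp add: tensor_lift_walk[OF star_bihom_oper_tensor] oper_tensor_left_translation scaleC_oper_sum)
  then have "min_norm walk = (1/4) * norm (\<Sum>a\<in>UNIV. reindex (\<lambda>(h, k :: free2). (inverse (gen a) * h, inverse (gen a) * k)))"
    by (simp add: min_norm_spatial norm_scaleC_oper)
  with norm_diagonal_walk_le show ?thesis by simp
qed

lemma star_walk: "star AA walk = walk"
proof (rule AA_eqI)
  let ?f = "\<lambda>a. scaleC_oper (1/4) (oper_tensor (left_translation (gen a)) (left_translation (gen a)))"
  have adj: "adjoint_oper (?f a) = ?f (case a of (x, s) \<Rightarrow> (x, \<not> s))" for a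
    by (cases a) (simp add: adjoint_scaleC oper_tensor_bounded left_translation_bounded_ops adjoint_oper_tensor
        adjoint_left_translation inverse_gen)
  have "spatial (star AA walk) = adjoint_oper (\<Sum>a\<in>UNIV. ?f a)"
    by (simp add: spatial_simps walk_closed tensor_lift_walk[OF star_bihom_oper_tensor])
  also have "\<dots> = (\<Sum>a\<in>UNIV. adjoint_oper (?f a))"
    by (rule adjoint_sum) (simp add: bounded_ops_scaleC oper_tensor_bounded left_translation_bounded_ops)
  also have "\<dots> = (\<Sum>a\<in>UNIV. ?f (case a of (x, s) \<Rightarrow> (x, \<not> s)))" by (simp only: adj)
  also have "\<dots> = (\<Sum>a\<in>UNIV. ?f a)" by (rule sum.reindex_bij_betw[OF bij_letter_flip])
  also have "\<dots> = spatial walk" by (simp add: tensor_lift_walk[OF star_bihom_oper_tensor])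
  finally show "spatial (star AA walk) = spatial walk" .
qed (simp_all add: AA_closed_simps walk_closed)

lemma norm_left_translation: "norm (left_translation g) \<le> 1"
  by (simp add: left_translation_reindex norm_reindex inj_translations)

text \<open>Supplies the hypothesis \<open>N [:0, 1:] \<le> 1\<close> under which the cutoff
  polynomials of the walk form a Cauchy sequence in an arbitrary C*-norm.\<close>

lemma cstar_norm_walk_le:
  assumes "cstar_norm AA p" shows "p walk \<le> 1"
proof -
  interpret AA: cstar_normed AA p by (rule cstar_normed_AA[OF assms])
  let ?s = "\<lambda>a. Poly_Mapping.single (left_translation (gen a), left_translation (gen a)) (1/4 :: complex)"
  have s: "?s a \<in> A_sums" for a by (intro formal_sums_single left_translation_A)
  have sc: "tcls (?s a) \<in> carrier AA" for a using s by (auto simp: carrier_AA)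
  have "p (tcls (?s a)) \<le> 1/4" for a
  proof -
    have "tcls (?s a) = (1/4) \<odot>\<^bsub>AA\<^esub> tens (left_translation (gen a)) (left_translation (gen a))"
      by (rule AA_eqI) (simp_all add: sc s AA_closed_simps tens_closed spatial_simps spatial_tens left_translation_A
          tensor_lift_tcls[OF star_bihom_oper_tensor] linear_ext_single)
    moreover have "p (tens (left_translation (gen a)) (left_translation (gen a))) \<le> 1 * 1"
      using norm_left_translation
      by (intro order_trans[OF cstar_norm_tens_le[OF assms left_translation_A left_translation_A] mult_mono]) auto
    ultimately show ?thesis by (simp add: AA.p_smult tens_closed left_translation_A)
  qed
  moreover have "p (tcls (\<Sum>a\<in>I. ?s a)) \<le> (\<Sum>a\<in>I. p (tcls (?s a)))" for I
  proof (induction I rule: infinite_finite_induct)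
    case (insert a I)
    have "p (tcls (?s a + (\<Sum>a\<in>I. ?s a))) = p (tcls (?s a) \<oplus>\<^bsub>AA\<^esub> tcls (\<Sum>a\<in>I. ?s a))"
      using s by (simp add: AA_add formal_sums_sum)
    also have "\<dots> \<le> p (tcls (?s a)) + p (tcls (\<Sum>a\<in>I. ?s a))"
      using s by (intro AA.p_add) (auto simp: carrier_AA formal_sums_sum)
    finally show ?case using insert by simp
  qed (simp_all flip: AA_zero)
  ultimately have "p walk \<le> (\<Sum>a\<in>(UNIV :: letter set). 1/4)"
    unfolding walk_sum_def by (meson order_trans sum_mono)
  then show ?thesis by (simp add: UNIV_letter)
qed

lemmas pi_r_hom = tensor_lift_hom[OF star_bihom_pi_r, folded pi_r_eq]

text \<open>Each term acts on \<open>ket 1\<close> as a left translation by \<open>s\<close> after a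
  right translation by \<open>s\<close>, giving \<open>ket (s * inverse s)\<close>. So the mean
  fixes it, although the minimal norm of the walk is below 1.\<close>

lemma pi_r_walk: "blinfun_apply (pi_r walk) (ket 1) = ket 1"
proof -
  have "pi_r walk = (\<Sum>a\<in>UNIV. scaleC_oper (1/4) (left_translation (gen a) o\<^sub>L right_translation (gen a)))"
    unfolding pi_r_eq
    by (simp add: tensor_lift_walk[OF star_bihom_pi_r] pi_r_bihom_def left_rep_def quotient_map_id_on_reduced
        left_translation_reduced right_rep_left_translation)
  then have "blinfun_apply (pi_r walk) (ket 1) = (\<Sum>a\<in>(UNIV :: letter set). scaleC (1/4) (ket 1))"
    by (simp add: blinfun.sum_left scaleC_oper_apply right_translation_ket left_translation_ket free2_right_inverse)
  also have "\<dots> = scaleC (1/4 + 1/4 + 1/4 + 1/4) (ket 1)"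
    unfolding scaleC_add_left by (simp add: UNIV_letter add.assoc)
  finally show ?thesis by simp
qed

text \<open>\<open>ket 1\<close> is an eigenvector of the walk for the eigenvalue 1, and a
  polynomial acts on it by its value at that eigenvalue.\<close>

lemma pi_r_peval_walk:
  assumes "cstar_norm AA p"
  shows "blinfun_apply (pi_r (cstar_normed.peval AA walk P)) (ket 1) = scaleC (of_real (poly P 1)) (ket 1)"
proof -
  interpret AA: cstar_normed AA p by (rule cstar_normed_AA[OF assms])
  note x = walk_closed
  show ?thesis
  proof (induction P)
    case 0
    then show ?case by (simp add: AA.peval_zero[OF x] pi_r_hom)
  next
    case (pCons a P)
    have "pi_r walk \<in> bounded_ops" by (rule pi_r_hom(1)[OF x])
    have id: "pi_r_bihom id_blinfun id_blinfun = id_blinfun"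
      by (simp add: pi_r_bihom_def left_rep_def quotient_map_id_on_reduced id_reduced right_rep_id)
    have "pi_r (AA.peval walk (pCons a P)) = scaleC_oper (of_real a) id_blinfun + (pi_r walk o\<^sub>L pi_r (AA.peval walk P))"
      by (simp add: AA.peval_pCons[OF x] pi_r_hom(2-) id AA_closed_simps x AA.peval_closed[OF x])
    then show ?case
      using bounded_opsD[OF \<open>pi_r walk \<in> bounded_ops\<close>]
      by (simp add: blinfun.add_left scaleC_oper_apply pCons.IH pi_r_walk flip: scaleC_add_left)
  qed
qed

subsection \<open>Compression by basis projections\<close>

lemma norm_basis_proj: "norm (basis_proj g) \<le> 1"
  by (rule norm_blinfun_bound) (simp_all add: basis_proj_apply norm_scaleC Rep_le_norm)

lemma basis_proj_A: "basis_proj g \<in> carrier A_alg"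
  by (rule compact_subset_A[OF basis_proj_compact])

lemma basis_proj_compress:
  assumes "a \<in> bounded_ops"
  shows "basis_proj g o\<^sub>L (a o\<^sub>L basis_proj g) = scaleC_oper (Rep_ell2 (blinfun_apply a (ket g)) g) (basis_proj g)"
  by (rule blinfun_eqI) (simp add: basis_proj_apply scaleC_oper_apply bounded_opsD[OF assms] mult.commute)

text \<open>By the C*-identity the norm of \<open>y T\<close> is decided by \<open>T w T\<close>
  with \<open>w\<close> the adjoint of \<open>y\<close> times \<open>y\<close>. That element lies in
  the corner on which \<open>p\<close> is dominated by the minimal norm.\<close>

lemma cstar_norm_compress:
  assumes p: "cstar_norm AA p" and y: "y \<in> carrier AA"
    and T: "T \<in> carrier AA" "star AA T = T" "min_norm T \<le> 1"
    and agree: "\<And>w. w \<in> carrier AA \<Longrightarrow> p (T \<otimes>\<^bsub>AA\<^esub> (w \<otimes>\<^bsub>AA\<^esub> T)) \<le> min_norm (T \<otimes>\<^bsub>AA\<^esub> (w \<otimes>\<^bsub>AA\<^esub> T))"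
  shows "p (y \<otimes>\<^bsub>AA\<^esub> T) \<le> min_norm y"
proof -
  interpret AA: cstar_normed AA p by (rule cstar_normed_AA[OF p])
  interpret m: cstar_normed AA min_norm by (rule cstar_normed_AA[OF cstar_norm_min])
  let ?w = "star AA y \<otimes>\<^bsub>AA\<^esub> y"
  have w: "?w \<in> carrier AA" by (simp add: AA_closed_simps y)
  have "(p (y \<otimes>\<^bsub>AA\<^esub> T))\<^sup>2 = p (T \<otimes>\<^bsub>AA\<^esub> (?w \<otimes>\<^bsub>AA\<^esub> T))"
    using AA.p_cstar[of "y \<otimes>\<^bsub>AA\<^esub> T"] y T by (simp add: AA_closed_simps AA.star_mult AA.m_assoc)
  also have "\<dots> \<le> min_norm (T \<otimes>\<^bsub>AA\<^esub> (?w \<otimes>\<^bsub>AA\<^esub> T))" by (rule agree[OF w])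
  also have "\<dots> \<le> min_norm T * (min_norm ?w * min_norm T)"
    using w T by (intro order_trans[OF m.p_mult mult_left_mono[OF m.p_mult]]) (auto simp: AA_closed_simps)
  also have "\<dots> \<le> 1 * (min_norm ?w * 1)" using w T by (intro mult_mono) auto
  also have "\<dots> = (min_norm y)\<^sup>2" using m.p_cstar[OF y] by simp
  finally show ?thesis by (rule power2_le_imp_le) (simp add: y)
qed

text \<open>The compression of any element by \<open>e\<^sub>g \<otimes> 1\<close> is an elementary tensor \<open>e\<^sub>g \<otimes> b\<close>, on which all C*-norms agree.\<close>

lemma cstar_norm_compress_left:
  assumes p: "cstar_norm AA p" and y: "y \<in> carrier AA"
  shows "p (y \<otimes>\<^bsub>AA\<^esub> tens (basis_proj g) id_blinfun) \<le> min_norm y"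
proof -
  interpret AA: cstar_normed AA p by (rule cstar_normed_AA[OF p])
  note simps = tens_simps basis_proj_A adjoint_basis_proj basis_proj_compress
  let ?e = "basis_proj g"
  let ?T = "tens ?e id_blinfun"
  have T: "?T \<in> carrier AA" "star AA ?T = ?T" by (simp add: simps) (rule AA_eqI; simp add: simps)
  have compress: "\<exists>b\<in>carrier A_alg. ?T \<otimes>\<^bsub>AA\<^esub> (w \<otimes>\<^bsub>AA\<^esub> ?T) = tens ?e b" if "w \<in> carrier AA" for w
    using that
  proof (induction rule: AA_induct)
    case (tens a b)
    have eq: "?T \<otimes>\<^bsub>AA\<^esub> (tens a b \<otimes>\<^bsub>AA\<^esub> ?T) = tens ?e (scaleC_oper (Rep_ell2 (blinfun_apply a (ket g)) g) b)"
      by (rule AA_eqI) (use tens in \<open>simp_all add: simps\<close>)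
    show ?case by (rule bexI, rule eq) (use tens in \<open>simp add: quotient_map_scaleC\<close>)
  next
    case (add X Y)
    then obtain b c where bc: "b \<in> carrier A_alg" "?T \<otimes>\<^bsub>AA\<^esub> (X \<otimes>\<^bsub>AA\<^esub> ?T) = tens ?e b"
      "c \<in> carrier A_alg" "?T \<otimes>\<^bsub>AA\<^esub> (Y \<otimes>\<^bsub>AA\<^esub> ?T) = tens ?e c" by blast
    have "?T \<otimes>\<^bsub>AA\<^esub> ((X \<oplus>\<^bsub>AA\<^esub> Y) \<otimes>\<^bsub>AA\<^esub> ?T) = tens ?e b \<oplus>\<^bsub>AA\<^esub> tens ?e c"
      unfolding bc(2,4)[symmetric] using add(1,2) T(1) by (simp add: AA.l_distr AA.r_distr)
    also have "\<dots> = tens ?e (b + c)" by (rule AA_eqI) (simp_all add: bc simps)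
    finally show ?case using bc by (intro bexI[of _ "b + c"]) (simp_all add: quotient_map_add)
  qed
  show ?thesis
  proof (rule cstar_norm_compress[OF p y T])
    have "norm ?e * norm (id_blinfun :: free2 oper) \<le> 1 * 1"
      by (intro mult_mono norm_basis_proj norm_blinfun_id_le) auto
    then show "min_norm ?T \<le> 1"
      using cstar_norm_tens_le[OF cstar_norm_min basis_proj_A id_A, of g] by simp
    fix w assume "w \<in> carrier AA"
    then obtain b where b: "b \<in> carrier A_alg" "?T \<otimes>\<^bsub>AA\<^esub> (w \<otimes>\<^bsub>AA\<^esub> ?T) = tens ?e b" using compress by blast
    \<comment> \<open>On the corner, \<open>p\<close> is at most \<open>norm b\<close>, and
      \<open>norm b\<close> is at most the minimal norm, by the isometric embedding with
      \<open>ket g\<close>.\<close>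
    have "p (tens ?e b) \<le> norm ?e * norm b"
      by (rule cstar_norm_tens_le[OF p basis_proj_A b(1)])
    also have "\<dots> \<le> norm b" using mult_right_mono[OF norm_basis_proj, of "norm b" g] by simp
    also have "\<dots> \<le> min_norm (tens ?e b)"
      using norm_le_oper_tensor_basis_proj(1)[of b g] b(1) by (simp add: min_norm_spatial simps)
    finally show "p (?T \<otimes>\<^bsub>AA\<^esub> (w \<otimes>\<^bsub>AA\<^esub> ?T)) \<le> min_norm (?T \<otimes>\<^bsub>AA\<^esub> (w \<otimes>\<^bsub>AA\<^esub> ?T))" by (simp add: b)
  qed
qed

lemma cstar_norm_compress_right:
  assumes p: "cstar_norm AA p" and y: "y \<in> carrier AA"
  shows "p (y \<otimes>\<^bsub>AA\<^esub> tens id_blinfun (basis_proj g)) \<le> min_norm y"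
proof -
  interpret AA: cstar_normed AA p by (rule cstar_normed_AA[OF p])
  note simps = tens_simps basis_proj_A adjoint_basis_proj basis_proj_compress
  let ?e = "basis_proj g"
  let ?T = "tens id_blinfun ?e"
  have T: "?T \<in> carrier AA" "star AA ?T = ?T" by (simp add: simps) (rule AA_eqI; simp add: simps)
  have compress: "\<exists>b\<in>carrier A_alg. ?T \<otimes>\<^bsub>AA\<^esub> (w \<otimes>\<^bsub>AA\<^esub> ?T) = tens b ?e" if "w \<in> carrier AA" for w
    using that
  proof (induction rule: AA_induct)
    case (tens a b)
    have eq: "?T \<otimes>\<^bsub>AA\<^esub> (tens a b \<otimes>\<^bsub>AA\<^esub> ?T) = tens (scaleC_oper (Rep_ell2 (blinfun_apply b (ket g)) g) a) ?e"
      by (rule AA_eqI) (use tens in \<open>simp_all add: simps\<close>)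
    show ?case by (rule bexI, rule eq) (use tens in \<open>simp add: quotient_map_scaleC\<close>)
  next
    case (add X Y)
    then obtain b c where bc: "b \<in> carrier A_alg" "?T \<otimes>\<^bsub>AA\<^esub> (X \<otimes>\<^bsub>AA\<^esub> ?T) = tens b ?e"
      "c \<in> carrier A_alg" "?T \<otimes>\<^bsub>AA\<^esub> (Y \<otimes>\<^bsub>AA\<^esub> ?T) = tens c ?e" by blast
    have "?T \<otimes>\<^bsub>AA\<^esub> ((X \<oplus>\<^bsub>AA\<^esub> Y) \<otimes>\<^bsub>AA\<^esub> ?T) = tens b ?e \<oplus>\<^bsub>AA\<^esub> tens c ?e"
      unfolding bc(2,4)[symmetric] using add(1,2) T(1) by (simp add: AA.l_distr AA.r_distr)
    also have "\<dots> = tens (b + c) ?e" by (rule AA_eqI) (simp_all add: bc simps)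
    finally show ?case using bc by (intro bexI[of _ "b + c"]) (simp_all add: quotient_map_add)
  qed
  show ?thesis
  proof (rule cstar_norm_compress[OF p y T])
    have "norm (id_blinfun :: free2 oper) * norm ?e \<le> 1 * 1"
      by (intro mult_mono norm_basis_proj norm_blinfun_id_le) auto
    then show "min_norm ?T \<le> 1"
      using cstar_norm_tens_le[OF cstar_norm_min id_A basis_proj_A, of g] by simp
    fix w assume "w \<in> carrier AA"
    then obtain b where b: "b \<in> carrier A_alg" "?T \<otimes>\<^bsub>AA\<^esub> (w \<otimes>\<^bsub>AA\<^esub> ?T) = tens b ?e" using compress by blast
    have "p (tens b ?e) \<le> norm b * norm ?e"
      by (rule cstar_norm_tens_le[OF p b(1) basis_proj_A])
    also have "\<dots> \<le> norm b" using mult_left_mono[OF norm_basis_proj, of "norm b" g] by simp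
    also have "\<dots> \<le> min_norm (tens b ?e)"
      using norm_le_oper_tensor_basis_proj(2)[of b g] b(1) by (simp add: min_norm_spatial simps)
    finally show "p (?T \<otimes>\<^bsub>AA\<^esub> (w \<otimes>\<^bsub>AA\<^esub> ?T)) \<le> min_norm (?T \<otimes>\<^bsub>AA\<^esub> (w \<otimes>\<^bsub>AA\<^esub> ?T))" by (simp add: b)
  qed
qed

subsection \<open>The representation on the diagonal\<close>

text \<open>On \<open>C \<odot> C\<close> the representation is scalar, with value the limit of the diagonal coefficients at infinity.\<close>

lemma pi_r_C_le_min:
  assumes "X \<in> alg_subtensor A_alg A_alg C_alg C_alg"
  shows "norm (pi_r X) \<le> min_norm X" "X \<in> carrier AA"
proof -
  \<comment> \<open>Both coordinates of the pair tend to infinity independently, so the diagonal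
    entry of \<open>c \<otimes> d\<close> tends to the product of the two scalars.\<close>
  let ?F = "(cofinite :: free2 filter) \<times>\<^sub>F (cofinite :: free2 filter)"
  let ?d = "\<lambda>X p. Rep_ell2 (blinfun_apply (spatial X) (ket p)) p"
  have C: "C_alg \<subseteq> carrier A_alg" "0 \<in> C_alg" "\<And>c a. a \<in> C_alg \<Longrightarrow> scaleC_oper c a \<in> C_alg"
    using cstar_subalgebra_C_alg by (auto simp: cstar_subalgebra_A_alg)
  show XA: "X \<in> carrier AA"
    using assms by (induction rule: alg_subtensor_induct) (use C in \<open>auto intro!: tens_closed AA_add_closed\<close>)
  have diag: "\<exists>t. quotient_map c = scaleC_oper t id_blinfun \<and> ((\<lambda>g. Rep_ell2 (blinfun_apply c (ket g)) g) \<longlongrightarrow> t) cofinite"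
    if c: "c \<in> C_alg" for c
  proof -
    obtain t where t: "c - scaleC_oper t id_blinfun \<in> compact_ops" by (rule C_alg_scalar_plus_compact[OF c])
    have "quotient_map c = scaleC_oper t id_blinfun"
      by (rule quotient_map_eq[OF reduced_scaleC[OF id_reduced] t])
    moreover have "((\<lambda>g. Rep_ell2 (blinfun_apply c (ket g)) g) \<longlongrightarrow> t) cofinite"
    proof (rule tendstoI)
      fix e :: real assume "e > 0"
      then obtain F where F: "finite F"
        "\<And>i. i \<notin> F \<Longrightarrow> cmod (cinner (ket i) (blinfun_apply (c - scaleC_oper t id_blinfun) (ket i))) \<le> e/2"
        using compact_ops_diagonal[OF t, of "e/2"] by auto
      have "dist (Rep_ell2 (blinfun_apply c (ket g)) g) t < e" if "g \<notin> F" for g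
        using F(2)[OF that] \<open>e > 0\<close> by (simp add: blinfun.diff_left scaleC_oper_apply Rep_ket dist_norm)
      then show "\<forall>\<^sub>F g in cofinite. dist (Rep_ell2 (blinfun_apply c (ket g)) g) t < e"
        using F(1) by (auto simp: eventually_cofinite intro: finite_subset)
    qed
    ultimately show ?thesis by blast
  qed
  have "\<exists>t. pi_r X = scaleC_oper t id_blinfun \<and> (?d X \<longlongrightarrow> t) ?F"
    using assms
  proof (induction rule: alg_subtensor_induct)
    case (tens c d)
    obtain s where s: "quotient_map c = scaleC_oper s id_blinfun" "((\<lambda>g. Rep_ell2 (blinfun_apply c (ket g)) g) \<longlongrightarrow> s) cofinite"
      using diag tens(1) by blast
    obtain t where t: "quotient_map d = scaleC_oper t id_blinfun" "((\<lambda>g. Rep_ell2 (blinfun_apply d (ket g)) g) \<longlongrightarrow> t) cofinite"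
      using diag tens(2) by blast
    have cd: "c \<in> carrier A_alg" "d \<in> carrier A_alg" using tens C by auto
    have "pi_r (tens c d) = scaleC_oper (s * t) id_blinfun"
      unfolding pi_r_eq
      by (simp add: tensor_lift_tens[OF star_bihom_pi_r] cd pi_r_bihom_def left_rep_def s t right_rep_scaleC id_reduced
          right_rep_id scaleC_oper_compose_left)
    moreover have "(?d (tens c d) \<longlongrightarrow> s * t) ?F"
    proof -
      have "?d (tens c d) = (\<lambda>p. Rep_ell2 (blinfun_apply c (ket (fst p))) (fst p) * Rep_ell2 (blinfun_apply d (ket (snd p))) (snd p))"
        by (auto simp: fun_eq_iff spatial_tens cd oper_tensor_ket A_bounded)
      then show ?thesis
        by (simp add: tendsto_mult filterlim_compose[OF s(2) filterlim_fst] filterlim_compose[OF t(2) filterlim_snd])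
    qed
    ultimately show ?case by blast
  next
    case (add X Y)
    then obtain s t where st: "pi_r X = scaleC_oper s id_blinfun" "(?d X \<longlongrightarrow> s) ?F"
      "pi_r Y = scaleC_oper t id_blinfun" "(?d Y \<longlongrightarrow> t) ?F" by blast
    have "?d (X \<oplus>\<^bsub>AA\<^esub> Y) = (\<lambda>p. ?d X p + ?d Y p)"
      using add(1,2) by (simp add: spatial_simps blinfun.add_left)
    then have "(?d (X \<oplus>\<^bsub>AA\<^esub> Y) \<longlongrightarrow> s + t) ?F" using tendsto_add[OF st(2,4)] by simp
    moreover have "pi_r (X \<oplus>\<^bsub>AA\<^esub> Y) = scaleC_oper (s + t) id_blinfun"
      using add(1,2) by (simp add: pi_r_hom st scaleC_oper_add_left)
    ultimately show ?case by blast
  qed (use C in auto)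
  then obtain t where t: "pi_r X = scaleC_oper t id_blinfun" "(?d X \<longlongrightarrow> t) ?F" by blast
  have "cmod (?d X p) \<le> norm (spatial X)" for p
    using order_trans[OF Rep_le_norm norm_blinfun, of "spatial X" "ket p" p] by simp
  \<comment> \<open>Infinitude of the group makes this a genuine limit, so the uniform bound on the
    diagonal entries is inherited by \<open>t\<close>.\<close>
  moreover have "?F \<noteq> bot"
    by (simp add: prod_filter_eq_bot cofinite_bot infinite_free2)
  ultimately have "cmod t \<le> norm (spatial X)"
    by (intro tendsto_upperbound[OF tendsto_norm[OF t(2)]]) (auto intro: always_eventually)
  moreover have "norm (pi_r X) \<le> cmod t * 1"
    unfolding t norm_scaleC_oper by (intro mult_left_mono norm_blinfun_id_le) auto
  ultimately show "norm (pi_r X) \<le> min_norm X" by (simp add: min_norm_spatial)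
qed

subsection \<open>The closed tensor square of the diagonal is not maximal abelian\<close>

text \<open>The contradiction is reached at a finite stage \<open>n\<close>: a single element
  \<open>X\<close> of \<open>C \<odot> C\<close> close to \<open>Z\<close> is compared with
  \<open>z n\<close>, and \<open>alpha_norm \<le> \<beta>\<close> turns closeness in the completion
  into closeness both in the minimal norm and under \<open>pi_r\<close>.\<close>

lemma not_maximal_abelian:
  assumes \<beta>: "cstar_norm AA \<beta>" and \<alpha>: "\<And>X. X \<in> carrier AA \<Longrightarrow> alpha_norm X \<le> \<beta> X"
  shows "\<not> maximal_abelian (cstar_completion AA \<beta>) (completion_norm \<beta>) (closed_subtensor A_alg A_alg \<beta> C_alg C_alg)"
proof
  interpret B: cstar_normed AA \<beta> by (rule cstar_normed_AA[OF \<beta>])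
  interpret m: cstar_normed AA min_norm by (rule cstar_normed_AA[OF cstar_norm_min])
  interpret Bc: cstar_normed B.Mc B.pc by (rule B.cstar_normed_completion)
  let ?E = "closed_subtensor A_alg A_alg \<beta> C_alg C_alg"
  let ?S = "alg_subtensor A_alg A_alg C_alg C_alg"
  assume max: "maximal_abelian B.Mc B.pc ?E"
  note x = walk_closed
  interpret NB: poly_cstar_seminorm "\<lambda>P. \<beta> (B.peval walk P)"
    by (rule B.poly_cstar_seminorm_peval[OF x star_walk])
  interpret Nm: poly_cstar_seminorm "\<lambda>P. min_norm (B.peval walk P)"
    by (rule m.poly_cstar_seminorm_peval[OF x star_walk])
  \<comment> \<open>Any number strictly between \<open>sqrt 3 / 2\<close> and 1 would serve.\<close>
  define r :: real where "r = 9/10"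
  have r: "0 \<le> r" "r \<le> 1" by (auto simp: r_def)
  define z where "z n = B.peval walk (cutoff r n)" for n
  have zA: "z n \<in> carrier AA" for n by (simp add: z_def B.peval_closed[OF x])
  have zCS: "z \<in> B.CS"
    unfolding cauchy_seqs_def
    using NB.N_cutoff_Cauchy[OF _ r] cstar_norm_walk_le[OF \<beta>] zA
    by (auto simp: z_def B.peval_X[OF x] B.peval_diff[OF x])
  have z_min: "(\<lambda>n. min_norm (z n)) \<longlonglongrightarrow> 0"
  proof -
    have "sqrt 3 < 9/5" by (rule real_less_lsqrt) (simp_all add: power2_eq_square)
    then have "sqrt 3 / 2 < r" by (simp add: r_def)
    then have "min_norm walk < r" using min_norm_walk by simp
    then show ?thesis unfolding z_def by (intro Nm.N_cutoff_tendsto_0) (simp_all add: B.peval_X[OF x] r)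
  qed
  define Z where "Z = B.cls z"
  have Z: "Z \<in> carrier B.Mc" "star B.Mc Z = Z"
  proof -
    show "Z \<in> carrier B.Mc" using zCS by (auto simp: Z_def B.carrier_completion)
    have "(\<lambda>n. star AA (z n)) = z" by (auto simp: z_def B.peval_star[OF x star_walk])
    then show "star B.Mc Z = Z" using zCS by (simp add: Z_def B.completion_star)
  qed
  \<comment> \<open>The commutant of \<open>Z\<close> is a C*-subalgebra, so
    \<open>C \<otimes> C\<close> lies in it as soon as the tensors of generators do.\<close>
  define K where "K = Bc.commutant {Z}"
  have K: "cstar_subalgebra B.Mc B.pc K"
    unfolding K_def by (rule Bc.cstar_subalgebra_commutant) (auto simp: Z)
  have K_closed: "X \<oplus>\<^bsub>B.Mc\<^esub> Y \<in> K" "X \<otimes>\<^bsub>B.Mc\<^esub> Y \<in> K" if "X \<in> K" "Y \<in> K" for X Y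
    using K that unfolding cstar_subalgebra_def by blast+
  have K_closed': "c \<odot>\<^bsub>B.Mc\<^esub> X \<in> K" "star B.Mc X \<in> K" if "X \<in> K" for X c
    using K that unfolding cstar_subalgebra_def by blast+
  have K_zero: "\<zero>\<^bsub>B.Mc\<^esub> \<in> K" using K unfolding cstar_subalgebra_def by blast
  have K_lim: "X \<in> K" if "X \<in> carrier B.Mc" "\<And>e. e > 0 \<Longrightarrow> \<exists>Y\<in>K. B.pc (X \<ominus>\<^bsub>B.Mc\<^esub> Y) < e" for X
    using K that unfolding cstar_subalgebra_def norm_closure_def by blast
  \<comment> \<open>If multiplication by \<open>T\<close> brings the \<beta>-norm of
    \<open>z n\<close> below its minimal norm, then \<open>Z\<close> times \<open>T\<close> vanishes
    in the completion, since the minimal norms tend to 0. The product in the other order vanishes by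
    taking adjoints, so both orders agree.\<close>
  have annihilate: "B.emb T \<in> K"
    if T: "T \<in> carrier AA" "star AA T = T" and le: "\<And>n. \<beta> (z n \<otimes>\<^bsub>AA\<^esub> T) \<le> min_norm (z n)" for T
  proof -
    have zero: "B.cls s = \<zero>\<^bsub>B.Mc\<^esub>" if s: "s \<in> B.CS" "\<And>n. \<beta> (s n) \<le> min_norm (z n)" for s
    proof -
      have "(\<lambda>n. \<beta> (s n)) \<longlonglongrightarrow> 0"
        by (rule tendsto_sandwich[OF _ _ tendsto_const z_min])
          (auto intro!: always_eventually s(2) B.p_nonneg B.CS_carrier[OF s(1)])
      then have "B.pc (B.cls s) = 0" using B.completion_norm_tendsto[OF s(1)] LIMSEQ_unique by blast
      then show ?thesis using s(1) by (subst (asm) Bc.p_eq_0) (auto simp: B.carrier_completion)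
    qed
    have right: "Z \<otimes>\<^bsub>B.Mc\<^esub> B.emb T = B.cls (\<lambda>n. z n \<otimes>\<^bsub>AA\<^esub> T)" and left: "B.emb T \<otimes>\<^bsub>B.Mc\<^esub> Z = B.cls (\<lambda>n. T \<otimes>\<^bsub>AA\<^esub> z n)"
      unfolding Z_def B.emb_cls using zCS T(1) by (simp_all add: B.completion_mult B.CS_const)
    have "star AA (z n \<otimes>\<^bsub>AA\<^esub> T) = T \<otimes>\<^bsub>AA\<^esub> z n" for n
      using B.peval_star[OF x star_walk] zA T by (simp add: B.star_mult z_def)
    then have le': "\<beta> (T \<otimes>\<^bsub>AA\<^esub> z n) \<le> min_norm (z n)" for n
      using B.p_star[of "z n \<otimes>\<^bsub>AA\<^esub> T"] le[of n] zA T by (metis AA_mult_closed)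
    have "Z \<otimes>\<^bsub>B.Mc\<^esub> B.emb T = B.emb T \<otimes>\<^bsub>B.Mc\<^esub> Z"
      unfolding left right
      using zero[of "\<lambda>n. z n \<otimes>\<^bsub>AA\<^esub> T"] zero[of "\<lambda>n. T \<otimes>\<^bsub>AA\<^esub> z n"] le le' zCS T(1)
      by (simp add: B.CS_mult B.CS_const)
    then show ?thesis using T(1) by (simp add: K_def Bc.commutant_def B.emb_closed)
  qed
  have one: "B.emb \<one>\<^bsub>AA\<^esub> \<in> K"
    unfolding K_def Bc.commutant_def B.emb_cls B.completion_one[symmetric] using Z by simp
  note simps = tens_simps basis_proj_A adjoint_basis_proj
  \<comment> \<open>\<open>\<tau>\<close> stands for one of the embeddings of \<open>A\<close> as
    \<open>A \<otimes> 1\<close> or \<open>1 \<otimes> A\<close>. The elements that it sends into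
    the commutant form a norm-closed *-subalgebra containing all \<open>e_g\<close> and 1, hence
    containing \<open>C\<close>.\<close>
  have factor: "B.emb (\<tau> c) \<in> K"
    if c: "c \<in> C_alg"
      and \<tau>: "\<And>a. a \<in> carrier A_alg \<Longrightarrow> \<tau> a \<in> carrier AA" "\<tau> id_blinfun = \<one>\<^bsub>AA\<^esub>"
        "\<And>a b. a \<in> carrier A_alg \<Longrightarrow> b \<in> carrier A_alg \<Longrightarrow> \<tau> (a + b) = \<tau> a \<oplus>\<^bsub>AA\<^esub> \<tau> b"
        "\<And>a b. a \<in> carrier A_alg \<Longrightarrow> b \<in> carrier A_alg \<Longrightarrow> \<tau> (a o\<^sub>L b) = \<tau> a \<otimes>\<^bsub>AA\<^esub> \<tau> b"
        "\<And>a s. a \<in> carrier A_alg \<Longrightarrow> \<tau> (scaleC_oper s a) = s \<odot>\<^bsub>AA\<^esub> \<tau> a"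
        "\<And>a. a \<in> carrier A_alg \<Longrightarrow> \<tau> (adjoint_oper a) = star AA (\<tau> a)"
      and le: "\<And>a. a \<in> carrier A_alg \<Longrightarrow> \<beta> (\<tau> a) \<le> norm a"
      and proj: "\<And>g n. \<beta> (z n \<otimes>\<^bsub>AA\<^esub> \<tau> (basis_proj g)) \<le> min_norm (z n)" for \<tau> c
  proof -
    let ?D = "{a \<in> carrier A_alg. B.emb (\<tau> a) \<in> K}"
    have zero: "\<tau> 0 = \<zero>\<^bsub>AA\<^esub>" using \<tau>(5)[OF zero_A, of 0] \<tau>(1)[OF zero_A] by simp
    have minus: "\<tau> (a - b) = \<tau> a \<ominus>\<^bsub>AA\<^esub> \<tau> b" if "a \<in> carrier A_alg" "b \<in> carrier A_alg" for a b
      using \<tau>(3)[of a "scaleC_oper (- 1) b"] \<tau>(5)[of b "- 1"] that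
      by (simp add: quotient_map_scaleC scaleC_oper_minus_one B.smult_minus_one \<tau>(1) B.minus_eq uminus_A)
    have "a \<in> ?D" if a: "a \<in> carrier A_alg" "\<forall>e>0. \<exists>b\<in>?D. norm (a - b) < e" for a
    proof -
      have "B.emb (\<tau> a) \<in> K"
      proof (rule K_lim)
        show "B.emb (\<tau> a) \<in> carrier B.Mc" using a \<tau>(1) by (simp add: B.emb_closed)
        fix e :: real assume "e > 0"
        then obtain b where b: "b \<in> ?D" "norm (a - b) < e" using a(2) by blast
        have "B.pc (B.emb (\<tau> a) \<ominus>\<^bsub>B.Mc\<^esub> B.emb (\<tau> b)) = \<beta> (\<tau> (a - b))"
          using a(1) b(1) by (simp add: B.emb_minus \<tau>(1) minus B.pc_emb)
        also have "\<dots> < e" using le[of "a - b"] a(1) b by (simp add: quotient_map_diff)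
        finally show "\<exists>Y\<in>K. B.pc (B.emb (\<tau> a) \<ominus>\<^bsub>B.Mc\<^esub> Y) < e" using b(1) by blast
      qed
      then show ?thesis using a(1) by simp
    qed
    then have "cstar_subalgebra A_alg norm ?D"
      unfolding cstar_subalgebra_A_alg
      by (simp add: quotient_map_add quotient_map_compose quotient_map_scaleC quotient_map_adjoint zero_A zero \<tau>
          B.emb_add B.emb_mult B.emb_smult B.emb_star B.emb_zero K_closed K_closed' K_zero)
    moreover have "basis_proj g \<in> ?D" for g
    proof -
      have "star AA (\<tau> (basis_proj g)) = \<tau> (basis_proj g)"
        using \<tau>(6)[OF basis_proj_A, of g] by (simp add: adjoint_basis_proj)
      then show ?thesis using annihilate[of "\<tau> (basis_proj g)"] \<tau>(1) proj by (simp add: basis_proj_A)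
    qed
    ultimately have "C_alg \<subseteq> ?D"
      unfolding C_alg_def by (intro cstar_generated_least) (auto simp: id_A \<tau> one)
    then show ?thesis using c by blast
  qed
  have norm_id: "norm a * norm (id_blinfun :: free2 oper) \<le> norm a" for a :: "free2 oper"
    by (intro mult_left_le norm_blinfun_id_le) auto
  have left: "B.emb (tens c id_blinfun) \<in> K" if "c \<in> C_alg" for c
  proof (rule factor[OF that, where \<tau> = "\<lambda>a. tens a id_blinfun"])
    show "\<beta> (tens a id_blinfun) \<le> norm a" if "a \<in> carrier A_alg" for a
      using order_trans[OF cstar_norm_tens_le[OF \<beta> that id_A] norm_id] .
    show "tens id_blinfun id_blinfun = \<one>\<^bsub>AA\<^esub>" by (simp add: AA_one)
    show "\<beta> (z n \<otimes>\<^bsub>AA\<^esub> tens (basis_proj g) id_blinfun) \<le> min_norm (z n)" for g n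
      by (rule cstar_norm_compress_left[OF \<beta> zA])
  qed ((rule AA_eqI)?, simp add: simps)+
  have right: "B.emb (tens id_blinfun c) \<in> K" if "c \<in> C_alg" for c
  proof (rule factor[OF that, where \<tau> = "\<lambda>a. tens id_blinfun a"])
    show "\<beta> (tens id_blinfun a) \<le> norm a" if "a \<in> carrier A_alg" for a
      using order_trans[OF cstar_norm_tens_le[OF \<beta> id_A that], of "norm a"] norm_id[of a] by (simp add: mult.commute)
    show "tens id_blinfun id_blinfun = \<one>\<^bsub>AA\<^esub>" by (simp add: AA_one)
    show "\<beta> (z n \<otimes>\<^bsub>AA\<^esub> tens id_blinfun (basis_proj g)) \<le> min_norm (z n)" for g n
      by (rule cstar_norm_compress_right[OF \<beta> zA])
  qed ((rule AA_eqI)?, simp add: simps)+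
  have C: "C_alg \<subseteq> carrier A_alg" "0 \<in> C_alg" "\<And>c a. a \<in> C_alg \<Longrightarrow> scaleC_oper c a \<in> C_alg"
    using cstar_subalgebra_C_alg by (auto simp: cstar_subalgebra_A_alg)
  have S_K: "B.emb X \<in> K" if "X \<in> ?S" for X
    using that
  proof (induction rule: alg_subtensor_induct)
    case (tens c d)
    have cd: "c \<in> carrier A_alg" "d \<in> carrier A_alg" using tens C by auto
    have "tens c d = tens c id_blinfun \<otimes>\<^bsub>AA\<^esub> tens id_blinfun d" by (rule AA_eqI) (simp_all add: cd simps)
    then have "B.emb (tens c d) = B.emb (tens c id_blinfun) \<otimes>\<^bsub>B.Mc\<^esub> B.emb (tens id_blinfun d)"
      using B.emb_mult[OF tens_closed[OF cd(1) id_A] tens_closed[OF id_A cd(2)]] by simp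
    then show ?case using K_closed(2)[OF left[OF tens(1)] right[OF tens(2)]] by simp
  next
    case (add X Y)
    then show ?case by (simp add: B.emb_add K_closed)
  qed (use C in auto)
  have "e \<in> K" if "e \<in> ?E" for e
    using that K_lim[of e] S_K unfolding closed_subtensor_def norm_closure_def by blast
  then have "Z \<otimes>\<^bsub>B.Mc\<^esub> e = e \<otimes>\<^bsub>B.Mc\<^esub> Z" if "e \<in> ?E" for e
    using that unfolding K_def Bc.commutant_def by blast
  from Bc.maximal_abelian_contains[OF max Z this] have "Z \<in> ?E" .
  \<comment> \<open>\<open>4 * \<epsilon>\<close> is the lower bound of
    \<open>cutoff_at_one\<close>, against which the final estimate needs
    \<open>3 * \<epsilon>\<close>: one part for the distance to \<open>X\<close> and two for
    \<open>X\<close> itself.\<close>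
  define \<epsilon> where "\<epsilon> = (1 - r\<^sup>2) / 8"
  have \<epsilon>: "\<epsilon> > 0" by (simp add: \<epsilon>_def r_def power2_eq_square)
  obtain X where X: "X \<in> ?S" "B.pc (Z \<ominus>\<^bsub>B.Mc\<^esub> B.emb X) < \<epsilon>"
    using \<open>Z \<in> ?E\<close> \<epsilon> unfolding closed_subtensor_def norm_closure_def by blast
  note XA = pi_r_C_le_min(2)[OF X(1)]
  have "Z \<ominus>\<^bsub>B.Mc\<^esub> B.emb X = B.cls (\<lambda>n. z n \<ominus>\<^bsub>AA\<^esub> X)" "(\<lambda>n. z n \<ominus>\<^bsub>AA\<^esub> X) \<in> B.CS"
    unfolding Z_def B.emb_cls using B.cls_minus[OF zCS B.CS_const[OF XA]] by auto
  with X(2) B.completion_norm_tendsto[of "\<lambda>n. z n \<ominus>\<^bsub>AA\<^esub> X"]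
  have "\<forall>\<^sub>F n in sequentially. \<beta> (z n \<ominus>\<^bsub>AA\<^esub> X) < \<epsilon>" by (intro order_tendstoD(2)) auto
  moreover have "\<forall>\<^sub>F n in sequentially. min_norm (z n) < \<epsilon>" using z_min \<epsilon> by (rule order_tendstoD(2))
  ultimately have "\<forall>\<^sub>F n in sequentially. \<beta> (z n \<ominus>\<^bsub>AA\<^esub> X) < \<epsilon> \<and> min_norm (z n) < \<epsilon>" by (rule eventually_conj)
  then obtain n where n: "\<beta> (z n \<ominus>\<^bsub>AA\<^esub> X) < \<epsilon>" "min_norm (z n) < \<epsilon>"
    by (auto simp: eventually_sequentially)
  have "alpha_norm (z n \<ominus>\<^bsub>AA\<^esub> X) < \<epsilon>" using \<alpha>[of "z n \<ominus>\<^bsub>AA\<^esub> X"] n(1) zA XA by (meson B.minus_closed le_less_trans)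
  then have 1: "min_norm (z n \<ominus>\<^bsub>AA\<^esub> X) < \<epsilon>" "norm (pi_r (z n \<ominus>\<^bsub>AA\<^esub> X)) < \<epsilon>" by (simp_all add: alpha_norm_def)
  \<comment> \<open>\<open>X\<close> is near \<open>z n\<close>, whose minimal norm is small; since
    \<open>X\<close> lies in \<open>C \<odot> C\<close>, smallness transfers from the minimal norm
    to \<open>pi_r X\<close>.\<close>
  have "min_norm X \<le> min_norm (z n) + min_norm (z n \<ominus>\<^bsub>AA\<^esub> X)"
    using m.p_diff_le[OF zA XA, of n] by linarith
  with 1(1) n(2) have "norm (pi_r X) < 2 * \<epsilon>" using pi_r_C_le_min(1)[OF X(1)] by linarith
  have "z n = (z n \<ominus>\<^bsub>AA\<^esub> X) \<oplus>\<^bsub>AA\<^esub> X" using zA XA by (simp add: B.minus_eq B.a_assoc B.l_neg)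
  then have "pi_r (z n) = pi_r (z n \<ominus>\<^bsub>AA\<^esub> X) + pi_r X" using pi_r_hom(2)[of "z n \<ominus>\<^bsub>AA\<^esub> X" X] zA XA by simp
  then have "norm (pi_r (z n)) \<le> norm (pi_r (z n \<ominus>\<^bsub>AA\<^esub> X)) + norm (pi_r X)" by (simp add: norm_triangle_ineq)
  then have "norm (pi_r (z n)) < 3 * \<epsilon>" using 1(2) \<open>norm (pi_r X) < 2 * \<epsilon>\<close> by linarith
  moreover have "4 * \<epsilon> \<le> norm (pi_r (z n))"
  proof -
    have "4 * \<epsilon> \<le> poly (cutoff r n) 1" using cutoff_at_one[OF r, of n] by (simp add: \<epsilon>_def)
    also have "\<dots> \<le> norm (blinfun_apply (pi_r (z n)) (ket 1))"
      by (simp add: z_def pi_r_peval_walk[OF \<beta>] norm_scaleC)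
    also have "\<dots> \<le> norm (pi_r (z n)) * norm (ket (1 :: free2))" by (rule norm_blinfun)
    finally show ?thesis by simp
  qed
  ultimately show False using \<epsilon> by linarith
qed

theorem proposition4:
  shows "cstar_norm (alg_tensor A_alg A_alg) alpha_norm
    \<and> maximal_abelian A_alg norm C_alg
    \<and> (\<forall>\<beta>. cstar_norm (alg_tensor A_alg A_alg) \<beta> \<and>
          (\<forall>x\<in>carrier (alg_tensor A_alg A_alg). \<beta> x \<ge> alpha_norm x) \<longrightarrow>
          \<not> maximal_abelian (cstar_completion (alg_tensor A_alg A_alg) \<beta>) (completion_norm \<beta>)
              (closed_subtensor A_alg A_alg \<beta> C_alg C_alg))
    \<and> \<not> maximal_abelian (cstar_completion (alg_tensor A_alg A_alg) (max_norm A_alg A_alg))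
          (completion_norm (max_norm A_alg A_alg))
          (closed_subtensor A_alg A_alg (max_norm A_alg A_alg) C_alg C_alg)"
  using cstar_norm_alpha maximal_abelian_C_alg not_maximal_abelian
    not_maximal_abelian[OF cstar_norm_max le_max_norm[OF cstar_norm_alpha]]
  by blast

end
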